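(* Let $\mathcal M,\mathcal N$ be connected, compact, oriented smooth $2$-dimensional Riemannian manifolds (possibly with Lipschitz boundaries) with $V_{\mathcal N}\le V_{\mathcal M}$, and let $p\ge 2$. For every $\phi\in \operatorname{Lip}_+^{\mathrm{inj}}(\mathcal M,\mathcal N)$, $$E_p(\phi)\ \ge\ F^{p/2}\left(\frac{V_{\phi(\mathcal M)}}{V_{\mathcal M}}\right).$$ Moreover: (i) If $V_{\phi(\mathcal M)}/V_{\mathcal M}\ge 1/4$, equality holds if and only if $\phi$ is a homothety. (ii) If $V_{\phi(\mathcal M)}/V_{\mathcal M}\le 1/4$ and $p=2$, equality holds if and only if $d\phi\in K$ almost everywhere. (iii) If $V_{\phi(\mathcal M)}/V_{\mathcal M}\le 1/4$ and $p>2$, equality holds if and only if $d\phi\in K_{s}$ almost everywhere, where $s=V_{\phi(\mathcal M)}/V_{\mathcal M}$.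
   Context: Write $\mathfrak g,\mathfrak h$ for the metrics of $\mathcal M,\mathcal N$; $V_{X}$ denotes the (Riemannian) area of $X$. $\operatorname{Lip}_+^{\mathrm{inj}}(\mathcal M,\mathcal N)$ is the set of Lipschitz maps $\phi:\mathcal M\to\mathcal N$ whose (signed) Jacobian $J\phi$ (the determinant of $d\phi$ with respect to the metrics and orientations) is $\ge 0$ a.e. and which are injective a.e., meaning $|\phi^{-1}(q)|\le 1$ for a.e. $q\in\mathcal N$. For $x\in\mathcal M$, $\operatorname{SO}(\mathfrak g,\phi^*\mathfrak h)_x$ is the set of orientation-preserving linear isometries $T_x\mathcal M\to T_{\phi(x)}\mathcal N$; distances in $\operatorname{Hom}(T_x\mathcal M,T_{\phi(x)}\mathcal N)$ are measured with the inner product induced by $\mathfrak g,\mathfrak h$ (Frobenius inner product in orthonormal frames). With area integration, $$E_p(\phi)=\frac1{V_{\mathcal M}}\int_{\mathcal M}\operatorname{dist}^p\big(d\phi,\operatorname{SO}(\mathfrak g,\phi^*\mathfrak h)\big).$$ $F:[0,\infty)\to\mathbb R$ is $F(s)=1-2s$ for $0\le s\le \frac14$ and $F(s)=2(\sqrt s-1)^2$ for $s\ge\frac14$; $F^{p/2}(s)=(F(s))^{p/2}$. $\sigma_1(A)\le\sigma_2(A)$ denote singular values of a linear map $A$ between oriented $2$-dimensional inner product spaces. $K$ is the set of such $A$ with $\det A\ge 0$ and $\sigma_1(A)+\sigma_2(A)=1$, and $K_s=\{A\in K:\det A=s\}$ for $0\le s\le 1/4$. "$d\phi\in K$ a.e."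 means $d\phi_x\in K$ for a.e. $x$, singular values being taken with respect to $\mathfrak g_x,\mathfrak h_{\phi(x)}$. $\phi$ is a homothety if $\phi^*\mathfrak h=\lambda^2\mathfrak g$ for some constant $\lambda>0$ (for Lipschitz $\phi$: a.e.; a Lipschitz map with $d\phi\in\lambda\operatorname{SO}(\mathfrak g,\phi^*\mathfrak h)$ a.e. is automatically smooth). *)

theory Defs
  imports "HOL-Analysis.Analysis"
begin

fun Ck_on :: "nat \<Rightarrow> 'a::euclidean_space set \<Rightarrow> ('a \<Rightarrow> 'b::real_normed_vector) \<Rightarrow> bool" where
  "Ck_on 0 U f \<longleftrightarrow> continuous_on U f"
| "Ck_on (Suc k) U f \<longleftrightarrow>
     (\<forall>x\<in>U. f differentiable (at x)) \<and>
     (\<forall>v. Ck_on k U (\<lambda>x. frechet_derivative f (at x) v))"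

text \<open>The set \<open>S\<close> need not be open (it may contain boundary points of a manifold); smoothness on
  \<open>S\<close> then means that \<open>f\<close> extends locally to a smooth function on an open set.\<close>

definition smooth_on :: "'a::euclidean_space set \<Rightarrow> ('a \<Rightarrow> 'b::real_normed_vector) \<Rightarrow> bool" where
  "smooth_on S f \<longleftrightarrow>
     (\<forall>x\<in>S. \<exists>V g. open V \<and> x \<in> V \<and> (\<forall>k. Ck_on k V g) \<and> (\<forall>y\<in>S \<inter> V. g y = f y))"

definition Jmat :: "(real^2 \<Rightarrow> real^2) \<Rightarrow> (real^2) set \<Rightarrow> real^2 \<Rightarrow> real^2^2" where
  "Jmat f S y = matrix (frechet_derivative f (at y within S))"

text \<open>A chart is a pair of a domain and a coordinate map. The Riemannian metric is given by its
  coordinate matrices: \<open>gmat M c x\<close> is the Gram matrix of the coordinate frame of the chart \<open>c\<close> in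
  the tangent space at \<open>x\<close>. The orientation is the one in which all charts of the atlas are
  positively oriented. The underlying set is \<open>topspace (surf_top M)\<close>.\<close>

type_synonym 'a chart = "'a set \<times> ('a \<Rightarrow> real^2)"

record 'a surface =
  surf_top :: "'a topology"
  atlas :: "'a chart set"
  gmat :: "'a chart \<Rightarrow> 'a \<Rightarrow> real^2^2"

abbreviation points :: "'a surface \<Rightarrow> 'a set" where
  "points M \<equiv> topspace (surf_top M)"

abbreviation cinv :: "'a chart \<Rightarrow> real^2 \<Rightarrow> 'a" where
  "cinv c \<equiv> inv_into (fst c) (snd c)"

text \<open>Local models: the plane (no boundary), and the closed region above the graph of a Lipschitz
  function, whose boundary is the graph.\<close>

definition lipschitz_model :: "(real^2) set \<Rightarrow> bool" where
  "lipschitz_model D \<longleftrightarrow>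
     D = UNIV \<or> (\<exists>b L. L-lipschitz_on UNIV b \<and> D = {y. b (y$1) \<le> y$2})"

definition is_chart :: "'a topology \<Rightarrow> 'a chart \<Rightarrow> bool" where
  "is_chart X c \<longleftrightarrow>
     openin X (fst c) \<and>
     (\<exists>D. lipschitz_model D \<and> openin (top_of_set D) (snd c ` fst c)) \<and>
     homeomorphic_map (subtopology X (fst c)) (top_of_set (snd c ` fst c)) (snd c)"

definition transition :: "'a chart \<Rightarrow> 'a chart \<Rightarrow> real^2 \<Rightarrow> real^2" where
  "transition c c' = snd c' \<circ> cinv c"

definition overlap :: "'a chart \<Rightarrow> 'a chart \<Rightarrow> (real^2) set" where
  "overlap c c' = snd c ` (fst c \<inter> fst c')"

definition oriented_atlas :: "'a topology \<Rightarrow> 'a chart set \<Rightarrow> bool" where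
  "oriented_atlas X \<A> \<longleftrightarrow>
     (\<forall>c\<in>\<A>. is_chart X c) \<and>
     (\<Union>c\<in>\<A>. fst c) = topspace X \<and>
     (\<forall>c\<in>\<A>. \<forall>c'\<in>\<A>. smooth_on (overlap c c') (transition c c') \<and>
        (\<forall>y\<in>overlap c c'. 0 < det (Jmat (transition c c') (overlap c c') y)))"

definition gip :: "real^2^2 \<Rightarrow> real^2 \<Rightarrow> real^2 \<Rightarrow> real" where
  "gip G u v = u \<bullet> (G *v v)"

definition riemannian_metric :: "'a surface \<Rightarrow> bool" where
  "riemannian_metric M \<longleftrightarrow>
     (\<forall>c\<in>atlas M.
        smooth_on (snd c ` fst c) (\<lambda>y. gmat M c (cinv c y)) \<and>
        (\<forall>x\<in>fst c. transpose (gmat M c x) = gmat M c x \<and> (\<forall>v. v \<noteq> 0 \<longrightarrow> 0 < gip (gmat M c x) v v))) \<and>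
     (\<forall>c\<in>atlas M. \<forall>c'\<in>atlas M. \<forall>x\<in>fst c \<inter> fst c'.
        let J = Jmat (transition c c') (overlap c c') (snd c x)
        in gmat M c x = transpose J ** gmat M c' x ** J)"

definition oriented_riemannian_surface :: "'a surface \<Rightarrow> bool" where
  "oriented_riemannian_surface M \<longleftrightarrow>
     Hausdorff_space (surf_top M) \<and> second_countable (surf_top M) \<and>
     oriented_atlas (surf_top M) (atlas M) \<and> riemannian_metric M"

text \<open>The tangent space at \<open>x\<close> is identified with \<open>real^2\<close> by means of a preferred chart at \<open>x\<close>;
  in this identification it carries the inner product with matrix \<open>metric_at M x\<close> and the standard
  orientation. The pointwise quantities below do not depend on the choice of the chart.\<close>

definition chart_at :: "'a surface \<Rightarrow> 'a \<Rightarrow> 'a chart" where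
  "chart_at M x = (SOME c. c \<in> atlas M \<and> x \<in> fst c)"

definition metric_at :: "'a surface \<Rightarrow> 'a \<Rightarrow> real^2^2" where
  "metric_at M x = gmat M (chart_at M x) x"

definition borel_top :: "'a topology \<Rightarrow> 'a measure" where
  "borel_top X = sigma (topspace X) {U. openin X U}"

text \<open>The area measure of one chart domain, \<open>A \<mapsto> \<integral> sqrt (det g) dy\<close> over the coordinate image of
  \<open>A \<inter> fst c\<close>, as a Borel measure on the whole surface.\<close>

definition chart_area :: "'a surface \<Rightarrow> 'a chart \<Rightarrow> 'a measure" where
  "chart_area M c =
     distr (density (restrict_space lborel (snd c ` fst c))
                    (\<lambda>y. ennreal (sqrt (det (gmat M c (cinv c y))))))
           (borel_top (surf_top M)) (cinv c)"

text \<open>The chart areas agree on overlaps, so their supremum in the lattice of measures is the measure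
  that restricts to each of them.\<close>

definition area :: "'a surface \<Rightarrow> 'a measure" where
  "area M = (SUP c\<in>atlas M. chart_area M c)"

definition vol :: "'a surface \<Rightarrow> 'a set \<Rightarrow> real" where
  "vol M A = measure (area M) A"

definition piecewise_C1_curve :: "'a surface \<Rightarrow> (real \<Rightarrow> 'a) \<Rightarrow> bool" where
  "piecewise_C1_curve M \<gamma> \<longleftrightarrow>
     continuous_map (top_of_set {0..1}) (surf_top M) \<gamma> \<and>
     (\<exists>S. finite S \<and> (\<forall>t\<in>{0<..<1} - S. \<forall>c\<in>atlas M. \<gamma> t \<in> fst c \<longrightarrow>
        (\<exists>e>0. (snd c \<circ> \<gamma>) C1_differentiable_on {t-e<..<t+e})))"

definition speed :: "'a surface \<Rightarrow> (real \<Rightarrow> 'a) \<Rightarrow> real \<Rightarrow> real" where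
  "speed M \<gamma> t =
     (let v = vector_derivative (snd (chart_at M (\<gamma> t)) \<circ> \<gamma>) (at t)
      in sqrt (gip (metric_at M (\<gamma> t)) v v))"

definition curve_length :: "'a surface \<Rightarrow> (real \<Rightarrow> 'a) \<Rightarrow> ennreal" where
  "curve_length M \<gamma> = (\<integral>\<^sup>+t\<in>{0..1}. ennreal (speed M \<gamma> t) \<partial>lborel)"

definition riem_dist :: "'a surface \<Rightarrow> 'a \<Rightarrow> 'a \<Rightarrow> ennreal" where
  "riem_dist M x y =
     (INF \<gamma>\<in>{\<gamma>. piecewise_C1_curve M \<gamma> \<and> \<gamma> 0 = x \<and> \<gamma> 1 = y}. curve_length M \<gamma>)"

text \<open>Here \<open>G\<close> and \<open>H\<close> are the Gram matrices of the inner products on the source and on the target,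
  and \<open>A\<close> is the matrix of a linear map from the source to the target. All coordinate bases are
  positively oriented.\<close>

definition adjoint_mat :: "real^2^2 \<Rightarrow> real^2^2 \<Rightarrow> real^2^2 \<Rightarrow> real^2^2" where
  "adjoint_mat G H A = matrix_inv G ** transpose A ** H"

definition hom_inner :: "real^2^2 \<Rightarrow> real^2^2 \<Rightarrow> real^2^2 \<Rightarrow> real^2^2 \<Rightarrow> real" where
  "hom_inner G H A B = trace (adjoint_mat G H A ** B)"

definition hom_norm :: "real^2^2 \<Rightarrow> real^2^2 \<Rightarrow> real^2^2 \<Rightarrow> real" where
  "hom_norm G H A = sqrt (hom_inner G H A A)"

definition SO :: "real^2^2 \<Rightarrow> real^2^2 \<Rightarrow> (real^2^2) set" where
  "SO G H = {R. 0 < det R \<and> (\<forall>u v. gip H (R *v u) (R *v v) = gip G u v)}"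

definition dist_SO :: "real^2^2 \<Rightarrow> real^2^2 \<Rightarrow> real^2^2 \<Rightarrow> real" where
  "dist_SO G H A = (INF R\<in>SO G H. hom_norm G H (A - R))"

text \<open>The determinant in positively oriented orthonormal frames: a positively oriented
  \<open>G\<close>-orthonormal frame has determinant \<open>1 / sqrt (det G)\<close> in the coordinate basis.\<close>

definition riem_det :: "real^2^2 \<Rightarrow> real^2^2 \<Rightarrow> real^2^2 \<Rightarrow> real" where
  "riem_det G H A = sqrt (det H) / sqrt (det G) * det A"

definition eigvals :: "real^2^2 \<Rightarrow> real set" where
  "eigvals B = {l. \<exists>v. v \<noteq> 0 \<and> B *v v = l *\<^sub>R v}"

text \<open>Singular values are the square roots of the eigenvalues of \<open>A\<^sup>* A\<close>. In dimension two the minimum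
  and the maximum of the spectrum are the two eigenvalues counted with multiplicity.\<close>

definition sv1 :: "real^2^2 \<Rightarrow> real^2^2 \<Rightarrow> real^2^2 \<Rightarrow> real" where
  "sv1 G H A = sqrt (Min (eigvals (adjoint_mat G H A ** A)))"

definition sv2 :: "real^2^2 \<Rightarrow> real^2^2 \<Rightarrow> real^2^2 \<Rightarrow> real" where
  "sv2 G H A = sqrt (Max (eigvals (adjoint_mat G H A ** A)))"

definition K :: "real^2^2 \<Rightarrow> real^2^2 \<Rightarrow> (real^2^2) set" where
  "K G H = {A. 0 \<le> riem_det G H A \<and> sv1 G H A + sv2 G H A = 1}"

definition Ks :: "real \<Rightarrow> real^2^2 \<Rightarrow> real^2^2 \<Rightarrow> (real^2^2) set" where
  "Ks s G H = {A \<in> K G H. riem_det G H A = s}"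

text \<open>The matrix of \<open>d\<phi>\<close> at \<open>x\<close> in the preferred charts at \<open>x\<close> and \<open>\<phi> x\<close>; it is meaningful where
  \<open>\<phi>\<close> is differentiable, that is almost everywhere for Lipschitz \<open>\<phi>\<close>.\<close>

definition dmap :: "'a surface \<Rightarrow> 'b surface \<Rightarrow> ('a \<Rightarrow> 'b) \<Rightarrow> 'a \<Rightarrow> real^2^2" where
  "dmap M N \<phi> x =
     (let c = chart_at M x; c' = chart_at N (\<phi> x)
      in Jmat (snd c' \<circ> \<phi> \<circ> cinv c) (snd c ` (fst c \<inter> \<phi> -` fst c')) (snd c x))"

definition jacobian :: "'a surface \<Rightarrow> 'b surface \<Rightarrow> ('a \<Rightarrow> 'b) \<Rightarrow> 'a \<Rightarrow> real" where
  "jacobian M N \<phi> x = riem_det (metric_at M x) (metric_at N (\<phi> x)) (dmap M N \<phi> x)"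

definition lipschitz_map :: "'a surface \<Rightarrow> 'b surface \<Rightarrow> ('a \<Rightarrow> 'b) \<Rightarrow> bool" where
  "lipschitz_map M N \<phi> \<longleftrightarrow>
     \<phi> \<in> points M \<rightarrow> points N \<and>
     (\<exists>L\<ge>0. \<forall>x\<in>points M. \<forall>y\<in>points M.
        riem_dist N (\<phi> x) (\<phi> y) \<le> ennreal L * riem_dist M x y)"

definition Lip_inj_plus :: "'a surface \<Rightarrow> 'b surface \<Rightarrow> ('a \<Rightarrow> 'b) set" where
  "Lip_inj_plus M N = {\<phi>. lipschitz_map M N \<phi> \<and>
     (AE x in area M. 0 \<le> jacobian M N \<phi> x) \<and>
     (AE q in area N. \<forall>x\<in>points M. \<forall>y\<in>points M. \<phi> x = q \<and> \<phi> y = q \<longrightarrow> x = y)}"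

text \<open>The completion of the area measure is used because \<open>dmap\<close> is unspecified on the null set where
  \<open>\<phi>\<close> is not differentiable, so the integrand need not be Borel measurable.\<close>

definition energy :: "real \<Rightarrow> 'a surface \<Rightarrow> 'b surface \<Rightarrow> ('a \<Rightarrow> 'b) \<Rightarrow> real" where
  "energy p M N \<phi> = 1 / vol M (points M) *
     (LINT x|completion (area M).
        dist_SO (metric_at M x) (metric_at N (\<phi> x)) (dmap M N \<phi> x) powr p)"

definition homothety :: "'a surface \<Rightarrow> 'b surface \<Rightarrow> ('a \<Rightarrow> 'b) \<Rightarrow> bool" where
  "homothety M N \<phi> \<longleftrightarrow> (\<exists>l>0. AE x in area M.
     transpose (dmap M N \<phi> x) ** metric_at N (\<phi> x) ** dmap M N \<phi> x = l\<^sup>2 *\<^sub>R metric_at M x)"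

definition F :: "real \<Rightarrow> real" where
  "F s = (if s \<le> 1/4 then 1 - 2 * s else 2 * (sqrt s - 1)\<^sup>2)"

end

(* Let t be the signed Jacobian of \<phi> at a point, \<sigma>1 \<le> \<sigma>2 the singular values of d\<phi> and w = \<sigma>1 + \<sigma>2.
   The squared distance of d\<phi> from SO is (w - 1)^2 + 1 - 2 t, where w \<ge> 2 sqrt t. Minimising over w gives
   at least F t, with equality exactly for w = 1 (if t \<le> 1/4) or \<sigma>1 = \<sigma>2 (if t \<ge> 1/4).
   By the area formula and injectivity almost everywhere, the mean of t over M is s = V(\<phi>(M)) / V(M),
   and s \<le> 1 because V(N) \<le> V(M). On [0,1] the function F^(p/2) has at s a supporting line valid for all t \<ge> 0,
   and integrating it gives the inequality. Equality forces t to lie on the contact set of that line almost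
   everywhere: t = s, or t \<le> 1/4 if p = 2 and s \<le> 1/4.
   Rademacher's theorem comes from the Borel differentiability of Lipschitz functions along lines
   and a weak-derivative argument for the additivity of the directional derivatives. *)

theory Submission
  imports Defs
begin

section \<open>Differentiability almost everywhere of Lipschitz maps of the plane\<close>

text \<open>The main obstacle is the passage between intrinsic and coordinate notions. The Lipschitz
  condition speaks of infima of curve lengths, while differentials and areas are read in charts, so
  distances are compared with chart norms in both directions and up to Lipschitz boundaries. The
  upper bound needs a detour inside the model region, the lower bound the fact that a short curve
  cannot leave a chart ball. The differential is meaningful only off a null set and is written in
  preferred charts that depend on the point without any regularity. What survives a change of charts
  is the squared norm \<open>hs\<close> and the Jacobian; these two determine the distance to SO and
  the singular values used here, and both are replaced almost everywhere by Borel functions before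
  anything is integrated. Injectivity almost everywhere refers to the target: the preimage of the
  exceptional null set may have positive area, and it is harmless only because the Jacobian vanishes
  almost everywhere on it. The threshold 1/4 is the value of t at which the bound 2 sqrt t for w
  passes the unconstrained minimiser w = 1.\<close>

lemma increase_from_local:
  fixes H :: "real \<Rightarrow> real"
  assumes "a \<le> b" "continuous_on {a..b} H"
    and step: "\<And>x. a \<le> x \<Longrightarrow> x < b \<Longrightarrow> \<exists>y. x < y \<and> y \<le> b \<and> H x \<le> H y"
  shows "H a \<le> H b"
proof -
  define S where "S = {x \<in> {a..b}. H a \<le> H x}"
  have "S = {a..b} \<inter> H -` {H a..}" by (auto simp: S_def)
  then have "closed S"
    using continuous_closed_preimage[OF assms(2)] by simp
  moreover have "S \<subseteq> {a..b}" by (auto simp: S_def)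
  ultimately have "compact S"
    by (metis bounded_closed_interval bounded_subset compact_eq_bounded_closed)
  moreover have "a \<in> S" using assms by (simp add: S_def)
  ultimately obtain s where s: "s \<in> S" "\<And>x. x \<in> S \<Longrightarrow> x \<le> s"
    using compact_attains_sup[of S] by blast
  \<comment> \<open>\<open>s\<close> is the last point where \<open>H\<close> is at least
    \<open>H a\<close>; a step to the right of it would produce a later one.\<close>
  have "s = b"
  proof (rule ccontr)
    assume "s \<noteq> b"
    then obtain y where "s < y" "y \<le> b" "H s \<le> H y"
      using step[of s] s(1) by (auto simp: S_def)
    then have "y \<in> S" using s(1) by (simp add: S_def)
    then show False using s(2)[of y] \<open>s < y\<close> by simp
  qed
  then show ?thesis using s(1) by (simp add: S_def)
qed

lemma increase_from_local_left:
  fixes H :: "real \<Rightarrow> real"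
  assumes "a \<le> b" "continuous_on {a..b} H"
    and step: "\<And>x. a < x \<Longrightarrow> x \<le> b \<Longrightarrow> \<exists>y. a \<le> y \<and> y < x \<and> H y \<le> H x"
  shows "H a \<le> H b"
proof -
  \<comment> \<open>Reflection in the origin turns steps to the left into steps to the
    right.\<close>
  have "- H (- (- b)) \<le> - H (- (- a))"
  proof (rule increase_from_local[of "-b" "-a" "\<lambda>x. - H (- x)"])
    show "continuous_on {- b..- a} (\<lambda>x. - H (- x))"
      by (intro continuous_intros continuous_on_compose2[OF assms(2)]) auto
    fix x assume "- b \<le> x" "x < - a"
    then obtain y where "a \<le> y" "y < - x" "H y \<le> H (- x)"
      using step[of "-x"] by auto
    then show "\<exists>y>x. y \<le> - a \<and> - H (- x) \<le> - H (- y)"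
      by (intro exI[of _ "-y"]) auto
  qed (use assms in auto)
  then show ?thesis by simp
qed

text \<open>For compact \<open>C \<subseteq> E\<close> the function \<open>f x - \<beta> * measure (C \<inter> {a..x})\<close> can be increased from every point,
  hence is monotone; this takes the place of a covering theorem.\<close>

lemma increment_ge_measure:
  fixes f :: "real \<Rightarrow> real"
  assumes "a \<le> b" "0 \<le> \<beta>" "mono f" "continuous_on UNIV f" "E \<in> sets borel"
    and E: "(\<forall>x\<in>E. \<forall>\<epsilon>>0. \<exists>h. 0 < h \<and> h < \<epsilon> \<and> \<beta> * h \<le> f (x + h) - f x) \<or>
            (\<forall>x\<in>E. \<forall>\<epsilon>>0. \<exists>h. 0 < h \<and> h < \<epsilon> \<and> \<beta> * h \<le> f x - f (x - h))"
  shows "\<beta> * measure lborel (E \<inter> {a..b}) \<le> f b - f a"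
proof -
  have compact_case: "\<beta> * measure lborel K \<le> f b - f a" if K: "compact K" "K \<subseteq> E \<inter> {a..b}" for K
  proof -
    define m where "m x = measure lborel (K \<inter> {a..x})" for x
    have Kb: "K \<in> sets lborel" using K(1) by (simp add: borel_compact)
    have fin: "K \<inter> {x..y} \<in> fmeasurable lborel" "K \<inter> {x<..y} \<in> fmeasurable lborel" for x y
    proof -
      have bd: "bounded {x<..y}" by (rule bounded_subset[of "{x..y}"]) auto
      have "A \<inter> K \<in> fmeasurable lborel" if "bounded A" "A \<in> sets lborel" for A
        using emeasure_bounded_finite[OF that(1)] that(2) Kb
        by (intro fmeasurable_Int_fmeasurable fmeasurableI) auto
      from this[of "{x..y}"] this[of "{x<..y}"] bd
      show "K \<inter> {x..y} \<in> fmeasurable lborel" "K \<inter> {x<..y} \<in> fmeasurable lborel"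
        by (simp_all add: Int_commute)
    qed
    have split: "m y = m x + measure lborel (K \<inter> {x<..y})" if "a \<le> x" "x \<le> y" for x y
    proof -
      have "K \<inter> {a..y} = (K \<inter> {a..x}) \<union> (K \<inter> {x<..y})" using that by auto
      moreover have "(K \<inter> {a..x}) \<inter> (K \<inter> {x<..y}) = {}" by auto
      ultimately show ?thesis
        unfolding m_def using measure_Un3[OF fin(1)[of a x] fin(2)[of x y]] by simp
    qed
    have lip: "measure lborel (K \<inter> {x<..y}) \<le> y - x" if "x \<le> y" for x y
    proof -
      have "measure lborel (K \<inter> {x<..y}) \<le> measure lborel {x<..y}"
        using Kb that by (intro measure_mono_fmeasurable) (auto simp: fmeasurable_def)
      then show ?thesis using that by simp
    qed
    define H where "H x = f x - \<beta> * m x" for x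
    have "continuous_on {a..b} m"
    proof (rule lipschitz_on_continuous_on)
      show "1-lipschitz_on {a..b} m"
      proof (rule lipschitz_onI)
        have *: "dist (m x) (m y) \<le> 1 * dist x y" if "x \<in> {a..b}" "y \<in> {a..b}" "x \<le> y" for x y
          using split[of x y] lip[of x y] that by (auto simp: dist_real_def)
        show "dist (m x) (m y) \<le> 1 * dist x y" if "x \<in> {a..b}" "y \<in> {a..b}" for x y
          using *[of x y] *[of y x] that by (cases "x \<le> y") (auto simp: dist_commute)
      qed simp
    qed
    then have cont: "continuous_on {a..b} H"
      unfolding H_def using assms(4) by (intro continuous_intros) (auto intro: continuous_on_subset)
    \<comment> \<open>Points off \<open>K\<close> have a neighbourhood missing \<open>K\<close>.
      There \<open>m\<close> does not grow, so monotonicity of \<open>f\<close> alone provides the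
      step.\<close>
    have far: "\<exists>\<epsilon>>0. \<forall>y. \<bar>y - x\<bar> < \<epsilon> \<longrightarrow> y \<notin> K" if "x \<notin> K" for x
    proof -
      have "open (- K)" using K(1) compact_imp_closed by blast
      then show ?thesis using that by (auto simp: open_dist dist_real_def)
    qed
    have "H a \<le> H b"
      using E
    proof
      assume E: "\<forall>x\<in>E. \<forall>\<epsilon>>0. \<exists>h. 0 < h \<and> h < \<epsilon> \<and> \<beta> * h \<le> f (x + h) - f x"
      show ?thesis
      proof (rule increase_from_local[OF assms(1) cont])
        fix x assume x: "a \<le> x" "x < b"
        show "\<exists>y>x. y \<le> b \<and> H x \<le> H y"
        proof (cases "x \<in> K")
          case True
          then obtain h where h: "0 < h" "h < b - x" "\<beta> * h \<le> f (x + h) - f x"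
            using E K(2) x by (metis IntD1 diff_gt_0_iff_gt subsetD)
          have "\<beta> * measure lborel (K \<inter> {x<..x + h}) \<le> \<beta> * h"
            using lip[of x "x + h"] h assms(2) by (intro mult_left_mono) auto
          then have "H x \<le> H (x + h)"
            using split[of x "x + h"] x h by (simp add: H_def algebra_simps)
          then show ?thesis using h by (intro exI[of _ "x + h"]) auto
        next
          case False
          then obtain \<epsilon> where e: "\<epsilon> > 0" "\<And>y. \<bar>y - x\<bar> < \<epsilon> \<Longrightarrow> y \<notin> K"
            using far by blast
          define h where "h = min (\<epsilon> / 2) (b - x)"
          have h: "0 < h" "h < \<epsilon>" "h \<le> b - x" using e x by (auto simp: h_def)
          have "K \<inter> {x<..x + h} = {}" using e(2) h by force
          then have "H x \<le> H (x + h)"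
            using split[of x "x + h"] x h monoD[OF assms(3), of x "x + h"] by (simp add: H_def)
          then show ?thesis using h by (intro exI[of _ "x + h"]) auto
        qed
      qed
    next
      assume E: "\<forall>x\<in>E. \<forall>\<epsilon>>0. \<exists>h. 0 < h \<and> h < \<epsilon> \<and> \<beta> * h \<le> f x - f (x - h)"
      show ?thesis
      proof (rule increase_from_local_left[OF assms(1) cont])
        fix x assume x: "a < x" "x \<le> b"
        show "\<exists>y\<ge>a. y < x \<and> H y \<le> H x"
        proof (cases "x \<in> K")
          case True
          then obtain h where h: "0 < h" "h < x - a" "\<beta> * h \<le> f x - f (x - h)"
            using E K(2) x by (metis IntD1 diff_gt_0_iff_gt subsetD)
          have "\<beta> * measure lborel (K \<inter> {x - h<..x}) \<le> \<beta> * h"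
            using lip[of "x - h" x] h assms(2) by (intro mult_left_mono) auto
          then have "H (x - h) \<le> H x"
            using split[of "x - h" x] x h by (simp add: H_def algebra_simps)
          then show ?thesis using h by (intro exI[of _ "x - h"]) auto
        next
          case False
          then obtain \<epsilon> where e: "\<epsilon> > 0" "\<And>y. \<bar>y - x\<bar> < \<epsilon> \<Longrightarrow> y \<notin> K"
            using far by blast
          define h where "h = min (\<epsilon> / 2) (x - a)"
          have h: "0 < h" "h < \<epsilon>" "h \<le> x - a" using e x by (auto simp: h_def)
          have "K \<inter> {x - h<..x} = {}" using e(2) h by force
          then have "H (x - h) \<le> H x"
            using split[of "x - h" x] x h monoD[OF assms(3), of "x - h" x] by (simp add: H_def)
          then show ?thesis using h by (intro exI[of _ "x - h"]) auto
        qed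
      qed
    qed
    moreover have "m b = measure lborel K"
      unfolding m_def using K(2) by (metis Int_absorb2 le_inf_iff)
    moreover have "m a \<le> 0"
    proof -
      have "m a \<le> measure lborel {a..a}"
        unfolding m_def using Kb by (intro measure_mono_fmeasurable) (auto simp: fmeasurable_def)
      then show ?thesis by simp
    qed
    ultimately have "\<beta> * measure lborel K \<le> f b - f a + \<beta> * m a" by (simp add: H_def)
    then show ?thesis using \<open>m a \<le> 0\<close> assms(2) by (smt (verit) mult_nonneg_nonpos)
  qed
  have Eb: "E \<inter> {a..b} \<in> lmeasurable"
    using assms(5) by (intro bounded_set_imp_lmeasurable) auto
  \<comment> \<open>Inner regularity passes from compact sets to \<open>E\<close>; the closed sets
    it supplies are compact because they lie in \<open>{a..b}\<close>.\<close>
  have eps: "\<beta> * measure lebesgue (E \<inter> {a..b}) \<le> f b - f a + \<beta> * \<epsilon>" if "0 < \<epsilon>" for \<epsilon>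
  proof -
    obtain K where K: "closed K" "K \<subseteq> E \<inter> {a..b}" "E \<inter> {a..b} - K \<in> lmeasurable"
        "emeasure lebesgue (E \<inter> {a..b} - K) < ennreal \<epsilon>"
      by (rule sets_lebesgue_inner_closed[OF fmeasurableD[OF Eb] \<open>0 < \<epsilon>\<close>])
    have "compact K"
      using K(1,2) by (metis bounded_closed_interval bounded_subset compact_eq_bounded_closed le_inf_iff)
    then have Km: "K \<in> lmeasurable" by (rule lmeasurable_compact)
    have "measure lebesgue (E \<inter> {a..b} - K) < \<epsilon>"
      using K(3,4) that by (simp add: emeasure_eq_measure2 ennreal_less_iff)
    then have K: "K \<subseteq> E \<inter> {a..b}" "compact K" "measure lebesgue (E \<inter> {a..b}) < measure lebesgue K + \<epsilon>"
      using measurable_measure_Diff[OF Eb fmeasurableD[OF Km] K(2)] K(2) \<open>compact K\<close> by auto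
    have "\<beta> * measure lebesgue (E \<inter> {a..b}) \<le> \<beta> * (measure lebesgue K + \<epsilon>)"
      using K assms(2) by (intro mult_left_mono) auto
    moreover have "measure lebesgue K = measure lborel K" using K(2) by (simp add: borel_compact)
    ultimately show ?thesis using compact_case[OF K(2,1)] by (simp add: algebra_simps)
  qed
  have "\<beta> * measure lebesgue (E \<inter> {a..b}) \<le> f b - f a"
  proof (cases "\<beta> = 0")
    case False
    show ?thesis
    proof (rule field_le_epsilon)
      fix e :: real assume "0 < e"
      then show "\<beta> * measure lebesgue (E \<inter> {a..b}) \<le> f b - f a + e"
        using eps[of "e / \<beta>"] False assms(2) by simp
    qed
  qed (use monoD[OF assms(3,1)] in simp)
  then show ?thesis using assms(5) by simp
qed

text \<open>A density argument by tiling. A compact \<open>K\<close> in \<open>E\<close> has an open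
  neighbourhood of nearly the same measure. Small intervals meeting \<open>K\<close> tile part of
  it, and the sparsity summed over them bounds the measure of \<open>K\<close> by
  \<open>\<theta>\<close> times that of the neighbourhood. As \<open>\<theta>\<close> is less than
  1, only measure zero is left.\<close>

lemma null_if_uniformly_sparse:
  fixes E :: "real set"
  assumes E: "E \<in> sets borel" and \<theta>: "0 \<le> \<theta>" "\<theta> < 1"
    and sparse: "\<And>a b. a \<le> b \<Longrightarrow> measure lborel (E \<inter> {a..b}) \<le> \<theta> * (b - a)"
  shows "E \<in> null_sets lborel"
proof -
  have compact_null: "measure lebesgue K = 0" if K: "compact K" "K \<subseteq> E" for K
  proof -
    have Km: "K \<in> lmeasurable" using K(1) by (rule lmeasurable_compact)
    have Kb: "K \<in> sets borel" using K(1) by (simp add: borel_compact)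
    have spK: "measure lebesgue (K \<inter> {a..b}) \<le> \<theta> * (b - a)" if "a \<le> b" for a b
    proof -
      have "E \<inter> {a..b} \<in> lmeasurable" using E by (intro bounded_set_imp_lmeasurable) auto
      then have "measure lebesgue (K \<inter> {a..b}) \<le> measure lebesgue (E \<inter> {a..b})"
        using K(2) Kb by (intro measure_mono_fmeasurable) auto
      then show ?thesis using sparse[OF that] E by simp
    qed
    have "measure lebesgue K \<le> \<theta> * measure lebesgue K + \<epsilon>" if "0 < \<epsilon>" for \<epsilon>
    proof -
      obtain U where U: "open U" "K \<subseteq> U" "U - K \<in> lmeasurable" "emeasure lebesgue (U - K) < ennreal \<epsilon>"
        using sets_lebesgue_outer_open[OF fmeasurableD[OF Km] \<open>0 < \<epsilon>\<close>] by metis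
      have Um: "U \<in> lmeasurable"
        using fmeasurable.Un[OF Km U(3)] U(2) by (simp add: Un_absorb1)
      have "measure lebesgue (U - K) < \<epsilon>"
        using U(3,4) that by (simp add: emeasure_eq_measure2 ennreal_less_iff)
      then have Ub: "measure lebesgue U \<le> measure lebesgue K + \<epsilon>"
        using measurable_measure_Diff[OF Um fmeasurableD[OF Km] U(2)] by simp
      obtain \<delta> where d: "\<delta> > 0" and balls: "(\<Union>x\<in>K. ball x \<delta>) \<subseteq> U"
        using compact_subset_open_imp_ball_epsilon_subset[OF K(1) U(1,2)] by blast
      have near: "y \<in> U" if "x \<in> K" "\<bar>y - x\<bar> < \<delta>" for x y
        using balls that by (force simp: dist_real_def abs_minus_commute)
      obtain B where B: "0 < B" "K \<subseteq> {-B<..<B}"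
        using compact_imp_bounded[OF K(1)] by (auto simp: bounded_pos_less real_norm_def abs_less_iff subset_iff greaterThanLessThan_def)
           (metis abs_less_iff greaterThanLessThan_iff linorder_not_le minus_less_iff not_less_iff_gr_or_eq)
      \<comment> \<open>The mesh \<open>2 * B / n\<close> is to be smaller than
        \<open>\<delta>\<close>, so that every cell meeting \<open>K\<close> lies inside
        \<open>U\<close>.\<close>
      obtain n :: nat where n: "2 * B / \<delta> < real n" using reals_Archimedean2 by blast
      then have n0: "0 < real n" using B d by (smt (verit) divide_pos_pos)
      define h where "h = 2 * B / real n"
      have h: "0 < h" "h < \<delta>" using B n n0 d by (auto simp: h_def field_simps)
      \<comment> \<open>Closed cells cover \<open>K\<close>; the open cells have the same measure
        and are disjoint, so that their measures add up.\<close>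
      define I I' where "I j = {-B + real j * h .. -B + (real j + 1) * h}"
        and "I' j = {-B + real j * h <..< -B + (real j + 1) * h}" for j :: nat
      define J where "J = {j. j < n \<and> I j \<inter> K \<noteq> {}}"
      have finJ: "finite J" by (simp add: J_def)
      have "K \<subseteq> (\<Union>j\<in>J. K \<inter> I j)"
      proof
        fix x assume x: "x \<in> K"
        define j where "j = nat \<lfloor>(x + B) / h\<rfloor>"
        have xB: "0 < (x + B) / h" using B(2) x h by (force intro: divide_pos_pos)
        then have j: "real j \<le> (x + B) / h" "(x + B) / h < real j + 1"
          unfolding j_def by linarith+
        have "(x + B) / h < n" using B(2) x h n0 by (force simp: h_def field_simps)
        then have "j < n" using j(1) by linarith
        moreover have "x \<in> I j" using j h by (simp add: I_def field_simps)
        ultimately show "x \<in> (\<Union>j\<in>J. K \<inter> I j)" using x by (auto simp: J_def)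
      qed
      then have "measure lebesgue K \<le> measure lebesgue (\<Union>j\<in>J. K \<inter> I j)"
        using finJ Km by (intro measure_mono_fmeasurable) (auto simp: I_def intro!: fmeasurable.finite_UN)
      also have "\<dots> \<le> (\<Sum>j\<in>J. measure lebesgue (K \<inter> I j))"
        using finJ Km by (intro measure_UNION_le) (auto simp: I_def)
      also have "\<dots> \<le> (\<Sum>j\<in>J. \<theta> * measure lebesgue (I' j))"
      proof (rule sum_mono)
        fix j
        have "-B + real j * h \<le> -B + (real j + 1) * h" using h by simp
        then show "measure lebesgue (K \<inter> I j) \<le> \<theta> * measure lebesgue (I' j)"
          using spK[of "-B + real j * h" "-B + (real j + 1) * h"] by (simp add: I_def I'_def)
      qed
      also have "\<dots> = \<theta> * measure lebesgue (\<Union>j\<in>J. I' j)"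
      proof -
        have "disjoint_family_on I' J"
        proof (unfold disjoint_family_on_def, intro ballI impI)
          fix i j :: nat assume "i \<noteq> j"
          then have "real i + 1 \<le> real j \<or> real j + 1 \<le> real i" by linarith
          then have "(real i + 1) * h \<le> real j * h \<or> (real j + 1) * h \<le> real i * h"
            using h by (metis less_imp_le mult_right_mono)
          then show "I' i \<inter> I' j = {}" by (auto simp: I'_def)
        qed
        moreover have "\<theta> * measure lebesgue (\<Union>j\<in>J. I' j) = (\<Sum>j\<in>J. \<theta> * measure lebesgue (I' j))" if "disjoint_family_on I' J"
        proof -
          have "emeasure lborel (I' j) < \<infinity>" for j
            unfolding I'_def by (rule emeasure_bounded_finite[OF bounded_subset[OF
              bounded_closed_interval[of "- B + real j * h" "- B + (real j + 1) * h"]]]) auto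
          then show ?thesis
            using finJ that
            by (subst measure_finite_Union) (auto simp: I'_def sum_distrib_left less_top)
        qed
        ultimately show ?thesis by simp
      qed
      also have "\<dots> \<le> \<theta> * measure lebesgue U"
      proof (rule mult_left_mono[OF measure_mono_fmeasurable])
        show "(\<Union>j\<in>J. I' j) \<subseteq> U"
        proof (clarify)
          fix j y assume "j \<in> J" "y \<in> I' j"
          then obtain x where "x \<in> K" "x \<in> I j" by (auto simp: J_def)
          moreover have "\<bar>y - x\<bar> \<le> h" 
            using \<open>x \<in> I j\<close> \<open>y \<in> I' j\<close> by (auto simp: I_def I'_def algebra_simps)
          ultimately show "y \<in> U" using near[of x y] h by auto
        qed
      qed (use \<theta> Um finJ in \<open>auto simp: I'_def\<close>)
      also have "\<dots> \<le> \<theta> * (measure lebesgue K + \<epsilon>)"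
        using Ub \<theta> by (intro mult_left_mono) auto
      also have "\<dots> \<le> \<theta> * measure lebesgue K + \<epsilon>"
        using \<theta> that by (simp add: distrib_left mult_left_le_one_le)
      finally show ?thesis .
    qed
    then have "measure lebesgue K \<le> \<theta> * measure lebesgue K"
      by (rule field_le_epsilon)
    then have "(1 - \<theta>) * measure lebesgue K \<le> 0" by (simp add: algebra_simps)
    then show ?thesis using \<theta> by (smt (verit) measure_nonneg mult_pos_pos)
  qed
  have "measure lebesgue (E \<inter> {-r..r}) = 0" for r
  proof -
    have Em: "E \<inter> {-r..r} \<in> lmeasurable" using E by (intro bounded_set_imp_lmeasurable) auto
    have "measure lebesgue (E \<inter> {-r..r}) \<le> 0 + \<epsilon>" if "0 < \<epsilon>" for \<epsilon>
    proof -
      obtain K where K: "closed K" "K \<subseteq> E \<inter> {-r..r}" "E \<inter> {-r..r} - K \<in> lmeasurable"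
          "emeasure lebesgue (E \<inter> {-r..r} - K) < ennreal \<epsilon>"
        by (rule sets_lebesgue_inner_closed[OF fmeasurableD[OF Em] \<open>0 < \<epsilon>\<close>])
      have cK: "compact K"
        using K(1,2) by (metis bounded_closed_interval bounded_subset compact_eq_bounded_closed le_inf_iff)
      have "measure lebesgue (E \<inter> {-r..r} - K) < \<epsilon>"
        using K(3,4) that by (simp add: emeasure_eq_measure2 ennreal_less_iff)
      moreover have "measure lebesgue K = 0" using compact_null[OF cK] K(2) by simp
      ultimately show ?thesis
        using measurable_measure_Diff[OF Em fmeasurableD[OF lmeasurable_compact[OF cK]] K(2)] by simp
    qed
    then show ?thesis using field_le_epsilon measure_nonneg by (metis antisym)
  qed
  then have "E \<inter> {-r..r} \<in> null_sets lborel" for r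
  proof -
    have "E \<inter> {-r..r} \<in> lmeasurable" using E by (intro bounded_set_imp_lmeasurable) auto
    then have "emeasure lebesgue (E \<inter> {-r..r}) = 0"
      using \<open>\<And>r. measure lebesgue (E \<inter> {-r..r}) = 0\<close>[of r] by (simp add: emeasure_eq_measure2)
    then show ?thesis using E by (auto simp: null_sets_def)
  qed
  then have "(\<Union>n::nat. E \<inter> {- real n..real n}) \<in> null_sets lborel" by (intro null_sets_UN)
  moreover have "E = (\<Union>n::nat. E \<inter> {- real n..real n})"
  proof -
    have "\<exists>n::nat. - real n \<le> x \<and> x \<le> real n" for x
    proof -
      obtain n where "\<bar>x\<bar> \<le> real n" using real_arch_simple by blast
      then show ?thesis by (intro exI[of _ n]) linarith
    qed
    then show ?thesis by auto
  qed
  ultimately show ?thesis by simp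
qed

text \<open>The signs \<open>\<sigma>\<close> and \<open>\<tau>\<close> are the sides from which the two difference quotients are taken. Rational
  increments keep the set Borel and suffice for continuous \<open>f\<close>.\<close>

definition oscillation_set ::
    "('a::real_normed_vector \<Rightarrow> real) \<Rightarrow> 'a \<Rightarrow> real \<Rightarrow> real \<Rightarrow> real \<Rightarrow> real \<Rightarrow> 'a set" where
  "oscillation_set f v \<alpha> \<beta> \<sigma> \<tau> = {z. \<forall>n::nat.
     (\<exists>h\<in>\<rat> \<inter> {0<..<1 / Suc n}. \<beta> * h < \<sigma> * (f (z + (\<sigma> * h) *\<^sub>R v) - f z)) \<and>
     (\<exists>h\<in>\<rat> \<inter> {0<..<1 / Suc n}. \<tau> * (f (z + (\<tau> * h) *\<^sub>R v) - f z) < \<alpha> * h)}"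

definition nondiff_set :: "('a::real_normed_vector \<Rightarrow> real) \<Rightarrow> 'a \<Rightarrow> 'a set" where
  "nondiff_set f v = (\<Union>\<alpha>\<in>\<rat>. \<Union>\<beta>\<in>\<rat> \<inter> {\<alpha><..}. \<Union>\<sigma>\<in>{1,-1}. \<Union>\<tau>\<in>{1,-1}. oscillation_set f v \<alpha> \<beta> \<sigma> \<tau>)"

lemma oscillation_set_borel:
  fixes f :: "'a::euclidean_space \<Rightarrow> real"
  assumes [measurable]: "f \<in> borel_measurable borel"
  shows "oscillation_set f v \<alpha> \<beta> \<sigma> \<tau> \<in> sets borel"
proof -
  have "oscillation_set f v \<alpha> \<beta> \<sigma> \<tau> = (\<Inter>n::nat.
     (\<Union>h\<in>\<rat> \<inter> {0<..<1 / Suc n}. {z \<in> space borel. \<beta> * h < \<sigma> * (f (z + (\<sigma> * h) *\<^sub>R v) - f z)}) \<inter>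
     (\<Union>h\<in>\<rat> \<inter> {0<..<1 / Suc n}. {z \<in> space borel. \<tau> * (f (z + (\<tau> * h) *\<^sub>R v) - f z) < \<alpha> * h}))"
    by (auto simp: oscillation_set_def)
  also have "\<dots> \<in> sets borel"
    by (intro sets.countable_INT'' sets.Int sets.countable_UN'' countable_Int1 countable_rat) measurable
  finally show ?thesis .
qed

lemma nondiff_set_borel:
  fixes f :: "'a::euclidean_space \<Rightarrow> real"
  assumes "f \<in> borel_measurable borel"
  shows "nondiff_set f v \<in> sets borel"
  unfolding nondiff_set_def
  by (intro sets.countable_UN'' oscillation_set_borel[OF assms] countable_Int1 countable_rat
      countable_finite finite.intros)

text \<open>Both \<open>f x + L * x\<close> and \<open>L * x - f x\<close> are increasing. On the
  set one grows at rate at least \<open>\<beta> + L\<close> and the other at rate at least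
  \<open>L - \<alpha>\<close>, from some side and at arbitrarily small scales. The sum of the rates
  is \<open>2 * L + (\<beta> - \<alpha>)\<close>, while the two functions together grow by only
  \<open>2 * L\<close> per unit length. Hence the set is uniformly sparse.\<close>

lemma oscillation_set_null:
  fixes f :: "real \<Rightarrow> real"
  assumes L: "L-lipschitz_on UNIV f" and "\<alpha> < \<beta>" and \<sigma>: "\<sigma> \<in> {1,-1}" and \<tau>: "\<tau> \<in> {1,-1}"
  shows "oscillation_set f 1 \<alpha> \<beta> \<sigma> \<tau> \<in> null_sets lborel" (is "?E \<in> _")
proof -
  have contf: "continuous_on UNIV f" using L by (rule lipschitz_on_continuous_on)
  have E: "?E \<in> sets borel"
    by (rule oscillation_set_borel) (use contf in \<open>rule borel_measurable_continuous_onI\<close>)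
  have lip: "\<bar>f x - f y\<bar> \<le> L * \<bar>x - y\<bar>" for x y
    using lipschitz_onD[OF L, of x y] by (simp add: dist_real_def)
  have L0: "0 \<le> L" using L by (rule lipschitz_on_nonneg)
  show ?thesis
  proof (cases "?E = {}")
    case False
    then obtain x where x: "x \<in> ?E" by auto
    then obtain h where h: "0 < h" "\<beta> * h < \<sigma> * (f (x + \<sigma> * h) - f x)"
      unfolding oscillation_set_def by (force dest: spec[of _ 0])
    have "\<sigma> * (f (x + \<sigma> * h) - f x) \<le> L * h"
      using lip[of "x + \<sigma> * h" x] \<sigma> h by (auto simp: abs_le_iff)
    \<comment> \<open>One point of the set already confines \<open>\<alpha>\<close> and
      \<open>\<beta>\<close> between \<open>- L\<close> and \<open>L\<close>, which makes both rates
      nonnegative as the growth estimate requires.\<close>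
    then have bL: "\<beta> < L" using h by (smt (verit) mult_right_less_imp_less)
    obtain h where h: "0 < h" "\<tau> * (f (x + \<tau> * h) - f x) < \<alpha> * h"
      using x unfolding oscillation_set_def by (force dest: spec[of _ 0])
    have "- (L * h) \<le> \<tau> * (f (x + \<tau> * h) - f x)"
      using lip[of "x + \<tau> * h" x] \<tau> h by (auto simp: abs_le_iff)
    then have aL: "- L < \<alpha>" using h by (smt (verit) mult_right_less_imp_less minus_mult_left)
    have side: "(\<forall>x\<in>?E. \<forall>\<epsilon>>0. \<exists>h. 0 < h \<and> h < \<epsilon> \<and> c * h \<le> g (x + h) - g x) \<or>
          (\<forall>x\<in>?E. \<forall>\<epsilon>>0. \<exists>h. 0 < h \<and> h < \<epsilon> \<and> c * h \<le> g x - g (x - h))"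
      if \<rho>: "\<rho> \<in> {1,-1::real}" and
        ex: "\<And>x n. x \<in> ?E \<Longrightarrow> \<exists>h. 0 < h \<and> h < 1 / Suc n \<and> c * h < \<rho> * (g (x + \<rho> * h) - g x)"
      for g \<rho> c
    proof -
      have *: "\<exists>h. 0 < h \<and> h < \<epsilon> \<and> c * h \<le> \<rho> * (g (x + \<rho> * h) - g x)" if "x \<in> ?E" "0 < \<epsilon>" for x \<epsilon>
      proof -
        obtain n where "1 / Suc n < \<epsilon>" using \<open>0 < \<epsilon>\<close> by (metis nat_approx_posE)
        then show ?thesis using ex[OF that(1), of n] by (force intro: less_trans)
      qed
      from \<rho> consider "\<rho> = 1" | "\<rho> = -1" by auto
      then show ?thesis using * by cases auto
    qed
    have up: "(\<beta> + L) * measure lborel (?E \<inter> {a..b}) \<le> (f b + L * b) - (f a + L * a)" if "a \<le> b" for a b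
    proof (rule increment_ge_measure[OF that, of _ "\<lambda>x. f x + L * x"])
      show "mono (\<lambda>x. f x + L * x)"
      proof (rule monoI)
        fix x y :: real assume "x \<le> y"
        then show "f x + L * x \<le> f y + L * y" using lip[of x y] by (auto simp: abs_le_iff algebra_simps)
      qed
      show "(\<forall>x\<in>?E. \<forall>\<epsilon>>0. \<exists>h. 0 < h \<and> h < \<epsilon> \<and> (\<beta> + L) * h \<le> (f (x + h) + L * (x + h)) - (f x + L * x)) \<or>
          (\<forall>x\<in>?E. \<forall>\<epsilon>>0. \<exists>h. 0 < h \<and> h < \<epsilon> \<and> (\<beta> + L) * h \<le> (f x + L * x) - (f (x - h) + L * (x - h)))"
      proof (rule side[OF \<sigma>])
        fix x n assume "x \<in> ?E"
        then obtain h where h: "0 < h" "h < 1 / Suc n" "\<beta> * h < \<sigma> * (f (x + \<sigma> * h) - f x)"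
          unfolding oscillation_set_def by force
        have "\<sigma> * (f (x + \<sigma> * h) + L * (x + \<sigma> * h) - (f x + L * x)) = \<sigma> * (f (x + \<sigma> * h) - f x) + L * h"
          using \<sigma> by (auto simp: algebra_simps)
        then show "\<exists>h>0. h < 1 / real (Suc n) \<and> (\<beta> + L) * h < \<sigma> * (f (x + \<sigma> * h) + L * (x + \<sigma> * h) - (f x + L * x))"
          using h by (intro exI[of _ h]) (auto simp: distrib_right)
      qed
    qed (use aL assms(2) E contf in \<open>auto intro!: continuous_intros\<close>)
    have down: "(L - \<alpha>) * measure lborel (?E \<inter> {a..b}) \<le> (L * b - f b) - (L * a - f a)" if "a \<le> b" for a b
    proof (rule increment_ge_measure[OF that, of _ "\<lambda>x. L * x - f x"])
      show "mono (\<lambda>x. L * x - f x)"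
      proof (rule monoI)
        fix x y :: real assume "x \<le> y"
        then show "L * x - f x \<le> L * y - f y" using lip[of x y] by (auto simp: abs_le_iff algebra_simps)
      qed
      show "(\<forall>x\<in>?E. \<forall>\<epsilon>>0. \<exists>h. 0 < h \<and> h < \<epsilon> \<and> (L - \<alpha>) * h \<le> (L * (x + h) - f (x + h)) - (L * x - f x)) \<or>
          (\<forall>x\<in>?E. \<forall>\<epsilon>>0. \<exists>h. 0 < h \<and> h < \<epsilon> \<and> (L - \<alpha>) * h \<le> (L * x - f x) - (L * (x - h) - f (x - h)))"
      proof (rule side[OF \<tau>])
        fix x n assume "x \<in> ?E"
        then obtain h where h: "0 < h" "h < 1 / Suc n" "\<tau> * (f (x + \<tau> * h) - f x) < \<alpha> * h"
          unfolding oscillation_set_def by force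
        have "\<tau> * (L * (x + \<tau> * h) - f (x + \<tau> * h) - (L * x - f x)) = L * h - \<tau> * (f (x + \<tau> * h) - f x)"
          using \<tau> by (auto simp: algebra_simps)
        then show "\<exists>h>0. h < 1 / real (Suc n) \<and> (L - \<alpha>) * h < \<tau> * (L * (x + \<tau> * h) - f (x + \<tau> * h) - (L * x - f x))"
          using h by (intro exI[of _ h]) (auto simp: left_diff_distrib)
      qed
    qed (use bL assms(2) E contf in \<open>auto intro!: continuous_intros\<close>)
    define \<theta> where "\<theta> = 2 * L / (2 * L + (\<beta> - \<alpha>))"
    have \<theta>: "0 \<le> \<theta>" "\<theta> < 1" using L0 assms(2) by (auto simp: \<theta>_def field_simps)
    show ?thesis
    proof (rule null_if_uniformly_sparse[OF E \<theta>])
      fix a b :: real assume "a \<le> b"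
      have "(2 * L + (\<beta> - \<alpha>)) * measure lborel (?E \<inter> {a..b}) \<le> 2 * L * (b - a)"
        using up[OF \<open>a \<le> b\<close>] down[OF \<open>a \<le> b\<close>] by (simp add: algebra_simps)
      then show "measure lborel (?E \<inter> {a..b}) \<le> \<theta> * (b - a)"
        using L0 assms(2) by (simp add: \<theta>_def field_simps)
    qed
  qed simp
qed

lemma nondiff_set_null:
  fixes f :: "real \<Rightarrow> real"
  assumes "L-lipschitz_on UNIV f"
  shows "nondiff_set f 1 \<in> null_sets lborel"
  unfolding nondiff_set_def
  by (intro null_sets_UN' oscillation_set_null[OF assms]) (auto intro: countable_Int1 countable_rat)

text \<open>If the lower and upper limits of the difference quotient differed, two rationals would
  separate them, and \<open>z\<close> would lie in the corresponding oscillation set. The Lipschitz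
  bound makes the common limit finite.\<close>

lemma directional_derivative_exists:
  fixes f :: "'a::real_normed_vector \<Rightarrow> real"
  assumes L: "L-lipschitz_on UNIV f" and z: "z \<notin> nondiff_set f v"
  shows "\<exists>l. ((\<lambda>t. f (z + t *\<^sub>R v)) has_real_derivative l) (at 0)"
proof -
  define Q where "Q h = (f (z + h *\<^sub>R v) - f z) / h" for h
  have contf: "continuous_on UNIV f" using L by (rule lipschitz_on_continuous_on)
  have contQ: "isCont Q h" if "h \<noteq> 0" for h
    unfolding Q_def using contf that
    by (intro continuous_intros continuous_at_compose[of h "\<lambda>h. z + h *\<^sub>R v" f, unfolded o_def])
       (auto simp: continuous_on_eq_continuous_at)
  have bound: "\<bar>Q h\<bar> \<le> L * norm v" for h
  proof (cases "h = 0")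
    case False
    then show ?thesis
      using lipschitz_onD[OF L, of "z + h *\<^sub>R v" z] by (simp add: Q_def dist_norm field_simps)
  qed (use lipschitz_on_nonneg[OF L] in \<open>simp add: Q_def\<close>)
  \<comment> \<open>A condition met frequently near 0 is met arbitrarily close to 0 on one of the
    two sides. Since it is open and \<open>Q\<close> is continuous off 0, the increment can be moved
    to a rational one.\<close>
  have pick: "\<exists>\<sigma>\<in>{1,-1}. \<forall>n::nat. \<exists>h\<in>\<rat> \<inter> {0<..<1 / Suc n}. P (Q (\<sigma> * h))"
    if fr: "\<exists>\<^sub>F h in at 0. P (Q h)" and op: "open {x. P x}" for P
  proof (rule ccontr)
    assume "\<not> ?thesis"
    then have A: "\<forall>\<sigma>\<in>{1,-1}. \<exists>n::nat. \<forall>h\<in>\<rat> \<inter> {0<..<1 / Suc n}. \<not> P (Q (\<sigma> * h))"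
      by blast
    obtain n1 n2 :: nat where n: "\<And>h. h \<in> \<rat> \<inter> {0<..<1 / Suc n1} \<Longrightarrow> \<not> P (Q h)"
      "\<And>h. h \<in> \<rat> \<inter> {0<..<1 / Suc n2} \<Longrightarrow> \<not> P (Q (- h))"
      using bspec[OF A, of 1] bspec[OF A, of "-1"] by (metis insertI1 insertI2 mult_1 mult_minus1)
    define d where "d = min (1 / Suc n1) (1 / Suc n2)"
    have "d > 0" by (simp add: d_def)
    then obtain h where h: "h \<noteq> 0" "\<bar>h\<bar> < d" "P (Q h)"
      using fr unfolding frequently_at by (force simp: dist_real_def)
    have "\<forall>\<^sub>F x in at h. Q x \<in> {x. P x}"
      using contQ[OF h(1)] op h(3) unfolding isCont_def by (metis mem_Collect_eq topological_tendstoD)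
    then obtain e where e: "e > 0" "\<And>x. x \<noteq> h \<Longrightarrow> \<bar>x - h\<bar> < e \<Longrightarrow> P (Q x)"
      by (auto simp: eventually_at dist_real_def)
    \<comment> \<open>Besides staying in the neighbourhood where \<open>P\<close> holds, the
      rational \<open>q\<close> must keep the sign of \<open>h\<close> and the bound
      \<open>d\<close>.\<close>
    define e' where "e' = min e (min (\<bar>h\<bar>) (d - \<bar>h\<bar>))"
    have "e' > 0" using e h by (simp add: e'_def)
    then obtain q where q: "q \<in> \<rat>" "h < q" "q < h + e'"
      using Rats_dense_in_real[of h "h + e'"] by auto
    have P: "P (Q q)" using q e by (intro e(2)) (auto simp: e'_def)
    show False
    proof (cases "h > 0")
      case True
      then have "q \<in> \<rat> \<inter> {0<..<1 / Suc n1}" using q h(2) by (auto simp: e'_def d_def)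
      then show False using n(1) P by blast
    next
      case False
      then have "- q \<in> \<rat> \<inter> {0<..<1 / Suc n2}" using q h by (auto simp: e'_def d_def)
      then show False using n(2)[of "- q"] P by simp
    qed
  qed
  let ?Q = "\<lambda>h. ereal (Q h)"
  have "Limsup (at 0) ?Q \<le> Liminf (at 0) ?Q"
  proof (rule ccontr)
    assume "\<not> ?thesis"
    then have lt: "Liminf (at 0) ?Q < Limsup (at 0) ?Q" by simp
    then obtain \<alpha> where a: "Liminf (at 0) ?Q < ereal (of_rat \<alpha>)" "ereal (of_rat \<alpha>) < Limsup (at 0) ?Q"
      using ereal_dense3[OF lt] by blast
    then obtain \<beta> where b: "ereal (of_rat \<alpha>) < ereal (of_rat \<beta>)" "ereal (of_rat \<beta>) < Limsup (at 0) ?Q"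
      using ereal_dense3[OF a(2)] by blast
    have "\<exists>\<^sub>F h in at 0. Q h > of_rat \<beta>"
    proof (rule ccontr)
      assume "\<not> ?thesis"
      then have "\<forall>\<^sub>F h in at 0. ?Q h \<le> ereal (of_rat \<beta>)" by (simp add: not_frequently not_less)
      then have "Limsup (at 0) ?Q \<le> ereal (of_rat \<beta>)" by (rule Limsup_bounded)
      then show False using b(2) by simp
    qed
    from pick[OF this open_Collect_less[OF continuous_on_const continuous_on_id]] obtain \<sigma> where s: "\<sigma> \<in> {1,-1}" "\<And>n::nat. \<exists>h\<in>\<rat> \<inter> {0<..<1 / Suc n}. Q (\<sigma> * h) > of_rat \<beta>"
      by blast
    have "\<exists>\<^sub>F h in at 0. Q h < of_rat \<alpha>"
    proof (rule ccontr)
      assume "\<not> ?thesis"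
      then have "\<forall>\<^sub>F h in at 0. ereal (of_rat \<alpha>) \<le> ?Q h" by (simp add: not_frequently not_less)
      then have "ereal (of_rat \<alpha>) \<le> Liminf (at 0) ?Q" by (rule Liminf_bounded)
      then show False using a(1) by simp
    qed
    from pick[OF this open_Collect_less[OF continuous_on_id continuous_on_const]] obtain \<tau> where t: "\<tau> \<in> {1,-1}" "\<And>n::nat. \<exists>h\<in>\<rat> \<inter> {0<..<1 / Suc n}. Q (\<tau> * h) < of_rat \<alpha>"
      by blast
    have qs: "\<rho> * (f (z + (\<rho> * h) *\<^sub>R v) - f z) = Q (\<rho> * h) * h" if "\<rho> \<in> {1,-1}" "0 < h" for \<rho> h
      using that by (auto simp: Q_def)
    have "z \<in> oscillation_set f v (of_rat \<alpha>) (of_rat \<beta>) \<sigma> \<tau>"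
      unfolding oscillation_set_def
    proof (intro CollectI allI conjI)
      fix n :: nat
      obtain h where "h\<in>\<rat> \<inter> {0<..<1 / Suc n}" "Q (\<sigma> * h) > of_rat \<beta>" using s(2) by blast
      then show "\<exists>h\<in>\<rat> \<inter> {0<..<1 / Suc n}. of_rat \<beta> * h < \<sigma> * (f (z + (\<sigma> * h) *\<^sub>R v) - f z)"
        using qs[OF s(1)] by (intro bexI[of _ h]) auto
      obtain h where "h\<in>\<rat> \<inter> {0<..<1 / Suc n}" "Q (\<tau> * h) < of_rat \<alpha>" using t(2) by blast
      then show "\<exists>h\<in>\<rat> \<inter> {0<..<1 / Suc n}. \<tau> * (f (z + (\<tau> * h) *\<^sub>R v) - f z) < of_rat \<alpha> * h"
        using qs[OF t(1)] by (intro bexI[of _ h]) auto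
    qed
    then have "z \<in> nondiff_set f v"
      unfolding nondiff_set_def using b(1) s(1) t(1) by (auto intro!: bexI[of _ "of_rat _"])
    then show False using z by blast
  qed
  then have eq: "Limsup (at 0) ?Q = Liminf (at 0) ?Q"
    by (intro antisym Liminf_le_Limsup) auto
  have "Limsup (at 0) ?Q \<le> ereal (L * norm v)"
    using bound by (intro Limsup_bounded always_eventually) (auto simp: abs_le_iff)
  moreover have "ereal (- (L * norm v)) \<le> Liminf (at 0) ?Q"
    using bound by (intro Liminf_bounded always_eventually) (auto simp: abs_le_iff minus_le_iff)
  ultimately obtain l where l: "Liminf (at 0) ?Q = ereal l"
    using eq by (cases "Liminf (at 0) ?Q") auto
  then have "(?Q \<longlongrightarrow> ereal l) (at 0)"
    using eq by (intro tendsto_iff_Liminf_eq_Limsup[THEN iffD2]) auto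
  then have "(Q \<longlongrightarrow> l) (at 0)" by (simp add: lim_ereal)
  then show ?thesis
    by (intro exI[of _ l]) (simp add: has_field_derivative_iff Q_def[abs_def])
qed

lemma nondiff_set_transfer:
  assumes "\<And>h. f (z + h *\<^sub>R v) = g (y + h *\<^sub>R w)"
  shows "z \<in> nondiff_set f v \<longleftrightarrow> y \<in> nondiff_set g w"
proof -
  have "f z = g y" using assms[of 0] by simp
  then have "z \<in> oscillation_set f v \<alpha> \<beta> \<sigma> \<tau> \<longleftrightarrow> y \<in> oscillation_set g w \<alpha> \<beta> \<sigma> \<tau>" for \<alpha> \<beta> \<sigma> \<tau>
    unfolding oscillation_set_def mem_Collect_eq assms by simp
  then show ?thesis
    unfolding nondiff_set_def UN_iff by (simp only:)
qed

text \<open>Fubini: the section over each \<open>x\<close> is the exceptional set of a Lipschitz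
  function of one variable.\<close>

lemma nondiff_set_null_pair:
  fixes g :: "real \<times> real \<Rightarrow> real"
  assumes L: "L-lipschitz_on UNIV g"
  shows "nondiff_set g (0,1) \<in> null_sets lborel"
proof -
  have "continuous_on UNIV g" using L by (rule lipschitz_on_continuous_on)
  then have B: "nondiff_set g (0,1) \<in> sets borel"
    by (intro nondiff_set_borel borel_measurable_continuous_onI)
  have sec: "Pair x -` nondiff_set g (0,1) = nondiff_set (\<lambda>t. g (x,t)) 1" for x
    unfolding vimage_def by (intro set_eqI, simp only: mem_Collect_eq, intro nondiff_set_transfer) simp
  have lip: "L-lipschitz_on UNIV (\<lambda>t. g (x,t))" for x
  proof (rule lipschitz_onI)
    show "dist (g (x, s)) (g (x, t)) \<le> L * dist s t" for s t
      using lipschitz_onD[OF L, of "(x,s)" "(x,t)"] by (simp add: dist_Pair_Pair)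
  qed (rule lipschitz_on_nonneg[OF L])
  have "emeasure (lborel \<Otimes>\<^sub>M lborel) (nondiff_set g (0,1)) = (\<integral>\<^sup>+x. emeasure lborel (Pair x -` nondiff_set g (0,1)) \<partial>(lborel::real measure))"
    using B by (intro lborel.emeasure_pair_measure_alt) (simp only: lborel_prod sets_lborel)
  also have "\<dots> = 0"
    using nondiff_set_null[OF lip] by (simp add: sec null_setsD1)
  finally show ?thesis using B by (simp add: lborel_prod null_sets_def)
qed

text \<open>A linear change of variables turns the direction \<open>v\<close> into
  \<open>(0,1)\<close>, and linear maps send null sets to null sets. For \<open>v = 0\<close> all
  quotients vanish, so no two rates can be separated.\<close>

lemma nondiff_set_null_plane:
  fixes f :: "real^2 \<Rightarrow> real"
  assumes L: "L-lipschitz_on UNIV f"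
  shows "nondiff_set f v \<in> null_sets lborel"
proof (cases "v = 0")
  case True
  have "oscillation_set f v \<alpha> \<beta> \<sigma> \<tau> = {}" if "\<alpha> < \<beta>" for \<alpha> \<beta> \<sigma> \<tau>
  proof (rule ccontr)
    assume "oscillation_set f v \<alpha> \<beta> \<sigma> \<tau> \<noteq> {}"
    then obtain z where "z \<in> oscillation_set f v \<alpha> \<beta> \<sigma> \<tau>" by blast
    then have "\<exists>h\<in>\<rat> \<inter> {0<..<1 / Suc 0}. \<beta> * h < \<sigma> * (f (z + (\<sigma> * h) *\<^sub>R v) - f z)"
        "\<exists>h\<in>\<rat> \<inter> {0<..<1 / Suc 0}. \<tau> * (f (z + (\<tau> * h) *\<^sub>R v) - f z) < \<alpha> * h"
      unfolding oscillation_set_def by blast+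
    then obtain h k where "0 < h" "\<beta> * h < 0" "0 < k" "0 < \<alpha> * k"
      using True by auto
    then show False using that by (simp add: mult_less_0_iff zero_less_mult_iff)
  qed
  then show ?thesis by (simp add: nondiff_set_def)
next
  case False
  have "continuous_on UNIV f" using L by (rule lipschitz_on_continuous_on)
  then have B: "nondiff_set f v \<in> sets borel"
    by (intro nondiff_set_borel borel_measurable_continuous_onI)
  \<comment> \<open>\<open>v\<close> turned by a right angle, so that \<open>w\<close> and
    \<open>v\<close> form an orthogonal basis.\<close>
  define w :: "real^2" where "w = vector [- v$2, v$1]"
  define A where "A = (\<lambda>(s, t). s *\<^sub>R w + t *\<^sub>R v)"
  have A: "bounded_linear A"
    unfolding A_def case_prod_beta by (intro bounded_linear_add bounded_linear_compose[OF bounded_linear_scaleR_left] bounded_linear_fst bounded_linear_snd)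
  then obtain c where c: "c-lipschitz_on UNIV A"
    using bounded_linear.lipschitz_boundE by blast
  have lipg: "(L * c)-lipschitz_on UNIV (f \<circ> A)"
    by (intro lipschitz_on_compose c lipschitz_on_subset[OF L]) auto
  have "nondiff_set f v \<subseteq> A ` nondiff_set (f \<circ> A) (0,1)"
  proof
    fix z assume z: "z \<in> nondiff_set f v"
    define n where "n = (v$1)\<^sup>2 + (v$2)\<^sup>2"
    have n: "n \<noteq> 0" using False by (simp add: n_def vec_eq_iff forall_2 sum_power2_eq_zero_iff)
    \<comment> \<open>The coordinates of \<open>z\<close> in the orthogonal basis \<open>w\<close>,
      \<open>v\<close>, whose vectors have squared length \<open>n\<close>.\<close>
    define s t where "s = (z$2 * v$1 - z$1 * v$2) / n" and "t = (z$1 * v$1 + z$2 * v$2) / n"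
    have "A (s, t) = z"
      unfolding A_def using n by (simp add: vec_eq_iff forall_2 w_def s_def t_def divide_simps)
         (simp add: n_def power2_eq_square algebra_simps)
    moreover have "A ((s, t) + h *\<^sub>R (0,1)) = A (s, t) + h *\<^sub>R v" for h
      by (simp add: A_def algebra_simps)
    ultimately have "(s, t) \<in> nondiff_set (f \<circ> A) (0,1)"
      using z nondiff_set_transfer[of f z v "f \<circ> A" "(s, t)" "(0, 1)"] by simp
    then show "z \<in> A ` nondiff_set (f \<circ> A) (0,1)"
      using \<open>A (s, t) = z\<close> by (metis imageI)
  qed
  moreover have "negligible (A ` nondiff_set (f \<circ> A) (0,1))"
    using A nondiff_set_null_pair[OF lipg]
    by (intro negligible_differentiable_image_negligible)
       (auto simp: negligible_iff_null_sets intro: null_sets_completionI bounded_linear_imp_differentiable_on)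
  ultimately have "negligible (nondiff_set f v)" by (metis negligible_subset)
  then show ?thesis using B by (auto simp: negligible_iff_null_sets null_sets_def)
qed

section \<open>Additivity of the directional derivatives and Rademacher's theorem\<close>

definition quot :: "('a::real_normed_vector \<Rightarrow> real) \<Rightarrow> 'a \<Rightarrow> nat \<Rightarrow> 'a \<Rightarrow> real" where
  "quot f v n z = real (Suc n) * (f (z + (1 / real (Suc n)) *\<^sub>R v) - f z)"

text \<open>A limit along the fixed sequence of increments \<open>1 / Suc n\<close> is a Borel
  function of the point. Where the sequence diverges the value is unspecified; almost everywhere it
  is the directional derivative.\<close>

definition pd :: "('a::real_normed_vector \<Rightarrow> real) \<Rightarrow> 'a \<Rightarrow> 'a \<Rightarrow> real" where
  "pd f v z = lim (\<lambda>n. quot f v n z)"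

lemma quot_tendsto:
  assumes "((\<lambda>t. f (z + t *\<^sub>R v)) has_real_derivative l) (at 0)"
  shows "(\<lambda>n. quot f v n z) \<longlonglongrightarrow> l" "pd f v z = l"
proof -
  have "((\<lambda>h. (f (z + h *\<^sub>R v) - f z) / h) \<longlongrightarrow> l) (at 0)"
    using assms by (simp add: has_field_derivative_iff)
  moreover have "filterlim (\<lambda>n. 1 / real (Suc n)) (at 0) sequentially"
    unfolding filterlim_at using LIMSEQ_Suc[OF lim_1_over_n] by (intro conjI always_eventually) auto
  ultimately have "(\<lambda>n. (f (z + (1 / real (Suc n)) *\<^sub>R v) - f z) / (1 / real (Suc n))) \<longlonglongrightarrow> l"
    by (rule filterlim_compose)
  then show "(\<lambda>n. quot f v n z) \<longlonglongrightarrow> l" by (simp add: quot_def mult.commute)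
  then show "pd f v z = l" unfolding pd_def by (rule limI)
qed

lemma quot_bound:
  assumes "L-lipschitz_on UNIV f"
  shows "\<bar>quot f v n z\<bar> \<le> L * norm v"
proof -
  have "\<bar>f (z + (1 / real (Suc n)) *\<^sub>R v) - f z\<bar> \<le> L * (1 / real (Suc n) * norm v)"
    using lipschitz_onD[OF assms, of "z + (1 / real (Suc n)) *\<^sub>R v" z] by (simp add: dist_norm)
  then have "real (Suc n) * \<bar>f (z + (1 / real (Suc n)) *\<^sub>R v) - f z\<bar> \<le> real (Suc n) * (L * (1 / real (Suc n) * norm v))"
    by (rule mult_left_mono) simp
  then show ?thesis by (simp add: quot_def abs_mult del: of_nat_Suc)
qed

text \<open>Adding the bound \<open>B\<close> makes \<open>g\<close> a density. The measures with
  densities \<open>g + B\<close> and \<open>B\<close> agree on boxes, which are stable under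
  intersection and generate the Borel sets, so the densities agree almost everywhere.\<close>

lemma AE_zero_if_box_integrals_zero:
  fixes g :: "'a::euclidean_space \<Rightarrow> real"
  assumes [measurable]: "g \<in> borel_measurable borel" and bd: "AE z in lborel. \<bar>g z\<bar> \<le> B"
    and zero: "\<And>a b. (\<integral>z. indicator (box a b) z * g z \<partial>lborel) = 0"
  shows "AE z in lborel. g z = 0"
proof -
  have int: "integrable lborel (\<lambda>z. indicator (box a b) z * h z)"
    if "h \<in> borel_measurable borel" "AE z in lborel. \<bar>h z\<bar> \<le> c" for a b :: 'a and c and h :: "'a \<Rightarrow> real"
  proof (rule Bochner_Integration.integrable_bound)
    show "integrable lborel (\<lambda>z. indicator (box a b) z * c)"
      using emeasure_bounded_finite[OF bounded_box[of a b]] by (intro integrable_mult_left integrable_real_indicator) auto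
    show "AE z in lborel. norm (indicator (box a b) z * h z) \<le> norm (indicator (box a b) z * c)"
      using that(2) by eventually_elim (auto simp: indicator_def)
  qed (use that in measurable)
  have pos: "AE z in lborel. 0 \<le> g z + B"
    using bd by eventually_elim auto
  have bdc: "AE z in (lborel::'a measure). \<bar>B\<bar> \<le> \<bar>B\<bar>" by simp
  have "density lborel (\<lambda>z. ennreal (g z + B)) = density lborel (\<lambda>z::'a. ennreal B)"
  proof (rule measure_eqI_generator_eq)
    let ?E = "range (\<lambda>(a, b). box a b :: 'a set)"
    show "Int_stable ?E"
      by (auto simp: Int_stable_def box_Int_box)
    show "sets (density lborel (\<lambda>z. ennreal (g z + B))) = sigma_sets UNIV ?E"
      "sets (density lborel (\<lambda>z::'a. ennreal B)) = sigma_sets UNIV ?E"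
      by (simp_all add: borel_eq_box)
    let ?A = "\<lambda>n::nat. box (- (real n *\<^sub>R One)) (real n *\<^sub>R One) :: 'a set"
    show "range ?A \<subseteq> ?E" "\<Union> (range ?A) = UNIV"
      unfolding UN_box_eq_UNIV by auto
    have box: "emeasure (density lborel (\<lambda>z. ennreal (h z))) (box a b) = ennreal (\<integral>z. indicator (box a b) z * h z \<partial>lborel)"
      if "h \<in> borel_measurable borel" "AE z in lborel. \<bar>h z\<bar> \<le> c" "AE z in lborel. 0 \<le> h z" for a b :: 'a and c h
    proof -
      have "emeasure (density lborel (\<lambda>z. ennreal (h z))) (box a b) = (\<integral>\<^sup>+z. ennreal (h z) * indicator (box a b) z \<partial>lborel)"
        using that by (subst emeasure_density) auto
      also have "\<dots> = (\<integral>\<^sup>+z. ennreal (indicator (box a b) z * h z) \<partial>lborel)"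
        by (intro nn_integral_cong) (auto simp: indicator_def)
      also have "\<dots> = ennreal (\<integral>z. indicator (box a b) z * h z \<partial>lborel)"
        using that(3) by (intro nn_integral_eq_integral int[OF that(1,2)]) (auto elim: eventually_mono)
      finally show ?thesis .
    qed
    have B0: "AE z in (lborel::'a measure). 0 \<le> B"
      using bd by eventually_elim auto
    have bd2: "AE z in lborel. \<bar>g z + B\<bar> \<le> 2 * \<bar>B\<bar>"
      using bd by eventually_elim auto
    have e2: "emeasure (density lborel (\<lambda>z::'a. ennreal B)) (box a b) = ennreal (\<integral>z. indicator (box a b) z * B \<partial>lborel)" for a b
      by (rule box[OF _ bdc B0]) simp
    show "emeasure (density lborel (\<lambda>z. ennreal (g z + B))) X = emeasure (density lborel (\<lambda>z. ennreal B)) X" if X: "X \<in> ?E" for X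
    proof -
      obtain a b where X: "X = box a b" using X by auto
      have "emeasure (density lborel (\<lambda>z. ennreal (g z + B))) (box a b) = ennreal (\<integral>z. indicator (box a b) z * (g z + B) \<partial>lborel)"
        by (rule box[OF _ bd2 pos]) simp
      also have "(\<integral>z. indicator (box a b) z * (g z + B) \<partial>lborel) = (\<integral>z. indicator (box a b) z * g z \<partial>lborel) + (\<integral>z. indicator (box a b) z * B \<partial>lborel)"
        unfolding distrib_left by (intro Bochner_Integration.integral_add int[OF _ bd] int[OF _ bdc]) auto
      finally show ?thesis by (simp add: X e2 zero)
    qed
    show "emeasure (density lborel (\<lambda>z. ennreal (g z + B))) (?A i) \<noteq> \<infinity>" for i
      by (subst box[OF _ bd2 pos]) auto
  qed auto
  then have "AE z in lborel. ennreal (g z + B) = ennreal B"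
    by (intro sigma_finite_measure.density_unique[OF sigma_finite_lborel]) auto
  then show ?thesis using pos bd
  proof eventually_elim
    case (elim z)
    then have "0 \<le> B" by linarith
    then show ?case using elim by simp
  qed
qed

lemma pd_measurable:
  fixes f :: "'a::euclidean_space \<Rightarrow> real"
  assumes "f \<in> borel_measurable borel"
  shows "pd f v \<in> borel_measurable borel"
proof -
  have [measurable]: "f \<in> borel_measurable borel" by fact
  have "(\<lambda>z. lim (\<lambda>n. quot f v n z)) \<in> borel_measurable borel"
    unfolding quot_def by (rule borel_measurable_lim_metric) measurable
  then show ?thesis by (simp add: pd_def[abs_def])
qed

text \<open>The quotient for \<open>v + w\<close> at \<open>z\<close> is the quotient for
  \<open>v\<close> at \<open>z\<close> plus the quotient for \<open>w\<close> at a point shifted by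
  a multiple of \<open>v\<close> tending to 0. Integrated over a box, the shift moves onto the
  indicator of the box, which converges off the boundary. Dominated convergence gives additivity of
  the integrals over all boxes, hence almost everywhere.\<close>

lemma pd_additive_AE:
  fixes f :: "real^2 \<Rightarrow> real"
  assumes L: "L-lipschitz_on UNIV f"
  shows "AE z in lborel. pd f (v + w) z = pd f v z + pd f w z"
proof -
  have contf: "continuous_on UNIV f" using L by (rule lipschitz_on_continuous_on)
  then have [measurable]: "f \<in> borel_measurable borel" by (rule borel_measurable_continuous_onI)
  have [measurable]: "pd f u \<in> borel_measurable borel" "quot f u n \<in> borel_measurable borel" for u n
    unfolding quot_def[abs_def] by (auto intro: pd_measurable)
  have lim: "AE z in lborel. (\<lambda>n. quot f u n z) \<longlonglongrightarrow> pd f u z" for u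
    using AE_not_in[OF nondiff_set_null_plane[OF L, of u]]
    by eventually_elim (metis directional_derivative_exists[OF L] quot_tendsto)
  have bd: "AE z in lborel. \<bar>pd f u z\<bar> \<le> L * norm u" for u
    using lim[of u]
  proof eventually_elim
    case (elim z)
    then show ?case
      by (rule LIMSEQ_le_const2[OF tendsto_rabs]) (use quot_bound[OF L] in auto)
  qed
  have L0: "0 \<le> L" using L by (rule lipschitz_on_nonneg)
  have "AE z in lborel. pd f (v + w) z - pd f v z - pd f w z = 0"
  proof (rule AE_zero_if_box_integrals_zero)
    show "AE z in lborel. \<bar>pd f (v + w) z - pd f v z - pd f w z\<bar> \<le> L * norm (v + w) + L * norm v + L * norm w"
      using bd[of v] bd[of w] bd[of "v + w"] by eventually_elim auto
    fix a b :: "real^2"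
    obtain R where R: "box a b \<subseteq> cball 0 R" "0 < R"
      using bounded_box[of a b] unfolding bounded_pos by (auto simp: subset_iff)
    let ?C = "indicator (box a b) :: real^2 \<Rightarrow> real"
    have intC: "integrable lborel (\<lambda>z. indicator (cball (0::real^2) (R + norm v)) z * c)" for c :: real
      using emeasure_bounded_finite[OF bounded_cball[of "0::real^2" "R + norm v"]]
      by (intro integrable_mult_left integrable_real_indicator) auto
    have dom: "integrable lborel (\<lambda>z. ?C (z - y) * h z)"
      if "h \<in> borel_measurable borel" "AE z in lborel. \<bar>h z\<bar> \<le> c" "norm y \<le> norm v" for h c y
    proof (rule Bochner_Integration.integrable_bound[OF intC[of c]])
      show "AE z in lborel. norm (?C (z - y) * h z) \<le> norm (indicator (cball (0::real^2) (R + norm v)) z * c)"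
        using that(2)
      proof eventually_elim
        case (elim z)
        have "z \<in> cball 0 (R + norm v)" if "z - y \<in> box a b"
          using subsetD[OF R(1) that] norm_triangle_ineq[of "z - y" y] \<open>norm y \<le> norm v\<close> by simp
        then show ?case using elim by (auto simp: indicator_def)
      qed
    qed (use that in measurable)
    \<comment> \<open>\<open>c = 1\<close> treats the box that moves with the increment,
      \<open>c = 0\<close> the fixed box.\<close>
    have lim0: "(\<lambda>n. \<integral>z. ?C (z - (c / real (Suc n)) *\<^sub>R v) * quot f u n z \<partial>lborel) \<longlonglongrightarrow> (\<integral>z. ?C z * pd f u z \<partial>lborel)"
      if c: "0 \<le> c" "c \<le> 1" for u c
    proof (rule integral_dominated_convergence[OF _ _ intC[of "L * norm u"]])
      have small: "norm ((c / real (Suc n)) *\<^sub>R v) \<le> norm v" for n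
      proof -
        have "\<bar>c / real (Suc n)\<bar> \<le> 1" using c by (simp add: field_simps)
        then show ?thesis unfolding norm_scaleR by (intro mult_left_le_one_le) auto
      qed
      show "AE z in lborel. norm (?C (z - (c / real (Suc n)) *\<^sub>R v) * quot f u n z) \<le> indicator (cball 0 (R + norm v)) z * (L * norm u)" for n
      proof (rule AE_I2)
        fix z
        have "z \<in> cball 0 (R + norm v)" if "z - (c / real (Suc n)) *\<^sub>R v \<in> box a b"
          using subsetD[OF R(1) that] norm_triangle_ineq[of "z - (c / real (Suc n)) *\<^sub>R v" "(c / real (Suc n)) *\<^sub>R v"] small[of n] by simp
        then show "norm (?C (z - (c / real (Suc n)) *\<^sub>R v) * quot f u n z) \<le> indicator (cball 0 (R + norm v)) z * (L * norm u)"
          using quot_bound[OF L, of u n z] L0 by (auto simp: indicator_def)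
      qed
      have "frontier (box a b) \<in> null_sets lborel"
        using negligible_convex_frontier[OF convex_box(2)[of a b]]
        by (auto simp: negligible_iff_null_sets null_sets_def)
      from lim[of u] AE_not_in[OF this]
      show "AE z in lborel. (\<lambda>n. ?C (z - (c / real (Suc n)) *\<^sub>R v) * quot f u n z) \<longlonglongrightarrow> ?C z * pd f u z"
      proof eventually_elim
        case (elim z)
        have s: "(\<lambda>n. z - (c / real (Suc n)) *\<^sub>R v) \<longlonglongrightarrow> z - 0 *\<^sub>R v"
          using LIMSEQ_Suc[OF lim_const_over_n[of c]] by (intro tendsto_intros) simp
        have "\<forall>\<^sub>F n in sequentially. ?C (z - (c / real (Suc n)) *\<^sub>R v) = ?C z"
        proof (cases "z \<in> box a b")
          case True
          then have "\<forall>\<^sub>F n in sequentially. z - (c / real (Suc n)) *\<^sub>R v \<in> box a b"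
            using s by (intro topological_tendstoD[OF s]) auto
          then show ?thesis by (rule eventually_mono) (use True in simp)
        next
          case False
          then have "z \<in> - closure (box a b)" using elim(2) interior_subset[of "box a b"] by (auto simp: frontier_def)
          then have "\<forall>\<^sub>F n in sequentially. z - (c / real (Suc n)) *\<^sub>R v \<in> - closure (box a b)"
            using s by (intro topological_tendstoD[OF s]) auto
          then show ?thesis
            by (rule eventually_mono) (use False closure_subset[of "box a b"] in \<open>auto simp: indicator_def\<close>)
        qed
        then have "(\<lambda>n. ?C (z - (c / real (Suc n)) *\<^sub>R v)) \<longlonglongrightarrow> ?C z"
          by (rule tendsto_eventually)
        then show ?case using elim(1) by (rule tendsto_mult)
      qed
    qed measurable
    have shift: "(\<integral>z. ?C z * quot f w n (z + (1 / real (Suc n)) *\<^sub>R v) \<partial>lborel) =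
        (\<integral>z. ?C (z - (1 / real (Suc n)) *\<^sub>R v) * quot f w n z \<partial>lborel)" for n
    proof -
      let ?y = "(1 / real (Suc n)) *\<^sub>R v"
      have "(\<integral>z. ?C (z - ?y) * quot f w n z \<partial>lborel) = (\<integral>z. ?C (z - ?y) * quot f w n z \<partial>(distr lborel borel ((+) ?y)))"
        by (simp add: lborel_distr_plus)
      also have "\<dots> = (\<integral>z. ?C (?y + z - ?y) * quot f w n (?y + z) \<partial>lborel)"
        by (rule integral_distr) measurable
      finally show ?thesis by (simp add: add.commute)
    qed
    have qadd: "quot f (v + w) n z = quot f w n (z + (1 / real (Suc n)) *\<^sub>R v) + quot f v n z" for n z
      by (simp add: quot_def algebra_simps)
    have "(\<integral>z. ?C z * quot f (v + w) n z \<partial>lborel) =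
      (\<integral>z. ?C (z - (1 / real (Suc n)) *\<^sub>R v) * quot f w n z \<partial>lborel) + (\<integral>z. ?C z * quot f v n z \<partial>lborel)" for n
    proof -
      have i1: "integrable lborel (\<lambda>z. ?C (z - 0) * quot f w n (z + (1 / real (Suc n)) *\<^sub>R v))"
        by (rule dom[where c = "L * norm w"]) (use quot_bound[OF L] in auto)
      have i2: "integrable lborel (\<lambda>z. ?C (z - 0) * quot f v n z)"
        by (rule dom[where c = "L * norm v"]) (use quot_bound[OF L] in auto)
      show ?thesis
        using Bochner_Integration.integral_add[OF i1 i2] unfolding qadd distrib_left shift[symmetric] diff_zero .
    qed
    moreover have "(\<lambda>n. \<integral>z. ?C z * quot f (v + w) n z \<partial>lborel) \<longlonglongrightarrow> (\<integral>z. ?C z * pd f (v + w) z \<partial>lborel)"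
      using lim0[of 0 "v + w"] by simp
    moreover have "(\<lambda>n. (\<integral>z. ?C (z - (1 / real (Suc n)) *\<^sub>R v) * quot f w n z \<partial>lborel) + (\<integral>z. ?C z * quot f v n z \<partial>lborel))
        \<longlonglongrightarrow> (\<integral>z. ?C z * pd f w z \<partial>lborel) + (\<integral>z. ?C z * pd f v z \<partial>lborel)"
      using tendsto_add[OF lim0[of 1 w] lim0[of 0 v]] by simp
    ultimately have eq: "(\<integral>z. ?C z * pd f (v + w) z \<partial>lborel) = (\<integral>z. ?C z * pd f w z \<partial>lborel) + (\<integral>z. ?C z * pd f v z \<partial>lborel)"
      using LIMSEQ_unique by (metis (no_types, lifting) ext)
    have ipd: "integrable lborel (\<lambda>z. ?C z * pd f u z)" for u
      using dom[of "pd f u" "L * norm u" 0] bd[of u] by simp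
    show "(\<integral>z. ?C z * (pd f (v + w) z - pd f v z - pd f w z) \<partial>lborel) = 0"
      using eq ipd by (simp add: right_diff_distrib)
  qed measurable
  then show ?thesis by eventually_elim simp
qed

lemma directional_derivative_scale:
  fixes f :: "'a::real_normed_vector \<Rightarrow> real"
  assumes "((\<lambda>t. f (z + t *\<^sub>R v)) has_real_derivative l) (at 0)"
  shows "((\<lambda>t. f (z + t *\<^sub>R (c *\<^sub>R v))) has_real_derivative c * l) (at 0)"
proof -
  have "((\<lambda>t. (\<lambda>s. f (z + s *\<^sub>R v)) (c * t)) has_real_derivative l * c) (at 0)"
    by (rule DERIV_chain2[of "\<lambda>s. f (z + s *\<^sub>R v)" l "\<lambda>t. c * t"]) (use assms in \<open>auto intro!: derivative_eq_intros\<close>)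
  moreover have "(\<lambda>t. f (z + (c * t) *\<^sub>R v)) = (\<lambda>t. f (z + t *\<^sub>R (c *\<^sub>R v)))"
    by (simp add: scaleR_scaleR mult.commute)
  ultimately show ?thesis by (simp only: mult.commute[of l])
qed

lemma rational_vector_dense:
  fixes u :: "real^2"
  assumes "0 < \<delta>"
  obtains v where "v$1 \<in> \<rat>" "v$2 \<in> \<rat>" "norm (v - u) < \<delta>"
proof -
  obtain a where a: "a \<in> \<rat>" "u$1 < a" "a < u$1 + \<delta>/2" using Rats_dense_in_real[of "u$1" "u$1 + \<delta>/2"] assms by auto
  obtain b where b: "b \<in> \<rat>" "u$2 < b" "b < u$2 + \<delta>/2" using Rats_dense_in_real[of "u$2" "u$2 + \<delta>/2"] assms by auto
  have "norm (vector [a,b] - u) \<le> \<bar>a - u$1\<bar> + \<bar>b - u$2\<bar>"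
    using norm_le_l1_cart[of "vector [a,b] - u"] by (simp add: sum_2)
  then have "norm (vector [a,b] - u) < \<delta>" using a b by linarith
  then show thesis using that[of "vector [a,b]"] a b by simp
qed

text \<open>Outside one null set the derivatives exist and are additive in countably many rational
  directions. The Lipschitz bound carries the estimate to all directions: finitely many rational
  vectors are \<open>\<delta>\<close>-close to the whole unit circle, so their moduli of
  differentiability have a positive minimum.\<close>

theorem rademacher_plane:
  fixes f :: "real^2 \<Rightarrow> real"
  assumes L: "L-lipschitz_on UNIV f"
  shows "AE z in lborel. f differentiable (at z)"
proof -
  let ?e1 = "vector [1, 0] :: real^2" and ?e2 = "vector [0, 1] :: real^2"
  let ?V = "(\<lambda>(a, b). vector [a, b] :: real^2) ` (\<rat> \<times> \<rat>)"
  have V: "countable ?V" by (intro countable_image countable_SIGMA countable_rat)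
  have L0: "0 \<le> L" using L by (rule lipschitz_on_nonneg)
  have "AE z in lborel. \<forall>v\<in>?V. z \<notin> nondiff_set f v \<and>
    pd f v z = pd f (v$1 *\<^sub>R ?e1) z + pd f (v$2 *\<^sub>R ?e2) z"
  proof (subst AE_ball_countable[OF V], intro ballI)
    fix v assume "v \<in> ?V"
    have v: "v$1 *\<^sub>R ?e1 + v$2 *\<^sub>R ?e2 = v" by (simp add: vec_eq_iff forall_2)
    show "AE z in lborel. z \<notin> nondiff_set f v \<and> pd f v z = pd f (v$1 *\<^sub>R ?e1) z + pd f (v$2 *\<^sub>R ?e2) z"
      using AE_not_in[OF nondiff_set_null_plane[OF L, of v]] pd_additive_AE[OF L, of "v$1 *\<^sub>R ?e1" "v$2 *\<^sub>R ?e2"]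
      unfolding v by eventually_elim auto
  qed
  then show ?thesis
  proof eventually_elim
    case (elim z)
    have ex: "\<exists>m. ((\<lambda>t. f (z + t *\<^sub>R v)) has_real_derivative m) (at 0)"
      and eqv: "pd f v z = pd f (v$1 *\<^sub>R ?e1) z + pd f (v$2 *\<^sub>R ?e2) z" if "v \<in> ?V" for v
      using bspec[OF elim that] directional_derivative_exists[OF L, of z v] by simp_all
    have e: "?e1 \<in> ?V" "?e2 \<in> ?V"
      by (rule image_eqI[of _ _ "(1, 0)"], simp, simp) (rule image_eqI[of _ _ "(0, 1)"], simp, simp)
    obtain p1 where p1: "((\<lambda>t. f (z + t *\<^sub>R ?e1)) has_real_derivative p1) (at 0)"
      using ex[OF e(1)] by (rule exE)
    obtain p2 where p2: "((\<lambda>t. f (z + t *\<^sub>R ?e2)) has_real_derivative p2) (at 0)"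
      using ex[OF e(2)] by (rule exE)
    \<comment> \<open>The only candidate for the differential; additivity shows that it gives the
      derivative in every rational direction.\<close>
    define l where "l h = p1 * h$1 + p2 * h$2" for h :: "real^2"
    have dl: "((\<lambda>t. f (z + t *\<^sub>R v)) has_real_derivative l v) (at 0)" if v: "v \<in> ?V" for v
    proof -
      obtain m where m: "((\<lambda>t. f (z + t *\<^sub>R v)) has_real_derivative m) (at 0)"
        using ex[OF v] by (rule exE)
      have "m = v$1 * p1 + v$2 * p2"
        using eqv[OF v] quot_tendsto(2)[OF m] quot_tendsto(2)[OF directional_derivative_scale[OF p1, of "v$1"]]
          quot_tendsto(2)[OF directional_derivative_scale[OF p2, of "v$2"]] by simp
      then show ?thesis using m by (simp add: l_def mult.commute)
    qed
    have bl: "bounded_linear l"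
      unfolding l_def by (intro bounded_linear_add bounded_linear_const_mult bounded_linear_vec_nth)
    define P where "P = \<bar>p1\<bar> + \<bar>p2\<bar>"
    have lP: "\<bar>l h\<bar> \<le> P * norm h" for h
    proof -
      have "\<bar>l h\<bar> \<le> \<bar>p1\<bar> * \<bar>h$1\<bar> + \<bar>p2\<bar> * \<bar>h$2\<bar>"
        unfolding l_def by (metis abs_mult abs_triangle_ineq)
      also have "\<dots> \<le> \<bar>p1\<bar> * norm h + \<bar>p2\<bar> * norm h"
        by (intro add_mono mult_left_mono component_le_norm_cart) auto
      finally show ?thesis by (simp add: P_def algebra_simps)
    qed
    have "\<exists>d>0. \<forall>y. norm (y - z) < d \<longrightarrow> norm (f y - f z - l (y - z)) \<le> \<epsilon> * norm (y - z)" if "0 < \<epsilon>" for \<epsilon>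
    proof -
      \<comment> \<open>Replacing a unit vector by a rational one costs at most
        \<open>L * \<delta>\<close> for \<open>f\<close> and \<open>P * \<delta>\<close> for
        \<open>l\<close>, per unit length. Together this is to stay below half of
        \<open>\<epsilon>\<close>; the extra 1 avoids division by zero.\<close>
      define \<delta> where "\<delta> = \<epsilon> / (2 * (L + P + 1))"
      have LP: "0 < L + P + 1" using L0 by (simp add: P_def)
      have \<delta>: "0 < \<delta>" "(L + P) * \<delta> \<le> \<epsilon> / 2"
        using that LP by (simp_all add: \<delta>_def field_simps)
      have "sphere 0 1 \<subseteq> (\<Union>v\<in>?V. ball v \<delta>)"
      proof
        fix u :: "real^2"
        obtain v where "v$1 \<in> \<rat>" "v$2 \<in> \<rat>" "norm (v - u) < \<delta>" using rational_vector_dense[OF \<delta>(1)] .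
        moreover have "v = vector [v$1, v$2]" by (simp add: vec_eq_iff forall_2)
        ultimately show "u \<in> (\<Union>v\<in>?V. ball v \<delta>)" by (force simp: dist_norm)
      qed
      then obtain W where W: "W \<subseteq> ?V" "finite W" "sphere 0 1 \<subseteq> (\<Union>v\<in>W. ball v \<delta>)"
        using compactE_image[OF compact_sphere, of ?V "\<lambda>v. ball v \<delta>" 0 1] by auto
      have "\<exists>d>0. \<forall>t. \<bar>t\<bar> < d \<longrightarrow> \<bar>f (z + t *\<^sub>R v) - f z - t * l v\<bar> \<le> \<epsilon>/2 * \<bar>t\<bar>" if v: "v \<in> W" for v
      proof -
        have "((\<lambda>t. f (z + t *\<^sub>R v)) has_derivative (\<lambda>t. t * l v)) (at 0)"
          using dl[of v] v W(1) by (auto simp: has_field_derivative_def mult_commute_abs)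
        then have "\<exists>d>0. \<forall>y. norm (y - 0) < d \<longrightarrow> norm (f (z + y *\<^sub>R v) - f (z + 0 *\<^sub>R v) - (y - 0) * l v) \<le> \<epsilon>/2 * norm (y - 0)"
          unfolding has_derivative_at_alt using \<open>0 < \<epsilon>\<close> half_gt_zero by blast
        then show ?thesis by (simp only: diff_zero scaleR_zero_left add_0_right real_norm_def)
      qed
      then obtain d where d: "\<And>v. v \<in> W \<Longrightarrow> 0 < d v"
        "\<And>v t. v \<in> W \<Longrightarrow> \<bar>t\<bar> < d v \<Longrightarrow> \<bar>f (z + t *\<^sub>R v) - f z - t * l v\<bar> \<le> \<epsilon>/2 * \<bar>t\<bar>"
        by metis
      define D where "D = Min (insert 1 (d ` W))"
      have D: "0 < D" "\<And>v. v \<in> W \<Longrightarrow> D \<le> d v"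
        using W(2) d(1) by (auto simp: D_def)
      show ?thesis
      proof (intro exI[of _ D] conjI D(1) allI impI)
        fix y assume y: "norm (y - z) < D"
        show "norm (f y - f z - l (y - z)) \<le> \<epsilon> * norm (y - z)"
        proof (cases "y = z")
          case True
          then show ?thesis by (simp add: l_def)
        next
          case False
          define t u where "t = norm (y - z)" and "u = (y - z) /\<^sub>R norm (y - z)"
          have t: "0 < t" and u: "norm u = 1" and yu: "y = z + t *\<^sub>R u"
            using False by (simp_all add: t_def u_def)
          then obtain v where v: "v \<in> W" "norm (u - v) < \<delta>"
            using W(3) by (force simp: dist_norm norm_minus_commute)
          have 1: "\<bar>f (z + t *\<^sub>R u) - f (z + t *\<^sub>R v)\<bar> \<le> L * (t * norm (u - v))"
            using lipschitz_onD[OF L, of "z + t *\<^sub>R u" "z + t *\<^sub>R v"] t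
            by (simp add: dist_norm flip: scaleR_diff_right)
          have 2: "\<bar>f (z + t *\<^sub>R v) - f z - t * l v\<bar> \<le> \<epsilon>/2 * t"
            using d(2)[OF v(1), of t] D(2)[OF v(1)] y t by (simp add: t_def)
          have 3: "\<bar>t * l (u - v)\<bar> \<le> t * (P * norm (u - v))"
            using lP[of "u - v"] t by (simp add: abs_mult)
          have "l (y - z) = t * l v + t * l (u - v)"
            by (simp add: yu l_def algebra_simps)
          then have "\<bar>f y - f z - l (y - z)\<bar> \<le> L * (t * norm (u - v)) + \<epsilon>/2 * t + t * (P * norm (u - v))"
            using 1 2 3 unfolding yu by linarith
          also have "\<dots> = t * ((L + P) * norm (u - v)) + \<epsilon>/2 * t" by (simp add: algebra_simps)
          also have "\<dots> \<le> t * ((L + P) * \<delta>) + \<epsilon>/2 * t"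
            using v t L0 by (intro add_right_mono mult_left_mono) (auto simp: P_def)
          also have "\<dots> \<le> t * (\<epsilon>/2) + \<epsilon>/2 * t"
            using \<delta> t by (intro add_right_mono mult_left_mono) auto
          finally show ?thesis by (simp add: t_def mult.commute)
        qed
      qed
    qed
    then have "(f has_derivative l) (at z)"
      unfolding has_derivative_at_alt using bl by blast
    then show ?case by (auto simp: differentiable_def)
  qed
qed

section \<open>Localisation to maps that are Lipschitz near each point\<close>

lemma AE_lborel_iff_negligible: "(AE x in lborel. P x) \<longleftrightarrow> negligible {x. \<not> P x}"
proof
  assume "AE x in lborel. P x"
  then obtain N where "N \<in> null_sets lborel" "{x. \<not> P x} \<subseteq> N"
    by (auto simp: eventually_ae_filter)
  then show "negligible {x. \<not> P x}"
    by (metis negligible_iff_null_sets negligible_subset null_sets_completionI)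
next
  assume "negligible {x. \<not> P x}"
  then have "{x. \<not> P x} \<in> null_sets lebesgue" by (simp add: negligible_iff_null_sets)
  from AE_not_in[OF this] show "AE x in lborel. P x" by (simp add: AE_completion_iff)
qed

theorem rademacher_local:
  fixes f :: "real^2 \<Rightarrow> real^2"
  assumes "\<And>z. z \<in> S \<Longrightarrow> \<exists>r>0. \<exists>C. C-lipschitz_on (cball z r) f"
  shows "negligible {z \<in> S. \<not> f differentiable (at z)}"
proof (rule locally_negligible_alt[THEN iffD2], rule ballI)
  fix z assume z: "z \<in> {z \<in> S. \<not> f differentiable (at z)}"
  let ?T = "{z \<in> S. \<not> f differentiable (at z)}"
  obtain r C where r: "0 < r" "C-lipschitz_on (cball z r) f" using assms z by blast
  \<comment> \<open>Composition with the nearest point projection of the ball, which is 1-Lipschitz,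
    extends \<open>f\<close> from the ball to a Lipschitz map of the plane.\<close>
  define p where "p = closest_point (cball z r)"
  have p: "1-lipschitz_on UNIV p"
    unfolding p_def using r(1) by (intro lipschitz_onI) (auto intro!: closest_point_lipschitz)
  have pr: "range p \<subseteq> cball z r" unfolding p_def using r(1) closest_point_in_set[of "cball z r"] by auto
  have fp: "C-lipschitz_on UNIV (f \<circ> p)"
    using lipschitz_on_compose[OF p lipschitz_on_subset[OF r(2) pr]] by simp
  have comp: "C-lipschitz_on UNIV (\<lambda>x. (f \<circ> p) x \<bullet> b)" if "b \<in> Basis" for b
  proof (rule lipschitz_onI)
    fix x y
    have "\<bar>(f \<circ> p) x \<bullet> b - (f \<circ> p) y \<bullet> b\<bar> \<le> norm ((f \<circ> p) x - (f \<circ> p) y)"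
      using Basis_le_norm[OF that] by (metis inner_diff_left)
    then show "dist ((f \<circ> p) x \<bullet> b) ((f \<circ> p) y \<bullet> b) \<le> C * dist x y"
      using lipschitz_onD[OF fp, of x y] by (simp add: dist_norm)
  qed (rule lipschitz_on_nonneg[OF fp])
  have "AE x in lborel. \<forall>b\<in>Basis. (\<lambda>x. (f \<circ> p) x \<bullet> b) differentiable (at x)"
    by (intro AE_finite_allI finite_Basis rademacher_plane[OF comp])
  then have "AE x in lborel. (f \<circ> p) differentiable (at x)"
    by (subst differentiable_componentwise_within)
  then have "negligible {x. \<not> (f \<circ> p) differentiable (at x)}"
    by (simp only: AE_lborel_iff_negligible)
  moreover have "?T \<inter> ball z r \<subseteq> {x. \<not> (f \<circ> p) differentiable (at x)}"
  proof clarify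
    fix x assume x: "x \<in> S" "\<not> f differentiable (at x)" "x \<in> ball z r" "(f \<circ> p) differentiable (at x)"
    have "f y = (f \<circ> p) y" if "y \<in> ball z r" for y
      using that by (simp add: p_def closest_point_self)
    then have "f differentiable (at x)"
      using x(3,4) has_derivative_transform_within_open[OF _ open_ball x(3), of "f \<circ> p" _ UNIV f]
      unfolding differentiable_def by metis
    then show False using x by simp
  qed
  ultimately have "negligible (?T \<inter> ball z r)" by (rule negligible_subset)
  moreover have "z \<in> ?T \<inter> ball z r" using z r(1) by (intro IntI) simp_all
  ultimately show "\<exists>U. openin (top_of_set ?T) U \<and> z \<in> U \<and> negligible U"
    using openin_open_Int[OF open_ball[of z r], of ?T] by blast
qed

section \<open>Linear maps between oriented Euclidean planes\<close>

lemma mat2_eq_iff: "A = B \<longleftrightarrow> A$1$1 = B$1$1 \<and> A$1$2 = B$1$2 \<and> A$2$1 = B$2$1 \<and> A$2$2 = B$2$2"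
  for A B :: "real^2^2"
  by (auto simp: vec_eq_iff forall_2)

lemma matrix_mult_2: "((A::real^2^2) ** B) $ i $ j = A$i$1 * B$1$j + A$i$2 * B$2$j"
  by (simp add: matrix_matrix_mult_def sum_2)

lemma trace_2: "trace (A::real^2^2) = A$1$1 + A$2$2"
  by (simp add: trace_def sum_2)

lemma matrix_inv_cancel:
  fixes A :: "real^'n^'n"
  assumes "det A \<noteq> 0"
  shows "A ** matrix_inv A = mat 1" "matrix_inv A ** A = mat 1"
proof -
  obtain A' where "A ** A' = mat 1 \<and> A' ** A = mat 1"
    using assms by (auto simp: invertible_def simp flip: invertible_det_nz)
  then have "A ** matrix_inv A = mat 1 \<and> matrix_inv A ** A = mat 1"
    unfolding matrix_inv_def by (rule someI)
  then show "A ** matrix_inv A = mat 1" "matrix_inv A ** A = mat 1"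
    by auto
qed

lemma matrix_inv_eqI:
  fixes A B :: "real^'n^'n"
  assumes "A ** B = mat 1"
  shows "matrix_inv A = B"
proof -
  have "det A \<noteq> 0"
    using assms by (metis det_I det_mul mult_zero_left zero_neq_one)
  then have "matrix_inv A ** (A ** B) = B"
    by (simp add: matrix_mul_assoc matrix_inv_cancel)
  then show ?thesis
    by (simp add: assms)
qed

lemma matrix_inv_cancel_assoc:
  fixes A B :: "real^'n^'n"
  assumes "det A \<noteq> 0"
  shows "A ** (matrix_inv A ** B) = B" "matrix_inv A ** (A ** B) = B"
  using assms by (simp_all add: matrix_mul_assoc matrix_inv_cancel)

lemma det_matrix_inv: "det A \<noteq> 0 \<Longrightarrow> det (matrix_inv A) = 1 / det (A::real^'n^'n)"
  by (metis det_I det_mul matrix_inv_cancel(1) nonzero_eq_divide_eq mult.commute)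

lemma matrix_inv_mult:
  fixes A B :: "real^'n^'n"
  assumes "det A \<noteq> 0" "det B \<noteq> 0"
  shows "matrix_inv (A ** B) = matrix_inv B ** matrix_inv A"
  by (rule matrix_inv_eqI) (simp add: assms matrix_inv_cancel matrix_inv_cancel_assoc flip: matrix_mul_assoc)

lemma matrix_inv_transpose:
  fixes A :: "real^'n^'n"
  assumes "det A \<noteq> 0"
  shows "matrix_inv (transpose A) = transpose (matrix_inv A)"
  by (rule matrix_inv_eqI) (simp add: assms matrix_inv_cancel transpose_mat flip: matrix_transpose_mul)

section \<open>Gram matrices and change of basis\<close>

definition posdef :: "real^2^2 \<Rightarrow> bool" where
  "posdef G \<longleftrightarrow> transpose G = G \<and> (\<forall>v. v \<noteq> 0 \<longrightarrow> 0 < gip G v v)"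

lemma gip_2: "gip G u v = u$1 * (G$1$1 * v$1 + G$1$2 * v$2) + u$2 * (G$2$1 * v$1 + G$2$2 * v$2)"
  by (simp add: gip_def inner_vec_def sum_2 matrix_vector_mult_def)

lemma posdefD:
  assumes "posdef G"
  shows "G$1$2 = G$2$1" "0 < G$1$1" "0 < G$2$2" "0 < det G"
proof -
  have "transpose G $ 2 $ 1 = G$2$1"
    using assms by (simp only: posdef_def)
  then show sym: "G$1$2 = G$2$1"
    by (simp only: transpose_def vec_lambda_beta)
  have pos: "0 < gip G v v" if "v \<noteq> 0" for v
    using assms that by (simp add: posdef_def)
  show G11: "0 < G$1$1"
    using pos[of "vector [1,0]"] by (simp add: gip_2 vec_eq_iff forall_2)
  define v :: "real^2" where "v = vector [-G$1$2, G$1$1]"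
  have "v \<noteq> 0"
    using G11 by (simp add: v_def vec_eq_iff forall_2)
  moreover have "gip G v v = G$1$1 * det G"
    by (simp add: gip_2 v_def det_2 sym algebra_simps)
  ultimately show "0 < det G"
    using pos[of v] G11 by (simp add: zero_less_mult_iff)
  show "0 < G$2$2"
    using pos[of "vector [0,1]"] by (simp add: gip_2 vec_eq_iff forall_2)
qed

lemma posdef_mat1: "posdef (mat 1)"
  by (auto simp: posdef_def transpose_mat gip_def)

text \<open>The Cholesky factor with positive diagonal. The middle factor \<open>mat 1\<close> gives
  the equation the shape of the change-of-basis rules, and the positive determinant respects
  orientation.\<close>

lemma posdef_factor:
  assumes "posdef G"
  obtains P where "0 < det P" "G = transpose P ** mat 1 ** P"
proof -
  note G = posdefD[OF assms]
  define P :: "real^2^2" where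
    "P = vector [vector [sqrt (G$1$1), G$1$2 / sqrt (G$1$1)], vector [0, sqrt (det G) / sqrt (G$1$1)]]"
  have "0 < det P"
    using G by (simp add: P_def det_2)
  moreover have "G$2$2 = G$1$2 * G$1$2 / G$1$1 + det G / G$1$1"
    using G by (simp add: det_2 field_simps)
  then have "G = transpose P ** mat 1 ** P"
    using G by (simp add: P_def mat2_eq_iff matrix_mult_2 transpose_def real_div_sqrt flip: real_sqrt_mult)
  ultimately show thesis
    by (rule that)
qed

lemma gip_change: "gip (transpose U ** G ** U) u v = gip G (U *v u) (U *v v)"
  by (simp add: gip_def matrix_vector_mul_assoc[symmetric] dot_lmul_matrix[symmetric] vector_transpose_matrix inner_commute)
     (metis dot_lmul_matrix inner_commute transpose_transpose vector_transpose_matrix)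

text \<open>Under coordinate changes \<open>U\<close> in the source and \<open>V\<close> in the
  target, the matrix of a map becomes \<open>V ** A ** matrix_inv U\<close>. This rule and its
  consequences serve two purposes: the reduction to the standard inner product, and the independence
  of charts.\<close>

lemma adjoint_change:
  assumes "posdef G" "det U \<noteq> 0" "det V \<noteq> 0"
  shows "adjoint_mat (transpose U ** G ** U) (transpose V ** H ** V) A =
    matrix_inv U ** adjoint_mat G H (V ** A ** matrix_inv U) ** V"
  using posdefD(4)[OF assms(1)] assms(2,3)
  by (simp add: adjoint_mat_def matrix_inv_mult matrix_inv_transpose det_mul matrix_transpose_mul
      flip: matrix_mul_assoc)

lemma hom_inner_change:
  assumes "posdef G" "det U \<noteq> 0" "det V \<noteq> 0"
  shows "hom_inner (transpose U ** G ** U) (transpose V ** H ** V) A B =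
    hom_inner G H (V ** A ** matrix_inv U) (V ** B ** matrix_inv U)"
  using trace_mul_sym[of "matrix_inv U" "adjoint_mat G H (V ** A ** matrix_inv U) ** V ** B"]
  by (simp add: hom_inner_def adjoint_change[OF assms] matrix_mul_assoc)

lemma riem_det_change:
  assumes "posdef G" "0 < det U" "0 < det V"
  shows "riem_det (transpose U ** G ** U) (transpose V ** H ** V) A = riem_det G H (V ** A ** matrix_inv U)"
proof -
  have "sqrt (det V * det H * det V) = det V * sqrt (det H)" "sqrt (det U * det G * det U) = det U * sqrt (det G)"
    using assms real_sqrt_mult[of "(det V)\<^sup>2" "det H"] real_sqrt_mult[of "(det U)\<^sup>2" "det G"]
    by (simp_all add: power2_eq_square ac_simps)
  then show ?thesis
    using assms posdefD(4)[OF assms(1)] by (simp add: riem_det_def det_mul det_matrix_inv ac_simps)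
qed

lemma SO_change:
  assumes "0 < det U" "0 < det V"
  shows "R \<in> SO (transpose U ** G ** U) (transpose V ** H ** V) \<longleftrightarrow> V ** R ** matrix_inv U \<in> SO G H"
proof -
  have U: "U *v (matrix_inv U *v x) = x" "matrix_inv U *v (U *v x) = x" for x
    using assms(1) by (simp_all add: matrix_vector_mul_assoc matrix_inv_cancel)
  have "(\<forall>u v. gip H (V *v (R *v u)) (V *v (R *v v)) = gip G (U *v u) (U *v v)) \<longleftrightarrow>
    (\<forall>u v. gip H (V *v (R *v (matrix_inv U *v u))) (V *v (R *v (matrix_inv U *v v))) = gip G u v)"
    by (metis U)
  then show ?thesis
    using assms by (simp add: SO_def gip_change det_mul det_matrix_inv zero_less_mult_iff zero_less_divide_iff
        flip: matrix_vector_mul_assoc)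
qed

lemma dist_SO_change:
  assumes "posdef G" "0 < det U" "0 < det V"
  shows "dist_SO (transpose U ** G ** U) (transpose V ** H ** V) A = dist_SO G H (V ** A ** matrix_inv U)"
proof -
  let ?c = "\<lambda>R. V ** R ** matrix_inv U"
  have inv: "?c (matrix_inv V ** R ** U) = R" for R
    using assms by (simp add: matrix_inv_cancel matrix_inv_cancel_assoc flip: matrix_mul_assoc)
  have "?c ` SO (transpose U ** G ** U) (transpose V ** H ** V) = SO G H"
  proof (intro subset_antisym subsetI)
    fix R assume "R \<in> SO G H"
    then have "matrix_inv V ** R ** U \<in> SO (transpose U ** G ** U) (transpose V ** H ** V)"
      by (simp add: SO_change[OF assms(2,3)] inv)
    then show "R \<in> ?c ` SO (transpose U ** G ** U) (transpose V ** H ** V)"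
      by (rule image_eqI[rotated]) (simp add: inv)
  qed (auto simp: SO_change[OF assms(2,3)])
  moreover have "hom_norm (transpose U ** G ** U) (transpose V ** H ** V) (A - R) = hom_norm G H (?c A - ?c R)" for R
  proof -
    have "?c (A - R) = ?c A - ?c R"
      by (simp add: mat2_eq_iff matrix_mult_2 algebra_simps)
    then show ?thesis
      using assms by (simp add: hom_norm_def hom_inner_change)
  qed
  ultimately show ?thesis
    unfolding dist_SO_def by (metis (no_types, lifting) INF_cong image_image)
qed

lemma eigvals_change:
  assumes "det U \<noteq> 0"
  shows "eigvals (matrix_inv U ** B ** U) = eigvals B"
proof -
  have U: "U *v (matrix_inv U *v x) = x" "matrix_inv U *v (U *v x) = x" for x
    using assms by (simp_all add: matrix_vector_mul_assoc matrix_inv_cancel)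
  have 1: "(matrix_inv U *v (B *v (U *v v)) = l *\<^sub>R v) = (B *v (U *v v) = l *\<^sub>R (U *v v))" for v l
    by (metis U matrix_vector_mult_scaleR)
  have 2: "U *v v \<noteq> 0 \<longleftrightarrow> v \<noteq> 0" for v
    by (metis U mult.commute matrix_vector_mult_0_right)
  show ?thesis
    unfolding eigvals_def matrix_vector_mul_assoc[symmetric] 1 by (metis (no_types, lifting) 2 U(1))
qed

lemma sv_change:
  assumes "posdef G" "det U \<noteq> 0" "det V \<noteq> 0"
  shows "sv1 (transpose U ** G ** U) (transpose V ** H ** V) A = sv1 G H (V ** A ** matrix_inv U)"
    and "sv2 (transpose U ** G ** U) (transpose V ** H ** V) A = sv2 G H (V ** A ** matrix_inv U)"
proof -
  have "adjoint_mat (transpose U ** G ** U) (transpose V ** H ** V) A ** A =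
    matrix_inv U ** (adjoint_mat G H (V ** A ** matrix_inv U) ** (V ** A ** matrix_inv U)) ** U"
    by (subst adjoint_change[OF assms]) (simp add: assms matrix_inv_cancel matrix_inv_cancel_assoc flip: matrix_mul_assoc)
  then show "sv1 (transpose U ** G ** U) (transpose V ** H ** V) A = sv1 G H (V ** A ** matrix_inv U)"
    and "sv2 (transpose U ** G ** U) (transpose V ** H ** V) A = sv2 G H (V ** A ** matrix_inv U)"
    unfolding sv1_def sv2_def by (simp_all add: eigvals_change[OF assms(2)])
qed

section \<open>Explicit formulas for the standard inner product\<close>

lemma matrix_inv_mat1: "matrix_inv (mat 1 :: real^'n^'n) = mat 1"
  by (rule matrix_inv_eqI) simp

lemma hom_inner_mat1:
  "hom_inner (mat 1) (mat 1) A B = A$1$1 * B$1$1 + A$1$2 * B$1$2 + A$2$1 * B$2$1 + A$2$2 * B$2$2"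
  by (simp add: hom_inner_def adjoint_mat_def matrix_inv_mat1 trace_2 matrix_mult_2 transpose_def)

lemma riem_det_mat1: "riem_det (mat 1) (mat 1) A = det A"
  by (simp add: riem_det_def)

text \<open>The squared Hilbert-Schmidt norm, that is, the sum of the squared singular values. With
  the Jacobian it determines every pointwise quantity of the theorem.\<close>

definition hs :: "real^2^2 \<Rightarrow> real^2^2 \<Rightarrow> real^2^2 \<Rightarrow> real" where
  "hs G H A = hom_inner G H A A"

lemma SO_mat1:
  "R \<in> SO (mat 1) (mat 1) \<longleftrightarrow>
     R$2$2 = R$1$1 \<and> R$1$2 = - R$2$1 \<and> (R$1$1)\<^sup>2 + (R$2$1)\<^sup>2 = 1"
proof
  assume R: "R \<in> SO (mat 1) (mat 1)"
  have ip: "(R *v u) \<bullet> (R *v v) = u \<bullet> v" for u v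
    using R by (simp add: SO_def gip_def)
  have d: "0 < det R"
    using R by (simp add: SO_def)
  have 1: "(R$1$1)\<^sup>2 + (R$2$1)\<^sup>2 = 1"
    using ip[of "vector [1,0]" "vector [1,0]"]
    by (simp add: inner_vec_def sum_2 matrix_vector_mult_def power2_eq_square)
  have 2: "R$1$1 * R$1$2 + R$2$1 * R$2$2 = 0"
    using ip[of "vector [1,0]" "vector [0,1]"]
    by (simp add: inner_vec_def sum_2 matrix_vector_mult_def)
  have 3: "(R$1$2)\<^sup>2 + (R$2$2)\<^sup>2 = 1"
    using ip[of "vector [0,1]" "vector [0,1]"]
    by (simp add: inner_vec_def sum_2 matrix_vector_mult_def power2_eq_square)
  \<comment> \<open>Lagrange's identity for the two columns; orthonormal columns leave only
    determinant 1 or -1.\<close>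
  have "(det R)\<^sup>2 + (R$1$1 * R$1$2 + R$2$1 * R$2$2)\<^sup>2
      = ((R$1$1)\<^sup>2 + (R$2$1)\<^sup>2) * ((R$1$2)\<^sup>2 + (R$2$2)\<^sup>2)"
    by (simp add: det_2 power2_eq_square algebra_simps)
  then have "(det R)\<^sup>2 = 1"
    by (simp add: 1 2 3)
  then have "det R = 1"
    using d by (simp add: power2_eq_1_iff)
  \<comment> \<open>The left side expands to the sum of the squared column lengths minus twice the
    determinant, which is 2 - 2.\<close>
  then have "(R$2$2 - R$1$1)\<^sup>2 + (R$1$2 + R$2$1)\<^sup>2 = 0"
    using 1 3 by (simp add: det_2 power2_eq_square algebra_simps)
  then have "R$2$2 - R$1$1 = 0 \<and> R$1$2 + R$2$1 = 0"
    by (simp only: sum_power2_eq_zero_iff)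
  with 1 show "R$2$2 = R$1$1 \<and> R$1$2 = - R$2$1 \<and> (R$1$1)\<^sup>2 + (R$2$1)\<^sup>2 = 1"
    by auto
next
  assume R: "R$2$2 = R$1$1 \<and> R$1$2 = - R$2$1 \<and> (R$1$1)\<^sup>2 + (R$2$1)\<^sup>2 = 1"
  then have "det R = 1"
    by (simp add: det_2 power2_eq_square)
  moreover have "gip (mat 1) (R *v u) (R *v v) = ((R$1$1)\<^sup>2 + (R$2$1)\<^sup>2) * gip (mat 1) u v" for u v
    using conjunct1[OF R] conjunct1[OF conjunct2[OF R]] by (simp add: gip_2 mat_def) (simp add: matrix_vector_mult_def sum_2 power2_eq_square algebra_simps)
  ultimately show "R \<in> SO (mat 1) (mat 1)"
    using R by (simp add: SO_def)
qed

text \<open>Subtracting or adding twice the determinant leaves a sum of two squares: the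
  anticonformal part of \<open>B\<close> in the first case, the conformal part in the
  second.\<close>

lemma hs_nonneg_mat1: "2 * \<bar>det B\<bar> \<le> hs (mat 1) (mat 1) B"
proof -
  have "0 \<le> (B$1$1 - B$2$2)\<^sup>2 + (B$1$2 + B$2$1)\<^sup>2" "0 \<le> (B$1$1 + B$2$2)\<^sup>2 + (B$1$2 - B$2$1)\<^sup>2"
    by simp_all
  then have "2 * det B \<le> hs (mat 1) (mat 1) B" "- 2 * det B \<le> hs (mat 1) (mat 1) B"
    by (simp_all add: hs_def hom_inner_mat1 det_2 power2_eq_square algebra_simps)
  then show ?thesis
    by linarith
qed

text \<open>All rotations have squared norm 2, so only the inner product with \<open>B\<close>
  varies. It is a linear function of cosine and sine, and its maximum over the unit circle is the
  length of the coefficient vector, whose square is \<open>hs + 2 * det B\<close>.\<close>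

lemma dist_SO_mat1:
  "dist_SO (mat 1) (mat 1) B = sqrt (hs (mat 1) (mat 1) B + 2 - 2 * sqrt (hs (mat 1) (mat 1) B + 2 * det B))"
proof -
  let ?S = "hs (mat 1) (mat 1) B"
  \<comment> \<open>The coefficients of cosine and sine in the inner product of \<open>B\<close>
    with a rotation.\<close>
  define x y where "x = B$1$1 + B$2$2" and "y = B$2$1 - B$1$2"
  define w where "w = sqrt (x\<^sup>2 + y\<^sup>2)"
  have w: "w = sqrt (?S + 2 * det B)"
    by (simp add: w_def x_def y_def hs_def hom_inner_mat1 det_2 power2_eq_square algebra_simps)
  have w2: "w\<^sup>2 = x\<^sup>2 + y\<^sup>2" "0 \<le> w"
    by (simp_all add: w_def)
  have nrm: "hom_norm (mat 1) (mat 1) (B - R) = sqrt (?S + 2 - 2 * (x * R$1$1 + y * R$2$1))"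
    if "R \<in> SO (mat 1) (mat 1)" for R
  proof -
    have R: "R$2$2 = R$1$1" "R$1$2 = - R$2$1" "(R$1$1)\<^sup>2 + (R$2$1)\<^sup>2 = 1"
      using that by (simp_all add: SO_mat1)
    have "hom_inner (mat 1) (mat 1) (B - R) (B - R) =
        ?S + 2 * ((R$1$1)\<^sup>2 + (R$2$1)\<^sup>2) - 2 * (x * R$1$1 + y * R$2$1)"
      using R by (simp add: hs_def hom_inner_mat1 x_def y_def power2_eq_square algebra_simps)
    then show ?thesis
      using R by (simp add: hom_norm_def)
  qed
  have le: "sqrt (?S + 2 - 2 * w) \<le> hom_norm (mat 1) (mat 1) (B - R)" if "R \<in> SO (mat 1) (mat 1)" for R
  proof -
    have R: "(R$1$1)\<^sup>2 + (R$2$1)\<^sup>2 = 1"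
      using that by (simp add: SO_mat1)
    have "(x * R$1$1 + y * R$2$1)\<^sup>2 + (x * R$2$1 - y * R$1$1)\<^sup>2 = (x\<^sup>2 + y\<^sup>2) * ((R$1$1)\<^sup>2 + (R$2$1)\<^sup>2)"
      by (simp add: power2_eq_square algebra_simps)
    then have "(x * R$1$1 + y * R$2$1)\<^sup>2 \<le> w\<^sup>2"
      using zero_le_power2[of "x * R$2$1 - y * R$1$1"] by (simp only: R w2(1) mult_1_right)
    then have "x * R$1$1 + y * R$2$1 \<le> w"
      using w2 by (metis power2_le_imp_le)
    then show ?thesis
      by (simp add: nrm[OF that])
  qed
  \<comment> \<open>The rotation pointing in the direction \<open>(x, y)\<close>. If this vector
    vanishes, all rotations are equally far from \<open>B\<close> and the identity serves.\<close>
  define R0 :: "real^2^2" where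
    "R0 = (if w = 0 then mat 1 else vector [vector [x/w, -y/w], vector [y/w, x/w]])"
  have R0: "R0 \<in> SO (mat 1) (mat 1)"
  proof (cases "w = 0")
    case True
    then show ?thesis
      by (simp add: R0_def SO_mat1) (simp add: mat_def)
  next
    case False
    then have "x\<^sup>2 + y\<^sup>2 \<noteq> 0"
      using w2 by (metis zero_eq_power2)
    then show ?thesis
      using False by (simp add: R0_def SO_mat1 power_divide add_divide_distrib[symmetric] flip: w2(1))
  qed
  have "x * R0$1$1 + y * R0$2$1 = w"
  proof (cases "w = 0")
    case True
    then have "x = 0 \<and> y = 0"
      using w2 by simp
    then show ?thesis
      using True by simp
  next
    case False
    then show ?thesis
      using w2 by (simp add: R0_def field_simps power2_eq_square)
  qed
  then have eq: "hom_norm (mat 1) (mat 1) (B - R0) = sqrt (?S + 2 - 2 * w)"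
    by (simp add: nrm[OF R0])
  have "dist_SO (mat 1) (mat 1) B = sqrt (?S + 2 - 2 * w)"
    unfolding dist_SO_def
  proof (rule antisym)
    have "bdd_below ((\<lambda>R. hom_norm (mat 1) (mat 1) (B - R)) ` SO (mat 1) (mat 1))"
      by (rule bdd_belowI2[of _ "sqrt (?S + 2 - 2 * w)"]) (use le in auto)
    then show "(INF R\<in>SO (mat 1) (mat 1). hom_norm (mat 1) (mat 1) (B - R)) \<le> sqrt (?S + 2 - 2 * w)"
      using cINF_lower[OF _ R0] eq by metis
    show "sqrt (?S + 2 - 2 * w) \<le> (INF R\<in>SO (mat 1) (mat 1). hom_norm (mat 1) (mat 1) (B - R))"
      by (rule cINF_greatest) (use R0 le in auto)
  qed
  then show ?thesis
    by (simp add: w)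
qed

lemma eigvals_2:
  "eigvals (B::real^2^2) = {l. l\<^sup>2 - trace B * l + det B = 0}"
proof -
  have "l \<in> eigvals B \<longleftrightarrow> det (B - mat l) = 0" for l
  proof -
    have "mat l *v v = l *\<^sub>R v" for v :: "real^2"
      by (simp add: vec_eq_iff forall_2 matrix_vector_mult_def sum_2 mat_def)
    then have "l \<in> eigvals B \<longleftrightarrow> (\<exists>v. v \<noteq> 0 \<and> (B - mat l) *v v = 0)"
      by (simp add: eigvals_def matrix_vector_mult_diff_rdistrib)
    then show ?thesis
      by (metis invertible_det_nz invertible_left_inverse matrix_left_invertible_ker)
  qed
  then show ?thesis
    by (auto simp: det_2 trace_2 mat_def power2_eq_square algebra_simps)
qed

text \<open>The eigenvalues of the adjoint times \<open>B\<close> have sum \<open>hs\<close> and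
  product the squared determinant. Hence the singular values have product
  \<open>\<bar>det B\<bar>\<close>, and squaring their sum gives the formula.\<close>

lemma sv_sum_mat1:
  "sv1 (mat 1) (mat 1) B + sv2 (mat 1) (mat 1) B = sqrt (hs (mat 1) (mat 1) B + 2 * \<bar>det B\<bar>)"
proof -
  let ?S = "hs (mat 1) (mat 1) B" and ?C = "adjoint_mat (mat 1) (mat 1) B ** B"
  have S: "trace ?C = ?S"
    by (simp add: hs_def hom_inner_def)
  have D: "det ?C = (det B)\<^sup>2"
    by (simp add: adjoint_mat_def matrix_inv_mat1 det_mul power2_eq_square)
  have SD: "2 * \<bar>det B\<bar> \<le> ?S"
    by (rule hs_nonneg_mat1)
  have "(2 * \<bar>det B\<bar>)\<^sup>2 \<le> ?S\<^sup>2"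
    using SD by (intro power_mono) auto
  then have disc: "0 \<le> ?S\<^sup>2 - 4 * (det B)\<^sup>2"
    by (simp add: power_mult_distrib)
  define r where "r = sqrt (?S\<^sup>2 - 4 * (det B)\<^sup>2)"
  have r: "0 \<le> r" "r\<^sup>2 = ?S\<^sup>2 - 4 * (det B)\<^sup>2"
    using disc by (simp_all add: r_def)
  have "r\<^sup>2 \<le> ?S\<^sup>2" using r by simp
  then have rS: "r \<le> ?S"
    using SD by (intro power2_le_imp_le[of r ?S]) auto
  have "l\<^sup>2 - ?S * l + (det B)\<^sup>2 = (l - (?S - r)/2) * (l - (?S + r)/2)" for l
    using r(2) by (simp add: power2_eq_square field_simps)
  then have ev: "eigvals ?C = {(?S - r)/2, (?S + r)/2}"
    by (auto simp: eigvals_2 S D)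
  have "Min (eigvals ?C) = (?S - r)/2" "Max (eigvals ?C) = (?S + r)/2"
    using r by (simp_all add: ev)
  then have sv: "sv1 (mat 1) (mat 1) B = sqrt ((?S - r)/2)" "sv2 (mat 1) (mat 1) B = sqrt ((?S + r)/2)"
    by (simp_all add: sv1_def sv2_def)
  have "(?S - r)/2 * ((?S + r)/2) = (det B)\<^sup>2"
    using r(2) by (simp add: power2_eq_square field_simps)
  then have "sqrt ((?S - r)/2) * sqrt ((?S + r)/2) = sqrt ((det B)\<^sup>2)"
    by (simp only: flip: real_sqrt_mult)
  then have "(sqrt ((?S - r)/2) + sqrt ((?S + r)/2))\<^sup>2 = ?S + 2 * \<bar>det B\<bar>"
    using rS r(1) by (simp add: power2_sum field_simps)
  then show ?thesis
    using rS r(1) by (simp add: sv real_sqrt_unique[symmetric])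
qed

section \<open>Transfer to arbitrary Gram matrices\<close>

lemma two_factors:
  assumes "posdef G" "posdef H"
  obtains P Q where "0 < det P" "0 < det Q" "det P \<noteq> 0" "det Q \<noteq> 0" "G = transpose P ** mat 1 ** P" "H = transpose Q ** mat 1 ** Q"
  using posdef_factor[OF assms(1)] posdef_factor[OF assms(2)] by (metis less_irrefl)

lemma hs_change:
  assumes "posdef G" "det U \<noteq> 0" "det V \<noteq> 0"
  shows "hs (transpose U ** G ** U) (transpose V ** H ** V) A = hs G H (V ** A ** matrix_inv U)"
  unfolding hs_def by (rule hom_inner_change[OF assms])

lemma dist_SO_eq:
  assumes "posdef G" "posdef H"
  shows "dist_SO G H A = sqrt (hs G H A + 2 - 2 * sqrt (hs G H A + 2 * riem_det G H A))"
proof -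
  obtain P Q where "0 < det P" "0 < det Q" "det P \<noteq> 0" "det Q \<noteq> 0" "G = transpose P ** mat 1 ** P" "H = transpose Q ** mat 1 ** Q"
    using two_factors[OF assms] .
  then show ?thesis
    by (simp only: dist_SO_change hs_change riem_det_change posdef_mat1 not_False_eq_True dist_SO_mat1 riem_det_mat1)
qed

lemma sv_sum_eq:
  assumes "posdef G" "posdef H"
  shows "sv1 G H A + sv2 G H A = sqrt (hs G H A + 2 * \<bar>riem_det G H A\<bar>)"
proof -
  obtain P Q where "0 < det P" "0 < det Q" "det P \<noteq> 0" "det Q \<noteq> 0" "G = transpose P ** mat 1 ** P" "H = transpose Q ** mat 1 ** Q"
    using two_factors[OF assms] .
  then show ?thesis
    by (simp only: sv_change hs_change riem_det_change posdef_mat1 not_False_eq_True sv_sum_mat1 riem_det_mat1)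
qed

lemma hs_ge:
  assumes "posdef G" "posdef H"
  shows "2 * \<bar>riem_det G H A\<bar> \<le> hs G H A"
proof -
  obtain P Q where "0 < det P" "0 < det Q" "det P \<noteq> 0" "det Q \<noteq> 0" "G = transpose P ** mat 1 ** P" "H = transpose Q ** mat 1 ** Q"
    using two_factors[OF assms] .
  then show ?thesis
    by (simp only: hs_change riem_det_change posdef_mat1 not_False_eq_True hs_nonneg_mat1 riem_det_mat1)
qed

text \<open>The equality case of \<open>hs_ge\<close>: in orthonormal frames a sum of two squares
  vanishes, which says that the matrix is a multiple of a rotation, hence that the pulled-back
  metric is a multiple of the given one.\<close>

lemma conformal_iff:
  assumes "posdef G" "posdef H" "0 \<le> riem_det G H A"
  shows "hs G H A = 2 * t \<and> riem_det G H A = t \<longleftrightarrow> transpose A ** H ** A = t *\<^sub>R G \<and> 0 \<le> t"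
proof -
  obtain P Q where PQ: "0 < det P" "0 < det Q" "det P \<noteq> 0" "det Q \<noteq> 0" "G = transpose P ** mat 1 ** P" "H = transpose Q ** mat 1 ** Q"
    using two_factors[OF assms(1,2)] .
  define B where "B = Q ** A ** matrix_inv P"
  have A: "Q ** A = B ** P"
    using PQ by (simp add: B_def matrix_inv_cancel flip: matrix_mul_assoc)
  have "transpose A ** H ** A = transpose (Q ** A) ** (Q ** A)"
    by (simp add: PQ matrix_transpose_mul matrix_mul_assoc)
  also have "\<dots> = transpose P ** (transpose B ** B) ** P"
    by (simp add: A matrix_transpose_mul matrix_mul_assoc)
  finally have "transpose A ** H ** A = t *\<^sub>R G \<longleftrightarrow> transpose P ** (transpose B ** B) ** P = transpose P ** (t *\<^sub>R mat 1) ** P"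
    by (simp add: PQ scalar_matrix_assoc matrix_scalar_ac)
  also have "\<dots> \<longleftrightarrow> transpose B ** B = t *\<^sub>R mat 1"
  proof -
    have "X = Y" if "transpose P ** X ** P = transpose P ** Y ** P" for X Y :: "real^2^2"
    proof -
      have "matrix_inv (transpose P) ** (transpose P ** X ** P) ** matrix_inv P = 
            matrix_inv (transpose P) ** (transpose P ** Y ** P) ** matrix_inv P"
        by (simp add: that)
      then show ?thesis
        using PQ by (simp add: matrix_inv_cancel matrix_inv_cancel_assoc flip: matrix_mul_assoc)
    qed
    then show ?thesis by auto
  qed
  finally have 1: "transpose A ** H ** A = t *\<^sub>R G \<longleftrightarrow> transpose B ** B = t *\<^sub>R mat 1" .
  have d: "riem_det G H A = det B" and h: "hs G H A = hs (mat 1) (mat 1) B"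
    using PQ by (simp_all only: hs_change riem_det_change posdef_mat1 not_False_eq_True riem_det_mat1 B_def)
  have nn: "0 \<le> det B"
    using assms(3) d by simp
  show ?thesis
    unfolding 1 d h
  proof
    assume "hs (mat 1) (mat 1) B = 2 * t \<and> det B = t"
    then have eq: "hs (mat 1) (mat 1) B = 2 * t" "det B = t" by auto
    then have "(B$1$1 - B$2$2)\<^sup>2 + (B$1$2 + B$2$1)\<^sup>2 = 0"
      by (simp add: hs_def hom_inner_mat1 det_2 power2_eq_square algebra_simps)
    then have "B$1$1 - B$2$2 = 0 \<and> B$1$2 + B$2$1 = 0"
      by (simp only: sum_power2_eq_zero_iff)
    then have B: "B$2$2 = B$1$1" "B$1$2 = - B$2$1" by auto
    then show "transpose B ** B = t *\<^sub>R mat 1 \<and> 0 \<le> t"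
    proof -
      have t: "t = B$1$1 * B$1$1 + B$2$1 * B$2$1"
        using eq(2) B by (simp add: det_2)
      have "transpose B ** B = t *\<^sub>R mat 1"
        unfolding t by (simp add: mat2_eq_iff matrix_mult_2 transpose_def mat_def B)
      then show ?thesis
        using eq(2) nn by simp
    qed
  next
    assume B: "transpose B ** B = t *\<^sub>R mat 1 \<and> 0 \<le> t"
    have "det (t *\<^sub>R mat 1 :: real^2^2) = t\<^sup>2"
      unfolding det_2 by (simp add: mat_def power2_eq_square)
    then have "(det B)\<^sup>2 = t\<^sup>2"
      using arg_cong[OF conjunct1[OF B], of det]
      by (simp add: det_mul power2_eq_square)
    \<comment> \<open>Taking determinants gives the equation only up to sign; the sign is fixed
      because neither side is negative.\<close>
    then have "det B = t"
      using nn B by (metis abs_of_nonneg power2_eq_iff_nonneg)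
    moreover have "hs (mat 1) (mat 1) B = 2 * t"
    proof -
      have "hs (mat 1) (mat 1) B = trace (transpose B ** B)"
        by (simp add: hs_def hom_inner_mat1 trace_2 matrix_mult_2 transpose_def)
      then show ?thesis
        using B by (simp add: trace_2 mat_def)
    qed
    ultimately show "hs (mat 1) (mat 1) B = 2 * t \<and> det B = t"
      by simp
  qed
qed

section \<open>The profile function\<close>

lemma dist_SO_power2:
  assumes "posdef G" "posdef H" and t: "t = riem_det G H A" "0 \<le> t"
    and w: "w = sqrt (hs G H A + 2 * t)"
  shows "(dist_SO G H A)\<^sup>2 = (w - 1)\<^sup>2 + 1 - 2 * t" "2 * sqrt t \<le> w" "w\<^sup>2 = hs G H A + 2 * t"
    "0 \<le> dist_SO G H A"
proof -
  have S: "2 * t \<le> hs G H A"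
    using hs_ge[OF assms(1,2), of A] t by simp
  then show w2: "w\<^sup>2 = hs G H A + 2 * t"
    using t w by simp
  have "(2 * sqrt t)\<^sup>2 \<le> w\<^sup>2"
    using S t w2 by (simp add: power_mult_distrib)
  then show ws: "2 * sqrt t \<le> w"
    by (rule power2_le_imp_le) (use w S t in simp)
  have eq: "hs G H A + 2 - 2 * w = (w - 1)\<^sup>2 + 1 - 2 * t"
    using w2 by (simp add: power2_eq_square algebra_simps)
  \<comment> \<open>Since \<open>2 * t\<close> is at most \<open>hs G H A\<close>, the square of
    \<open>w\<close> is at most twice \<open>hs G H A\<close>. The expression is therefore at least
    half the square of \<open>w - 2\<close>.\<close>
  moreover have "0 \<le> hs G H A + 2 - 2 * w"
  proof -
    have "(w - 2)\<^sup>2 \<ge> 0" by simp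
    then show ?thesis using w2 S by (simp add: power2_eq_square algebra_simps)
  qed
  moreover have "dist_SO G H A = sqrt (hs G H A + 2 - 2 * w)"
    using t w by (simp add: dist_SO_eq[OF assms(1,2)])
  ultimately show "(dist_SO G H A)\<^sup>2 = (w - 1)\<^sup>2 + 1 - 2 * t" "0 \<le> dist_SO G H A"
    by simp_all
qed

lemma F_alt: "1/4 \<le> s \<Longrightarrow> F s = 2 * (sqrt s - 1)\<^sup>2"
proof (cases "s = 1/4")
  case True
  have "sqrt (1/4) = 1/2" by (simp add: real_sqrt_divide)
  then have "2 * (sqrt (1/4) - 1)\<^sup>2 = (1/2::real)" by (simp only:) (simp add: power2_eq_square)
  then show ?thesis unfolding True by (simp add: F_def)
qed (simp add: F_def)

lemma F_nonneg: "0 \<le> s \<Longrightarrow> 0 \<le> F s"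
  by (simp add: F_def)

lemma dist_SO_ge_F:
  assumes "posdef G" "posdef H" "0 \<le> riem_det G H A"
  shows "F (riem_det G H A) \<le> (dist_SO G H A)\<^sup>2"
    and "riem_det G H A \<le> 1/4 \<Longrightarrow> (dist_SO G H A)\<^sup>2 = F (riem_det G H A) \<longleftrightarrow> A \<in> K G H"
    and "1/4 \<le> riem_det G H A \<Longrightarrow> (dist_SO G H A)\<^sup>2 = F (riem_det G H A) \<longleftrightarrow>
      transpose A ** H ** A = riem_det G H A *\<^sub>R G"
proof -
  define t w where "t = riem_det G H A" and "w = sqrt (hs G H A + 2 * t)"
  have t: "0 \<le> t" using assms(3) by (simp add: t_def)
  note D = dist_SO_power2[OF assms(1,2) t_def t w_def]
  have w0: "0 \<le> w" using D(2) real_sqrt_ge_zero[OF t] by linarith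
  have K: "A \<in> K G H \<longleftrightarrow> w = 1"
    using sv_sum_eq[OF assms(1,2), of A] t by (simp add: K_def w_def t_def)
  have C: "transpose A ** H ** A = riem_det G H A *\<^sub>R G \<longleftrightarrow> w = 2 * sqrt t"
  proof -
    have "transpose A ** H ** A = t *\<^sub>R G \<longleftrightarrow> hs G H A = 2 * t"
      using conformal_iff[OF assms, of t] t by (simp add: t_def)
    also have "\<dots> \<longleftrightarrow> w\<^sup>2 = (2 * sqrt t)\<^sup>2"
      using t by (simp add: D(3) power_mult_distrib)
    also have "\<dots> \<longleftrightarrow> w = 2 * sqrt t"
      by (intro power2_eq_iff_nonneg) (use w0 t in auto)
    finally show ?thesis by (simp add: t_def)
  qed
  \<comment> \<open>For \<open>t\<close> at least 1/4 the admissible range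
    \<open>2 * sqrt t \<le> w\<close> lies to the right of the vertex \<open>w = 1\<close> of the
    parabola, so the minimum sits at the left end; \<open>F t\<close> is the value there.\<close>
  have big: "F t = (2 * sqrt t - 1)\<^sup>2 + 1 - 2 * t" "1 \<le> 2 * sqrt t" if "1/4 \<le> t"
  proof -
    have "sqrt (1/4) \<le> sqrt t" using that by (simp only: real_sqrt_le_iff)
    then show "1 \<le> 2 * sqrt t" by (simp add: real_sqrt_divide)
    have "sqrt t * sqrt t = t" using t by simp
    then show "F t = (2 * sqrt t - 1)\<^sup>2 + 1 - 2 * t"
      by (simp add: F_alt[OF that] power2_eq_square algebra_simps)
  qed
  have small: "F t = 1 - 2 * t" if "t \<le> 1/4"
    using that by (simp add: F_def)
  show "F (riem_det G H A) \<le> (dist_SO G H A)\<^sup>2"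
  proof (cases "t \<le> 1/4")
    case True
    then show ?thesis using small D(1) by (simp add: t_def)
  next
    case False
    then have "(2 * sqrt t - 1)\<^sup>2 \<le> (w - 1)\<^sup>2"
      using big D(2) by (intro power_mono) auto
    then show ?thesis using big D(1) False by (simp add: t_def)
  qed
  show "(dist_SO G H A)\<^sup>2 = F (riem_det G H A) \<longleftrightarrow> A \<in> K G H" if "riem_det G H A \<le> 1/4"
    using small D(1) that unfolding K by (simp add: t_def)
  show "(dist_SO G H A)\<^sup>2 = F (riem_det G H A) \<longleftrightarrow>
      transpose A ** H ** A = riem_det G H A *\<^sub>R G" if "1/4 \<le> riem_det G H A"
  proof -
    have "(dist_SO G H A)\<^sup>2 = F t \<longleftrightarrow> (w - 1)\<^sup>2 = (2 * sqrt t - 1)\<^sup>2"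
      using big D(1) that by (simp add: t_def)
    also have "\<dots> \<longleftrightarrow> w - 1 = 2 * sqrt t - 1"
      using big D(2) that by (intro power2_eq_iff_nonneg) (auto simp: t_def)
    finally show ?thesis unfolding C by (simp add: t_def)
  qed
qed

text \<open>The derivative of \<open>F\<close>. Both formulas give -2 at 1/4, so \<open>F\<close> is
  continuously differentiable across the junction.\<close>

definition F_slope :: "real \<Rightarrow> real" where
  "F_slope s = (if s \<le> 1/4 then -2 else 2 * (1 - 1 / sqrt s))"

text \<open>Convexity of \<open>F\<close> by completing squares in the square roots \<open>u\<close>
  of \<open>t\<close> and \<open>r\<close> of \<open>s\<close>. \<open>F\<close> is affine up to 1/4
  and strictly above its tangent elsewhere, so the tangent at 1/4 touches the graph along the whole
  affine part.\<close>

lemma F_support: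
  assumes "0 \<le> s" "0 \<le> t"
  shows "F s + F_slope s * (t - s) \<le> F t"
    and "1/4 \<le> s \<Longrightarrow> F t = F s + F_slope s * (t - s) \<Longrightarrow> t = s \<or> s = 1/4 \<and> t \<le> 1/4"
proof -
  define u r where "u = sqrt t" and "r = sqrt s"
  have u: "0 \<le> u" "t = u * u" and r: "0 \<le> r" "s = r * r"
    using assms by (simp_all add: u_def r_def)
  have half: "1/4 \<le> x * x \<longleftrightarrow> 1/2 \<le> x" if "0 \<le> x" for x :: real
    using that abs_le_square_iff[of "1/2" x] by (simp add: power2_eq_square)
  have eqh: "x * x = 1/4 \<longleftrightarrow> x = 1/2" if "0 \<le> x" for x :: real
    using that power2_eq_iff_nonneg[of x "1/2"] by (simp add: power2_eq_square)
  have Fb: "F (x * x) = 2 * (x - 1)\<^sup>2" if "1/2 \<le> x" for x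
    using F_alt[of "x * x"] that half[of x] by simp
  have Fs: "F (x * x) = 2 * (x - 1)\<^sup>2 - (2 * x - 1)\<^sup>2" if "0 \<le> x" "x \<le> 1/2" for x
  proof -
    have "x * x \<le> 1/4" using that half[of x] eqh[of x] by (smt (verit))
    then show ?thesis by (simp add: F_def power2_eq_square algebra_simps)
  qed
  have "F s + F_slope s * (t - s) \<le> F t \<and>
    (1/4 \<le> s \<longrightarrow> F t = F s + F_slope s * (t - s) \<longrightarrow> t = s \<or> s = 1/4 \<and> t \<le> 1/4)"
  proof (cases "r \<le> 1/2")
    case True
    then have s: "s \<le> 1/4" using half[of r] eqh[of r] r by (smt (verit))
    then have line: "F s + F_slope s * (t - s) = 1 - 2 * t"
      by (simp add: F_def F_slope_def)
    show ?thesis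
    proof (cases "u \<le> 1/2")
      case True
      then have "t \<le> 1/4" using half[of u] eqh[of u] u by (smt (verit))
      then show ?thesis using s line by (simp add: F_def)
    next
      case False
      have "F t = 1 - 2 * t + (2 * u - 1)\<^sup>2"
        using Fb[of u] False u(2) by (simp add: power2_eq_square algebra_simps)
      then show ?thesis using line False by simp
    qed
  next
    case False
    then have s: "1/4 < s" using half[of r] eqh[of r] r by (smt (verit))
    \<comment> \<open>The gap between the second branch and its tangent at \<open>s\<close> is an
      explicit square; it is also needed for \<open>u\<close> below 1/2, where \<open>F\<close> has
      the other branch.\<close>
    have line: "2 * (u - 1)\<^sup>2 = F s + F_slope s * (t - s) + 2 / r * (u - r)\<^sup>2"
    proof -
    have "F s = 2 * (r - 1)\<^sup>2" "F_slope s = 2 * (1 - 1 / r)"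
      using s False Fb[of r] by (simp_all add: F_slope_def r_def)
    moreover have "2 * (u - 1)\<^sup>2 = 2 * (r - 1)\<^sup>2 + 2 * (1 - 1 / r) * (u * u - r * r) + 2 / r * (u - r)\<^sup>2"
      using False by (simp add: power2_eq_square field_simps)
    ultimately show ?thesis by (simp only: u(2) r(2))
  qed
    have r2: "1/2 < r" using False by simp
    show ?thesis
    proof (cases "u \<le> 1/2")
      case True
      have "F t - (F s + F_slope s * (t - s)) = 2 / r * (u - r)\<^sup>2 - (2 * u - 1)\<^sup>2"
        using Fs[OF u(1) True] line u(2) by simp
      \<comment> \<open>Regrouping makes the sign visible: the first term is positive since
        \<open>r\<close> exceeds 1/2, the second is nonnegative since \<open>u\<close> is at most
        1/2.\<close>
      also have "\<dots> = (2 / r) * (1/2 - r)\<^sup>2 + (4 - 2 / r) * (1/4 - u * u)"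
        using r2 by (simp add: power2_eq_square field_simps)
      finally have *: "F t - (F s + F_slope s * (t - s)) = (2 / r) * (1/2 - r)\<^sup>2 + (4 - 2 / r) * (1/4 - u * u)" .
      have "0 < (2 / r) * (1/2 - r)\<^sup>2" using r2 by simp
      moreover have "0 \<le> (4 - 2 / r) * (1/4 - u * u)"
      proof (rule mult_nonneg_nonneg)
        show "0 \<le> 4 - 2 / r" using r2 by (simp add: field_simps)
        show "0 \<le> 1/4 - u * u" using mult_mono[OF True True] u by simp
      qed
      ultimately show ?thesis using * by linarith
    next
      case F: False
      then have "F t = 2 * (u - 1)\<^sup>2" using Fb[of u] u(2) by simp
      then have *: "F t = F s + F_slope s * (t - s) + 2 / r * (u - r)\<^sup>2" using line by simp
      moreover have "0 \<le> 2 / r * (u - r)\<^sup>2" using r2 by simp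
      ultimately show ?thesis using r2 u r by auto
    qed
  qed
  then show "F s + F_slope s * (t - s) \<le> F t"
    and "1/4 \<le> s \<Longrightarrow> F t = F s + F_slope s * (t - s) \<Longrightarrow> t = s \<or> s = 1/4 \<and> t \<le> 1/4"
    by blast+
qed

text \<open>The strict tangent inequality for a power greater than 1. Homogeneity reduces it to the
  base point 1 with \<open>y = x / a\<close>, where \<open>y powr q - q * y\<close> has its strict
  minimum.\<close>

lemma powr_support:
  fixes x a q :: real
  assumes "0 \<le> x" "0 < a" "1 < q"
  shows "a powr q + q * a powr (q - 1) * (x - a) \<le> x powr q"
    and "x powr q = a powr q + q * a powr (q - 1) * (x - a) \<Longrightarrow> x = a"
proof -
  have base: "1 + q * (y - 1) < y powr q" if "0 \<le> y" "y \<noteq> 1" for y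
  proof (cases "y = 0")
    case True
    then show ?thesis using assms by simp
  next
    case False
    define f where "f y = y powr q - q * y" for y
    have D: "(f has_real_derivative q * (z powr (q - 1) - 1)) (at z)" if "0 < z" for z
      unfolding f_def using that by (auto intro!: derivative_eq_intros simp: algebra_simps)
    have y: "0 < y" using False that by simp
    have "f 1 < f y"
    proof (cases "1 < y")
      case True
      show ?thesis
      proof (rule DERIV_pos_imp_increasing_open[OF True])
        fix z assume z: "1 < z" "z < y"
        then have "1 < z powr (q - 1)" using assms by simp
        then show "\<exists>l. (f has_real_derivative l) (at z) \<and> 0 < l"
          using D[of z] z assms by (intro exI[of _ "q * (z powr (q - 1) - 1)"]) auto
      qed (auto simp: f_def intro!: continuous_intros)
    next
      case F: False
      then have "y < 1" using that by simp
      then show ?thesis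
      proof (rule DERIV_neg_imp_decreasing_open)
        fix z assume z: "y < z" "z < 1"
        then have "z powr (q - 1) < 1" using assms y powr_less_mono2[of "q - 1" z 1] by simp
        then show "\<exists>l. (f has_real_derivative l) (at z) \<and> l < 0"
          using D[of z] z y assms by (intro exI[of _ "q * (z powr (q - 1) - 1)"]) (auto simp: mult_less_0_iff)
      qed (use y in \<open>auto simp: f_def intro!: continuous_intros\<close>)
    qed
    then show ?thesis by (simp add: f_def algebra_simps)
  qed
  have a: "a powr q * (1 + q * (x / a - 1)) = a powr q + q * a powr (q - 1) * (x - a)"
    using assms by (simp add: powr_diff field_simps)
  have x: "a powr q * (x / a) powr q = x powr q"
    using assms by (simp add: powr_divide)
  have "a powr q + q * a powr (q - 1) * (x - a) < x powr q" if "x \<noteq> a"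
    unfolding a[symmetric] x[symmetric] using base[of "x / a"] assms that
    by (intro mult_strict_left_mono) auto
  then show "a powr q + q * a powr (q - 1) * (x - a) \<le> x powr q"
    and "x powr q = a powr q + q * a powr (q - 1) * (x - a) \<Longrightarrow> x = a"
    by (cases "x = a"; force)+
qed

text \<open>The tangent of the power at \<open>F s\<close> is composed with the tangent of
  \<open>F\<close> at \<open>s\<close>, so the slope is the one given by the chain rule. For
  \<open>q > 1\<close> strictness of the power makes contact unique; for \<open>q = 1\<close> the
  line is the tangent of \<open>F\<close> itself.\<close>

lemma F_powr_support:
  assumes s: "0 \<le> s" "s \<le> 1" and q: "1 \<le> q"
  obtains m where "\<And>t. 0 \<le> t \<Longrightarrow> F s powr q + m * (t - s) \<le> F t powr q"
    and "\<And>t. 0 \<le> t \<Longrightarrow> F t powr q = F s powr q + m * (t - s) \<Longrightarrow> t = s \<or> q = 1 \<and> s \<le> 1/4 \<and> t \<le> 1/4"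
    and "\<And>t. 0 \<le> t \<Longrightarrow> t \<le> 1/4 \<Longrightarrow> s \<le> 1/4 \<Longrightarrow> q = 1 \<Longrightarrow> F t powr q = F s powr q + m * (t - s)"
proof (cases "q = 1")
  case True
  have "F t powr q = F t" if "0 \<le> t" for t
    using True F_nonneg[OF that] by simp
  moreover have "t = s \<or> s \<le> 1/4 \<and> t \<le> 1/4" if "0 \<le> t" "F t = F s + F_slope s * (t - s)" for t
  proof (cases "1/4 \<le> s")
    case True
    then show ?thesis using F_support(2)[OF s(1) that(1)] that(2) by auto
  next
    case False
    have "t \<le> 1/4"
    proof (rule ccontr)
      assume "\<not> t \<le> 1/4"
      moreover have "1 - 2 * t = F t" using that(2) False by (simp add: F_def F_slope_def)
      \<comment> \<open>The tangents at \<open>s < 1/4\<close> and at 1/4 are the same line, so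
        contact beyond 1/4 would contradict strictness of the tangent at 1/4.\<close>
      moreover have "F t = F (1/4) + F_slope (1/4) * (t - 1/4)" using that(2) False by (simp add: F_def F_slope_def)
      ultimately show False using F_support(2)[of "1/4" t] that(1) by simp
    qed
    then show ?thesis using False by simp
  qed
  ultimately show thesis
    using s F_support(1)[OF s(1)] True by (intro that[of "F_slope s"]) (auto simp: F_def F_slope_def)
next
  case False
  then have q1: "1 < q" using q by simp
  show thesis
  proof (cases "s = 1")
    case True
    \<comment> \<open>Here the base point of the power is zero, outside the range of
      \<open>powr_support\<close>; the horizontal line supports a nonnegative function at its
      zero.\<close>
    have F1: "F s = 0" by (simp add: True F_def)
    have "t = 1" if "0 \<le> t" "F t = 0" for t
    proof -
      have "F_slope 1 = 0" by (simp add: F_slope_def)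
      then show ?thesis using F_support(2)[of 1 t] that F1 True by simp
    qed
    then show thesis
      using False q1 F1 True by (intro that[of 0]) auto
  next
    case s1: False
    then have "s < 1" using s by simp
    have slope: "F_slope s < 0"
      using \<open>s < 1\<close> by (auto simp: F_slope_def field_simps)
    have Fs: "0 < F s"
      using \<open>s < 1\<close> s by (auto simp: F_def)
    define c where "c = q * F s powr (q - 1)"
    have c: "0 < c" using q1 Fs by (simp add: c_def)
    have lower: "F s powr q + c * F_slope s * (t - s) \<le> F s powr q + c * (F t - F s)" if "0 \<le> t" for t
      using F_support(1)[OF s(1) that] c by (simp add: mult.assoc)
    show thesis
    proof (rule that[of "c * F_slope s"])
      fix t :: real assume t: "0 \<le> t"
      show "F s powr q + c * F_slope s * (t - s) \<le> F t powr q"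
        using lower[OF t] powr_support(1)[OF F_nonneg[OF t] Fs q1] by (simp add: c_def)
      assume eq: "F t powr q = F s powr q + c * F_slope s * (t - s)"
      \<comment> \<open>Contact squeezes both inequalities into equalities. The power then forces
        \<open>F t = F s\<close>, and since the slope is negative the line takes this value only at
        \<open>t = s\<close>.\<close>
      have ge: "F s powr q + c * (F t - F s) \<le> F t powr q"
        using powr_support(1)[OF F_nonneg[OF t] Fs q1] by (simp add: c_def)
      then have "F t powr q = F s powr q + c * (F t - F s)"
        using lower[OF t] eq by simp
      then have Fts: "F t = F s"
        using powr_support(2)[OF F_nonneg[OF t] Fs q1] by (simp add: c_def)
      then have "F s powr q = F s powr q + c * F_slope s * (t - s)"
        using eq by simp
      then have "t = s" using c slope by simp
      then show "t = s \<or> q = 1 \<and> s \<le> 1/4 \<and> t \<le> 1/4" ..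
    qed (use False in auto)
  qed
qed

section \<open>Charts and area\<close>

abbreviation im :: "'a chart \<Rightarrow> (real^2) set" where
  "im c \<equiv> snd c ` fst c"

text \<open>The first-order part of smoothness, stated for the local extension: it lives on an open
  set, so at boundary points there is still a full derivative depending continuously on the
  point.\<close>

lemma smooth_on_extension:
  assumes "smooth_on S f" "x \<in> S"
  shows "\<exists>V g. open V \<and> x \<in> V \<and> continuous_on V g \<and> (\<forall>y\<in>V. g differentiable (at y)) \<and>
    (\<forall>v. continuous_on V (\<lambda>y. frechet_derivative g (at y) v)) \<and> (\<forall>y\<in>S \<inter> V. g y = f y)"
proof -
  obtain V g where Vg: "open V \<and> x \<in> V \<and> (\<forall>k. Ck_on k V g) \<and> (\<forall>y\<in>S \<inter> V. g y = f y)"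
    using bspec[OF assms(1)[unfolded smooth_on_def] assms(2)] by (elim exE)
  then have V: "open V" "x \<in> V" and C: "Ck_on k V g" and eq: "\<forall>y\<in>S \<inter> V. g y = f y" for k
    by iprover+
  have "continuous_on V g" using C[of 0] by (simp only: Ck_on.simps)
  moreover have "(\<forall>y\<in>V. g differentiable (at y)) \<and> (\<forall>v. continuous_on V (\<lambda>y. frechet_derivative g (at y) v))"
    using C[of "Suc 0"] unfolding Ck_on.simps .
  ultimately show ?thesis using V eq by iprover
qed

lemma smooth_on_continuous_on:
  assumes "smooth_on S f"
  shows "continuous_on S f"
  unfolding continuous_on_eq_continuous_within
proof
  fix x assume x: "x \<in> S"
  obtain V g where V: "open V" "x \<in> V" "continuous_on V g" "\<forall>y\<in>S \<inter> V. g y = f y"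
    using smooth_on_extension[OF assms x] by (elim exE conjE)
  have "continuous (at x) g"
    using V(1-3) by (simp add: continuous_on_eq_continuous_at)
  then have g: "continuous (at x within S) g" by (rule continuous_at_imp_continuous_within)
  obtain d where d: "d > 0" "ball x d \<subseteq> V" using V(1,2) openE by blast
  show "continuous (at x within S) f"
    by (rule continuous_transform_within[OF g d(1) x]) (use V(4) d(2) in \<open>auto simp: dist_commute subset_iff\<close>)
qed

lemma smooth_on_has_derivative:
  assumes "smooth_on S f" "x \<in> S"
  shows "(f has_derivative frechet_derivative f (at x within S)) (at x within S)"
proof -
  obtain V g where V: "open V" "x \<in> V" "\<forall>y\<in>V. g differentiable (at y)" "\<forall>y\<in>S \<inter> V. g y = f y"
    using smooth_on_extension[OF assms] by (elim exE conjE)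
  obtain d where d: "d > 0" "ball x d \<subseteq> V" using V(1,2) openE by blast
  obtain g' where "(g has_derivative g') (at x)" using V(2,3) unfolding differentiable_def by blast
  then have "(g has_derivative g') (at x within S)" by (rule has_derivative_at_withinI)
  then have "(f has_derivative g') (at x within S)"
    by (rule has_derivative_transform_within[OF _ d(1) assms(2)])
       (use V(4) d(2) in \<open>auto simp: dist_commute subset_iff\<close>)
  then have "f differentiable (at x within S)" unfolding differentiable_def by blast
  then show ?thesis by (simp only: frechet_derivative_works)
qed

lemma sets_borel_top: "sets (borel_top X) = sigma_sets (topspace X) {U. openin X U}"
  unfolding borel_top_def by (rule sets_measure_of) (auto dest: openin_subset)

lemma space_borel_top: "space (borel_top X) = topspace X"
  unfolding borel_top_def by (rule space_measure_of) (auto dest: openin_subset)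

lemma openin_borel_top: "openin X U \<Longrightarrow> U \<in> sets (borel_top X)"
  by (simp add: sets_borel_top sigma_sets.Basic)

lemma closedin_borel_top: "closedin X U \<Longrightarrow> U \<in> sets (borel_top X)"
  by (metis closedin_def openin_borel_top sets.compl_sets space_borel_top double_diff order_refl)

text \<open>The graph is the image of a coordinate line, a null set, under a Lipschitz map of that
  line.\<close>

lemma lipschitz_graph_negligible:
  assumes "L-lipschitz_on UNIV b"
  shows "negligible {y::real^2. y$2 = b (y$1)}"
proof -
  let ?h = "\<lambda>y::real^2. vector [y$1, b (y$1)] :: real^2"
  have "negligible {y::real^2. y$2 = 0}" by (rule negligible_standard_hyperplane_cart)
  then have "negligible (?h ` {y. y$2 = 0})"
  proof (rule negligible_locally_Lipschitz_image[rotated])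
    fix x :: "real^2"
    have "norm (?h y - ?h x) \<le> (1 + L) * norm (y - x)" for y
    proof -
      have "norm (?h y - ?h x) \<le> \<bar>y$1 - x$1\<bar> + \<bar>b (y$1) - b (x$1)\<bar>"
        using norm_le_l1_cart[of "?h y - ?h x"] by (simp add: sum_2)
      also have "\<dots> \<le> (1 + L) * \<bar>y$1 - x$1\<bar>"
        using lipschitz_onD[OF assms, of "y$1" "x$1"] by (simp add: dist_real_def algebra_simps)
      also have "\<dots> \<le> (1 + L) * norm (y - x)"
        using component_le_norm_cart[of "y - x" 1] lipschitz_on_nonneg[OF assms]
        by (intro mult_left_mono) auto
      finally show ?thesis .
    qed
    then show "\<exists>T B. open T \<and> x \<in> T \<and> (\<forall>y\<in>{y. y$2 = 0} \<inter> T. norm (?h y - ?h x) \<le> B * norm (y - x))"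
      by (intro exI[of _ UNIV] exI[of _ "1 + L"]) auto
  qed simp
  moreover have "{y::real^2. y$2 = b (y$1)} \<subseteq> ?h ` {y. y$2 = 0}"
  proof
    fix y :: "real^2" assume "y \<in> {y. y$2 = b (y$1)}"
    then have "y = ?h (vector [y$1, 0])" by (simp add: vec_eq_iff forall_2)
    then show "y \<in> ?h ` {y. y$2 = 0}" by (rule image_eqI) simp
  qed
  ultimately show ?thesis by (rule negligible_subset)
qed

lemma lipschitz_model_closed:
  assumes "lipschitz_model D"
  shows "closed D"
proof -
  have "closed {y::real^2. b (y$1) \<le> y$2}" if "L-lipschitz_on UNIV b" for b L
  proof (rule closed_Collect_le)
    have "continuous_on UNIV b" using that by (rule lipschitz_on_continuous_on)
    then show "continuous_on UNIV (\<lambda>y::real^2. b (y$1))"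
      by (rule continuous_on_compose2) (auto intro!: continuous_intros)
  qed (intro continuous_intros)
  then show ?thesis using assms by (auto simp: lipschitz_model_def)
qed

lemma lipschitz_model_frontier:
  assumes "lipschitz_model D"
  shows "negligible (D - interior D)"
proof (cases "D = UNIV")
  case False
  then obtain b L where b: "L-lipschitz_on UNIV b" "D = {y. b (y$1) \<le> y$2}"
    using assms by (auto simp: lipschitz_model_def)
  have "continuous_on UNIV b" using b(1) by (rule lipschitz_on_continuous_on)
  then have "continuous_on UNIV (\<lambda>y::real^2. b (y$1))"
    by (rule continuous_on_compose2) (auto intro!: continuous_intros)
  then have "open {y::real^2. b (y$1) < y$2}"
    by (rule open_Collect_less) (intro continuous_intros)
  then have "{y. b (y$1) < y$2} \<subseteq> interior D"
    by (rule interior_maximal[rotated]) (auto simp: b)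
  then have "D - interior D \<subseteq> {y. y$2 = b (y$1)}" by (force simp: b)
  then show ?thesis using lipschitz_graph_negligible[OF b(1)] negligible_subset by blast
qed simp

text \<open>Moving straight up from a point of the region enters the open set above the graph. This
  is what makes the total area positive even if a chart is centred at the boundary.\<close>

lemma lipschitz_model_interior_near:
  assumes "lipschitz_model D" "y \<in> D" "0 < e"
  shows "ball y e \<inter> interior D \<noteq> {}"
proof (cases "D = UNIV")
  case True
  then show ?thesis using assms(3) by auto
next
  case False
  then obtain b L where b: "L-lipschitz_on UNIV b" "D = {y. b (y$1) \<le> y$2}"
    using assms by (auto simp: lipschitz_model_def)
  have "continuous_on UNIV b" using b(1) by (rule lipschitz_on_continuous_on)
  then have "continuous_on UNIV (\<lambda>y::real^2. b (y$1))"
    by (rule continuous_on_compose2) (auto intro!: continuous_intros)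
  then have "open {y::real^2. b (y$1) < y$2}"
    by (rule open_Collect_less) (intro continuous_intros)
  then have "{y. b (y$1) < y$2} \<subseteq> interior D"
    by (rule interior_maximal[rotated]) (auto simp: b)
  moreover define z where "z = y + (e/2) *\<^sub>R vector [0, 1]"
  have "norm (vector [0, 1] :: real^2) = 1" by (simp add: norm_vec_def L2_set_def sum_2)
  then have "z \<in> ball y e" using assms(3) by (simp add: z_def dist_norm)
  moreover have "z \<in> {y. b (y$1) < y$2}" using assms(2,3) by (simp add: z_def b)
  ultimately show ?thesis by blast
qed

section \<open>Charts, transition maps and chart areas of one surface\<close>

locale rsurface =
  fixes M :: "'a surface"
  assumes surface: "oriented_riemannian_surface M"
begin

lemma chartD:
  assumes "c \<in> atlas M"
  shows chart_openin: "openin (surf_top M) (fst c)"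
    and chart_subset: "fst c \<subseteq> points M"
    and chart_model: "\<exists>D. lipschitz_model D \<and> openin (top_of_set D) (im c)"
    and chart_inj: "inj_on (snd c) (fst c)"
    and chart_cont: "continuous_map (subtopology (surf_top M) (fst c)) (top_of_set (im c)) (snd c)"
    and chart_open_map: "open_map (subtopology (surf_top M) (fst c)) (top_of_set (im c)) (snd c)"
proof -
  have c: "is_chart (surf_top M) c"
    using surface assms by (simp add: oriented_riemannian_surface_def oriented_atlas_def)
  then show o: "openin (surf_top M) (fst c)" and "\<exists>D. lipschitz_model D \<and> openin (top_of_set D) (im c)"
    by (auto simp: is_chart_def)
  then show s: "fst c \<subseteq> points M" by (simp add: openin_subset)
  have h: "homeomorphic_map (subtopology (surf_top M) (fst c)) (top_of_set (im c)) (snd c)"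
    using c by (simp add: is_chart_def)
  then show "continuous_map (subtopology (surf_top M) (fst c)) (top_of_set (im c)) (snd c)"
    "open_map (subtopology (surf_top M) (fst c)) (top_of_set (im c)) (snd c)"
    by (auto simp: homeomorphic_eq_everything_map)
  have "topspace (subtopology (surf_top M) (fst c)) = fst c" using s by auto
  then show "inj_on (snd c) (fst c)"
    using h by (simp add: homeomorphic_eq_everything_map)
qed

lemma cinv_snd: "c \<in> atlas M \<Longrightarrow> x \<in> fst c \<Longrightarrow> cinv c (snd c x) = x"
  using chart_inj by (rule inv_into_f_f)

lemma snd_cinv: "y \<in> im c \<Longrightarrow> snd c (cinv c y) = y"
  by (rule f_inv_into_f)

lemma cinv_in: "y \<in> im c \<Longrightarrow> cinv c y \<in> fst c"
  by (rule inv_into_into)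

lemma atlas_cover: "x \<in> points M \<Longrightarrow> \<exists>c\<in>atlas M. x \<in> fst c"
  using surface unfolding oriented_riemannian_surface_def oriented_atlas_def by blast

lemma chart_at: "x \<in> points M \<Longrightarrow> chart_at M x \<in> atlas M" "x \<in> points M \<Longrightarrow> x \<in> fst (chart_at M x)"
  unfolding chart_at_def using atlas_cover someI_ex by (metis (mono_tags, lifting))+

lemma openin_chart_image:
  assumes "c \<in> atlas M" "openin (surf_top M) W" "W \<subseteq> fst c"
  shows "openin (top_of_set (im c)) (snd c ` W)"
  using chart_open_map[OF assms(1)] assms chart_openin[OF assms(1)]
  by (simp add: open_map_def openin_open_subtopology)

lemma openin_chart_vimage:
  assumes "c \<in> atlas M" "open V"
  shows "openin (surf_top M) (fst c \<inter> snd c -` V)"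
proof -
  have "openin (subtopology (surf_top M) (fst c)) {x \<in> topspace (subtopology (surf_top M) (fst c)). snd c x \<in> im c \<inter> V}"
    using chart_cont[OF assms(1)] assms(2) by (intro openin_continuous_map_preimage) auto
  moreover have "{x \<in> topspace (subtopology (surf_top M) (fst c)). snd c x \<in> im c \<inter> V} = fst c \<inter> snd c -` V"
    using chart_subset[OF assms(1)] by auto
  ultimately show ?thesis using chart_openin[OF assms(1)] by (simp add: openin_open_subtopology)
qed

lemma cinv_vimage:
  assumes "c \<in> atlas M"
  shows "cinv c -` U \<inter> im c = snd c ` (U \<inter> fst c)"
proof (intro subset_antisym subsetI)
  fix y assume y: "y \<in> cinv c -` U \<inter> im c"
  then have "cinv c y \<in> U \<inter> fst c" "y = snd c (cinv c y)" using cinv_in[of y c] snd_cinv[of y c] by simp_all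
  then show "y \<in> snd c ` (U \<inter> fst c)" by (rule rev_image_eqI)
next
  fix y assume "y \<in> snd c ` (U \<inter> fst c)"
  then obtain x where x: "x \<in> U" "x \<in> fst c" "y = snd c x" by blast
  then show "y \<in> cinv c -` U \<inter> im c" using cinv_snd[OF assms x(2)] by simp
qed

lemma cinv_cont:
  assumes "c \<in> atlas M"
  shows "continuous_map (top_of_set (im c)) (surf_top M) (cinv c)"
  unfolding continuous_map
proof (intro conjI allI impI)
  show "cinv c ` topspace (top_of_set (im c)) \<subseteq> points M"
    using subsetD[OF chart_subset[OF assms] cinv_in[of _ c]] by auto
  fix U assume U: "openin (surf_top M) U"
  have "{y \<in> topspace (top_of_set (im c)). cinv c y \<in> U} = snd c ` (U \<inter> fst c)"
    unfolding cinv_vimage[OF assms, symmetric] by auto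
  then show "openin (top_of_set (im c)) {y \<in> topspace (top_of_set (im c)). cinv c y \<in> U}"
    using openin_chart_image[OF assms, of "U \<inter> fst c"] U chart_openin[OF assms] by auto
qed

lemma im_borel: "c \<in> atlas M \<Longrightarrow> im c \<in> sets borel"
  using chart_model[of c] lipschitz_model_closed
  by (metis borel_closed borel_open openin_open sets.Int)

lemma im_frontier: 
  assumes "c \<in> atlas M" shows "negligible (im c - interior (im c))"
proof -
  obtain D W where D: "lipschitz_model D" "open W" "im c = D \<inter> W"
    using chart_model[OF assms] by (auto simp: openin_open)
  then have "im c - interior (im c) \<subseteq> D - interior D"
    by (auto simp: interior_open)
  then show ?thesis using lipschitz_model_frontier[OF D(1)] negligible_subset by blast
qed

text \<open>The model region is closed and the chart image is relatively open in it, so small closed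
  balls cut out compact sets also at boundary points.\<close>

lemma compact_chart_ball:
  assumes "c \<in> atlas M" "y \<in> im c"
  obtains r where "0 < r" "compact (cball y r \<inter> im c)"
proof -
  obtain D W where D: "lipschitz_model D" "open W" "im c = D \<inter> W"
    using chart_model[OF assms(1)] by (auto simp: openin_open)
  obtain r where r: "0 < r" "cball y r \<subseteq> W"
    using D assms(2) open_contains_cball by (metis IntD2)
  then have "cball y r \<inter> im c = cball y r \<inter> D" using D by auto
  then show thesis
    using that[of r] r lipschitz_model_closed[OF D(1)] by (simp add: compact_Int_closed)
qed

definition jac :: "'a chart \<Rightarrow> 'a chart \<Rightarrow> 'a \<Rightarrow> real^2^2" where
  "jac c c' x = Jmat (transition c c') (overlap c c') (snd c x)"

lemma transition_snd: "c \<in> atlas M \<Longrightarrow> x \<in> fst c \<Longrightarrow> transition c c' (snd c x) = snd c' x"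
  by (simp add: transition_def cinv_snd)

lemma transition_smooth: "c \<in> atlas M \<Longrightarrow> c' \<in> atlas M \<Longrightarrow> smooth_on (overlap c c') (transition c c')"
  using surface unfolding oriented_riemannian_surface_def oriented_atlas_def by blast

lemma transition_has_derivative:
  assumes "c \<in> atlas M" "c' \<in> atlas M" "x \<in> fst c" "x \<in> fst c'"
  shows "(transition c c' has_derivative (\<lambda>v. jac c c' x *v v)) (at (snd c x) within overlap c c')"
proof -
  have y: "snd c x \<in> overlap c c'" using assms by (auto simp: overlap_def)
  note d = smooth_on_has_derivative[OF transition_smooth[OF assms(1,2)] y]
  moreover have "(\<lambda>v. jac c c' x *v v) = frechet_derivative (transition c c') (at (snd c x) within overlap c c')"
    unfolding jac_def Jmat_def using has_derivative_linear[OF d] by (simp add: fun_eq_iff matrix_works)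
  ultimately show ?thesis by simp
qed

lemma jac_pos:
  assumes "c \<in> atlas M" "c' \<in> atlas M" "x \<in> fst c" "x \<in> fst c'"
  shows "0 < det (jac c c' x)"
proof -
  have "snd c x \<in> overlap c c'" using assms by (auto simp: overlap_def)
  then show ?thesis
    using surface assms unfolding oriented_riemannian_surface_def oriented_atlas_def jac_def by blast
qed

lemma metric_smooth: "c \<in> atlas M \<Longrightarrow> continuous_on (im c) (\<lambda>y. gmat M c (cinv c y))"
  using surface smooth_on_continuous_on unfolding oriented_riemannian_surface_def riemannian_metric_def by blast

lemma metric_posdef: "c \<in> atlas M \<Longrightarrow> x \<in> fst c \<Longrightarrow> posdef (gmat M c x)"
  using surface unfolding oriented_riemannian_surface_def riemannian_metric_def posdef_def by blast

lemma metric_change: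
  assumes "c \<in> atlas M" "c' \<in> atlas M" "x \<in> fst c" "x \<in> fst c'"
  shows "gmat M c x = transpose (jac c c' x) ** gmat M c' x ** jac c c' x"
proof -
  have "\<forall>c\<in>atlas M. \<forall>c'\<in>atlas M. \<forall>x\<in>fst c \<inter> fst c'. gmat M c x =
      transpose (Jmat (transition c c') (overlap c c') (snd c x)) ** gmat M c' x ** Jmat (transition c c') (overlap c c') (snd c x)"
    using surface unfolding oriented_riemannian_surface_def riemannian_metric_def Let_def
    by (elim conjE)
  from bspec[OF bspec[OF bspec[OF this assms(1)] assms(2)] IntI[OF assms(3,4)]] show ?thesis
    unfolding jac_def .
qed

lemma metric_at_posdef: "x \<in> points M \<Longrightarrow> posdef (metric_at M x)"
  unfolding metric_at_def using chart_at metric_posdef by blast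

abbreviation wt :: "'a chart \<Rightarrow> real^2 \<Rightarrow> real" where
  "wt c y \<equiv> sqrt (det (gmat M c (cinv c y)))"

lemma wt_pos: "c \<in> atlas M \<Longrightarrow> y \<in> im c \<Longrightarrow> 0 < wt c y"
  using posdefD(4)[OF metric_posdef[OF _ cinv_in[of y c]]] by simp

lemma wt_cont: "c \<in> atlas M \<Longrightarrow> continuous_on (im c) (wt c)"
  unfolding det_2 by (intro continuous_intros metric_smooth)

lemma wt_change:
  assumes "c \<in> atlas M" "c' \<in> atlas M" "x \<in> fst c" "x \<in> fst c'"
  shows "wt c (snd c x) = det (jac c c' x) * wt c' (snd c' x)"
  using jac_pos[OF assms] real_sqrt_mult[of "(det (jac c c' x))\<^sup>2" "det (gmat M c' x)"]
  by (simp add: cinv_snd assms metric_change[OF assms] det_mul power2_eq_square ac_simps)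

lemma cinv_measurable:
  assumes "c \<in> atlas M"
  shows "cinv c \<in> measurable (restrict_space borel (im c)) (borel_top (surf_top M))"
  unfolding borel_top_def
proof (rule measurable_sigma_sets[OF sets_measure_of])
  fix U assume U: "U \<in> {U. openin (surf_top M) U}"
  then have "openin (top_of_set (im c)) {y \<in> topspace (top_of_set (im c)). cinv c y \<in> U}"
    using cinv_cont[OF assms] by (intro openin_continuous_map_preimage) auto
  moreover have "{y \<in> topspace (top_of_set (im c)). cinv c y \<in> U} = cinv c -` U \<inter> im c" by auto
  ultimately obtain T where "open T" "cinv c -` U \<inter> im c = im c \<inter> T" by (auto simp: openin_open)
  then show "cinv c -` U \<inter> space (restrict_space borel (im c)) \<in> sets (restrict_space borel (im c))"
    by (auto simp: space_restrict_space sets_restrict_space)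
qed (use cinv_snd[OF assms] chart_subset[OF assms] in \<open>auto dest: openin_subset simp: space_restrict_space\<close>)

lemma chart_image_borel:
  assumes "c \<in> atlas M" "B \<in> sets (borel_top (surf_top M))"
  shows "snd c ` (B \<inter> fst c) \<in> sets borel"
proof -
  have "snd c ` (B \<inter> fst c) = cinv c -` B \<inter> space (restrict_space borel (im c))"
    unfolding cinv_vimage[OF assms(1), symmetric] by (simp add: space_restrict_space)
  also have "\<dots> \<in> sets (restrict_space borel (im c))"
    using cinv_measurable[OF assms(1)] assms(2) by (rule measurable_sets)
  finally show ?thesis
    using im_borel[OF assms(1)] by (auto simp: sets_restrict_space)
qed

lemma sets_chart_area [simp]: "sets (chart_area M c) = sets (borel_top (surf_top M))"
  by (simp add: chart_area_def)

lemma wt_measurable: 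
  assumes "c \<in> atlas M"
  shows "(\<lambda>y. indicator (im c) y * wt c y) \<in> borel_measurable borel"
  using borel_measurable_continuous_on_indicator[OF im_borel[OF assms] wt_cont[OF assms]] by simp

lemma emeasure_chart_area:
  assumes "c \<in> atlas M" "B \<in> sets (borel_top (surf_top M))"
  shows "emeasure (chart_area M c) B = (\<integral>\<^sup>+y. ennreal (wt c y) * indicator (snd c ` (B \<inter> fst c)) y \<partial>lborel)"
proof -
  have lb: "restrict_space lborel (im c) = restrict_space lborel (im c)" by simp
  have sets_eq: "sets (restrict_space lborel (im c)) = sets (restrict_space borel (im c))"
    by (rule sets_restrict_space_cong) simp
  have m1: "cinv c \<in> measurable (density (restrict_space lborel (im c)) (\<lambda>y. ennreal (wt c y))) (borel_top (surf_top M))"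
    using cinv_measurable[OF assms(1)] measurable_cong_sets[of "density (restrict_space lborel (im c)) (\<lambda>y. ennreal (wt c y))" "restrict_space borel (im c)", OF _ refl]
    by (simp add: sets_eq)
  have m2: "(\<lambda>y. ennreal (wt c y)) \<in> borel_measurable (restrict_space lborel (im c))"
  proof -
    have "wt c \<in> borel_measurable (restrict_space borel (im c))"
      by (rule borel_measurable_continuous_on_restrict[OF wt_cont[OF assms(1)]])
    then have "wt c \<in> borel_measurable (restrict_space lborel (im c))"
      using measurable_cong_sets[OF sets_eq refl] by blast
    then show ?thesis by measurable
  qed
  note img = cinv_vimage[OF assms(1), of B]
  have "emeasure (chart_area M c) B = emeasure (density (restrict_space lborel (im c)) (\<lambda>y. ennreal (wt c y))) (snd c ` (B \<inter> fst c))"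
    unfolding chart_area_def using m1 assms(2) by (subst emeasure_distr) (auto simp: space_restrict_space img)
  also have "\<dots> = (\<integral>\<^sup>+y. ennreal (wt c y) * indicator (snd c ` (B \<inter> fst c)) y \<partial>(restrict_space lborel (im c)))"
    using m2 chart_image_borel[OF assms] by (intro emeasure_density) (auto simp: sets_restrict_space)
  also have "\<dots> = (\<integral>\<^sup>+y. ennreal (wt c y) * indicator (snd c ` (B \<inter> fst c)) y * indicator (im c) y \<partial>lborel)"
    using im_borel[OF assms(1)] by (intro nn_integral_restrict_space) simp
  also have "\<dots> = (\<integral>\<^sup>+y. ennreal (wt c y) * indicator (snd c ` (B \<inter> fst c)) y \<partial>lborel)"
    by (intro nn_integral_cong) (auto simp: indicator_def)
  finally show ?thesis .
qed

end

section \<open>Change of variables for nonnegative integrands\<close>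

lemma absolutely_integrable_vec1:
  fixes h :: "real^2 \<Rightarrow> real"
  shows "(\<lambda>x. (\<chi> i. h x) :: real^1) absolutely_integrable_on S \<longleftrightarrow> h absolutely_integrable_on S"
    and "h absolutely_integrable_on S \<Longrightarrow> integral S (\<lambda>x. (\<chi> i. h x) :: real^1) = (\<chi> i. integral S h)"
proof -
  have bl: "bounded_linear (\<lambda>x. (\<chi> i. x) :: real^1)"
    by (rule linear_conv_bounded_linear[THEN iffD1]) (auto intro!: linearI simp: vec_eq_iff)
  have "h absolutely_integrable_on S" if "(\<lambda>x. (\<chi> i. h x) :: real^1) absolutely_integrable_on S"
    using absolutely_integrable_linear[OF that bounded_linear_vec_nth[of 1]] by (simp add: o_def)
  moreover have "(\<lambda>x. (\<chi> i. h x) :: real^1) absolutely_integrable_on S" if "h absolutely_integrable_on S"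
    using absolutely_integrable_linear[OF that bl] by (simp add: o_def)
  ultimately show "(\<lambda>x. (\<chi> i. h x) :: real^1) absolutely_integrable_on S \<longleftrightarrow> h absolutely_integrable_on S"
    by blast
  show "integral S (\<lambda>x. (\<chi> i. h x) :: real^1) = (\<chi> i. integral S h)" if "h absolutely_integrable_on S"
    using integral_linear[OF absolutely_integrable_on_def[THEN iffD1, OF that, THEN conjunct1] bl] by (simp add: o_def)
qed

lemma absolutely_integrable_vec1_iff:
  fixes h :: "real^2 \<Rightarrow> real" and b :: "real^1"
  shows "(\<lambda>x. (\<chi> i. h x) :: real^1) absolutely_integrable_on S \<and> integral S (\<lambda>x. (\<chi> i. h x) :: real^1) = b
    \<longleftrightarrow> h absolutely_integrable_on S \<and> (\<chi> i. integral S h) = b"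
  using absolutely_integrable_vec1(1)[where h = h and S = S] absolutely_integrable_vec1(2)[where h = h and S = S] by fastforce

lemma nn_set_integral_absolutely_integrable:
  fixes h :: "real^2 \<Rightarrow> real"
  assumes "\<And>x. x \<in> S \<Longrightarrow> 0 \<le> h x" and meas: "(\<lambda>x. indicator S x * h x) \<in> borel_measurable lebesgue"
  shows "h absolutely_integrable_on S \<longleftrightarrow> (\<integral>\<^sup>+x. ennreal (indicator S x * h x) \<partial>lebesgue) < \<infinity>"
    and "h absolutely_integrable_on S \<Longrightarrow>
      (\<integral>\<^sup>+x. ennreal (indicator S x * h x) \<partial>lebesgue) = ennreal (integral S h)"
proof -
  have nn: "0 \<le> indicator S x * h x" for x using assms(1) by (auto simp: indicator_def)
  have ai: "h absolutely_integrable_on S \<longleftrightarrow> integrable lebesgue (\<lambda>x. indicator S x * h x)"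
    by (simp add: set_integrable_def)
  show "h absolutely_integrable_on S \<longleftrightarrow> (\<integral>\<^sup>+x. ennreal (indicator S x * h x) \<partial>lebesgue) < \<infinity>"
    unfolding ai integrable_iff_bounded using meas nn by simp
  assume a: "h absolutely_integrable_on S"
  have "(\<integral>\<^sup>+x. ennreal (indicator S x * h x) \<partial>lebesgue) = ennreal (integral\<^sup>L lebesgue (\<lambda>x. indicator S x * h x))"
    using a ai nn by (intro nn_integral_eq_integral) auto
  also have "integral\<^sup>L lebesgue (\<lambda>x. indicator S x * h x) = integral S h"
    using set_lebesgue_integral_eq_integral(2)[OF a] by (simp add: set_lebesgue_integral_def)
  finally show "(\<integral>\<^sup>+x. ennreal (indicator S x * h x) \<partial>lebesgue) = ennreal (integral S h)" .
qed

text \<open>The absolutely integrable case comes from the vector-valued theorem applied to functions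
  with values in \<open>real^1\<close>. The theorem also says that both sides are integrable
  together, so otherwise both nonnegative integrals are infinite.\<close>

lemma nn_integral_change_of_variables:
  fixes g :: "real^2 \<Rightarrow> real^2" and f :: "real^2 \<Rightarrow> real"
  assumes S: "S \<in> sets lebesgue"
    and der: "\<And>x. x \<in> S \<Longrightarrow> (g has_derivative g' x) (at x within S)"
    and inj: "inj_on g S" and nonneg: "\<And>y. y \<in> g ` S \<Longrightarrow> 0 \<le> f y"
    and mf: "(\<lambda>y. indicator (g ` S) y * f y) \<in> borel_measurable lebesgue"
    and mg: "(\<lambda>x. indicator S x * (\<bar>det (matrix (g' x))\<bar> * f (g x))) \<in> borel_measurable lebesgue"
  shows "(\<integral>\<^sup>+x. ennreal (indicator S x * (\<bar>det (matrix (g' x))\<bar> * f (g x))) \<partial>lebesgue) =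
    (\<integral>\<^sup>+y. ennreal (indicator (g ` S) y * f y) \<partial>lebesgue)"
proof -
  let ?h = "\<lambda>x. \<bar>det (matrix (g' x))\<bar> * f (g x)"
  have cov: "(?h absolutely_integrable_on S \<and> (\<chi> i. integral S ?h) = b) \<longleftrightarrow>
      (f absolutely_integrable_on g ` S \<and> (\<chi> i. integral (g ` S) f) = b)" for b :: "real^1"
  proof -
    have "(\<lambda>x. \<bar>det (matrix (g' x))\<bar> *\<^sub>R ((\<chi> i. f (g x)) :: real^1)) = (\<lambda>x. \<chi> i. ?h x)"
      by (simp add: vec_eq_iff fun_eq_iff)
    from has_absolute_integral_change_of_variables[OF S der inj, of "\<lambda>y. (\<chi> i. f y) :: real^1" b, unfolded this]
    show ?thesis unfolding absolutely_integrable_vec1_iff .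
  qed
  have nn: "0 \<le> ?h x" if "x \<in> S" for x using nonneg that by simp
  note I1 = nn_set_integral_absolutely_integrable[OF nn mg]
  note I2 = nn_set_integral_absolutely_integrable[OF nonneg mf]
  show ?thesis
  proof (cases "f absolutely_integrable_on g ` S")
    case True
    then have h: "?h absolutely_integrable_on S" "(\<chi> i. integral S ?h) = ((\<chi> i. integral (g ` S) f) :: real^1)"
      using cov by blast+
    then have "integral S ?h = integral (g ` S) f" by (simp add: vec_eq_iff)
    then show ?thesis using I1(2)[OF _ h(1)] I2(2)[OF _ True] by simp
  next
    case False
    then have "\<not> ?h absolutely_integrable_on S" using cov by blast
    then show ?thesis using False I1(1) I2(1) by (simp add: not_less top_unique)
  qed
qed

context rsurface begin

lemma overlap_image:
  assumes "c \<in> atlas M" "B \<subseteq> fst c"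
  shows "transition c c' ` (snd c ` B) = snd c' ` B"
  using transition_snd[OF assms(1), of _ c'] assms(2) by (simp add: image_image subset_iff cong: image_cong)

text \<open>Change of variables along the transition map. The Gram matrices are related by its
  Jacobian matrix, whose determinant is therefore the quotient of the two area weights.\<close>

lemma chart_area_agree:
  assumes c: "c \<in> atlas M" "c' \<in> atlas M" and B: "B \<in> sets (borel_top (surf_top M))" "B \<subseteq> fst c" "B \<subseteq> fst c'"
  shows "emeasure (chart_area M c) B = emeasure (chart_area M c') B"
proof -
  let ?S = "snd c ` B" and ?T = "snd c' ` B" and ?t = "transition c c'"
  define J where "J y = jac c c' (cinv c y)" for y
  have S: "?S \<in> sets borel" and T: "?T \<in> sets borel"
    using chart_image_borel[OF c(1) B(1)] chart_image_borel[OF c(2) B(1)] B(2,3) by (simp_all add: Int_absorb2)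
  have img: "?t ` ?S = ?T" using overlap_image[OF c(1) B(2)] .
  have xB: "cinv c (snd c x) = x" "x \<in> fst c" "x \<in> fst c'" if "x \<in> B" for x
    using cinv_snd[OF c(1)] B that by auto
  have der: "(?t has_derivative (\<lambda>v. J y *v v)) (at y within ?S)" if "y \<in> ?S" for y
  proof -
    obtain x where x: "x \<in> B" "y = snd c x" using \<open>y \<in> ?S\<close> by blast
    have "?S \<subseteq> overlap c c'" using B by (auto simp: overlap_def)
    then show ?thesis
      using has_derivative_subset[OF transition_has_derivative[OF c xB(2,3)[OF x(1)]], of ?S] x
      by (simp add: J_def xB)
  qed
  have wtJ: "wt c y = \<bar>det (matrix (\<lambda>v. J y *v v))\<bar> * wt c' (?t y)" if "y \<in> ?S" for y
  proof -
    obtain x where x: "x \<in> B" "y = snd c x" using \<open>y \<in> ?S\<close> by blast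
    show ?thesis
      using wt_change[OF c xB(2,3)[OF x(1)]] jac_pos[OF c xB(2,3)[OF x(1)]] transition_snd[OF c(1) xB(2)[OF x(1)], of c']
      by (simp add: x J_def xB matrix_of_matrix_vector_mul)
  qed
  have inj: "inj_on ?t ?S"
  proof (rule inj_onI)
    fix y z assume "y \<in> ?S" "z \<in> ?S" "?t y = ?t z"
    then obtain a b where ab: "a \<in> B" "b \<in> B" "y = snd c a" "z = snd c b" by blast
    then have "snd c' a = snd c' b"
      using \<open>?t y = ?t z\<close> transition_snd[OF c(1) xB(2)] by simp
    then have "a = b" using chart_inj[OF c(2)] xB(3) ab by (auto dest: inj_onD)
    then show "y = z" using ab by simp
  qed
  have wtm: "(\<lambda>y. indicator A y * wt d y) \<in> borel_measurable borel" if "d \<in> atlas M" "A \<in> sets borel" "A \<subseteq> im d" for A d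
  proof -
    have "(\<lambda>y. indicator A y * wt d y) = (\<lambda>y. indicator A y * (indicator (im d) y * wt d y))"
      using that(3) by (auto simp: indicator_def fun_eq_iff)
    then show ?thesis using wt_measurable[OF that(1)] that(2) by simp
  qed
  have mS: "(\<lambda>y. indicator ?S y * wt c y) \<in> borel_measurable borel" using B S by (intro wtm c) auto
  have mT: "(\<lambda>y. indicator ?T y * wt c' y) \<in> borel_measurable borel" using B T by (intro wtm c) auto
  have eqS: "indicator ?S x * (\<bar>det (matrix (\<lambda>v. J x *v v))\<bar> * wt c' (?t x)) = indicator ?S x * wt c x" for x
    using wtJ by (auto simp: indicator_def)
  have "(\<integral>\<^sup>+x. ennreal (indicator ?S x * (\<bar>det (matrix (\<lambda>v. J x *v v))\<bar> * wt c' (?t x))) \<partial>lebesgue) =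
      (\<integral>\<^sup>+y. ennreal (indicator (?t ` ?S) y * wt c' y) \<partial>lebesgue)"
  proof (rule nn_integral_change_of_variables[OF _ der inj])
    show "0 \<le> wt c' y" if "y \<in> ?t ` ?S" for y
      using that wt_pos[OF c(2), of y] B(3) unfolding img by force
    show "(\<lambda>y. indicator (?t ` ?S) y * wt c' y) \<in> borel_measurable lebesgue"
      unfolding img using mT by (simp add: measurable_completion)
    show "(\<lambda>x. indicator ?S x * (\<bar>det (matrix (\<lambda>v. J x *v v))\<bar> * wt c' (?t x))) \<in> borel_measurable lebesgue"
      unfolding eqS using mS by (simp add: measurable_completion)
  qed (use S in auto)
  then have eq: "(\<integral>\<^sup>+x. ennreal (indicator ?S x * wt c x) \<partial>lborel) = (\<integral>\<^sup>+y. ennreal (indicator ?T y * wt c' y) \<partial>lborel)"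
    unfolding eqS img by (simp only: nn_integral_completion)
  have ind: "ennreal (wt d y) * indicator A y = ennreal (indicator A y * wt d y)" for d A y
    by (auto simp: indicator_def)
  have BI: "B \<inter> fst c = B" "B \<inter> fst c' = B" using B by auto
  show ?thesis
    unfolding emeasure_chart_area[OF c(1) B(1)] emeasure_chart_area[OF c(2) B(1)] ind BI by (rule eq)
qed

end

section \<open>Area on a compact surface\<close>

locale compact_rsurface = rsurface +
  assumes compact: "compact_space (surf_top M)" and nonempty: "points M \<noteq> {}"
begin

lemma finite_chart_subcover:
  assumes "\<And>x. x \<in> points M \<Longrightarrow> openin (surf_top M) (U x) \<and> x \<in> U x"
  obtains X where "finite X" "X \<subseteq> points M" "points M = (\<Union>x\<in>X. U x)"
proof -
  have "\<exists>\<F>. finite \<F> \<and> \<F> \<subseteq> U ` points M \<and> points M \<subseteq> \<Union>\<F>"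
    using compact assms unfolding compact_space_def by (intro compactinD) (auto)
  then obtain \<F> where F: "finite \<F>" "\<F> \<subseteq> U ` points M" "points M \<subseteq> \<Union>\<F>" by blast
  then obtain X where X: "X \<subseteq> points M" "finite X" "\<F> = U ` X" by (meson finite_subset_image)
  have "(\<Union>x\<in>X. U x) \<subseteq> points M" using assms X(1) openin_subset by blast
  then show thesis using that[OF X(2,1)] F(3) X(3) by blast
qed

text \<open>Each piece is the trace of a closed set on a member of the cover, so that its continuous images are
  countable unions of compact sets, hence Borel, as soon as the members of the cover are.\<close>

lemma finite_chart_partition:
  assumes U': "\<forall>x\<in>points M. openin (surf_top M) (U x) \<and> x \<in> U x"
  shows "\<exists>n (a :: nat \<Rightarrow> 'a) P. (\<forall>i<n. a i \<in> points M \<and> (\<exists>C. closedin (surf_top M) C \<and> P i = U (a i) \<inter> C) \<and>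
      P i \<in> sets (borel_top (surf_top M))) \<and> points M = (\<Union>i<n. P i) \<and> disjoint_family_on P {..<n}"
proof -
  note U = bspec[OF U']
  obtain X where X: "finite X" "X \<subseteq> points M" "points M = (\<Union>x\<in>X. U x)"
    by (rule finite_chart_subcover[OF U])
  obtain n and a :: "nat \<Rightarrow> 'a" where a: "a ` {..<n} = X" 
    using ex_bij_betw_nat_finite[OF X(1)] unfolding bij_betw_def atLeast0LessThan by metis
  define P where "P i = U (a i) \<inter> (points M - (\<Union>j<i. U (a j)))" for i
  have ai: "a i \<in> points M" if "i < n" for i using a X(2) that by auto
  have cl: "closedin (surf_top M) (points M - (\<Union>j<i. U (a j)))" if "i < n" for i
    using U ai that by (intro closedin_diff openin_Union closedin_topspace) (auto simp: image_iff intro: less_trans)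
  show ?thesis
  proof (intro exI conjI allI impI)
    show "a i \<in> points M" if "i < n" for i by (rule ai[OF that])
    show "closedin (surf_top M) (points M - (\<Union>j<i. U (a j)))" if "i < n" for i
      by (rule cl[OF that])
    show "P i \<in> sets (borel_top (surf_top M))" if "i < n" for i
      unfolding P_def using U[OF ai[OF that]] cl[OF that] by (intro sets.Int openin_borel_top closedin_borel_top) auto
    show "points M = (\<Union>i<n. P i)"
    proof (intro subset_antisym subsetI)
      fix x assume x: "x \<in> points M"
      then have "\<exists>i. i < n \<and> x \<in> U (a i)" using X(3) a by (auto simp: image_iff)
      then obtain i where i: "i < n" "x \<in> U (a i)" "\<And>j. j < i \<Longrightarrow> \<not> (j < n \<and> x \<in> U (a j))"
        using exists_least_iff[of "\<lambda>i. i < n \<and> x \<in> U (a i)"] by blast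
      then have "x \<in> P i" using x by (auto simp: P_def)
      then show "x \<in> (\<Union>i<n. P i)" using i(1) by blast
    qed (auto simp: P_def)
    show "disjoint_family_on P {..<n}"
    proof (unfold disjoint_family_on_def, intro ballI impI)
      fix i j :: nat assume "i \<noteq> j"
      then show "P i \<inter> P j = {}" by (cases i j rule: linorder_cases) (auto simp: P_def)
    qed
  qed (simp add: P_def)
qed

lemma chart_atE: "\<forall>x\<in>points M. openin (surf_top M) (fst (chart_at M x)) \<and> x \<in> fst (chart_at M x)"
  using chart_at chart_openin by blast

lemma sets_area [simp]: "sets (area M) = sets (borel_top (surf_top M))"
proof -
  have "atlas M \<noteq> {}" using nonempty atlas_cover by blast
  then show ?thesis unfolding area_def by (intro sets_SUP) auto
qed

lemma space_area [simp]: "space (area M) = points M"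
  using sets_eq_imp_space_eq[OF sets_area] by (simp add: space_borel_top)

text \<open>A supremum of measures is not in general the supremum of their values on a set, so it is
  squeezed: from below by the area of the chart \<open>c\<close>, from above by a measure glued from
  finitely many chart areas.\<close>

lemma emeasure_area_chart:
  assumes c: "c \<in> atlas M" and B: "B \<in> sets (borel_top (surf_top M))" "B \<subseteq> fst c"
  shows "emeasure (area M) B = emeasure (chart_area M c) B"
proof -
  obtain n and a :: "nat \<Rightarrow> 'a" and P where part:
    "\<forall>i<n. a i \<in> points M \<and> (\<exists>C. closedin (surf_top M) C \<and> P i = fst (chart_at M (a i)) \<inter> C) \<and>
      P i \<in> sets (borel_top (surf_top M))" "points M = (\<Union>i<n. P i)" "disjoint_family_on P {..<n}"
    using finite_chart_partition[where U = "\<lambda>x. fst (chart_at M x)", OF chart_atE] by (elim exE conjE)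
  then have aP: "\<And>i. i < n \<Longrightarrow> a i \<in> points M" "\<And>i. i < n \<Longrightarrow> P i \<subseteq> fst (chart_at M (a i))"
    "points M = (\<Union>i<n. P i)" "disjoint_family_on P {..<n}" "\<And>i. i < n \<Longrightarrow> P i \<in> sets (borel_top (surf_top M))"
    by blast+
  define ch where "ch i = chart_at M (a i)" for i
  have ch: "ch i \<in> atlas M" if "i < n" for i using chart_at(1)[OF aP(1)[OF that]] by (simp add: ch_def)
  \<comment> \<open>The glued measure: each piece of a finite partition is measured in its own
    chart.\<close>
  define \<mu> where "\<mu> A = (\<Sum>i<n. emeasure (chart_area M (ch i)) (A \<inter> P i))" for A
  define m where "m = measure_of (points M) (sets (borel_top (surf_top M))) \<mu>"
  have sb: "sigma_algebra (points M) (sets (borel_top (surf_top M)))"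
    using sets.sigma_algebra_axioms[of "borel_top (surf_top M)"] by (simp add: space_borel_top)
  have sm: "sets m = sets (borel_top (surf_top M))" "space m = points M"
    unfolding m_def using sb by (simp_all add: sigma_algebra.sets_measure_of_eq sigma_algebra.space_measure_of_eq)
  have em: "emeasure m A = \<mu> A" if "A \<in> sets (borel_top (surf_top M))" for A
  proof (rule emeasure_measure_of[OF m_def])
    show "countably_additive (sets m) \<mu>"
    proof (rule countably_additiveI)
      fix A :: "nat \<Rightarrow> 'a set" assume A: "range A \<subseteq> sets m" "disjoint_family A" "\<Union> (range A) \<in> sets m"
      have "(\<Sum>k. emeasure (chart_area M (ch i)) (A k \<inter> P i)) = emeasure (chart_area M (ch i)) (\<Union> (range A) \<inter> P i)" if "i < n" for i
        using A aP(5)[OF that] by (subst suminf_emeasure) (auto simp: sm disjoint_family_on_def image_subset_iff)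
      then show "(\<Sum>k. \<mu> (A k)) = \<mu> (\<Union> (range A))"
        unfolding \<mu>_def by (subst suminf_sum) auto
    qed
  qed (use that sm in \<open>auto simp: positive_def \<mu>_def dest: sets.sets_into_space\<close>)
  have split: "emeasure \<nu> A = (\<Sum>i<n. emeasure \<nu> (A \<inter> P i))"
    if "sets \<nu> = sets (borel_top (surf_top M))" "A \<in> sets (borel_top (surf_top M))" for \<nu> A
  proof -
    have "A \<subseteq> points M" using sets.sets_into_space[OF that(2)] by (simp add: space_borel_top)
    then have "A = (\<Union>i<n. A \<inter> P i)" using aP(3) by blast
    moreover have "emeasure \<nu> (\<Union>i<n. A \<inter> P i) = (\<Sum>i<n. emeasure \<nu> (A \<inter> P i))"
      using that aP(4,5) by (intro sum_emeasure[symmetric]) (auto simp: disjoint_family_on_def)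
    ultimately show ?thesis by simp
  qed
  \<comment> \<open>The chart area of \<open>d\<close> lives on \<open>fst d\<close>; there the two
    charts agree, and enlarging the set again only increases the right side.\<close>
  have loc: "emeasure (chart_area M d) (A \<inter> P i) \<le> emeasure (chart_area M (ch i)) (A \<inter> P i)"
    if "d \<in> atlas M" "A \<in> sets (borel_top (surf_top M))" "i < n" for d A i
  proof -
    have P: "P i \<in> sets (borel_top (surf_top M))" "P i \<subseteq> fst (ch i)" using aP that by (simp_all add: ch_def)
    have d: "fst d \<in> sets (borel_top (surf_top M))" using chart_openin[OF that(1)] by (rule openin_borel_top)
    have "emeasure (chart_area M d) (A \<inter> P i) = emeasure (chart_area M d) (A \<inter> P i \<inter> fst d)"
      using that P d by (simp add: emeasure_chart_area Int_assoc)
    also have "\<dots> = emeasure (chart_area M (ch i)) (A \<inter> P i \<inter> fst d)"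
      using that P d ch by (intro chart_area_agree) auto
    also have "\<dots> \<le> emeasure (chart_area M (ch i)) (A \<inter> P i)"
      using that P d by (intro emeasure_mono) auto
    finally show ?thesis .
  qed
  have "area M \<le> m"
    unfolding area_def
  proof (rule SUP_least)
    fix d assume d: "d \<in> atlas M"
    have "emeasure (chart_area M d) A \<le> emeasure m A" if "A \<in> sets (borel_top (surf_top M))" for A
      unfolding em[OF that] \<mu>_def split[OF sets_chart_area that]
      by (intro sum_mono loc[OF d that]) simp
    then show "chart_area M d \<le> m" by (subst le_measure) (simp_all add: sm)
  qed
  then have le: "emeasure (area M) B \<le> \<mu> B"
    using em[OF B(1)] B(1) by (subst (asm) le_measure) (auto simp: sm)
  have "\<mu> B \<le> emeasure (chart_area M c) B"
  proof -
    have "emeasure (chart_area M (ch i)) (B \<inter> P i) = emeasure (chart_area M c) (B \<inter> P i)" if "i < n" for i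
      using B aP(2,5)[OF that] c ch[OF that] by (intro chart_area_agree) (auto simp: ch_def)
    then show ?thesis
      unfolding \<mu>_def using split[of "chart_area M c" B] B(1) by simp
  qed
  moreover have "chart_area M c \<le> area M" unfolding area_def using c by (rule SUP_upper)
  then have "emeasure (chart_area M c) B \<le> emeasure (area M) B"
    using B(1) by (subst (asm) le_measure) auto
  ultimately show ?thesis using le by (intro antisym) (auto intro: order_trans)
qed

end

section \<open>Riemannian distance in charts\<close>

text \<open>The region above a graph need not be convex, so two points are joined through a third
  one lying high above the midpoint of their abscissae. Both segments climb to it with slope at
  least \<open>L\<close>, hence stay above the graph, and their lengths are comparable with the
  original distance.\<close>

lemma lipschitz_model_connect:
  assumes "lipschitz_model D"
  shows "\<exists>A\<ge>0. \<forall>y\<in>D. \<forall>z\<in>D. \<exists>w. norm (w - y) \<le> A * norm (y - z) \<and> norm (w - z) \<le> A * norm (y - z) \<and>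
    closed_segment y w \<subseteq> D \<and> closed_segment w z \<subseteq> D"
proof (cases "D = UNIV")
  case True
  have "\<exists>w. norm (w - y) \<le> 1 * norm (y - z) \<and> norm (w - z) \<le> 1 * norm (y - z) \<and>
    closed_segment y w \<subseteq> D \<and> closed_segment w z \<subseteq> D" for y z
    by (rule exI[of _ z]) (simp add: True norm_minus_commute)
  then show ?thesis by (intro exI[of _ "1::real"] conjI ballI) simp_all
next
  case False
  then obtain b L where b: "L-lipschitz_on UNIV b" "D = {y. b (y$1) \<le> y$2}"
    using assms by (auto simp: lipschitz_model_def)
  have L: "0 \<le> L" using b(1) by (rule lipschitz_on_nonneg)
  \<comment> \<open>The upward cone of slope \<open>L\<close> at a point of the region remains in
    the region.\<close>
  have cone: "closed_segment y w \<subseteq> D" if y: "y \<in> D" and w: "L * \<bar>w$1 - y$1\<bar> \<le> w$2 - y$2" for y w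
  proof
    fix p assume "p \<in> closed_segment y w"
    then obtain s where s: "0 \<le> s" "s \<le> 1" "p = (1 - s) *\<^sub>R y + s *\<^sub>R w" by (auto simp: closed_segment_def)
    have p1: "p$1 - y$1 = s * (w$1 - y$1)" and p2: "p$2 - y$2 = s * (w$2 - y$2)"
      by (simp_all add: s(3) algebra_simps)
    have "b (p$1) \<le> b (y$1) + L * \<bar>p$1 - y$1\<bar>"
      using lipschitz_onD[OF b(1), of "p$1" "y$1"] by (simp add: dist_real_def)
    also have "L * \<bar>p$1 - y$1\<bar> = s * (L * \<bar>w$1 - y$1\<bar>)" unfolding p1 abs_mult abs_of_nonneg[OF s(1)] by (rule mult.left_commute)
    also have "\<dots> \<le> s * (w$2 - y$2)" using w s(1) by (rule mult_left_mono)
    finally show "p \<in> D" using y p2 by (simp add: b)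
  qed
  show ?thesis
  proof (intro exI[of _ "2 + L"] conjI ballI)
    fix y z assume yz: "y \<in> D" "z \<in> D"
    \<comment> \<open>The last summand gives the height needed for slope \<open>L\<close> over half
      the horizontal distance; the maximum makes the climb start from the higher point.\<close>
    define w :: "real^2" where "w = vector [(y$1 + z$1) / 2, max (y$2) (z$2) + L * (\<bar>y$1 - z$1\<bar> / 2)]"
    have w1: "w$1 = (y$1 + z$1) / 2" and w2: "w$2 = max (y$2) (z$2) + L * (\<bar>y$1 - z$1\<bar> / 2)"
      by (simp_all add: w_def)
    have h: "\<bar>w$1 - y$1\<bar> = \<bar>y$1 - z$1\<bar> / 2" "\<bar>w$1 - z$1\<bar> = \<bar>y$1 - z$1\<bar> / 2"
      by (simp_all add: w1 abs_if field_simps)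
    have Lp: "0 \<le> L * (\<bar>y$1 - z$1\<bar> / 2)" using L by simp
    have v: "\<bar>w$2 - y$2\<bar> \<le> \<bar>y$2 - z$2\<bar> + L * (\<bar>y$1 - z$1\<bar> / 2)" "\<bar>w$2 - z$2\<bar> \<le> \<bar>y$2 - z$2\<bar> + L * (\<bar>y$1 - z$1\<bar> / 2)"
      using Lp by (auto simp: w2 abs_if max_def)
    have c1: "\<bar>y$1 - z$1\<bar> \<le> norm (y - z)" "\<bar>y$2 - z$2\<bar> \<le> norm (y - z)"
      using component_le_norm_cart[of "y - z"] by auto
    have Lc: "L * (\<bar>y$1 - z$1\<bar> / 2) \<le> L * norm (y - z)"
      using c1(1) L by (intro mult_left_mono) auto
    have "norm (w - y) \<le> \<bar>w$1 - y$1\<bar> + \<bar>w$2 - y$2\<bar>" "norm (w - z) \<le> \<bar>w$1 - z$1\<bar> + \<bar>w$2 - z$2\<bar>"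
      using norm_le_l1_cart[of "w - y"] norm_le_l1_cart[of "w - z"] by (simp_all add: sum_2)
    note N = this
    have a: "\<bar>w$1 - y$1\<bar> \<le> norm (y - z)" "\<bar>w$1 - z$1\<bar> \<le> norm (y - z)"
      unfolding h by (rule order_trans[OF _ c1(1)], simp)+
    have n: "norm (w - y) \<le> (2 + L) * norm (y - z)" "norm (w - z) \<le> (2 + L) * norm (y - z)"
      using order_trans[OF N(1) add_mono[OF a(1) order_trans[OF v(1) add_mono[OF c1(2) Lc]]]]
        order_trans[OF N(2) add_mono[OF a(2) order_trans[OF v(2) add_mono[OF c1(2) Lc]]]]
      by (simp_all add: distrib_right)
    have "closed_segment y w \<subseteq> D" "closed_segment z w \<subseteq> D"
      by (rule cone, rule yz, unfold h w2, simp)+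
    then have seg: "closed_segment y w \<subseteq> D" "closed_segment w z \<subseteq> D" by (simp_all add: closed_segment_commute)
    show "\<exists>w. norm (w - y) \<le> (2 + L) * norm (y - z) \<and> norm (w - z) \<le> (2 + L) * norm (y - z) \<and>
        closed_segment y w \<subseteq> D \<and> closed_segment w z \<subseteq> D"
      using n seg by blast
  qed (use L in simp)
qed

context rsurface begin

text \<open>The quadratic form is continuous and positive on the compact product of \<open>Q\<close>
  with the unit circle; its extrema there give the constants by homogeneity.\<close>

lemma metric_bounds:
  assumes c: "c \<in> atlas M" and Q: "compact Q" "Q \<subseteq> im c"
  obtains \<kappa> \<Lambda> where "0 < \<kappa>" "0 < \<Lambda>"
    "\<And>y v. y \<in> Q \<Longrightarrow> \<kappa> * norm v \<le> sqrt (gip (gmat M c (cinv c y)) v v)"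
    "\<And>y v. y \<in> Q \<Longrightarrow> sqrt (gip (gmat M c (cinv c y)) v v) \<le> \<Lambda> * norm v"
proof (cases "Q = {}")
  case True
  then show thesis by (intro that[of 1 1]) auto
next
  case False
  define q where "q = (\<lambda>(y, v). gip (gmat M c (cinv c y)) v v)"
  let ?P = "Q \<times> sphere (0::real^2) 1"
  have "continuous_on Q (\<lambda>y. gmat M c (cinv c y))"
    using metric_smooth[OF c] Q(2) by (rule continuous_on_subset)
  then have g: "continuous_on ?P (\<lambda>p. gmat M c (cinv c (fst p)))"
    by (rule continuous_on_compose2) (auto intro: continuous_intros)
  have cq: "continuous_on ?P q"
    unfolding q_def case_prod_beta gip_2 by (intro continuous_intros g)
  have cP: "compact ?P" using Q(1) by (simp add: compact_Times)
  have "vector [1, 0] \<in> sphere (0::real^2) 1" by (simp add: norm_vec_def L2_set_def sum_2)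
  then have ne: "?P \<noteq> {}" using False by blast
  have pos: "0 < q p" if pP: "p \<in> ?P" for p
  proof -
    obtain y v where p: "p = (y, v)" "y \<in> Q" "norm v = 1" using pP by (cases p) auto
    then have "posdef (gmat M c (cinv c y))" "v \<noteq> 0"
      using metric_posdef[OF c cinv_in[OF subsetD[OF Q(2)]]] by auto
    then show ?thesis by (simp add: q_def p(1) posdef_def)
  qed
  obtain p0 where p0: "p0 \<in> ?P" "\<And>p. p \<in> ?P \<Longrightarrow> q p0 \<le> q p"
    using continuous_attains_inf[OF cP ne cq] by blast
  obtain p1 where p1: "p1 \<in> ?P" "\<And>p. p \<in> ?P \<Longrightarrow> q p \<le> q p1"
    using continuous_attains_sup[OF cP ne cq] by blast
  have scale: "sqrt (gip (gmat M c (cinv c y)) v v) = norm v * sqrt (q (y, v /\<^sub>R norm v))" if "v \<noteq> 0" for y v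
  proof -
    have "gip (gmat M c (cinv c y)) v v = (norm v)\<^sup>2 * q (y, v /\<^sub>R norm v)"
      using that by (simp add: q_def gip_2 power2_eq_square field_simps)
    then show ?thesis by (simp add: real_sqrt_mult)
  qed
  show thesis
  proof (rule that[of "sqrt (q p0)" "sqrt (q p1)"])
    show "0 < sqrt (q p0)" "0 < sqrt (q p1)" using pos p0(1) p1(1) by simp_all
    fix y v assume y: "y \<in> Q"
    have mem: "(y, v /\<^sub>R norm v) \<in> ?P" if "v \<noteq> 0" using y that by simp
    show "sqrt (q p0) * norm v \<le> sqrt (gip (gmat M c (cinv c y)) v v)"
    proof (cases "v = 0")
      case False
      have "sqrt (q p0) \<le> sqrt (q (y, v /\<^sub>R norm v))"
        using p0(2)[OF mem[OF False]] by (simp only: real_sqrt_le_iff)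
      then show ?thesis unfolding scale[OF False] by (simp only: mult.commute[of _ "norm v"] mult_left_mono norm_ge_zero)
    qed (simp add: gip_2)
    show "sqrt (gip (gmat M c (cinv c y)) v v) \<le> sqrt (q p1) * norm v"
    proof (cases "v = 0")
      case False
      have "sqrt (q (y, v /\<^sub>R norm v)) \<le> sqrt (q p1)"
        using p1(2)[OF mem[OF False]] by (simp only: real_sqrt_le_iff)
      then show ?thesis unfolding scale[OF False] by (simp only: mult.commute[of _ "norm v"] mult_left_mono norm_ge_zero)
    qed (simp add: gip_2)
  qed
qed

lemma curve_stays:
  assumes "continuous_map (top_of_set {0..1}) (surf_top M) \<gamma>" "0 < t" "t < 1" "openin (surf_top M) W" "\<gamma> t \<in> W"
  obtains e where "0 < e" "{t-e<..<t+e} \<subseteq> {0<..<1::real}" "\<And>s. s \<in> {t-e<..<t+e} \<Longrightarrow> \<gamma> s \<in> W"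
proof -
  have "openin (top_of_set {0..1}) {s \<in> {0..1}. \<gamma> s \<in> W}"
    using openin_continuous_map_preimage[OF assms(1,4)] by simp
  then obtain T where T: "open T" "{s \<in> {0..1}. \<gamma> s \<in> W} = {0..1} \<inter> T"
    unfolding openin_open by blast
  have "t \<in> {s \<in> {0..1}. \<gamma> s \<in> W}" using assms by simp
  then have "t \<in> T \<inter> {0<..<1}" using assms(2,3) unfolding T(2) by simp
  moreover have "open (T \<inter> {0<..<1})" using T(1) by (simp add: open_Int)
  ultimately obtain e where e: "0 < e" "ball t e \<subseteq> T \<inter> {0<..<1}" using openE by blast
  have b: "ball t e = {t-e<..<t+e}" by (rule ball_eq_greaterThanLessThan)
  show thesis
  proof (rule that[OF e(1)])
    show "{t-e<..<t+e} \<subseteq> {0<..<1}" using e(2) b by auto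
    fix s assume "s \<in> {t-e<..<t+e}"
    then have "s \<in> {0..1} \<inter> T" using e(2) b by force
    then show "\<gamma> s \<in> W" using T(2) by blast
  qed
qed

text \<open>\<open>speed\<close> is defined in the preferred chart, which may change from one time
  to the next. By the chain rule and the transformation rule of the metric, any fixed chart computes
  it.\<close>

lemma speed_in_chart:
  assumes c: "c \<in> atlas M" and \<gamma>: "continuous_map (top_of_set {0..1}) (surf_top M) \<gamma>" "0 < t" "t < 1" "\<gamma> t \<in> fst c"
    and v: "((snd c \<circ> \<gamma>) has_vector_derivative v) (at t)"
  shows "speed M \<gamma> t = sqrt (gip (gmat M c (\<gamma> t)) v v)"
proof -
  define d where "d = chart_at M (\<gamma> t)"
  have "\<gamma> t \<in> points M" using chart_subset[OF c] \<gamma>(4) by blast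
  then have d: "d \<in> atlas M" "\<gamma> t \<in> fst d" unfolding d_def by (rule chart_at)+
  obtain e where e: "0 < e" "{t-e<..<t+e} \<subseteq> {0<..<1}" "\<And>s. s \<in> {t-e<..<t+e} \<Longrightarrow> \<gamma> s \<in> fst c \<inter> fst d"
    using curve_stays[OF \<gamma>(1-3), of "fst c \<inter> fst d"] \<gamma>(4) d chart_openin[OF c] chart_openin[OF d(1)] by blast
  let ?I = "{t-e<..<t+e}" and ?J = "jac c d (\<gamma> t)"
  have tI: "t \<in> ?I" using e(1) by simp
  have "((snd c \<circ> \<gamma>) has_derivative (\<lambda>h. h *\<^sub>R v)) (at t within ?I)"
    using v unfolding has_vector_derivative_def by (rule has_derivative_at_withinI)
  moreover have "(transition c d has_derivative (\<lambda>v. ?J *v v)) (at ((snd c \<circ> \<gamma>) t) within (snd c \<circ> \<gamma>) ` ?I)"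
    using transition_has_derivative[OF c d(1) \<gamma>(4) d(2)] unfolding o_apply
    by (rule has_derivative_subset) (use e(3) in \<open>auto simp: overlap_def\<close>)
  ultimately have "((transition c d \<circ> (snd c \<circ> \<gamma>)) has_derivative ((\<lambda>v. ?J *v v) \<circ> (\<lambda>h. h *\<^sub>R v))) (at t within ?I)"
    by (rule diff_chain_within)
  then have "((transition c d \<circ> (snd c \<circ> \<gamma>)) has_vector_derivative (?J *v v)) (at t)"
    using tI by (simp add: has_vector_derivative_def o_def matrix_vector_mult_scaleR at_within_open[OF tI open_greaterThanLessThan])
  then have "((snd d \<circ> \<gamma>) has_vector_derivative (?J *v v)) (at t)"
    by (rule has_vector_derivative_transform_within_open[OF _ open_greaterThanLessThan tI])
       (use e(3) transition_snd[OF c] in auto)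
  then have "vector_derivative (snd d \<circ> \<gamma>) (at t) = ?J *v v" by (rule vector_derivative_at)
  then show ?thesis
    unfolding speed_def Let_def d_def[symmetric] metric_at_def metric_change[OF c d(1) \<gamma>(4) d(2)] gip_change
    by simp
qed

text \<open>A segment in the chart \<open>c\<close> must be continuously differentiable in every
  other chart as well. The transition map is replaced by its extension to an open set, because the
  segment may run along the boundary of the chart image.\<close>

lemma affine_curve_C1:
  assumes c: "c \<in> atlas M" "c' \<in> atlas M" and \<alpha>: "continuous_map (top_of_set {0..1}) (surf_top M) (cinv c \<circ> \<alpha>)"
    and t: "0 < t" "t < 1" "\<And>s. s \<in> {0..1} \<Longrightarrow> \<alpha> s \<in> im c"
    and aff: "0 < e0" "\<And>s. s \<in> {t-e0<..<t+e0} \<Longrightarrow> \<alpha> s = p + s *\<^sub>R u" and mem: "cinv c (\<alpha> t) \<in> fst c'"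
  shows "\<exists>e>0. (snd c' \<circ> (cinv c \<circ> \<alpha>)) C1_differentiable_on {t-e<..<t+e}"
proof -
  have at: "\<alpha> t \<in> im c" using t by simp
  have ov: "\<alpha> s \<in> overlap c c'" if "s \<in> {0..1}" "cinv c (\<alpha> s) \<in> fst c'" for s
  proof -
    have "cinv c (\<alpha> s) \<in> fst c \<inter> fst c'" using that t(3) cinv_in[of "\<alpha> s" c] by simp
    then show ?thesis unfolding overlap_def using snd_cinv[OF t(3)[OF that(1)]] by (metis imageI)
  qed
  have ovt: "\<alpha> t \<in> overlap c c'" using ov[of t] t mem by simp
  obtain V g where V: "open V" "\<alpha> t \<in> V" "continuous_on V g" "\<forall>y\<in>V. g differentiable (at y)"
    "\<forall>v. continuous_on V (\<lambda>y. frechet_derivative g (at y) v)" "\<forall>y\<in>overlap c c' \<inter> V. g y = transition c c' y"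
    using smooth_on_extension[OF transition_smooth[OF c] ovt] by (elim exE conjE)
  obtain e1 where e1: "0 < e1" "{t-e1<..<t+e1} \<subseteq> {0<..<1}" "\<And>s. s \<in> {t-e1<..<t+e1} \<Longrightarrow> (cinv c \<circ> \<alpha>) s \<in> fst c'"
    using curve_stays[OF \<alpha> t(1,2) chart_openin[OF c(2)]] mem by auto
  have "open ((\<lambda>s. p + s *\<^sub>R u) -` V)"
    using V(1) by (intro continuous_open_vimage) (auto intro!: continuous_intros)
  moreover have "t \<in> (\<lambda>s. p + s *\<^sub>R u) -` V" using V(2) aff(2)[of t] aff(1) by simp
  ultimately obtain e2 where e2: "0 < e2" "ball t e2 \<subseteq> (\<lambda>s. p + s *\<^sub>R u) -` V" using openE by blast
  define e where "e = min e0 (min e1 e2)"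
  let ?I = "{t-e<..<t+e}"
  have e: "0 < e" using aff(1) e1(1) e2(1) by (simp add: e_def)
  have I: "\<alpha> s = p + s *\<^sub>R u" "s \<in> {0..1}" "cinv c (\<alpha> s) \<in> fst c'" "p + s *\<^sub>R u \<in> V" if "s \<in> ?I" for s
  proof -
    have "s \<in> {t-e0<..<t+e0}" "s \<in> {t-e1<..<t+e1}" "s \<in> ball t e2"
      using that by (auto simp: e_def ball_eq_greaterThanLessThan)
    then show "\<alpha> s = p + s *\<^sub>R u" "s \<in> {0..1}" "cinv c (\<alpha> s) \<in> fst c'" "p + s *\<^sub>R u \<in> V"
      using aff(2) subsetD[OF e1(2)] e1(3)[of s] subsetD[OF e2(2)] by (auto simp: less_imp_le)
  qed
  let ?D = "\<lambda>s. frechet_derivative g (at (p + s *\<^sub>R u)) u"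
  have "((snd c' \<circ> (cinv c \<circ> \<alpha>)) has_vector_derivative ?D s) (at s)" if s: "s \<in> ?I" for s
  proof -
    have dg: "(g has_derivative frechet_derivative g (at (p + s *\<^sub>R u))) (at (p + s *\<^sub>R u))"
      using bspec[OF V(4) I(4)[OF s]] by (simp only: frechet_derivative_works)
    have da: "((\<lambda>s. p + s *\<^sub>R u) has_vector_derivative u) (at s)"
      by (auto intro!: derivative_eq_intros)
    have "((g \<circ> (\<lambda>s. p + s *\<^sub>R u)) has_vector_derivative ?D s) (at s)"
      by (rule vector_derivative_diff_chain_within[OF da has_derivative_at_withinI[OF dg]])
    then show ?thesis
    proof (rule has_vector_derivative_transform_within_open[OF _ open_greaterThanLessThan s])
      fix r assume r: "r \<in> ?I"
      show "(g \<circ> (\<lambda>s. p + s *\<^sub>R u)) r = (snd c' \<circ> (cinv c \<circ> \<alpha>)) r"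
        using bspec[OF V(6), of "\<alpha> r"] ov[OF I(2,3)[OF r]] I(1,4)[OF r] by (simp add: transition_def)
    qed
  qed
  moreover have "continuous_on ?I ?D"
    by (rule continuous_on_compose2[OF V(5)[rule_format]]) (use I(4) in \<open>auto intro!: continuous_intros\<close>)
  ultimately show ?thesis
    unfolding C1_differentiable_on_def using e by (intro exI[of _ e] conjI exI[of _ ?D]) auto
qed

lemma riem_dist_two_segments:
  assumes c: "c \<in> atlas M" and seg: "closed_segment y w \<subseteq> Q" "closed_segment w z \<subseteq> Q" "Q \<subseteq> im c"
    and \<Lambda>: "0 \<le> \<Lambda>" "\<And>y v. y \<in> Q \<Longrightarrow> sqrt (gip (gmat M c (cinv c y)) v v) \<le> \<Lambda> * norm v"
    and B: "norm (w - y) \<le> B" "norm (w - z) \<le> B"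
  shows "riem_dist M (cinv c y) (cinv c z) \<le> ennreal (\<Lambda> * (2 * B))"
proof -
  define \<alpha> where "\<alpha> = linepath y w +++ linepath w z"
  let ?\<gamma> = "cinv c \<circ> \<alpha>"
  have B0: "0 \<le> B" using B(1) norm_ge_zero order_trans by blast
  have "path_image \<alpha> = closed_segment y w \<union> closed_segment w z"
    unfolding \<alpha>_def by (subst path_image_join) auto
  then have aQ: "\<alpha> s \<in> Q" if "s \<in> {0..1}" for s
    using seg(1,2) that unfolding path_image_def by blast
  have "path \<alpha>" unfolding \<alpha>_def by (intro path_join_imp) auto
  then have "continuous_map (top_of_set {0..1}) (top_of_set (im c)) \<alpha>"
    using aQ seg(3) by (auto simp: path_def continuous_map_in_subtopology)
  then have \<gamma>: "continuous_map (top_of_set {0..1}) (surf_top M) ?\<gamma>"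
    using cinv_cont[OF c] by (rule continuous_map_compose)
  \<comment> \<open>Away from time 1/2 the path is locally affine. Each segment is traversed in half
    a unit of time, hence the bound \<open>2 * B\<close> on the velocity.\<close>
  have aff: "\<exists>e0>0. \<exists>p u. norm u \<le> 2 * B \<and> (\<forall>s\<in>{t-e0<..<t+e0}. \<alpha> s = p + s *\<^sub>R u)" if t: "t \<in> {0<..<1} - {1/2}" for t
  proof (cases "t < 1/2")
    case True
    have "norm (2 *\<^sub>R (w - y)) \<le> 2 * B" using B(1) by (simp only: norm_scaleR)
    moreover have "\<forall>s\<in>{t-(1/2-t)<..<t+(1/2-t)}. \<alpha> s = y + s *\<^sub>R (2 *\<^sub>R (w - y))"
      by (auto simp: \<alpha>_def joinpaths_def linepath_def scaleR_diff_left scaleR_diff_right mult.commute)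
    moreover have "0 < 1/2 - t" using True by simp
    ultimately show ?thesis by blast
  next
    case False
    have "norm (2 *\<^sub>R (z - w)) \<le> 2 * B" using B(2) by (simp only: norm_scaleR norm_minus_commute[of z w])
    moreover have "\<forall>s\<in>{t-(t-1/2)<..<t+(t-1/2)}. \<alpha> s = (2 *\<^sub>R w - z) + s *\<^sub>R (2 *\<^sub>R (z - w))"
      by (auto simp: \<alpha>_def joinpaths_def linepath_def vec_eq_iff algebra_simps)
    moreover have "0 < t - 1/2" using False t by auto
    ultimately show ?thesis by blast
  qed
  have pc: "piecewise_C1_curve M ?\<gamma>"
    unfolding piecewise_C1_curve_def
  proof (intro conjI \<gamma> exI[of _ "{1/2}"] ballI impI)
    fix t c' assume t: "t \<in> {0<..<1::real} - {1/2}" and c': "c' \<in> atlas M" "?\<gamma> t \<in> fst c'"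
    obtain e0 p u where a: "0 < e0" "\<forall>s\<in>{t-e0<..<t+e0}. \<alpha> s = p + s *\<^sub>R u" using aff[OF t] by blast
    show "\<exists>e>0. (snd c' \<circ> ?\<gamma>) C1_differentiable_on {t-e<..<t+e}"
      by (rule affine_curve_C1[OF c c'(1) \<gamma> _ _ _ a(1) a(2)[rule_format]])
         (use t aQ seg(3) c'(2) in auto)
  qed simp
  have sp: "speed M ?\<gamma> t \<le> \<Lambda> * (2 * B)" if t: "t \<in> {0<..<1} - {1/2}" for t
  proof -
    obtain e0 p u where a: "0 < e0" "norm u \<le> 2 * B" "\<forall>s\<in>{t-e0<..<t+e0}. \<alpha> s = p + s *\<^sub>R u" using aff[OF t] by blast
    have im: "\<alpha> s \<in> im c" if "s \<in> {0..1}" for s using aQ[OF that] seg(3) by blast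
    define I where "I = {t-e0<..<t+e0} \<inter> {0<..<1}"
    have tI: "t \<in> I" "open I" using t a(1) by (auto simp: I_def)
    have "((\<lambda>s. p + s *\<^sub>R u) has_vector_derivative u) (at t)"
      by (auto intro!: derivative_eq_intros)
    then have d: "((snd c \<circ> ?\<gamma>) has_vector_derivative u) (at t)"
    proof (rule has_vector_derivative_transform_within_open[OF _ tI(2,1)])
      fix s assume "s \<in> I"
      then have "s \<in> {0..1}" "\<alpha> s = p + s *\<^sub>R u" using a(3) by (auto simp: I_def)
      then show "p + s *\<^sub>R u = (snd c \<circ> ?\<gamma>) s" using snd_cinv[OF im[of s]] by simp
    qed
    have "?\<gamma> t \<in> fst c" using cinv_in[OF im, of t] t by simp
    then have "speed M ?\<gamma> t = sqrt (gip (gmat M c (cinv c (\<alpha> t))) u u)"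
      using speed_in_chart[OF c \<gamma> _ _ _ d] t by simp
    also have "\<dots> \<le> \<Lambda> * norm u" using \<Lambda>(2)[OF aQ, of t] t by simp
    also have "\<dots> \<le> \<Lambda> * (2 * B)" using a(2) \<Lambda>(1) by (rule mult_left_mono)
    finally show ?thesis .
  qed
  \<comment> \<open>The corner and the end points, where the speed is not controlled, do not affect
    the length integral.\<close>
  have null: "{0, 1/2, 1::real} \<in> null_sets lborel" by (intro finite_imp_null_set_lborel) simp
  have "curve_length M ?\<gamma> \<le> (\<integral>\<^sup>+t. ennreal (\<Lambda> * (2 * B)) * indicator {0..1::real} t \<partial>lborel)"
    unfolding curve_length_def
  proof -
    have "AE t in lborel. ennreal (speed M ?\<gamma> t) * indicator {0..1} t \<le> ennreal (\<Lambda> * (2 * B)) * indicator {0..1::real} t"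
      using AE_not_in[OF null]
    proof eventually_elim
      case (elim t)
      show ?case
      proof (cases "t \<in> {0..1}")
        case True
        then have "t \<in> {0<..<1} - {1/2}" using elim by auto
        then show ?thesis using sp[of t] True by (simp add: ennreal_leI)
      qed simp
    qed
    then show "(\<integral>\<^sup>+t. ennreal (speed M ?\<gamma> t) * indicator {0..1} t \<partial>lborel) \<le> (\<integral>\<^sup>+t. ennreal (\<Lambda> * (2 * B)) * indicator {0..1::real} t \<partial>lborel)"
      by (rule nn_integral_mono_AE)
  qed
  also have "\<dots> = ennreal (\<Lambda> * (2 * B))"
    by (simp add: nn_integral_cmult_indicator)
  finally have len: "curve_length M ?\<gamma> \<le> ennreal (\<Lambda> * (2 * B))" .
  have "riem_dist M (cinv c y) (cinv c z) \<le> curve_length M ?\<gamma>"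
    unfolding riem_dist_def
    by (rule INF_lower) (use pc in \<open>auto simp: \<alpha>_def joinpaths_def linepath_def\<close>)
  then show ?thesis using len by (rule order_trans)
qed

text \<open>The two-segment detour, measured with the upper metric bound on a compact neighbourhood,
  is a competitor for the distance.\<close>

lemma riem_dist_upper:
  assumes c: "c \<in> atlas M" and x: "x \<in> fst c"
  obtains r C where "0 < r" "0 \<le> C"
    "\<And>x1 x2. x1 \<in> fst c \<Longrightarrow> x2 \<in> fst c \<Longrightarrow> snd c x1 \<in> ball (snd c x) r \<Longrightarrow> snd c x2 \<in> ball (snd c x) r \<Longrightarrow>
      riem_dist M x1 x2 \<le> ennreal (C * norm (snd c x1 - snd c x2))"
proof -
  let ?y = "snd c x"
  obtain D W where D: "lipschitz_model D" "open W" "im c = D \<inter> W"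
    using chart_model[OF c] by (auto simp: openin_open)
  have yW: "?y \<in> W" using D(3) x by blast
  obtain r0 where r0: "0 < r0" "cball ?y r0 \<subseteq> W" using D(2) yW open_contains_cball by metis
  define Q where "Q = cball ?y r0 \<inter> D"
  have Q: "compact Q" "Q \<subseteq> im c"
    using lipschitz_model_closed[OF D(1)] r0(2) D(3) by (auto simp: Q_def compact_Int_closed)
  obtain \<kappa> \<Lambda> where \<Lambda>: "0 < \<Lambda>" "\<And>y v. y \<in> Q \<Longrightarrow> sqrt (gip (gmat M c (cinv c y)) v v) \<le> \<Lambda> * norm v"
    using metric_bounds[OF c Q] by metis
  obtain A where A: "0 \<le> A" "\<forall>y\<in>D. \<forall>z\<in>D. \<exists>w. norm (w - y) \<le> A * norm (y - z) \<and> norm (w - z) \<le> A * norm (y - z) \<and>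
    closed_segment y w \<subseteq> D \<and> closed_segment w z \<subseteq> D"
    using lipschitz_model_connect[OF D(1)] by blast
  \<comment> \<open>Points within \<open>r\<close> of the centre are at most \<open>2 * r\<close>
    apart, so the detour point is within \<open>r + A * (2 * r) = r0\<close> of the centre and the
    metric bound still applies.\<close>
  define r where "r = r0 / (1 + 2 * A)"
  have r: "0 < r" "r + A * (2 * r) = r0"
  proof -
    show "0 < r" using r0(1) A(1) by (simp add: r_def)
    have "r * (1 + 2 * A) = r0" using A(1) by (simp add: r_def)
    then show "r + A * (2 * r) = r0" by (simp add: algebra_simps)
  qed
  show thesis
  proof (rule that[of r "\<Lambda> * (2 * A)"])
    fix x1 x2 assume m: "x1 \<in> fst c" "x2 \<in> fst c" "snd c x1 \<in> ball ?y r" "snd c x2 \<in> ball ?y r"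
    define y z where "y = snd c x1" and "z = snd c x2"
    have yz: "y \<in> D" "z \<in> D" using m D(3) by (auto simp: y_def z_def)
    have ny: "norm (y - ?y) < r" "norm (z - ?y) < r" using m(3,4) by (simp_all add: y_def z_def dist_norm norm_minus_commute)
    have nyz: "norm (y - z) \<le> 2 * r" using norm_triangle_ineq4[of "y - ?y" "z - ?y"] ny by simp
    obtain w where w: "norm (w - y) \<le> A * norm (y - z)" "norm (w - z) \<le> A * norm (y - z)"
      "closed_segment y w \<subseteq> D" "closed_segment w z \<subseteq> D" using A(2) yz by blast
    have "A * norm (y - z) \<le> A * (2 * r)" using nyz A(1) by (rule mult_left_mono)
    then have "norm (w - ?y) \<le> r0"
      using norm_triangle_ineq[of "w - y" "y - ?y"] w(1) ny(1) r(2) by simp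
    then have cb: "w \<in> cball ?y r0" by (simp add: dist_norm norm_minus_commute)
    have "r \<le> r0" using r A(1) by (smt (verit) mult_nonneg_nonneg)
    then have cb2: "y \<in> cball ?y r0" "z \<in> cball ?y r0" using ny by (auto simp: dist_norm norm_minus_commute)
    have "closed_segment y w \<subseteq> Q" "closed_segment w z \<subseteq> Q"
      unfolding Q_def using w(3,4) cb cb2 by (simp_all add: closed_segment_subset)
    from riem_dist_two_segments[OF c this Q(2) _ \<Lambda>(2) w(1,2)] \<Lambda>(1)
    have "riem_dist M (cinv c y) (cinv c z) \<le> ennreal (\<Lambda> * (2 * (A * norm (y - z))))" by simp
    then show "riem_dist M x1 x2 \<le> ennreal (\<Lambda> * (2 * A) * norm (snd c x1 - snd c x2))"
      by (simp add: y_def z_def cinv_snd[OF c] m mult.assoc)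
  qed (use r \<Lambda>(1) A(1) in auto)
qed

text \<open>The chart displacement is the integral of the velocity, so its norm is at most the
  integral of the norm of the velocity, which the lower metric bound compares with the
  speed.\<close>

lemma curve_length_lower:
  assumes c: "c \<in> atlas M" and \<kappa>: "0 < \<kappa>" "\<And>y v. y \<in> Q \<Longrightarrow> \<kappa> * norm v \<le> sqrt (gip (gmat M c (cinv c y)) v v)"
    and \<gamma>: "piecewise_C1_curve M \<gamma>" and T: "0 \<le> T" "T \<le> 1"
    and Q: "\<And>t. t \<in> {0..T} \<Longrightarrow> \<gamma> t \<in> fst c \<and> snd c (\<gamma> t) \<in> Q"
  shows "ennreal (\<kappa> * norm (snd c (\<gamma> T) - snd c (\<gamma> 0))) \<le> curve_length M \<gamma>"
proof -
  let ?\<alpha> = "snd c \<circ> \<gamma>"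
  have cg: "continuous_map (top_of_set {0..1}) (surf_top M) \<gamma>"
    using \<gamma> by (simp add: piecewise_C1_curve_def)
  obtain S where S: "finite S" "\<forall>t\<in>{0<..<1} - S. \<forall>c\<in>atlas M. \<gamma> t \<in> fst c \<longrightarrow>
        (\<exists>e>0. (snd c \<circ> \<gamma>) C1_differentiable_on {t-e<..<t+e})"
    using \<gamma> unfolding piecewise_C1_curve_def by blast
  have "continuous_map (top_of_set {0..T}) (surf_top M) \<gamma>"
    using continuous_map_from_subtopology[OF cg, of "{0..T}"] T by (simp add: subtopology_subtopology Int_absorb1)
  then have "continuous_map (top_of_set {0..T}) (subtopology (surf_top M) (fst c)) \<gamma>"
    using Q by (auto simp: continuous_map_in_subtopology)
  from continuous_map_compose[OF this chart_cont[OF c]]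
  have cont: "continuous_on {0..T} ?\<alpha>" by (simp add: continuous_map_in_subtopology)
  \<comment> \<open>Removing the exceptional times leaves an open set on which the velocity exists
    and is continuous, so that the integrand \<open>h\<close> is Borel.\<close>
  define O' where "O' = {0<..<T} - S"
  have O'open: "open O'" unfolding O'_def using S(1) by (intro open_Diff finite_imp_closed) auto
  define a' where "a' t = vector_derivative ?\<alpha> (at t)" for t
  have C1: "\<exists>e>0. ?\<alpha> C1_differentiable_on {t-e<..<t+e}" if "t \<in> O'" for t
  proof -
    have "t \<in> {0<..<1} - S" "\<gamma> t \<in> fst c" using that T Q[of t] by (auto simp: O'_def)
    then show ?thesis using bspec[OF bspec[OF S(2)] c] by blast
  qed
  have der: "(?\<alpha> has_vector_derivative a' t) (at t)" if "t \<in> O'" for t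
  proof -
    obtain e where e: "0 < e" "?\<alpha> C1_differentiable_on {t-e<..<t+e}" using C1[OF \<open>t \<in> O'\<close>] by blast
    then obtain v where "(?\<alpha> has_vector_derivative v) (at t)"
      unfolding C1_differentiable_on_def by force
    then show ?thesis unfolding a'_def by (metis vector_derivative_at)
  qed
  have conta: "continuous_on O' a'"
    unfolding continuous_on_eq_continuous_at[OF O'open]
  proof
    fix t assume "t \<in> O'"
    obtain e where e: "0 < e" "?\<alpha> C1_differentiable_on {t-e<..<t+e}" using C1[OF \<open>t \<in> O'\<close>] by blast
    then obtain D where D: "\<forall>x\<in>{t-e<..<t+e}. (?\<alpha> has_vector_derivative D x) (at x)" "continuous_on {t-e<..<t+e} D"
      unfolding C1_differentiable_on_def by blast
    have "a' x = D x" if "x \<in> {t-e<..<t+e}" for x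
      unfolding a'_def using D(1) that by (intro vector_derivative_at) blast
    then have "continuous_on {t-e<..<t+e} a' \<longleftrightarrow> continuous_on {t-e<..<t+e} D"
      by (intro continuous_on_cong refl)
    then have "continuous_on {t-e<..<t+e} a'" using D(2) by blast
    then show "isCont a' t" using e(1) by (simp add: continuous_on_eq_continuous_at)
  qed
  \<comment> \<open>Set to zero off \<open>O'\<close>, so that the integral extends to the whole
    line and can be compared with that of \<open>h\<close>.\<close>
  define f0 where "f0 t = (if t \<in> O' then a' t else 0)" for t
  define h where "h t = indicator O' t * norm (a' t)" for t
  have meas: "h \<in> borel_measurable borel"
    unfolding h_def using borel_measurable_continuous_on_indicator[of O' "\<lambda>t. norm (a' t)"] O'open conta
    by (simp add: continuous_on_norm)
  have h0: "0 \<le> h t" for t by (simp add: h_def)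
  have "(a' has_integral (?\<alpha> T - ?\<alpha> 0)) {0..T}"
    by (rule fundamental_theorem_of_calculus_interior_strong[OF S(1) T(1) _ cont]) (use der in \<open>simp add: O'_def\<close>)
  then have "(f0 has_integral (?\<alpha> T - ?\<alpha> 0)) {0..T}"
    by (rule has_integral_spike_finite[of "S \<union> {0, T}", rotated 2]) (use S(1) in \<open>auto simp: f0_def O'_def\<close>)
  then have int: "(f0 has_integral (?\<alpha> T - ?\<alpha> 0)) UNIV"
    by (rule has_integral_on_superset) (auto simp: f0_def O'_def)
  have kh: "ennreal \<kappa> * (\<integral>\<^sup>+t. ennreal (h t) \<partial>lborel) \<le> curve_length M \<gamma>"
  proof -
    have "ennreal (\<kappa> * h t) \<le> ennreal (speed M \<gamma> t) * indicator {0..1} t" for t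
    proof (cases "t \<in> O'")
      case True
      then have t: "0 < t" "t < 1" "\<gamma> t \<in> fst c" "snd c (\<gamma> t) \<in> Q" using T Q[of t] by (auto simp: O'_def)
      have "\<kappa> * norm (a' t) \<le> speed M \<gamma> t"
        using speed_in_chart[OF c cg t(1-3) der[OF True]] \<kappa>(2)[OF t(4), of "a' t"] by (simp add: cinv_snd[OF c t(3)])
      then show ?thesis using True t by (simp add: h_def ennreal_leI)
    qed (simp add: h_def)
    then have "(\<integral>\<^sup>+t. ennreal (\<kappa> * h t) \<partial>lborel) \<le> curve_length M \<gamma>"
      unfolding curve_length_def by (rule nn_integral_mono)
    moreover have "(\<integral>\<^sup>+t. ennreal (\<kappa> * h t) \<partial>lborel) = ennreal \<kappa> * (\<integral>\<^sup>+t. ennreal (h t) \<partial>lborel)"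
      using \<kappa>(1) h0 meas by (simp add: ennreal_mult nn_integral_cmult)
    ultimately show ?thesis by simp
  qed
  show ?thesis
  proof (cases "(\<integral>\<^sup>+t. ennreal (h t) \<partial>lborel) = \<infinity>")
    case True
    then have "curve_length M \<gamma> = \<infinity>" using kh \<kappa>(1) by (simp add: ennreal_mult_top top_unique)
    then show ?thesis by simp
  next
    case False
    then obtain R where R: "0 \<le> R" "(\<integral>\<^sup>+t. ennreal (h t) \<partial>lborel) = ennreal R"
      by (cases "\<integral>\<^sup>+t. ennreal (h t) \<partial>lborel") auto
    then have hi: "(h has_integral R) UNIV"
      by (intro nn_integral_has_integral meas h0)
    have "norm (integral UNIV f0) \<le> integral UNIV h"
      by (rule integral_norm_bound_integral) (use int hi in \<open>auto simp: f0_def h_def\<close>)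
    then have "norm (?\<alpha> T - ?\<alpha> 0) \<le> R"
      using int hi by (simp add: integral_unique)
    then have "ennreal (\<kappa> * norm (?\<alpha> T - ?\<alpha> 0)) \<le> ennreal \<kappa> * ennreal R"
      using \<kappa>(1) R(1) by (simp add: ennreal_mult[symmetric] ennreal_leI)
    then show ?thesis using kh R(2) by simp
  qed
qed

text \<open>A curve from near the centre to the edge of the chart ball already covers a definite
  chart distance, so short curves never leave the chart. That \<open>q2\<close> ends up in the chart
  domain is part of the conclusion, which is what later yields continuity of Lipschitz maps.\<close>

lemma riem_dist_lower:
  assumes c: "c \<in> atlas M" and q: "q \<in> fst c"
  shows "\<exists>r>0. \<exists>\<kappa>>0. \<forall>q1\<in>fst c. \<forall>q2\<in>points M. \<forall>\<rho>. snd c q1 \<in> ball (snd c q) (r/4) \<longrightarrow> \<rho> \<le> r/2 \<longrightarrow>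
    riem_dist M q1 q2 < ennreal (\<kappa> * \<rho>) \<longrightarrow> q2 \<in> fst c \<and> norm (snd c q2 - snd c q1) < \<rho>"
proof -
  let ?y = "snd c q"
  obtain r where r: "0 < r" "compact (cball ?y r \<inter> im c)"
    using compact_chart_ball[OF c, of ?y] q by blast
  let ?Q = "cball ?y r \<inter> im c"
  obtain \<kappa> \<Lambda> where \<kappa>: "0 < \<kappa>" "\<And>y v. y \<in> ?Q \<Longrightarrow> \<kappa> * norm v \<le> sqrt (gip (gmat M c (cinv c y)) v v)"
    using metric_bounds[OF c r(2)] by (metis inf.cobounded2)
  define Wo where "Wo = fst c \<inter> snd c -` ball ?y r"
  define Wc where "Wc = fst c \<inter> snd c -` cball ?y r"
  have Wo: "openin (surf_top M) Wo" unfolding Wo_def by (rule openin_chart_vimage[OF c open_ball])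
  \<comment> \<open>As a compact subset of a Hausdorff space, \<open>Wc\<close> is closed in the
    whole surface and not merely in the chart domain, so a curve cannot escape from it by leaving
    the chart.\<close>
  have "Wc = cinv c ` ?Q"
  proof (intro subset_antisym subsetI)
    fix x assume "x \<in> Wc"
    then have "snd c x \<in> ?Q" "x = cinv c (snd c x)" using cinv_snd[OF c] by (auto simp: Wc_def)
    then show "x \<in> cinv c ` ?Q" by (rule rev_image_eqI)
  next
    fix x assume "x \<in> cinv c ` ?Q"
    then obtain y where "y \<in> cball ?y r" "y \<in> im c" "x = cinv c y" by blast
    then show "x \<in> Wc" using cinv_in[of y c] snd_cinv[of y c] by (simp add: Wc_def)
  qed
  moreover have "compactin (surf_top M) (cinv c ` ?Q)"
    using r(2) by (intro image_compactin[OF _ cinv_cont[OF c]]) (simp add: compactin_subtopology)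
  moreover have "Hausdorff_space (surf_top M)" using surface by (simp add: oriented_riemannian_surface_def)
  ultimately have Wc: "closedin (surf_top M) Wc" by (simp add: compactin_imp_closedin)
  have WoWc: "Wo \<subseteq> Wc" by (auto simp: Wo_def Wc_def)
  show ?thesis
  proof (rule exI[of _ r], intro conjI r(1), rule exI[of _ \<kappa>], intro conjI \<kappa>(1) ballI allI impI)
    fix q1 q2 \<rho> assume q1: "q1 \<in> fst c" "snd c q1 \<in> ball ?y (r/4)" and q2: "q2 \<in> points M"
      and \<rho>: "\<rho> \<le> r/2" and less: "riem_dist M q1 q2 < ennreal (\<kappa> * \<rho>)"
    obtain \<gamma> where \<gamma>: "piecewise_C1_curve M \<gamma>" "\<gamma> 0 = q1" "\<gamma> 1 = q2" "curve_length M \<gamma> < ennreal (\<kappa> * \<rho>)"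
      using less unfolding riem_dist_def INF_less_iff by blast
    have cg: "continuous_map (top_of_set {0..1}) (surf_top M) \<gamma>"
      using \<gamma>(1) by (simp add: piecewise_C1_curve_def)
    have small: "norm (snd c (\<gamma> T) - snd c q1) < \<rho>" if T: "0 \<le> T" "T \<le> 1" "\<And>t. t \<in> {0..T} \<Longrightarrow> \<gamma> t \<in> Wc" for T
    proof -
      have "ennreal (\<kappa> * norm (snd c (\<gamma> T) - snd c (\<gamma> 0))) \<le> curve_length M \<gamma>"
      proof (rule curve_length_lower[OF c \<kappa> \<gamma>(1) T(1,2)])
        fix t assume "t \<in> {0..T}"
        from T(3)[OF this] show "\<gamma> t \<in> fst c \<and> snd c (\<gamma> t) \<in> ?Q" by (simp add: Wc_def)
      qed
      then have "ennreal (\<kappa> * norm (snd c (\<gamma> T) - snd c (\<gamma> 0))) < ennreal (\<kappa> * \<rho>)"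
        using \<gamma>(4) by (rule le_less_trans)
      then have "\<kappa> * norm (snd c (\<gamma> T) - snd c (\<gamma> 0)) < \<kappa> * \<rho>"
        using \<kappa>(1) by (subst (asm) ennreal_less_iff) auto
      then show ?thesis using \<kappa>(1) \<gamma>(2) by simp
    qed
    define A where "A = {t \<in> {0..1}. \<gamma> t \<notin> Wo}"
    have "A = {}"
    proof (rule ccontr)
      assume ne: "A \<noteq> {}"
      have "openin (top_of_set {0..1}) {t \<in> {0..1}. \<gamma> t \<in> Wo}"
        using openin_continuous_map_preimage[OF cg Wo] by simp
      then have "closedin (top_of_set {0..1}) ({0..1} - {t \<in> {0..1}. \<gamma> t \<in> Wo})"
        using closedin_diff[OF closedin_topspace[of "top_of_set {0..1::real}"]] by simp
      moreover have "{0..1} - {t \<in> {0..1}. \<gamma> t \<in> Wo} = A" by (auto simp: A_def)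
      ultimately have "compact A"
        using closedin_compact[of "{0..1::real}" A] by simp
      \<comment> \<open>The first time outside the open ball. Up to and including this time the
        curve is in \<open>Wc\<close>, where the length estimate holds.\<close>
      then obtain T where T: "T \<in> A" "\<And>t. t \<in> A \<Longrightarrow> T \<le> t" using compact_attains_inf[OF _ ne] by blast
      have T01: "0 \<le> T" "T \<le> 1" using T(1) by (auto simp: A_def)
      have "q1 \<in> Wo" using q1 r(1) by (simp add: Wo_def)
      then have "T \<noteq> 0" using T(1) \<gamma>(2) by (auto simp: A_def)
      have before: "\<gamma> t \<in> Wo" if "0 \<le> t" "t < T" for t
        using T(2)[of t] that T01 by (auto simp: A_def)
      define B where "B = {t \<in> {0..1}. \<gamma> t \<in> Wc}"
      have "closedin (top_of_set {0..1}) B"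
        using closedin_continuous_map_preimage[OF cg Wc] by (simp add: B_def)
      then have clB: "closed B" using closedin_closed_trans[OF _ closed_atLeastAtMost] by blast
      have "{0<..<T} \<subseteq> B" using before WoWc T01 by (auto simp: B_def)
      then have "closure {0<..<T} \<subseteq> B" using clB by (rule closure_minimal)
      then have "{0..T} \<subseteq> B" using \<open>T \<noteq> 0\<close> T01(1) by simp
      then have "\<gamma> t \<in> Wc" if "t \<in> {0..T}" for t using that by (auto simp: B_def)
      from small[OF T01 this] have d: "norm (snd c (\<gamma> T) - snd c q1) < \<rho>" .
      have "\<gamma> T \<in> Wc" using \<open>{0..T} \<subseteq> B\<close> T01 by (auto simp: B_def)
      then have "snd c (\<gamma> T) \<notin> ball ?y r" using T(1) by (auto simp: A_def Wo_def Wc_def)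
      then have "r \<le> norm (snd c (\<gamma> T) - ?y)" by (simp add: dist_norm norm_minus_commute)
      also have "\<dots> \<le> norm (snd c (\<gamma> T) - snd c q1) + norm (snd c q1 - ?y)"
        using norm_triangle_ineq[of "snd c (\<gamma> T) - snd c q1" "snd c q1 - ?y"] by simp
      \<comment> \<open>Starting within \<open>r/4\<close> and moving less than
        \<open>\<rho> \<le> r/2\<close> cannot reach the distance \<open>r\<close>; this explains
        both constants.\<close>
      also have "\<dots> < r/2 + r/4" using d \<rho> q1(2) by (simp add: dist_norm norm_minus_commute)
      finally show False using r(1) by simp
    qed
    then have all: "\<gamma> t \<in> Wo" if "t \<in> {0..1}" for t using that by (auto simp: A_def)
    have q2W: "q2 \<in> Wo" using all[of 1] \<gamma>(3) by simp
    have "norm (snd c (\<gamma> 1) - snd c q1) < \<rho>"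
      by (rule small) (use all WoWc in auto)
    then show "q2 \<in> fst c" "norm (snd c q2 - snd c q1) < \<rho>" using q2W \<gamma>(3) by (simp_all add: Wo_def)
  qed
qed

end

section \<open>Integration against the area measure\<close>

lemma matrix_inv_2:
  fixes G :: "real^2^2"
  assumes "det G \<noteq> 0"
  shows "matrix_inv G = vector [vector [G$2$2 / det G, - G$1$2 / det G], vector [- G$2$1 / det G, G$1$1 / det G]]"
proof (rule matrix_inv_eqI)
  have "(G$1$1 * G$2$2 - G$1$2 * G$2$1) / det G = 1"
    using assms unfolding det_2[of G] by simp
  then show "G ** vector [vector [G$2$2 / det G, - G$1$2 / det G], vector [- G$2$1 / det G, G$1$1 / det G]] = mat 1"
    by (simp add: mat2_eq_iff matrix_mult_2 diff_divide_distrib mult.commute) (simp add: mat_def mult.commute)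
qed

text \<open>A rational expression in the entries of \<open>G\<close> and of the pulled-back metric,
  from which measurability can be read off.\<close>

lemma hs_explicit:
  assumes "posdef G" and X: "X = transpose A ** H ** A"
  shows "hs G H A = (G$2$2 * X$1$1 - G$1$2 * X$2$1 - G$2$1 * X$1$2 + G$1$1 * X$2$2) / det G"
proof -
  have "hs G H A = trace (matrix_inv G ** X)"
    by (simp add: hs_def hom_inner_def adjoint_mat_def X matrix_mul_assoc)
  also have "\<dots> = (G$2$2 * X$1$1 - G$1$2 * X$2$1 - G$2$1 * X$1$2 + G$1$1 * X$2$2) / det G"
    using posdefD(4)[OF assms(1)]
    by (simp add: matrix_inv_2 trace_2 matrix_mult_2 add_divide_distrib diff_divide_distrib)
  finally show ?thesis .
qed

lemma matrix_vector_mult_norm_2: "gip (mat 1) v v = (norm (v::real^2))\<^sup>2"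
  by (simp add: gip_def dot_square_norm)

text \<open>In orthonormal frames \<open>hs\<close> is the sum of the squared lengths of the images
  of two unit vectors, each passing through the factors \<open>1 / \<kappa>\<close>,
  \<open>C\<close> and \<open>\<Lambda>\<close>.\<close>

lemma hs_bound:
  assumes GH: "posdef G" "posdef H" and pos: "0 < \<kappa>" "0 \<le> \<Lambda>" "0 \<le> C"
    and G: "\<And>v. \<kappa> * norm v \<le> sqrt (gip G v v)"
    and H: "\<And>v. sqrt (gip H v v) \<le> \<Lambda> * norm v"
    and A: "\<And>v. norm (A *v v) \<le> C * norm v"
  shows "hs G H A \<le> 2 * (\<Lambda> * (C / \<kappa>))\<^sup>2"
proof -
  obtain P Q where PQ: "0 < det P" "0 < det Q" "det P \<noteq> 0" "det Q \<noteq> 0" "G = transpose P ** mat 1 ** P" "H = transpose Q ** mat 1 ** Q"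
    using two_factors[OF GH] .
  define B where "B = Q ** A ** matrix_inv P"
  have hs: "hs G H A = hs (mat 1) (mat 1) B"
    using PQ by (simp only: hs_change posdef_mat1 not_False_eq_True B_def)
  have le: "(norm (B *v b))\<^sup>2 \<le> (\<Lambda> * (C / \<kappa>))\<^sup>2" if b: "norm b = 1" for b
  proof -
    define e where "e = matrix_inv P *v b"
    have Pe: "P *v e = b" using PQ by (simp add: e_def matrix_vector_mul_assoc matrix_inv_cancel)
    have "gip G e e = 1" unfolding PQ(5) gip_change Pe matrix_vector_mult_norm_2 b by simp
    then have "norm e \<le> 1 / \<kappa>" using G[of e] pos by (simp add: field_simps)
    then have "norm (A *v e) \<le> C * (1 / \<kappa>)" using A[of e] pos(3) by (meson mult_left_mono order_trans)
    then have "norm (A *v e) \<le> C / \<kappa>" by simp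
    then have "\<Lambda> * norm (A *v e) \<le> \<Lambda> * (C / \<kappa>)" using pos(2) by (rule mult_left_mono)
    moreover have "B *v b = Q *v (A *v e)" by (simp add: B_def e_def flip: matrix_vector_mul_assoc)
    then have "gip H (A *v e) (A *v e) = (norm (B *v b))\<^sup>2"
      unfolding PQ(6) gip_change matrix_vector_mult_norm_2 by simp
    then have "sqrt (gip H (A *v e) (A *v e)) = norm (B *v b)" by simp
    ultimately have "norm (B *v b) \<le> \<Lambda> * (C / \<kappa>)" using H[of "A *v e"] by simp
    then show ?thesis by (intro power_mono) auto
  qed
  have n: "norm (vector [1, 0] :: real^2) = 1" "norm (vector [0, 1] :: real^2) = 1"
    by (simp_all add: norm_vec_def L2_set_def sum_2)
  have "hs (mat 1) (mat 1) B = (norm (B *v vector [1, 0]))\<^sup>2 + (norm (B *v vector [0, 1]))\<^sup>2"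
    unfolding hs_def hom_inner_mat1 power2_norm_eq_inner
    by (simp add: inner_vec_def sum_2 matrix_vector_mult_def)
  then show ?thesis using le[OF n(1)] le[OF n(2)] hs by simp
qed

text \<open>Where the determinant is nonzero, \<open>f\<close> does not shrink short distances too
  much. Countably many sets with a uniform bound of this kind cover these points, and on small parts
  of each the inverse is Lipschitz, so the points form images of a null set.\<close>

lemma det_zero_if_image_negligible:
  fixes f :: "real^2 \<Rightarrow> real^2"
  assumes der: "\<And>x. x \<in> S \<Longrightarrow> (f has_derivative f' x) (at x)" and neg: "negligible (f ` S)"
  shows "negligible {x \<in> S. det (matrix (f' x)) \<noteq> 0}"
proof -
  define T where "T n = {x \<in> S. \<forall>y. norm (y - x) < 1 / real (Suc n) \<longrightarrow> (1 / real (Suc n)) * norm (y - x) \<le> norm (f y - f x)}" for n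
  have T: "negligible (T n)" for n
  proof (rule locally_negligible_alt[THEN iffD2], rule ballI)
    fix x assume x: "x \<in> T n"
    \<comment> \<open>Half the scale occurring in \<open>T n\<close>, so that any two points of
      \<open>U\<close> are close enough for its estimate.\<close>
    define U where "U = T n \<inter> ball x (1 / (2 * real (Suc n)))"
    have close: "norm (y - z) \<le> real (Suc n) * norm (f y - f z)" if "y \<in> U" "z \<in> U" for y z
    proof -
      have "dist y z \<le> dist x y + dist x z" by (metis dist_commute dist_triangle)
      also have "\<dots> < 1 / (2 * real (Suc n)) + 1 / (2 * real (Suc n))" using that by (intro add_strict_mono) (auto simp: U_def)
      also have "\<dots> = 1 / real (Suc n)" by (simp add: field_simps)
      finally have d: "norm (y - z) < 1 / real (Suc n)" by (simp add: dist_norm)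
      have "z \<in> T n" using that(2) by (simp add: U_def)
      then have "(1 / real (Suc n)) * norm (y - z) \<le> norm (f y - f z)" using d unfolding T_def by blast
      then show ?thesis by (simp add: field_simps)
    qed
    have inj: "inj_on f U"
    proof (rule inj_onI)
      fix y z assume "y \<in> U" "z \<in> U" "f y = f z"
      then show "y = z" using close[of y z] by simp
    qed
    have "U \<subseteq> S" by (auto simp: U_def T_def)
    then have "negligible (f ` U)" using neg negligible_subset image_mono by metis
    then have "negligible (inv_into U f ` (f ` U))"
    proof (rule negligible_locally_Lipschitz_image[rotated])
      fix w assume "w \<in> f ` U"
      then obtain y where y: "y \<in> U" "w = f y" by blast
      have "norm (inv_into U f w' - inv_into U f w) \<le> real (Suc n) * norm (w' - w)" if w': "w' \<in> f ` U" for w'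
      proof -
        obtain z where "z \<in> U" "w' = f z" using w' by blast
        then show ?thesis using close[of z y] y inv_into_f_f[OF inj] by simp
      qed
      then show "\<exists>T B. open T \<and> w \<in> T \<and> (\<forall>y\<in>f ` U \<inter> T. norm (inv_into U f y - inv_into U f w) \<le> B * norm (y - w))"
        by (intro exI[of _ UNIV] exI[of _ "real (Suc n)"]) simp
    qed simp
    moreover have "inv_into U f ` (f ` U) = U" using inj by (rule inv_into_image_cancel) simp
    ultimately have "negligible U" by simp
    moreover have "x \<in> U" using x by (simp add: U_def)
    moreover have "openin (top_of_set (T n)) U" unfolding U_def by (rule openin_open_Int) simp
    ultimately show "\<exists>U. openin (top_of_set (T n)) U \<and> x \<in> U \<and> negligible U" by blast
  qed
  have "{x \<in> S. det (matrix (f' x)) \<noteq> 0} \<subseteq> (\<Union>n. T n)"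
  proof
    fix x assume "x \<in> {x \<in> S. det (matrix (f' x)) \<noteq> 0}"
    then have x: "x \<in> S" "det (matrix (f' x)) \<noteq> 0" by auto
    note d = der[OF x(1)]
    have lin: "linear (f' x)" using d by (rule has_derivative_linear)
    then have "inj (f' x)" using x(2) by (simp add: det_nz_iff_inj)
    then obtain B where B: "0 < B" "\<And>v. B * norm v \<le> norm (f' x v)"
      using linear_inj_bounded_below_pos[OF lin] by (metis mult.commute)
    have "\<exists>d>0. \<forall>y. norm (y - x) < d \<longrightarrow> norm (f y - f x - f' x (y - x)) \<le> B/2 * norm (y - x)"
      using d B(1) half_gt_zero unfolding has_derivative_at_alt by blast
    then obtain d where d: "0 < d" "\<And>y. norm (y - x) < d \<Longrightarrow> norm (f y - f x - f' x (y - x)) \<le> B/2 * norm (y - x)"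
      by blast
    obtain n where n: "1 / real (Suc n) < min d (B/2)"
      using nat_approx_posE[of "min d (B/2)"] d(1) B(1) by auto
    have "(1 / real (Suc n)) * norm (y - x) \<le> norm (f y - f x)" if "norm (y - x) < 1 / real (Suc n)" for y
    proof -
      have "norm (f' x (y - x)) \<le> norm (f y - f x) + norm (f y - f x - f' x (y - x))"
        using norm_triangle_ineq4[of "f y - f x" "f y - f x - f' x (y - x)"] by simp
      then have "B * norm (y - x) \<le> norm (f y - f x) + B/2 * norm (y - x)"
        using B(2)[of "y - x"] d(2)[of y] that n by simp
      then have "B/2 * norm (y - x) \<le> norm (f y - f x)" by simp
      moreover have "(1 / real (Suc n)) * norm (y - x) \<le> B/2 * norm (y - x)"
        using n by (intro mult_right_mono) auto
      ultimately show ?thesis by linarith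
    qed
    then have "x \<in> T n" using x(1) by (simp add: T_def)
    then show "x \<in> (\<Union>n. T n)" by blast
  qed
  then show ?thesis using negligible_Union_nat[of T] T negligible_subset by blast
qed

context rsurface begin

lemma snd_measurable:
  assumes c: "c \<in> atlas M"
  shows "snd c \<in> measurable (restrict_space (borel_top (surf_top M)) (fst c)) borel"
proof (rule borel_measurableI)
  fix V :: "(real^2) set" assume "open V"
  then have "fst c \<inter> snd c -` V \<in> sets (borel_top (surf_top M))"
    by (intro openin_borel_top openin_chart_vimage c)
  moreover have "snd c -` V \<inter> space (restrict_space (borel_top (surf_top M)) (fst c)) = fst c \<inter> snd c -` V"
    using chart_subset[OF c] by (auto simp: space_restrict_space space_borel_top)
  ultimately show "snd c -` V \<inter> space (restrict_space (borel_top (surf_top M)) (fst c)) \<in> sets (restrict_space (borel_top (surf_top M)) (fst c))"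
    by (auto simp: sets_restrict_space)
qed

lemma chart_borel: "c \<in> atlas M \<Longrightarrow> fst c \<in> sets (borel_top (surf_top M))"
  by (intro openin_borel_top chart_openin)

lemma chart_vimage_borel:
  assumes c: "c \<in> atlas M" and A: "A \<in> sets borel"
  shows "fst c \<inter> snd c -` A \<in> sets (borel_top (surf_top M))"
proof -
  have "snd c -` A \<inter> space (restrict_space (borel_top (surf_top M)) (fst c)) \<in> sets (restrict_space (borel_top (surf_top M)) (fst c))"
    using snd_measurable[OF c] A by (rule measurable_sets)
  moreover have "snd c -` A \<inter> space (restrict_space (borel_top (surf_top M)) (fst c)) = fst c \<inter> snd c -` A"
    using chart_subset[OF c] by (auto simp: space_restrict_space space_borel_top)
  ultimately show ?thesis
    using chart_borel[OF c] by (auto simp: sets_restrict_space)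
qed

lemma chart_function_measurable:
  fixes g :: "real^2 \<Rightarrow> 'c::topological_space"
  assumes c: "c \<in> atlas M" and g: "g \<in> borel_measurable borel"
  shows "(\<lambda>x. g (snd c x)) \<in> borel_measurable (restrict_space (borel_top (surf_top M)) (fst c))"
  using snd_measurable[OF c] g by (rule measurable_compose)

lemma nn_integral_chart_area:
  assumes c: "c \<in> atlas M" and h: "h \<in> borel_measurable (borel_top (surf_top M))"
    and P: "P \<in> sets (borel_top (surf_top M))" "P \<subseteq> fst c"
  shows "(\<integral>\<^sup>+x. h x * indicator P x \<partial>(chart_area M c)) =
    (\<integral>\<^sup>+y. ennreal (wt c y) * h (cinv c y) * indicator (snd c ` P) y \<partial>lborel)"
proof -
  let ?R = "restrict_space lborel (im c)"
  have sets_eq: "sets ?R = sets (restrict_space borel (im c))"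
    by (rule sets_restrict_space_cong) simp
  have m1: "cinv c \<in> measurable ?R (borel_top (surf_top M))"
    using cinv_measurable[OF c] measurable_cong_sets[OF sets_eq refl] by blast
  then have m1': "cinv c \<in> measurable (density ?R (\<lambda>y. ennreal (wt c y))) (borel_top (surf_top M))" by simp
  have "wt c \<in> borel_measurable (restrict_space borel (im c))"
    by (rule borel_measurable_continuous_on_restrict[OF wt_cont[OF c]])
  then have "wt c \<in> borel_measurable ?R"
    using measurable_cong_sets[OF sets_eq refl] by blast
  then have m2: "(\<lambda>y. ennreal (wt c y)) \<in> borel_measurable ?R" by measurable
  have hP: "(\<lambda>x. h x * indicator P x) \<in> borel_measurable (borel_top (surf_top M))"
    using h P(1) by measurable
  have "(\<integral>\<^sup>+x. h x * indicator P x \<partial>(chart_area M c)) =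
      (\<integral>\<^sup>+y. h (cinv c y) * indicator P (cinv c y) \<partial>(density ?R (\<lambda>y. ennreal (wt c y))))"
    unfolding chart_area_def by (rule nn_integral_distr[OF m1']) (use hP in simp)
  also have "\<dots> = (\<integral>\<^sup>+y. ennreal (wt c y) * (h (cinv c y) * indicator P (cinv c y)) \<partial>?R)"
    by (rule nn_integral_density[OF m2 measurable_compose[OF m1 hP]])
  also have "\<dots> = (\<integral>\<^sup>+y. ennreal (wt c y) * (h (cinv c y) * indicator P (cinv c y)) * indicator (im c) y \<partial>lborel)"
    using im_borel[OF c] by (intro nn_integral_restrict_space) simp
  also have "\<dots> = (\<integral>\<^sup>+y. ennreal (wt c y) * h (cinv c y) * indicator (snd c ` P) y \<partial>lborel)"
  proof (rule nn_integral_cong)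
    fix y
    have "indicator P (cinv c y) * indicator (im c) y = (indicator (snd c ` P) y :: ennreal)"
      using cinv_vimage[OF c, of P] P(2) by (auto simp: indicator_def Int_absorb2)
    then show "ennreal (wt c y) * (h (cinv c y) * indicator P (cinv c y)) * indicator (im c) y =
        ennreal (wt c y) * h (cinv c y) * indicator (snd c ` P) y"
      by (simp add: mult.assoc)
  qed
  finally show ?thesis .
qed

end

section \<open>Null sets, finiteness and positivity of the area\<close>

context compact_rsurface begin

lemma nn_integral_area:
  assumes c: "c \<in> atlas M" and h: "h \<in> borel_measurable (borel_top (surf_top M))"
    and P: "P \<in> sets (borel_top (surf_top M))" "P \<subseteq> fst c"
  shows "(\<integral>\<^sup>+x. h x * indicator P x \<partial>(area M)) =
    (\<integral>\<^sup>+y. ennreal (wt c y) * h (cinv c y) * indicator (snd c ` P) y \<partial>lborel)"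
proof -
  have "density (area M) (indicator P) = density (chart_area M c) (indicator P)"
  proof (rule measure_eqI)
    fix A assume "A \<in> sets (density (area M) (indicator P))"
    then have A: "A \<in> sets (borel_top (surf_top M))" by simp
    have "emeasure (density \<nu> (indicator P)) A = emeasure \<nu> (P \<inter> A)"
      if "sets \<nu> = sets (borel_top (surf_top M))" for \<nu> :: "'a measure"
    proof -
      have "P \<in> sets \<nu>" "A \<in> sets \<nu>" using that A P(1) by auto
      then show ?thesis by (simp add: emeasure_density nn_integral_indicator flip: indicator_inter_arith)
    qed
    then show "emeasure (density (area M) (indicator P)) A = emeasure (density (chart_area M c) (indicator P)) A"
      using emeasure_area_chart[OF c, of "P \<inter> A"] A P by auto
  qed simp
  moreover have "(\<integral>\<^sup>+x. h x \<partial>(density \<nu> (indicator P))) = (\<integral>\<^sup>+x. h x * indicator P x \<partial>\<nu>)"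
    if "sets \<nu> = sets (borel_top (surf_top M))" for \<nu> :: "'a measure"
  proof -
    have "indicator P \<in> borel_measurable \<nu>" "h \<in> borel_measurable \<nu>"
      using that P(1) h measurable_cong_sets[OF that refl] by auto
    then show ?thesis by (subst nn_integral_density) (auto simp: mult.commute)
  qed
  ultimately have "(\<integral>\<^sup>+x. h x * indicator P x \<partial>(area M)) = (\<integral>\<^sup>+x. h x * indicator P x \<partial>(chart_area M c))"
    by (metis sets_area sets_chart_area)
  then show ?thesis by (simp add: nn_integral_chart_area[OF c h P])
qed

text \<open>The area weight is positive on the chart image, so the weighted and the plain planar
  measure have the same null sets there.\<close>

lemma null_sets_area_chart:
  assumes c: "c \<in> atlas M" and B: "B \<in> sets (borel_top (surf_top M))" "B \<subseteq> fst c"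
  shows "B \<in> null_sets (area M) \<longleftrightarrow> snd c ` B \<in> null_sets lborel"
proof -
  have bor: "snd c ` B \<in> sets borel" using chart_image_borel[OF c B(1)] B(2) by (simp add: Int_absorb2)
  have BI: "B \<inter> fst c = B" using B(2) by blast
  have m: "(\<lambda>y. ennreal (wt c y) * indicator (snd c ` B) y) \<in> borel_measurable borel"
  proof -
    have "(\<lambda>y. ennreal (wt c y) * indicator (snd c ` B) y) = (\<lambda>y. ennreal (indicator (im c) y * wt c y) * indicator (snd c ` B) y)"
      using B(2) by (auto simp: indicator_def fun_eq_iff)
    then show ?thesis using wt_measurable[OF c] bor by simp
  qed
  have "emeasure (area M) B = 0 \<longleftrightarrow> (AE y in lborel. ennreal (wt c y) * indicator (snd c ` B) y = 0)"
    unfolding emeasure_area_chart[OF c B] emeasure_chart_area[OF c B(1)] BI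
    using m by (subst nn_integral_0_iff_AE) auto
  also have "\<dots> \<longleftrightarrow> (AE y in lborel. y \<notin> snd c ` B)"
  proof (intro AE_cong)
    fix y
    show "ennreal (wt c y) * indicator (snd c ` B) y = 0 \<longleftrightarrow> y \<notin> snd c ` B"
      using wt_pos[OF c, of y] B(2) by (cases "y \<in> snd c ` B") (auto simp: ennreal_eq_0_iff)
  qed
  finally show ?thesis
    using bor B(1) AE_iff_null_sets[of "snd c ` B" lborel] by (simp add: null_sets_def)
qed

lemma AE_area_piece:
  assumes c: "c \<in> atlas M" and P: "P \<in> sets (borel_top (surf_top M))" "P \<subseteq> fst c"
  shows "(AE x in area M. x \<in> P \<longrightarrow> R x) \<longleftrightarrow> (AE y in lborel. y \<in> snd c ` P \<longrightarrow> R (cinv c y))"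
proof
  assume "AE x in area M. x \<in> P \<longrightarrow> R x"
  then obtain B where B: "B \<in> null_sets (area M)" "{x \<in> space (area M). \<not> (x \<in> P \<longrightarrow> R x)} \<subseteq> B"
    by (auto simp: eventually_ae_filter)
  have "P \<inter> B \<in> sets (borel_top (surf_top M))" using B(1) P(1) by (auto simp: null_sets_def)
  moreover have "P \<inter> B \<in> null_sets (area M)" using B(1) P(1) by (intro null_set_Int1) auto
  ultimately have "snd c ` (P \<inter> B) \<in> null_sets lborel" using null_sets_area_chart[OF c] P(2) by blast
  from AE_not_in[OF this] show "AE y in lborel. y \<in> snd c ` P \<longrightarrow> R (cinv c y)"
  proof eventually_elim
    case (elim y)
    show ?case
    proof
      assume "y \<in> snd c ` P"
      then obtain x where x: "x \<in> P" "y = snd c x" by blast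
      then have "x \<notin> B" using elim by blast
      moreover have "x \<in> space (area M)" using x(1) P(2) chart_subset[OF c] by auto
      ultimately have "R x" using B(2) x(1) by blast
      then show "R (cinv c y)" using x P(2) cinv_snd[OF c] by auto
    qed
  qed
next
  assume "AE y in lborel. y \<in> snd c ` P \<longrightarrow> R (cinv c y)"
  then obtain A where A: "A \<in> null_sets lborel" "{y. \<not> (y \<in> snd c ` P \<longrightarrow> R (cinv c y))} \<subseteq> A"
    by (auto simp: eventually_ae_filter)
  have Ab: "A \<in> sets borel" using A(1) by (auto simp: null_sets_def)
  define B where "B = P \<inter> (fst c \<inter> snd c -` A)"
  have B: "B \<in> sets (borel_top (surf_top M))" "B \<subseteq> fst c"
    unfolding B_def using P chart_vimage_borel[OF c Ab] by auto
  have sub: "snd c ` B \<subseteq> A" by (auto simp: B_def)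
  have "snd c ` B \<in> sets lborel" using chart_image_borel[OF c B(1)] B(2) by (simp add: Int_absorb2)
  from null_sets_subset[OF A(1) this sub] have "snd c ` B \<in> null_sets lborel" .
  then have "B \<in> null_sets (area M)" using null_sets_area_chart[OF c B] by blast
  from AE_not_in[OF this] show "AE x in area M. x \<in> P \<longrightarrow> R x"
  proof eventually_elim
    case (elim x)
    show ?case
    proof
      assume x: "x \<in> P"
      then have xc: "x \<in> fst c" using P(2) by blast
      then have "snd c x \<notin> A" using elim x by (auto simp: B_def)
      then have "R (cinv c (snd c x))" using A(2) x by blast
      then show "R x" by (simp add: cinv_snd[OF c xc])
    qed
  qed
qed

lemma area_finite: "emeasure (area M) (points M) < \<infinity>"
proof -
  have ex: "\<exists>U. openin (surf_top M) U \<and> x \<in> U \<and> emeasure (area M) U < \<infinity>" if x: "x \<in> points M" for x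
  proof -
    obtain c where c: "c \<in> atlas M" "x \<in> fst c" using atlas_cover x by blast
    obtain r where r: "0 < r" "compact (cball (snd c x) r \<inter> im c)"
      using compact_chart_ball[OF c(1), of "snd c x"] c(2) by blast
    define U where "U = fst c \<inter> snd c -` ball (snd c x) r"
    have U: "openin (surf_top M) U" "x \<in> U" unfolding U_def using openin_chart_vimage[OF c(1)] c(2) r(1) by auto
    have Ub: "U \<in> sets (borel_top (surf_top M))" "U \<subseteq> fst c" using U openin_borel_top by (auto simp: U_def)
    have "continuous_on (cball (snd c x) r \<inter> im c) (wt c)"
      using wt_cont[OF c(1)] by (rule continuous_on_subset) simp
    then have "bounded (wt c ` (cball (snd c x) r \<inter> im c))"
      using r(2) compact_continuous_image compact_imp_bounded by blast
    then obtain b where b: "\<And>y. y \<in> cball (snd c x) r \<inter> im c \<Longrightarrow> \<bar>wt c y\<bar> \<le> b"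
      unfolding bounded_iff by fastforce
    have "emeasure (area M) U = (\<integral>\<^sup>+y. ennreal (wt c y) * indicator (snd c ` U) y \<partial>lborel)"
      unfolding emeasure_area_chart[OF c(1) Ub] emeasure_chart_area[OF c(1) Ub(1)] using Ub(2) by (simp add: Int_absorb2)
    also have "\<dots> \<le> (\<integral>\<^sup>+y. ennreal b * indicator (cball (snd c x) r) y \<partial>lborel)"
    proof (rule nn_integral_mono)
      fix y
      show "ennreal (wt c y) * indicator (snd c ` U) y \<le> ennreal b * indicator (cball (snd c x) r) y"
      proof (cases "y \<in> snd c ` U")
        case True
        then have "y \<in> cball (snd c x) r \<inter> im c" by (auto simp: U_def)
        then show ?thesis using b[of y] True by (auto intro!: ennreal_leI)
      qed simp
    qed
    also have "\<dots> = ennreal b * emeasure lborel (cball (snd c x) r)"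
      by (rule nn_integral_cmult_indicator) simp
    also have "\<dots> < \<infinity>"
      using emeasure_bounded_finite[OF bounded_cball[of "snd c x" r]] by (simp add: ennreal_mult_less_top)
    finally show ?thesis using U by blast
  qed
  then obtain U where U: "\<And>x. x \<in> points M \<Longrightarrow> openin (surf_top M) (U x) \<and> x \<in> U x \<and> emeasure (area M) (U x) < \<infinity>"
    by metis
  obtain X where X: "finite X" "X \<subseteq> points M" "points M = (\<Union>x\<in>X. U x)"
    by (rule finite_chart_subcover[of U]) (use U in auto)
  have "emeasure (area M) (\<Union>x\<in>X. U x) \<le> (\<Sum>x\<in>X. emeasure (area M) (U x))"
    using U[OF subsetD[OF X(2)]] by (intro emeasure_subadditive_finite X(1)) (auto intro: openin_borel_top)
  also have "\<dots> < \<infinity>" using X U by (auto simp: ennreal_sum_less_top)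
  finally show ?thesis using X(3) by simp
qed

lemma finite_measure_area: "finite_measure (area M)"
  by (rule finite_measureI) (use area_finite in simp)

lemma vol_pos: "0 < vol M (points M)"
proof -
  obtain x where x: "x \<in> points M" using nonempty by blast
  obtain c where c: "c \<in> atlas M" "x \<in> fst c" using atlas_cover x by blast
  obtain D W where D: "lipschitz_model D" "open W" "im c = D \<inter> W"
    using chart_model[OF c(1)] by (auto simp: openin_open)
  have y: "snd c x \<in> D" "snd c x \<in> W" using c(2) D(3) by blast+
  obtain e where e: "0 < e" "ball (snd c x) e \<subseteq> W" using D(2) y(2) openE by blast
  have "\<not> negligible (ball (snd c x) e \<inter> interior D)"
    using lipschitz_model_interior_near[OF D(1) y(1) e(1)] by (intro open_not_negligible) auto
  moreover have "ball (snd c x) e \<inter> interior D \<subseteq> im c" using e(2) D(3) interior_subset by blast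
  ultimately have "\<not> negligible (im c)" using negligible_subset by blast
  then have "im c \<notin> null_sets lborel" by (meson negligible_iff_null_sets null_sets_completionI)
  then have "fst c \<notin> null_sets (area M)" using null_sets_area_chart[OF c(1) chart_borel[OF c(1)]] by simp
  then have "0 < emeasure (area M) (fst c)" using chart_borel[OF c(1)] by (auto simp: null_sets_def zero_less_iff_neq_zero)
  also have "\<dots> \<le> emeasure (area M) (points M)"
    using emeasure_space[of "area M" "fst c"] by simp
  finally show ?thesis
    unfolding vol_def measure_def using area_finite by (simp add: enn2real_positive_iff)
qed

end

section \<open>Lipschitz maps in charts\<close>

lemma lipschitz_derivative_bound:
  fixes f :: "real^2 \<Rightarrow> real^2"
  assumes "open S" "y \<in> S" and lip: "\<And>z. z \<in> S \<Longrightarrow> norm (f z - f y) \<le> C * norm (z - y)"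
    and d: "(f has_derivative f') (at y)"
  shows "norm (f' v) \<le> C * norm v"
proof (cases "v = 0")
  case True
  then show ?thesis using linear_0[OF has_derivative_linear[OF d]] by simp
next
  case False
  obtain r where r: "0 < r" "ball y r \<subseteq> S" using assms(1,2) openE by blast
  have "norm (f' v) \<le> C * norm v + e" if e: "0 < e" for e
  proof -
    have "0 < e / norm v" using e False by simp
    then obtain \<delta> where \<delta>: "0 < \<delta>" "\<forall>z. norm (z - y) < \<delta> \<longrightarrow> norm (f z - f y - f' (z - y)) \<le> e / norm v * norm (z - y)"
      using d unfolding has_derivative_at_alt by blast
    \<comment> \<open>Scaled so that \<open>t *\<^sub>R v\<close> has half the length allowed by
      both \<open>r\<close> and \<open>\<delta>\<close>.\<close>
    define t where "t = min r \<delta> / (2 * norm v)"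
    have t: "0 < t" using r(1) \<delta>(1) False by (simp add: t_def)
    have nt: "norm (t *\<^sub>R v) < r" "norm (t *\<^sub>R v) < \<delta>" using r(1) \<delta>(1) False by (simp_all add: t_def)
    define z where "z = y + t *\<^sub>R v"
    have z: "z \<in> S" using r(2) nt(1) by (auto simp: z_def dist_norm)
    have zy: "z - y = t *\<^sub>R v" by (simp add: z_def)
    have "norm (f' (t *\<^sub>R v)) \<le> norm (f z - f y) + norm (f z - f y - f' (z - y))"
      using norm_triangle_ineq4[of "f z - f y" "f z - f y - f' (z - y)"] zy by simp
    also have "\<dots> \<le> C * norm (t *\<^sub>R v) + e / norm v * norm (t *\<^sub>R v)"
    proof (rule add_mono)
      show "norm (f z - f y) \<le> C * norm (t *\<^sub>R v)" using lip[OF z] by (simp only: zy)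
      have "norm (z - y) < \<delta>" using nt(2) by (simp only: zy)
      then show "norm (f z - f y - f' (z - y)) \<le> e / norm v * norm (t *\<^sub>R v)" using \<delta>(2) zy by metis
    qed
    also have "\<dots> = t * (C * norm v + e)" using t False by (simp add: algebra_simps)
    finally have "t * norm (f' v) \<le> t * (C * norm v + e)"
      using t linear_scale[OF has_derivative_linear[OF d], of t v] by simp
    then show ?thesis using t by simp
  qed
  then show ?thesis by (rule field_le_epsilon)
qed

locale surface_map = M: compact_rsurface M + N: compact_rsurface N
  for M :: "'a surface" and N :: "'b surface" +
  fixes \<phi> :: "'a \<Rightarrow> 'b"
  assumes lip: "lipschitz_map M N \<phi>"
begin

lemma map_points: "x \<in> points M \<Longrightarrow> \<phi> x \<in> points N"
  using lip by (auto simp: lipschitz_map_def)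

text \<open>A sandwich: the chart distance in \<open>M\<close> bounds the Riemannian distance there,
  the Lipschitz condition transports the bound to \<open>N\<close>, and the lower estimate in
  \<open>N\<close> returns it to a chart distance while keeping the image points in the chart
  \<open>c'\<close>.\<close>

lemma local_lipschitz_in_charts:
  assumes c: "c \<in> atlas M" "x \<in> fst c" and c': "c' \<in> atlas N" "\<phi> x \<in> fst c'" and \<delta>: "0 < \<delta>"
  shows "\<exists>r>0. \<exists>C\<ge>0. \<forall>x1\<in>fst c. snd c x1 \<in> ball (snd c x) r \<longrightarrow>
    \<phi> x1 \<in> fst c' \<and> snd c' (\<phi> x1) \<in> ball (snd c' (\<phi> x)) \<delta> \<and>
    (\<forall>x2\<in>fst c. snd c x2 \<in> ball (snd c x) r \<longrightarrow>
      norm (snd c' (\<phi> x1) - snd c' (\<phi> x2)) \<le> C * norm (snd c x1 - snd c x2))"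
proof -
  obtain L where L: "0 \<le> L" "\<forall>x\<in>points M. \<forall>y\<in>points M. riem_dist N (\<phi> x) (\<phi> y) \<le> ennreal L * riem_dist M x y"
    using lip unfolding lipschitz_map_def by blast
  obtain r1 C1 where r1: "0 < r1" "0 \<le> C1" and up:
    "\<And>x1 x2. x1 \<in> fst c \<Longrightarrow> x2 \<in> fst c \<Longrightarrow> snd c x1 \<in> ball (snd c x) r1 \<Longrightarrow> snd c x2 \<in> ball (snd c x) r1 \<Longrightarrow>
      riem_dist M x1 x2 \<le> ennreal (C1 * norm (snd c x1 - snd c x2))"
    using M.riem_dist_upper[OF c] by blast
  obtain r2 \<kappa> where r2: "0 < r2" "0 < \<kappa>" and low: "\<forall>q1\<in>fst c'. \<forall>q2\<in>points N. \<forall>\<rho>. snd c' q1 \<in> ball (snd c' (\<phi> x)) (r2/4) \<longrightarrow> \<rho> \<le> r2/2 \<longrightarrow>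
    riem_dist N q1 q2 < ennreal (\<kappa> * \<rho>) \<longrightarrow> q2 \<in> fst c' \<and> norm (snd c' q2 - snd c' q1) < \<rho>"
    using N.riem_dist_lower[OF c'] by blast
  \<comment> \<open>Strictly larger than \<open>L * C1\<close>, because the lower estimate in
    \<open>N\<close> takes a strict inequality as its premise.\<close>
  define A where "A = L * C1 + 1"
  have A: "0 < A" "L * C1 < A" using L(1) r1(2) by (simp_all add: A_def add_pos_nonneg add_nonneg_pos)
  have dist: "riem_dist N (\<phi> x1) (\<phi> x2) < ennreal s"
    if "x1 \<in> fst c" "x2 \<in> fst c" "snd c x1 \<in> ball (snd c x) r1" "snd c x2 \<in> ball (snd c x) r1"
      and s: "L * C1 * norm (snd c x1 - snd c x2) < s" for x1 x2 s
  proof -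
    have "x1 \<in> points M" "x2 \<in> points M" using that M.chart_subset[OF c(1)] by auto
    then have "riem_dist N (\<phi> x1) (\<phi> x2) \<le> ennreal L * riem_dist M x1 x2" using L(2) by blast
    also have "\<dots> \<le> ennreal L * ennreal (C1 * norm (snd c x1 - snd c x2))"
      by (intro mult_left_mono up that) simp
    also have "\<dots> = ennreal (L * C1 * norm (snd c x1 - snd c x2))"
      using L(1) r1(2) by (simp add: ennreal_mult[symmetric] mult.assoc)
    also have "\<dots> < ennreal s" using s L(1) r1(2) by (subst ennreal_less_iff) auto
    finally show ?thesis .
  qed
  define \<rho>0 where "\<rho>0 = min (r2/4) \<delta>"
  have \<rho>0: "0 < \<rho>0" "\<rho>0 \<le> r2/4" "\<rho>0 \<le> \<delta>" using r2(1) \<delta> by (auto simp: \<rho>0_def)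
  \<comment> \<open>\<open>A * r \<le> \<kappa> * \<rho>0\<close> sends the ball of radius
    \<open>r\<close> into the ball of radius \<open>\<rho>0\<close>; since \<open>\<rho>0\<close> is
    at most \<open>r2/4\<close>, images can again serve as starting points of the lower
    estimate.\<close>
  define r where "r = min r1 (\<kappa> * \<rho>0 / A)"
  have r: "0 < r" "r \<le> r1" "A * r \<le> \<kappa> * \<rho>0"
  proof -
    show "0 < r" "r \<le> r1" using r1(1) r2(2) \<rho>0(1) A(1) by (simp_all add: r_def)
    have "r \<le> \<kappa> * \<rho>0 / A" by (simp add: r_def)
    then show "A * r \<le> \<kappa> * \<rho>0" using A(1) by (simp add: field_simps)
  qed
  have b1: "z \<in> ball (snd c x) r1" if "z \<in> ball (snd c x) r" for z using that r(2) by simp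
  have first: "\<phi> x1 \<in> fst c' \<and> snd c' (\<phi> x1) \<in> ball (snd c' (\<phi> x)) \<rho>0"
    if x1: "x1 \<in> fst c" "snd c x1 \<in> ball (snd c x) r" for x1
  proof -
    have "norm (snd c x - snd c x1) \<le> r" using x1(2) by (simp add: dist_norm)
    then have "L * C1 * norm (snd c x - snd c x1) \<le> L * C1 * r" using L(1) r1(2) by (intro mult_left_mono) auto
    also have "\<dots> < A * r" using A(2) r(1) by simp
    also have "\<dots> \<le> \<kappa> * \<rho>0" by (rule r(3))
    finally have "riem_dist N (\<phi> x) (\<phi> x1) < ennreal (\<kappa> * \<rho>0)"
      using c(2) x1 r1(1) b1 by (intro dist) auto
    moreover have "\<phi> x1 \<in> points N" using map_points M.chart_subset[OF c(1)] x1(1) by blast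
    ultimately have "\<phi> x1 \<in> fst c' \<and> norm (snd c' (\<phi> x1) - snd c' (\<phi> x)) < \<rho>0"
      using low[rule_format, OF c'(2) \<open>\<phi> x1 \<in> points N\<close>, of \<rho>0] r2(1) \<rho>0(2) by simp
    then show ?thesis by (simp add: dist_norm norm_minus_commute)
  qed
  define C where "C = A / \<kappa>"
  have C: "0 \<le> C" "\<kappa> * C = A" using A(1) r2(2) by (simp_all add: C_def)
  have second: "norm (snd c' (\<phi> x1) - snd c' (\<phi> x2)) \<le> C * norm (snd c x1 - snd c x2)"
    if x1: "x1 \<in> fst c" "snd c x1 \<in> ball (snd c x) r" and x2: "x2 \<in> fst c" "snd c x2 \<in> ball (snd c x) r" for x1 x2
  proof (cases "snd c x1 = snd c x2")
    case True
    then have "x1 = x2" using M.chart_inj[OF c(1)] x1(1) x2(1) by (auto dest: inj_onD)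
    then show ?thesis by simp
  next
    case False
    define n where "n = norm (snd c x1 - snd c x2)"
    have n: "0 < n" using False by (simp add: n_def)
    have "n \<le> norm (snd c x - snd c x1) + norm (snd c x - snd c x2)"
      using norm_triangle_ineq4[of "snd c x - snd c x2" "snd c x - snd c x1"] by (simp add: n_def)
    then have "n \<le> 2 * r" using x1(2) x2(2) by (simp add: dist_norm)
    then have "\<kappa> * (C * n) \<le> A * (2 * r)" using A(1) by (simp add: mult.assoc[symmetric] C(2))
    also have "\<dots> \<le> \<kappa> * (r2 / 2)"
    proof -
      have "\<kappa> * \<rho>0 \<le> \<kappa> * (r2/4)" using \<rho>0(2) r2(2) by simp
      then show ?thesis using r(3) by simp
    qed
    finally have \<rho>: "C * n \<le> r2 / 2" using r2(2) by simp
    have "L * C1 * n < \<kappa> * (C * n)" using A(2) n by (simp add: mult.assoc[symmetric] C(2))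
    then have d: "riem_dist N (\<phi> x1) (\<phi> x2) < ennreal (\<kappa> * (C * n))"
      using x1 x2 b1 by (intro dist) (auto simp: n_def)
    have "\<phi> x2 \<in> points N" using map_points M.chart_subset[OF c(1)] x2(1) by blast
    moreover have "\<phi> x1 \<in> fst c'" "snd c' (\<phi> x1) \<in> ball (snd c' (\<phi> x)) (r2/4)"
      using first[OF x1] \<rho>0(2) by auto
    ultimately have "norm (snd c' (\<phi> x2) - snd c' (\<phi> x1)) < C * n"
      using low[rule_format, of "\<phi> x1" "\<phi> x2" "C * n"] \<rho> d by blast
    then show ?thesis by (simp add: n_def norm_minus_commute)
  qed
  have "snd c' (\<phi> x1) \<in> ball (snd c' (\<phi> x)) \<delta>" if "x1 \<in> fst c" "snd c x1 \<in> ball (snd c x) r" for x1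
    using first[OF that] \<rho>0(3) by simp
  then show ?thesis
    using first second r(1) C(1) by (intro exI[of _ r] conjI exI[of _ C] ballI impI) blast+
qed

lemma map_continuous: "continuous_map (surf_top M) (surf_top N) \<phi>"
  unfolding continuous_map
proof (intro conjI allI impI)
  show "\<phi> ` points M \<subseteq> points N" using map_points by blast
  fix V assume V: "openin (surf_top N) V"
  show "openin (surf_top M) {x \<in> points M. \<phi> x \<in> V}"
  proof (subst openin_subopen, intro ballI)
    fix x assume x: "x \<in> {x \<in> points M. \<phi> x \<in> V}"
    obtain c where c: "c \<in> atlas M" "x \<in> fst c" using M.atlas_cover x by blast
    obtain c' where c': "c' \<in> atlas N" "\<phi> x \<in> fst c'" using N.atlas_cover map_points x by blast
    have "openin (top_of_set (im c')) (snd c' ` (V \<inter> fst c'))"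
      using V N.chart_openin[OF c'(1)] by (intro N.openin_chart_image[OF c'(1)] openin_Int) auto
    then obtain W where W: "open W" "snd c' ` (V \<inter> fst c') = im c' \<inter> W" by (auto simp: openin_open)
    have "snd c' (\<phi> x) \<in> im c' \<inter> W" using W(2) x c'(2) by blast
    then obtain \<delta> where \<delta>: "0 < \<delta>" "ball (snd c' (\<phi> x)) \<delta> \<subseteq> W" using W(1) openE by blast
    obtain r where r: "0 < r" "\<forall>x1\<in>fst c. snd c x1 \<in> ball (snd c x) r \<longrightarrow> \<phi> x1 \<in> fst c' \<and> snd c' (\<phi> x1) \<in> ball (snd c' (\<phi> x)) \<delta>"
      using local_lipschitz_in_charts[OF c c' \<delta>(1)] by blast
    let ?U = "fst c \<inter> snd c -` ball (snd c x) r"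
    have "?U \<subseteq> {x \<in> points M. \<phi> x \<in> V}"
    proof
      fix x1 assume x1: "x1 \<in> ?U"
      then have p: "\<phi> x1 \<in> fst c'" "snd c' (\<phi> x1) \<in> W" using r(2) \<delta>(2) by blast+
      then have "snd c' (\<phi> x1) \<in> snd c' ` (V \<inter> fst c')" using W(2) by blast
      then obtain q where "q \<in> V" "q \<in> fst c'" "snd c' (\<phi> x1) = snd c' q" by blast
      then have "\<phi> x1 \<in> V" using N.chart_inj[OF c'(1)] p(1) by (metis inj_onD)
      then show "x1 \<in> {x \<in> points M. \<phi> x \<in> V}" using x1 M.chart_subset[OF c(1)] by blast
    qed
    moreover have "openin (surf_top M) ?U" by (rule M.openin_chart_vimage[OF c(1) open_ball])
    moreover have "x \<in> ?U" using c(2) r(1) by simp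
    ultimately show "\<exists>T. openin (surf_top M) T \<and> x \<in> T \<and> T \<subseteq> {x \<in> points M. \<phi> x \<in> V}" by blast
  qed
qed

lemma map_measurable: "\<phi> \<in> measurable (borel_top (surf_top M)) (borel_top (surf_top N))"
proof -
  have "\<phi> \<in> measurable (borel_top (surf_top M)) (sigma (points N) {U. openin (surf_top N) U})"
  proof (rule measurable_sigma_sets[OF sets_measure_of])
    fix U assume "U \<in> {U. openin (surf_top N) U}"
    then have "openin (surf_top M) {x \<in> points M. \<phi> x \<in> U}"
      using openin_continuous_map_preimage[OF map_continuous] by blast
    moreover have "\<phi> -` U \<inter> space (borel_top (surf_top M)) = {x \<in> points M. \<phi> x \<in> U}"
      by (auto simp: space_borel_top)
    ultimately show "\<phi> -` U \<inter> space (borel_top (surf_top M)) \<in> sets (borel_top (surf_top M))"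
      by (simp add: openin_borel_top)
  qed (use map_points in \<open>auto dest: openin_subset simp: space_borel_top\<close>)
  then show ?thesis by (simp add: borel_top_def)
qed

text \<open>The differential in preferred charts is \<open>A\<close> composed with the Jacobian
  matrices of the transitions, and \<open>hs\<close> and the Jacobian do not see such a change. This
  lets one fixed pair of charts serve a whole neighbourhood.\<close>

lemma dmap_in_charts:
  assumes c: "c \<in> atlas M" "x \<in> fst c" and c': "c' \<in> atlas N" "\<phi> x \<in> fst c'"
    and y: "snd c x \<in> interior (im c)"
    and d: "((snd c' \<circ> \<phi> \<circ> cinv c) has_derivative (\<lambda>v. A *v v)) (at (snd c x))"
  shows "hs (metric_at M x) (metric_at N (\<phi> x)) (dmap M N \<phi> x) = hs (gmat M c x) (gmat N c' (\<phi> x)) A"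
    and "jacobian M N \<phi> x = riem_det (gmat M c x) (gmat N c' (\<phi> x)) A"
proof -
  define d d' where "d = chart_at M x" and "d' = chart_at N (\<phi> x)"
  have xM: "x \<in> points M" using c M.chart_subset by blast
  have xN: "\<phi> x \<in> points N" using xM by (rule map_points)
  have d: "d \<in> atlas M" "x \<in> fst d" and d': "d' \<in> atlas N" "\<phi> x \<in> fst d'"
    unfolding d_def d'_def using M.chart_at[OF xM] N.chart_at[OF xN] by blast+
  let ?\<psi> = "snd c' \<circ> \<phi> \<circ> cinv c" and ?\<chi> = "snd d' \<circ> \<phi> \<circ> cinv d"
  let ?Jf = "M.jac c d x" and ?U = "M.jac d c x" and ?W = "N.jac c' d' (\<phi> x)"
  define W where "W = fst c \<inter> fst d \<inter> {x \<in> points M. \<phi> x \<in> fst c' \<inter> fst d'}"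
  have "openin (surf_top M) {x \<in> points M. \<phi> x \<in> fst c' \<inter> fst d'}"
    using N.chart_openin[OF c'(1)] N.chart_openin[OF d'(1)]
    by (intro openin_continuous_map_preimage[OF map_continuous] openin_Int)
  then have W: "openin (surf_top M) W"
    unfolding W_def by (intro openin_Int M.chart_openin c(1) d(1))
  have xW: "x \<in> W" using c(2) d(2) c'(2) d'(2) xM by (simp add: W_def)
  have Wc: "z \<in> fst c" "z \<in> fst d" "\<phi> z \<in> fst c'" "\<phi> z \<in> fst d'" if "z \<in> W" for z
    using that by (simp_all add: W_def)
  have Wsub: "W \<subseteq> fst c" "W \<subseteq> fst d" using Wc by blast+
  obtain O1 where O1: "open O1" "snd c ` W = im c \<inter> O1"
    using M.openin_chart_image[OF c(1) W Wsub(1)] by (auto simp: openin_open)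
  obtain O2 where O2: "open O2" "snd d ` W = im d \<inter> O2"
    using M.openin_chart_image[OF d(1) W Wsub(2)] by (auto simp: openin_open)
  define T where "T = interior (im c) \<inter> O1"
  have T: "open T" "snd c x \<in> T" "T \<subseteq> snd c ` W"
    using O1 y xW interior_subset[of "im c"] by (auto simp: T_def)
  define S where "S = snd d ` W"
  define S0 where "S0 = snd d ` (fst d \<inter> \<phi> -` fst d')"
  have xS: "snd d x \<in> S" using xW by (simp add: S_def)
  \<comment> \<open>The domain used in \<open>dmap\<close> agrees with \<open>S\<close> near the
    point, so derivatives within the two sets are the same.\<close>
  have atS: "at (snd d x) within S0 = at (snd d x) within S"
  proof (rule at_within_nhd[OF _ O2(1)])
    show "snd d x \<in> O2" using xS O2(2) by (auto simp: S_def)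
    have "S \<subseteq> S0" using Wc by (auto simp: S_def S0_def)
    moreover have "S0 \<inter> O2 \<subseteq> S" using O2(2) by (auto simp: S_def S0_def)
    ultimately show "S0 \<inter> O2 - {snd d x} = S \<inter> O2 - {snd d x}" by blast
  qed
  have cz: "cinv c (snd c z) = z" "cinv d (snd d z) = z" "cinv c' (snd c' (\<phi> z)) = \<phi> z" if "z \<in> W" for z
    using M.cinv_snd[OF c(1)] M.cinv_snd[OF d(1)] N.cinv_snd[OF c'(1)] Wc[OF that] by simp_all
  have trW: "transition d c (snd d z) = snd c z" "transition c d (snd c z) = snd d z"
      "transition c' d' (snd c' (\<phi> z)) = snd d' (\<phi> z)" if "z \<in> W" for z
    using M.transition_snd[OF d(1)] M.transition_snd[OF c(1)] N.transition_snd[OF c'(1)] Wc[OF that] by simp_all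
  have dtr: "(transition d c has_derivative (\<lambda>v. ?U *v v)) (at (snd d x) within S)"
    using M.transition_has_derivative[OF d(1) c(1) d(2) c(2)]
    by (rule has_derivative_subset) (use Wc in \<open>auto simp: S_def overlap_def\<close>)
  have dW: "(transition c' d' has_derivative (\<lambda>v. ?W *v v)) (at (snd c' (\<phi> x)) within R)"
    if "R \<subseteq> (\<lambda>z. snd c' (\<phi> z)) ` W" for R
    using N.transition_has_derivative[OF c'(1) d'(1) c'(2) d'(2)]
  proof (rule has_derivative_subset)
    have "(\<lambda>z. snd c' (\<phi> z)) ` W \<subseteq> overlap c' d'"
      using Wc by (auto simp: overlap_def)
    then show "R \<subseteq> overlap c' d'" using that by blast
  qed
  have \<psi>z: "?\<psi> (snd c z) = snd c' (\<phi> z)" if "z \<in> W" for z using cz[OF that] by simp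
  \<comment> \<open>\<open>dmap\<close> picks some derivative within its domain, which is meaningful
    only once differentiability is known; the chain rule through the charts \<open>c\<close> and
    \<open>c'\<close> supplies it.\<close>
  have ex: "?\<chi> differentiable (at (snd d x) within S0)"
  proof -
    have "(?\<psi> has_derivative (\<lambda>v. A *v v)) (at (transition d c (snd d x)) within transition d c ` S)"
      unfolding trW(1)[OF xW] using assms(6) by (rule has_derivative_at_withinI)
    from diff_chain_within[OF dtr this]
    have d1: "(?\<psi> \<circ> transition d c has_derivative (\<lambda>v. A *v v) \<circ> (\<lambda>v. ?U *v v)) (at (snd d x) within S)" .
    have val: "(?\<psi> \<circ> transition d c) (snd d z) = snd c' (\<phi> z)" if "z \<in> W" for z
      using \<psi>z[OF that] trW(1)[OF that] by simp
    have "(transition c' d' has_derivative (\<lambda>v. ?W *v v)) (at ((?\<psi> \<circ> transition d c) (snd d x)) within (?\<psi> \<circ> transition d c) ` S)"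
      unfolding val[OF xW] by (rule dW) (use val in \<open>auto simp: S_def\<close>)
    from diff_chain_within[OF d1 this]
    have d2: "(transition c' d' \<circ> (?\<psi> \<circ> transition d c) has_derivative (\<lambda>v. ?W *v v) \<circ> ((\<lambda>v. A *v v) \<circ> (\<lambda>v. ?U *v v))) (at (snd d x) within S)" .
    have "(?\<chi> has_derivative (\<lambda>v. ?W *v v) \<circ> ((\<lambda>v. A *v v) \<circ> (\<lambda>v. ?U *v v))) (at (snd d x) within S)"
    proof (rule has_derivative_transform[OF xS _ d2])
      fix s assume "s \<in> S"
      then obtain z where z: "z \<in> W" "s = snd d z" by (auto simp: S_def)
      show "?\<chi> s = (transition c' d' \<circ> (?\<psi> \<circ> transition d c)) s"
        using val[OF z(1)] trW(3)[OF z(1)] cz(2)[OF z(1)] z(2) by simp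
    qed
    then show ?thesis unfolding atS differentiable_def by blast
  qed
  define A0 where "A0 = dmap M N \<phi> x"
  have A0: "(?\<chi> has_derivative (\<lambda>v. A0 *v v)) (at (snd d x) within S0)"
  proof -
    have f: "(?\<chi> has_derivative frechet_derivative ?\<chi> (at (snd d x) within S0)) (at (snd d x) within S0)"
      using ex by (simp only: frechet_derivative_works)
    have "A0 = matrix (frechet_derivative ?\<chi> (at (snd d x) within S0))"
      unfolding A0_def dmap_def Let_def Jmat_def d_def[symmetric] d'_def[symmetric] S0_def by simp
    then have "(\<lambda>v. A0 *v v) = frechet_derivative ?\<chi> (at (snd d x) within S0)"
      using has_derivative_linear[OF f] by (simp add: fun_eq_iff matrix_works)
    then show ?thesis using f by simp
  qed
  \<comment> \<open>Both sides are compared in the chart \<open>c\<close>, where the point is known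
    to be interior and derivatives are unique; in the preferred chart interiority is not at
    hand.\<close>
  have lhs: "(transition c' d' \<circ> ?\<psi> has_derivative (\<lambda>v. ?W *v v) \<circ> (\<lambda>v. A *v v)) (at (snd c x) within T)"
  proof (rule diff_chain_within)
    show "(?\<psi> has_derivative (\<lambda>v. A *v v)) (at (snd c x) within T)" using assms(6) by (rule has_derivative_at_withinI)
    show "(transition c' d' has_derivative (\<lambda>v. ?W *v v)) (at (?\<psi> (snd c x)) within ?\<psi> ` T)"
      unfolding \<psi>z[OF xW]
    proof (rule dW)
      show "?\<psi> ` T \<subseteq> (\<lambda>z. snd c' (\<phi> z)) ` W"
      proof
        fix w assume "w \<in> ?\<psi> ` T"
        then obtain z where "z \<in> W" "w = ?\<psi> (snd c z)" using T(3) by blast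
        then show "w \<in> (\<lambda>z. snd c' (\<phi> z)) ` W" using \<psi>z by auto
      qed
    qed
  qed
  have rhs: "(?\<chi> \<circ> transition c d has_derivative (\<lambda>v. A0 *v v) \<circ> (\<lambda>v. ?Jf *v v)) (at (snd c x) within T)"
  proof (rule diff_chain_within)
    show "(transition c d has_derivative (\<lambda>v. ?Jf *v v)) (at (snd c x) within T)"
      using M.transition_has_derivative[OF c(1) d(1) c(2) d(2)]
      by (rule has_derivative_subset) (use T(3) Wc in \<open>auto simp: overlap_def\<close>)
    show "(?\<chi> has_derivative (\<lambda>v. A0 *v v)) (at (transition c d (snd c x)) within transition c d ` T)"
      unfolding trW(2)[OF xW] using A0
    proof (rule has_derivative_subset)
      show "transition c d ` T \<subseteq> S0"
      proof
        fix w assume "w \<in> transition c d ` T"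
        then obtain z where "z \<in> W" "w = transition c d (snd c z)" using T(3) by blast
        then show "w \<in> S0" using trW(2) Wc by (auto simp: S0_def)
      qed
    qed
  qed
  have "(transition c' d' \<circ> ?\<psi> has_derivative (\<lambda>v. A0 *v v) \<circ> (\<lambda>v. ?Jf *v v)) (at (snd c x) within T)"
  proof (rule has_derivative_transform[OF T(2) _ rhs])
    fix w assume "w \<in> T"
    then obtain z where z: "z \<in> W" "w = snd c z" using T(3) by blast
    show "(transition c' d' \<circ> ?\<psi>) w = (?\<chi> \<circ> transition c d) w"
      using trW(2,3)[OF z(1)] \<psi>z[OF z(1)] cz(2)[OF z(1)] z(2) by simp
  qed
  then have "(\<lambda>v. A0 *v v) \<circ> (\<lambda>v. ?Jf *v v) = (\<lambda>v. ?W *v v) \<circ> (\<lambda>v. A *v v)"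
    using lhs unfolding at_within_open[OF T(2,1)] by (rule has_derivative_unique)
  then have "(A0 ** ?Jf) *v v = (?W ** A) *v v" for v
    by (simp add: fun_eq_iff matrix_vector_mul_assoc)
  then have "A0 ** ?Jf = ?W ** A" by (simp add: matrix_eq)
  then have A0eq: "A0 = ?W ** A ** matrix_inv ?Jf"
    using M.jac_pos[OF c(1) d(1) c(2) d(2)] matrix_inv_cancel(1)[of ?Jf]
    by (metis less_irrefl matrix_mul_assoc matrix_mul_rid)
  have pd: "posdef (metric_at M x)" using M.metric_at_posdef[OF xM] .
  have J: "0 < det ?Jf" "0 < det ?W" using M.jac_pos[OF c(1) d(1) c(2) d(2)] N.jac_pos[OF c'(1) d'(1) c'(2) d'(2)] .
  have m: "gmat M c x = transpose ?Jf ** metric_at M x ** ?Jf" "gmat N c' (\<phi> x) = transpose ?W ** metric_at N (\<phi> x) ** ?W"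
    unfolding metric_at_def d_def[symmetric] d'_def[symmetric]
    by (rule M.metric_change[OF c(1) d(1) c(2) d(2)], rule N.metric_change[OF c'(1) d'(1) c'(2) d'(2)])
  show "hs (metric_at M x) (metric_at N (\<phi> x)) (dmap M N \<phi> x) = hs (gmat M c x) (gmat N c' (\<phi> x)) A"
    unfolding m A0_def[symmetric] A0eq using J by (subst hs_change[OF pd]) auto
  show "jacobian M N \<phi> x = riem_det (gmat M c x) (gmat N c' (\<phi> x)) A"
    unfolding jacobian_def m A0_def[symmetric] A0eq using J by (subst riem_det_change[OF pd]) auto
qed

end

section \<open>The area formula\<close>

text \<open>The bounds are imposed on the open set \<open>U\<close> because derivatives need room,
  while integration takes place on a Borel part \<open>P\<close> of it. The image of
  \<open>P\<close> is required to be Borel because its area is to be computed.\<close>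

locale map_piece = surface_map M N \<phi>
  for M :: "'a surface" and N :: "'b surface" and \<phi> :: "'a \<Rightarrow> 'b" +
  fixes c :: "'a chart" and c' :: "'b chart" and U P :: "'a set" and C \<kappa> \<Lambda> :: real
  assumes c: "c \<in> atlas M" and c': "c' \<in> atlas N"
    and U: "openin (surf_top M) U" "U \<subseteq> fst c" and img: "\<phi> ` U \<subseteq> fst c'"
    and lipU: "0 \<le> C" "\<forall>x1\<in>U. \<forall>x2\<in>U. norm (snd c' (\<phi> x1) - snd c' (\<phi> x2)) \<le> C * norm (snd c x1 - snd c x2)"
    and metM: "0 < \<kappa>" "\<forall>x\<in>U. \<forall>v. \<kappa> * norm v \<le> sqrt (gip (gmat M c x) v v)"
    and metN: "0 \<le> \<Lambda>" "\<forall>x\<in>U. \<forall>v. sqrt (gip (gmat N c' (\<phi> x)) v v) \<le> \<Lambda> * norm v"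
    and P: "P \<subseteq> U" "P \<in> sets (borel_top (surf_top M))" "\<phi> ` P \<in> sets (borel_top (surf_top N))"
begin

definition rep :: "real^2 \<Rightarrow> real^2" where "rep = snd c' \<circ> \<phi> \<circ> cinv c"

definition Y :: "(real^2) set" where "Y = snd c ` P"

definition Drep :: "real^2 \<Rightarrow> real^2^2" where "Drep y = matrix (frechet_derivative rep (at y))"

text \<open>The good points, at which \<open>Drep\<close> is a genuine derivative and
  \<open>dmap\<close> can be computed from it.\<close>

definition Yg :: "(real^2) set" where
  "Yg = {y \<in> Y. y \<in> interior (snd c ` U) \<and> rep differentiable (at y)}"

lemma Pc: "P \<subseteq> fst c" using P(1) U(2) by blast

lemma Y_borel: "Y \<in> sets borel"
  using M.chart_image_borel[OF c P(2)] Pc by (simp add: Y_def Int_absorb2)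

lemma rep_snd: "x \<in> U \<Longrightarrow> rep (snd c x) = snd c' (\<phi> x)"
  using M.cinv_snd[OF c] U(2) by (auto simp: rep_def)

lemma UE: "y \<in> snd c ` U \<Longrightarrow> cinv c y \<in> U \<and> snd c (cinv c y) = y"
  using M.cinv_snd[OF c] U(2) by auto

lemma rep_lipschitz:
  assumes "y \<in> snd c ` U" "z \<in> snd c ` U"
  shows "norm (rep y - rep z) \<le> C * norm (y - z)"
proof -
  obtain a b where "a \<in> U" "b \<in> U" "y = snd c a" "z = snd c b" using assms by blast
  then show ?thesis using lipU(2) by (simp add: rep_snd)
qed

lemma YU: "Y \<subseteq> snd c ` U" using P(1) by (auto simp: Y_def)

text \<open>Interior points are handled by Rademacher's theorem; the remaining ones lie on the
  boundary of the chart image, a piece of a Lipschitz graph.\<close>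

lemma negligible_bad: "negligible (Y - Yg)"
proof -
  have "negligible {y \<in> interior (snd c ` U). \<not> rep differentiable (at y)}"
  proof (rule rademacher_local)
    fix z assume "z \<in> interior (snd c ` U)"
    then obtain r where r: "0 < r" "cball z r \<subseteq> interior (snd c ` U)" using open_contains_cball open_interior by blast
    have "C-lipschitz_on (cball z r) rep"
    proof (rule lipschitz_onI)
      fix x y assume "x \<in> cball z r" "y \<in> cball z r"
      then have "x \<in> snd c ` U" "y \<in> snd c ` U" using r(2) interior_subset by blast+
      then show "dist (rep x) (rep y) \<le> C * dist x y" using rep_lipschitz by (simp add: dist_norm)
    qed (rule lipU(1))
    then show "\<exists>r>0. \<exists>C. C-lipschitz_on (cball z r) rep" using r(1) by blast
  qed
  moreover have "negligible (snd c ` U - interior (snd c ` U))"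
  proof -
    obtain W where W: "open W" "snd c ` U = im c \<inter> W"
      using M.openin_chart_image[OF c U] by (auto simp: openin_open)
    have "snd c ` U - interior (snd c ` U) \<subseteq> im c - interior (im c)"
      using W by (auto simp: interior_open)
    then show ?thesis using M.im_frontier[OF c] negligible_subset by blast
  qed
  moreover have "Y - Yg \<subseteq> (snd c ` U - interior (snd c ` U)) \<union> {y \<in> interior (snd c ` U). \<not> rep differentiable (at y)}"
    using YU by (auto simp: Yg_def)
  ultimately show ?thesis by (meson negligible_Un negligible_subset)
qed

lemma Yg_lebesgue: "Yg \<in> sets lebesgue"
proof -
  have "Yg = Y - (Y - Yg)" by (auto simp: Yg_def)
  moreover have "Y - Yg \<in> sets lebesgue" using negligible_bad negligible_imp_sets by blast
  moreover have "Y \<in> sets lebesgue" using Y_borel by simp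
  ultimately show ?thesis by (metis sets.Diff)
qed

lemma AE_Yg: "AE y in lborel. y \<in> Y \<longrightarrow> y \<in> Yg"
proof -
  have "{y. \<not> (y \<in> Y \<longrightarrow> y \<in> Yg)} = Y - Yg" by auto
  then show ?thesis using negligible_bad by (simp add: AE_lborel_iff_negligible)
qed

lemma Yg_D:
  assumes y: "y \<in> Yg"
  shows "y \<in> snd c ` U" "y \<in> im c" "y \<in> interior (im c)" "cinv c y \<in> U" "snd c (cinv c y) = y"
    "(rep has_derivative (\<lambda>v. Drep y *v v)) (at y)"
proof -
  show yU: "y \<in> snd c ` U" using y YU by (auto simp: Yg_def)
  then show "y \<in> im c" "cinv c y \<in> U" "snd c (cinv c y) = y" using U(2) UE by auto
  have "interior (snd c ` U) \<subseteq> interior (im c)" using U(2) by (intro interior_mono) auto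
  then show "y \<in> interior (im c)" using y by (auto simp: Yg_def)
  have f: "(rep has_derivative frechet_derivative rep (at y)) (at y)"
    using y by (simp add: Yg_def flip: frechet_derivative_works)
  have "(\<lambda>v. Drep y *v v) = frechet_derivative rep (at y)"
    unfolding Drep_def using has_derivative_linear[OF f] by (simp add: fun_eq_iff matrix_works)
  then show "(rep has_derivative (\<lambda>v. Drep y *v v)) (at y)" using f by simp
qed

lemma invariants_Yg:
  assumes "y \<in> Yg"
  shows "hs (metric_at M (cinv c y)) (metric_at N (\<phi> (cinv c y))) (dmap M N \<phi> (cinv c y)) =
      hs (gmat M c (cinv c y)) (gmat N c' (\<phi> (cinv c y))) (Drep y)"
    and "jacobian M N \<phi> (cinv c y) = riem_det (gmat M c (cinv c y)) (gmat N c' (\<phi> (cinv c y))) (Drep y)"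
proof -
  note D = Yg_D[OF assms]
  have x: "cinv c y \<in> fst c" "\<phi> (cinv c y) \<in> fst c'" using D(4) U(2) img by auto
  have i: "snd c (cinv c y) \<in> interior (im c)" using D(3,5) by simp
  have d: "((snd c' \<circ> \<phi> \<circ> cinv c) has_derivative (\<lambda>v. Drep y *v v)) (at (snd c (cinv c y)))"
    using D(6) by (simp add: D(5) rep_def)
  show "hs (metric_at M (cinv c y)) (metric_at N (\<phi> (cinv c y))) (dmap M N \<phi> (cinv c y)) =
      hs (gmat M c (cinv c y)) (gmat N c' (\<phi> (cinv c y))) (Drep y)"
    "jacobian M N \<phi> (cinv c y) = riem_det (gmat M c (cinv c y)) (gmat N c' (\<phi> (cinv c y))) (Drep y)"
    by (rule dmap_in_charts[OF c x(1) c' x(2) i d])+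
qed

lemma hs_Yg_bound:
  assumes y: "y \<in> Yg"
  shows "hs (gmat M c (cinv c y)) (gmat N c' (\<phi> (cinv c y))) (Drep y) \<le> 2 * (\<Lambda> * (C / \<kappa>))\<^sup>2"
proof -
  note D = Yg_D[OF y]
  have x: "cinv c y \<in> fst c" "\<phi> (cinv c y) \<in> fst c'" using D(4) U(2) img by auto
  show ?thesis
  proof (rule hs_bound[OF M.metric_posdef[OF c x(1)] N.metric_posdef[OF c' x(2)] metM(1) metN(1) lipU(1)])
    show "\<kappa> * norm v \<le> sqrt (gip (gmat M c (cinv c y)) v v)" for v using metM(2) D(4) by blast
    show "sqrt (gip (gmat N c' (\<phi> (cinv c y))) v v) \<le> \<Lambda> * norm v" for v using metN(2) D(4) by blast
    have yi: "y \<in> interior (snd c ` U)" using y by (simp add: Yg_def)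
    show "norm (Drep y *v v) \<le> C * norm v" for v
    proof (rule lipschitz_derivative_bound[OF open_interior yi _ D(6)])
      fix z assume "z \<in> interior (snd c ` U)"
      then have "z \<in> snd c ` U" using interior_subset by blast
      then show "norm (rep z - rep y) \<le> C * norm (z - y)" using D(1) by (rule rep_lipschitz)
    qed
  qed
qed

lemma rep_continuous: "continuous_on (snd c ` U) rep"
proof (rule lipschitz_on_continuous_on)
  show "C-lipschitz_on (snd c ` U) rep"
    by (rule lipschitz_onI[OF _ lipU(1)]) (simp add: dist_norm rep_lipschitz)
qed

lemma rep_im: "y \<in> snd c ` U \<Longrightarrow> rep y \<in> im c' \<and> cinv c' (rep y) = \<phi> (cinv c y)"
  using UE[of y] img N.cinv_snd[OF c'] by (auto simp: rep_def)

lemma measurable_entries: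
  "(\<lambda>y. Drep y $ i $ j) \<in> borel_measurable (lebesgue_on Yg)"
  "(\<lambda>y. gmat M c (cinv c y) $ i $ j) \<in> borel_measurable (lebesgue_on Yg)"
  "(\<lambda>y. gmat N c' (\<phi> (cinv c y)) $ i $ j) \<in> borel_measurable (lebesgue_on Yg)"
  "(\<lambda>y. det (Drep y)) \<in> borel_measurable (lebesgue_on Yg)"
proof -
  have "(\<lambda>y. matrix ((\<lambda>v. Drep y *v v)) $ i $ j) \<in> borel_measurable (lebesgue_on Yg)" for i j
    by (rule borel_measurable_partial_derivatives[OF Yg_lebesgue]) (rule has_derivative_at_withinI, rule Yg_D(6))
  then show D: "(\<lambda>y. Drep y $ i $ j) \<in> borel_measurable (lebesgue_on Yg)" for i j
    by (simp add: matrix_of_matrix_vector_mul)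
  then show "(\<lambda>y. det (Drep y)) \<in> borel_measurable (lebesgue_on Yg)" unfolding det_2 by measurable
  have YgU: "Yg \<subseteq> snd c ` U" using Yg_D(1) by blast
  have cM: "continuous_on Yg (\<lambda>y. gmat M c (cinv c y))"
    using M.metric_smooth[OF c] by (rule continuous_on_subset) (use Yg_D(2) in blast)
  have "continuous_on (snd c ` U) (\<lambda>y. gmat N c' (cinv c' (rep y)))"
    using N.metric_smooth[OF c'] rep_continuous by (rule continuous_on_compose2) (use rep_im in blast)
  then have "continuous_on Yg (\<lambda>y. gmat N c' (cinv c' (rep y)))" using YgU by (rule continuous_on_subset)
  moreover have "continuous_on Yg (\<lambda>y. gmat N c' (cinv c' (rep y))) \<longleftrightarrow> continuous_on Yg (\<lambda>y. gmat N c' (\<phi> (cinv c y)))"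
    by (rule continuous_on_cong[OF refl]) (use rep_im YgU in force)
  ultimately have cN: "continuous_on Yg (\<lambda>y. gmat N c' (\<phi> (cinv c y)))" by blast
  show "(\<lambda>y. gmat M c (cinv c y) $ i $ j) \<in> borel_measurable (lebesgue_on Yg)"
    by (rule continuous_imp_measurable_on_sets_lebesgue[OF _ Yg_lebesgue]) (intro continuous_intros cM)
  show "(\<lambda>y. gmat N c' (\<phi> (cinv c y)) $ i $ j) \<in> borel_measurable (lebesgue_on Yg)"
    by (rule continuous_imp_measurable_on_sets_lebesgue[OF _ Yg_lebesgue]) (intro continuous_intros cN)
qed

text \<open>On the good points the function is only Lebesgue measurable. It is changed on a null set
  to a Borel function of the coordinates, which is pulled back through the chart.\<close>

lemma borel_representative:
  fixes f :: "'a \<Rightarrow> real"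
  assumes "(\<lambda>y. h y) \<in> borel_measurable (lebesgue_on Yg)" "\<And>y. y \<in> Yg \<Longrightarrow> f (cinv c y) = h y"
  shows "\<exists>g\<in>borel_measurable (borel_top (surf_top M)). AE x in area M. x \<in> P \<longrightarrow> f x = g x"
proof -
  have "(\<lambda>y. if y \<in> Yg then h y else 0) \<in> borel_measurable lebesgue"
    using assms(1) Yg_lebesgue by (rule borel_measurable_if_I)
  then obtain g' where g': "g' \<in> borel_measurable lborel" "AE y in lborel. (if y \<in> Yg then h y else 0) = g' y"
    using completion_ex_borel_measurable_real by blast
  define g where "g x = (if x \<in> fst c then g' (snd c x) else 0)" for x
  have "(\<lambda>x. g' (snd c x)) \<in> borel_measurable (restrict_space (borel_top (surf_top M)) (fst c))"
    using g'(1) by (intro M.chart_function_measurable[OF c]) simp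
  then have "(\<lambda>x. indicator (fst c) x *\<^sub>R g' (snd c x)) \<in> borel_measurable (borel_top (surf_top M))"
    using M.chart_borel[OF c] M.chart_subset[OF c]
    by (subst (asm) borel_measurable_restrict_space_iff) (auto simp: space_borel_top Int_absorb2)
  moreover have "(\<lambda>x. indicator (fst c) x *\<^sub>R g' (snd c x)) = g"
    by (auto simp: g_def fun_eq_iff indicator_def)
  ultimately have "g \<in> borel_measurable (borel_top (surf_top M))" by simp
  moreover have "AE x in area M. x \<in> P \<longrightarrow> f x = g x"
    unfolding M.AE_area_piece[OF c P(2) Pc]
    using g'(2) AE_Yg
  proof eventually_elim
    case (elim y)
    show ?case
    proof
      assume "y \<in> snd c ` P"
      then have y: "y \<in> Yg" using elim(2) by (simp add: Y_def)
      have "cinv c y \<in> fst c" using Yg_D(4)[OF y] U(2) by blast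
      then show "f (cinv c y) = g (cinv c y)"
        using elim(1) y assms(2)[OF y] Yg_D(5)[OF y] by (simp add: g_def)
    qed
  qed
  ultimately show ?thesis by blast
qed

lemma hs_representative:
  "\<exists>g\<in>borel_measurable (borel_top (surf_top M)). AE x in area M. x \<in> P \<longrightarrow>
    hs (metric_at M x) (metric_at N (\<phi> x)) (dmap M N \<phi> x) = g x"
proof -
  let ?G = "\<lambda>y. gmat M c (cinv c y)" and ?H = "\<lambda>y. gmat N c' (\<phi> (cinv c y))"
  let ?X = "\<lambda>y. transpose (Drep y) ** ?H y ** Drep y"
  let ?h = "\<lambda>y. (?G y$2$2 * ?X y$1$1 - ?G y$1$2 * ?X y$2$1 - ?G y$2$1 * ?X y$1$2 + ?G y$1$1 * ?X y$2$2) / det (?G y)"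
  note [measurable] = measurable_entries
  have X: "(\<lambda>y. ?X y $ i $ j) \<in> borel_measurable (lebesgue_on Yg)" for i j
    by (simp add: matrix_mult_2 transpose_def)
  have "(\<lambda>y. det (?G y)) \<in> borel_measurable (lebesgue_on Yg)" unfolding det_2 by measurable
  with X have "?h \<in> borel_measurable (lebesgue_on Yg)"
    by (intro borel_measurable_divide borel_measurable_add borel_measurable_diff borel_measurable_times measurable_entries)
  then show ?thesis
  proof (rule borel_representative)
    fix y assume y: "y \<in> Yg"
    have "cinv c y \<in> fst c" using Yg_D(4)[OF y] U(2) by blast
    from hs_explicit[OF M.metric_posdef[OF c this] refl]
    show "hs (metric_at M (cinv c y)) (metric_at N (\<phi> (cinv c y))) (dmap M N \<phi> (cinv c y)) = ?h y"
      unfolding invariants_Yg(1)[OF y] .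
  qed
qed

lemma jacobian_representative:
  "\<exists>g\<in>borel_measurable (borel_top (surf_top M)). AE x in area M. x \<in> P \<longrightarrow> jacobian M N \<phi> x = g x"
proof -
  let ?G = "\<lambda>y. gmat M c (cinv c y)" and ?H = "\<lambda>y. gmat N c' (\<phi> (cinv c y))"
  note [measurable] = measurable_entries
  have [measurable]: "(\<lambda>y. det (?G y)) \<in> borel_measurable (lebesgue_on Yg)" "(\<lambda>y. det (?H y)) \<in> borel_measurable (lebesgue_on Yg)"
    unfolding det_2 by measurable
  have "(\<lambda>y. riem_det (?G y) (?H y) (Drep y)) \<in> borel_measurable (lebesgue_on Yg)"
    unfolding riem_det_def by measurable
  then show ?thesis
    by (rule borel_representative) (rule invariants_Yg(2))
qed

lemma hs_AE_bound:
  "AE x in area M. x \<in> P \<longrightarrow> hs (metric_at M x) (metric_at N (\<phi> x)) (dmap M N \<phi> x) \<le> 2 * (\<Lambda> * (C / \<kappa>))\<^sup>2"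
  unfolding M.AE_area_piece[OF c P(2) Pc]
  using AE_Yg
proof eventually_elim
  case (elim y)
  show ?case
  proof
    assume "y \<in> snd c ` P"
    then have y: "y \<in> Yg" using elim by (simp add: Y_def)
    show "hs (metric_at M (cinv c y)) (metric_at N (\<phi> (cinv c y))) (dmap M N \<phi> (cinv c y)) \<le> 2 * (\<Lambda> * (C / \<kappa>))\<^sup>2"
      unfolding invariants_Yg(1)[OF y] by (rule hs_Yg_bound[OF y])
  qed
qed

text \<open>The map is injective off the preimage of the null set \<open>Z\<close>; on that preimage the Jacobian
  vanishes almost everywhere, because the image is null.\<close>

lemma area_formula:
  assumes Z: "Z \<in> null_sets (area N)"
    and inj: "\<And>x y. x \<in> P \<Longrightarrow> y \<in> P \<Longrightarrow> \<phi> x = \<phi> y \<Longrightarrow> \<phi> x \<notin> Z \<Longrightarrow> x = y"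
    and jpos: "AE x in area M. 0 \<le> jacobian M N \<phi> x"
    and g: "g \<in> borel_measurable (borel_top (surf_top M))" "AE x in area M. x \<in> P \<longrightarrow> jacobian M N \<phi> x = g x"
  shows "(\<integral>\<^sup>+x. ennreal (g x) * indicator P x \<partial>(area M)) = emeasure (area N) (\<phi> ` P)"
proof -
  let ?w = "\<lambda>y. sqrt (det (gmat M c (cinv c y)))" and ?w' = "\<lambda>z. sqrt (det (gmat N c' (cinv c' z)))"
  define Q where "Q = snd c' ` (\<phi> ` P)"
  have imgP: "\<phi> ` P \<subseteq> fst c'" using img P(1) by blast
  have Q: "Q \<in> sets borel" using N.chart_image_borel[OF c' P(3)] imgP by (simp add: Q_def Int_absorb2)
  have Qim: "Q \<subseteq> im c'" using imgP by (auto simp: Q_def)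
  have Zs: "Z \<in> sets (borel_top (surf_top N))" using Z by (auto simp: null_sets_def)
  \<comment> \<open>The part lying over \<open>Z\<close>, where injectivity may fail. Change of
    variables is applied to \<open>Y1\<close>, the good points outside it.\<close>
  define Yb where "Yb = snd c ` (P \<inter> \<phi> -` Z)"
  have "\<phi> -` Z \<inter> space (borel_top (surf_top M)) \<in> sets (borel_top (surf_top M))"
    using map_measurable Zs by (rule measurable_sets)
  then have PZ: "P \<inter> (\<phi> -` Z \<inter> space (borel_top (surf_top M))) \<in> sets (borel_top (surf_top M))"
    using P(2) by blast
  have PZeq: "P \<inter> (\<phi> -` Z \<inter> space (borel_top (surf_top M))) = P \<inter> \<phi> -` Z"
    using Pc M.chart_subset[OF c] by (auto simp: space_borel_top)
  have "snd c ` (P \<inter> \<phi> -` Z \<inter> fst c) \<in> sets borel"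
    using M.chart_image_borel[OF c PZ] unfolding PZeq .
  moreover have "P \<inter> \<phi> -` Z \<inter> fst c = P \<inter> \<phi> -` Z" using Pc by blast
  ultimately have Yb: "Yb \<in> sets borel" by (simp add: Yb_def)
  have YbE: "y \<in> Yb \<longleftrightarrow> \<phi> (cinv c y) \<in> Z" if "y \<in> Y" for y
    using that Pc M.cinv_snd[OF c] M.chart_inj[OF c] by (auto simp: Yb_def Y_def subset_iff inj_on_def)
  define Y1 where "Y1 = Yg - Yb"
  have Y1: "Y1 \<in> sets lebesgue" unfolding Y1_def using Yg_lebesgue Yb by auto
  have YgY: "Yg \<subseteq> Y" by (auto simp: Yg_def)
  have repY: "rep ` Y = Q"
  proof -
    have "rep (snd c x) = snd c' (\<phi> x)" if "x \<in> P" for x using rep_snd P(1) that by blast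
    then show ?thesis by (auto simp: Y_def Q_def image_image cong: image_cong)
  qed
  have negZ: "negligible (snd c' ` (Z \<inter> fst c'))"
  proof -
    have "Z \<inter> fst c' \<in> null_sets (area N)" using Z N.chart_borel[OF c'] by (intro null_set_Int2) auto
    moreover have "Z \<inter> fst c' \<in> sets (borel_top (surf_top N))" using Zs N.chart_borel[OF c'] by blast
    ultimately have "snd c' ` (Z \<inter> fst c') \<in> null_sets lborel" using N.null_sets_area_chart[OF c'] by blast
    then show ?thesis by (simp add: negligible_iff_null_sets null_sets_completionI)
  qed
  have repYb: "rep ` (Y \<inter> Yb) \<subseteq> snd c' ` (Z \<inter> fst c')"
  proof
    fix z assume "z \<in> rep ` (Y \<inter> Yb)"
    then obtain y where y: "y \<in> Y" "y \<in> Yb" "z = rep y" by blast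
    have yU: "y \<in> snd c ` U" using y(1) YU by blast
    have "\<phi> (cinv c y) \<in> Z" using YbE[OF y(1)] y(2) by blast
    moreover have "\<phi> (cinv c y) \<in> fst c'" using UE[OF yU] img by blast
    ultimately show "z \<in> snd c' ` (Z \<inter> fst c')" using y(3) by (auto simp: rep_def)
  qed
  \<comment> \<open>Lipschitz maps preserve null sets, so discarding the bad points loses only a
    null part of the image.\<close>
  have negbad: "negligible (rep ` (Y - Yg))"
  proof (rule negligible_locally_Lipschitz_image[OF _ negligible_bad])
    fix x assume "x \<in> Y - Yg"
    then have x: "x \<in> snd c ` U" using YU by blast
    have "\<forall>y\<in>(Y - Yg) \<inter> UNIV. norm (rep y - rep x) \<le> C * norm (y - x)" using rep_lipschitz x YU by blast
    then show "\<exists>T B. open T \<and> x \<in> T \<and> (\<forall>y\<in>(Y - Yg) \<inter> T. norm (rep y - rep x) \<le> B * norm (y - x))"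
      using open_UNIV by blast
  qed simp
  have diffneg: "negligible (Q - rep ` Y1)"
  proof -
    have "Q - rep ` Y1 \<subseteq> rep ` (Y - Yg) \<union> snd c' ` (Z \<inter> fst c')"
    proof
      fix z assume z: "z \<in> Q - rep ` Y1"
      then obtain y where y: "y \<in> Y" "z = rep y" using repY by blast
      show "z \<in> rep ` (Y - Yg) \<union> snd c' ` (Z \<inter> fst c')"
      proof (cases "y \<in> Yg")
        case True
        then have "y \<in> Yb" using z y by (auto simp: Y1_def)
        then show ?thesis using y repYb by blast
      qed (use y in blast)
    qed
    then show ?thesis using negbad negZ by (meson negligible_Un negligible_subset)
  qed
  have rep1: "rep ` Y1 \<subseteq> Q" using repY YgY by (auto simp: Y1_def)
  have "rep ` Y1 = Q - (Q - rep ` Y1)" using rep1 by blast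
  moreover have "Q \<in> sets lebesgue" "Q - rep ` Y1 \<in> sets lebesgue"
    using Q diffneg by (auto intro: negligible_imp_sets)
  ultimately have repY1: "rep ` Y1 \<in> sets lebesgue" by (metis sets.Diff)
  have injY1: "inj_on rep Y1"
  proof (rule inj_onI)
    fix y z assume yz: "y \<in> Y1" "z \<in> Y1" "rep y = rep z"
    then have Yyz: "y \<in> Y" "z \<in> Y" using YgY by (auto simp: Y1_def)
    obtain a b where ab: "a \<in> P" "b \<in> P" "y = snd c a" "z = snd c b" using Yyz by (auto simp: Y_def)
    have "snd c' (\<phi> a) = snd c' (\<phi> b)" using yz(3) ab P(1) by (simp add: rep_snd subset_iff)
    moreover have "\<phi> a \<in> fst c'" "\<phi> b \<in> fst c'" using ab imgP by auto
    ultimately have eq: "\<phi> a = \<phi> b" using N.chart_inj[OF c'] by (auto dest: inj_onD)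
    have "cinv c y = a" using ab(1,3) Pc M.cinv_snd[OF c] by blast
    then have "\<phi> a \<notin> Z" using YbE[OF Yyz(1)] yz(1) by (simp add: Y1_def)
    then show "y = z" using inj[OF ab(1,2) eq] ab by simp
  qed
  have w'pos: "0 < ?w' (rep y)" if "y \<in> Yg" for y
    using N.wt_pos[OF c'] rep_im[OF Yg_D(1)[OF that]] by blast
  have wpos: "0 < ?w y" if "y \<in> Yg" for y
    using M.wt_pos[OF c Yg_D(2)[OF that]] .
  \<comment> \<open>The weights in \<open>riem_det\<close> cancel, leaving the integrand of the
    planar change of variables.\<close>
  have jac: "?w y * jacobian M N \<phi> (cinv c y) = ?w' (rep y) * det (Drep y)" if y: "y \<in> Yg" for y
    using wpos[OF y] rep_im[OF Yg_D(1)[OF y]] unfolding invariants_Yg(2)[OF y] riem_det_def by simp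
  have cont_w': "(\<lambda>y. ?w' (rep y)) \<in> borel_measurable (lebesgue_on Yg)"
  proof (rule continuous_imp_measurable_on_sets_lebesgue[OF _ Yg_lebesgue])
    have "continuous_on Yg rep" using rep_continuous by (rule continuous_on_subset) (use Yg_D(1) in blast)
    then show "continuous_on Yg (\<lambda>y. ?w' (rep y))"
      by (rule continuous_on_compose2[OF N.wt_cont[OF c']]) (use rep_im Yg_D(1) in blast)
  qed
  have cov: "(\<integral>\<^sup>+y. ennreal (indicator Y1 y * (\<bar>det (matrix (\<lambda>v. Drep y *v v))\<bar> * ?w' (rep y))) \<partial>lebesgue) =
      (\<integral>\<^sup>+z. ennreal (indicator (rep ` Y1) z * ?w' z) \<partial>lebesgue)"
  proof (rule nn_integral_change_of_variables[OF Y1 _ injY1])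
    show "(rep has_derivative (\<lambda>v. Drep y *v v)) (at y within Y1)" if "y \<in> Y1" for y
      using Yg_D(6)[of y] that by (simp add: Y1_def has_derivative_at_withinI)
    show "0 \<le> ?w' z" if "z \<in> rep ` Y1" for z
      using w'pos that by (force simp: Y1_def)
    have "(\<lambda>z. indicator (im c') z * ?w' z) \<in> borel_measurable lebesgue"
      using N.wt_measurable[OF c'] by (simp add: measurable_completion)
    then have "(\<lambda>z. indicator (rep ` Y1) z * (indicator (im c') z * ?w' z)) \<in> borel_measurable lebesgue"
      by (rule borel_measurable_times[OF borel_measurable_indicator[OF repY1]])
    moreover have "(\<lambda>z. indicator (rep ` Y1) z * (indicator (im c') z * ?w' z)) = (\<lambda>z. indicator (rep ` Y1) z * ?w' z)"
      using rep1 Qim by (auto simp: indicator_def fun_eq_iff)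
    ultimately show "(\<lambda>z. indicator (rep ` Y1) z * ?w' z) \<in> borel_measurable lebesgue" by simp
    have "(\<lambda>y. \<bar>det (Drep y)\<bar> * ?w' (rep y)) \<in> borel_measurable (lebesgue_on Yg)"
      using measurable_entries(4) cont_w' by measurable
    then have "(\<lambda>y. if y \<in> Yg then \<bar>det (Drep y)\<bar> * ?w' (rep y) else 0) \<in> borel_measurable lebesgue"
      using Yg_lebesgue by (rule borel_measurable_if_I)
    then have "(\<lambda>y. indicator Y1 y * (if y \<in> Yg then \<bar>det (Drep y)\<bar> * ?w' (rep y) else 0)) \<in> borel_measurable lebesgue"
      by (rule borel_measurable_times[OF borel_measurable_indicator[OF Y1]])
    moreover have "(\<lambda>y. indicator Y1 y * (if y \<in> Yg then \<bar>det (Drep y)\<bar> * ?w' (rep y) else 0)) =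
        (\<lambda>y. indicator Y1 y * (\<bar>det (matrix (\<lambda>v. Drep y *v v))\<bar> * ?w' (rep y)))"
      by (auto simp: indicator_def fun_eq_iff Y1_def matrix_of_matrix_vector_mul)
    ultimately show "(\<lambda>y. indicator Y1 y * (\<bar>det (matrix (\<lambda>v. Drep y *v v))\<bar> * ?w' (rep y))) \<in> borel_measurable lebesgue"
      by simp
  qed
  have negdet: "negligible {y \<in> Yg \<inter> Yb. det (matrix (\<lambda>v. Drep y *v v)) \<noteq> 0}"
  proof (rule det_zero_if_image_negligible)
    show "(rep has_derivative (\<lambda>v. Drep y *v v)) (at y)" if "y \<in> Yg \<inter> Yb" for y
      using that Yg_D(6) by blast
    have "rep ` (Yg \<inter> Yb) \<subseteq> snd c' ` (Z \<inter> fst c')" using repYb YgY by blast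
    then show "negligible (rep ` (Yg \<inter> Yb))" using negZ negligible_subset by blast
  qed
  then have AEdet: "AE y in lborel. \<not> (y \<in> Yg \<inter> Yb \<and> det (Drep y) \<noteq> 0)"
    unfolding AE_lborel_iff_negligible by (simp only: matrix_of_matrix_vector_mul not_not)
  have AEg: "AE y in lborel. y \<in> Y \<longrightarrow> jacobian M N \<phi> (cinv c y) = g (cinv c y)"
    using g(2) unfolding M.AE_area_piece[OF c P(2) Pc] Y_def .
  have "AE x in area M. x \<in> P \<longrightarrow> 0 \<le> jacobian M N \<phi> x" using jpos by eventually_elim simp
  then have AEpos: "AE y in lborel. y \<in> Y \<longrightarrow> 0 \<le> jacobian M N \<phi> (cinv c y)"
    unfolding M.AE_area_piece[OF c P(2) Pc] Y_def .
  have "(\<integral>\<^sup>+x. ennreal (g x) * indicator P x \<partial>(area M)) =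
      (\<integral>\<^sup>+y. ennreal (?w y) * ennreal (g (cinv c y)) * indicator (snd c ` P) y \<partial>lborel)"
    using g(1) by (intro M.nn_integral_area[OF c _ P(2) Pc]) measurable
  also have "\<dots> = (\<integral>\<^sup>+y. ennreal (indicator Y1 y * (\<bar>det (matrix (\<lambda>v. Drep y *v v))\<bar> * ?w' (rep y))) \<partial>lborel)"
  proof (rule nn_integral_cong_AE)
    show "AE y in lborel. ennreal (?w y) * ennreal (g (cinv c y)) * indicator (snd c ` P) y =
        ennreal (indicator Y1 y * (\<bar>det (matrix (\<lambda>v. Drep y *v v))\<bar> * ?w' (rep y)))"
      using AE_Yg AEdet AEg AEpos
    proof eventually_elim
      case (elim y)
      show ?case
      proof (cases "y \<in> Y")
        case False
        then have "y \<notin> Y1" using YgY by (auto simp: Y1_def)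
        then show ?thesis using False by (simp add: Y_def)
      next
        case True
        then have y: "y \<in> Yg" and gy: "g (cinv c y) = jacobian M N \<phi> (cinv c y)" and jp: "0 \<le> jacobian M N \<phi> (cinv c y)"
          using elim by simp_all
        have dp: "0 \<le> det (Drep y)"
        proof -
          have "0 \<le> ?w' (rep y) * det (Drep y)" using jac[OF y] wpos[OF y] jp by (metis less_imp_le mult_nonneg_nonneg)
          then show ?thesis using w'pos[OF y] by (simp add: zero_le_mult_iff)
        qed
        have "ennreal (?w y) * ennreal (g (cinv c y)) = ennreal (?w y * jacobian M N \<phi> (cinv c y))"
          unfolding gy using wpos[OF y] jp by (intro ennreal_mult[symmetric]) auto
        also have "\<dots> = ennreal (\<bar>det (Drep y)\<bar> * ?w' (rep y))"
          unfolding jac[OF y] using dp by (simp add: mult.commute)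
        finally have e: "ennreal (?w y) * ennreal (g (cinv c y)) = ennreal (\<bar>det (Drep y)\<bar> * ?w' (rep y))" .
        show ?thesis
        proof (cases "y \<in> Yb")
          case False
          then show ?thesis using e y True by (simp add: Y1_def Y_def matrix_of_matrix_vector_mul)
        next
          case True
          \<comment> \<open>Points over \<open>Z\<close> contribute nothing to the left side because
            the determinant vanishes there almost everywhere, and they are absent from
            \<open>Y1\<close> on the right.\<close>
          then have "det (Drep y) = 0" using elim(2) y by blast
          then have "ennreal (?w y) * ennreal (g (cinv c y)) = 0" using e by simp
          then show ?thesis using True by (simp add: Y1_def)
        qed
      qed
    qed
  qed
  also have "\<dots> = (\<integral>\<^sup>+z. ennreal (indicator (rep ` Y1) z * ?w' z) \<partial>lborel)"
    using cov by (simp only: nn_integral_completion)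
  also have "\<dots> = (\<integral>\<^sup>+z. ennreal (?w' z) * indicator (snd c' ` (\<phi> ` P \<inter> fst c')) z \<partial>lborel)"
  proof (rule nn_integral_cong_AE)
    have "AE z in lborel. z \<notin> Q - rep ` Y1" using diffneg unfolding AE_lborel_iff_negligible by (simp only: not_not Collect_mem_eq)
    then show "AE z in lborel. ennreal (indicator (rep ` Y1) z * ?w' z) = ennreal (?w' z) * indicator (snd c' ` (\<phi> ` P \<inter> fst c')) z"
    proof eventually_elim
      case (elim z)
      have "snd c' ` (\<phi> ` P \<inter> fst c') = Q" using imgP by (simp add: Q_def Int_absorb2)
      moreover have "z \<in> rep ` Y1 \<longleftrightarrow> z \<in> Q" using elim rep1 by blast
      ultimately show ?case by (simp add: indicator_def)
    qed
  qed
  also have "\<dots> = emeasure (chart_area N c') (\<phi> ` P)"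
    by (rule N.emeasure_chart_area[OF c' P(3), symmetric])
  also have "\<dots> = emeasure (area N) (\<phi> ` P)"
    by (rule N.emeasure_area_chart[OF c' P(3) imgP, symmetric])
  finally show ?thesis .
qed

end

text \<open>In a complete measure space, agreement almost everywhere with a measurable function
  implies measurability; this makes the energy integral computable from a Borel
  representative.\<close>

lemma integral_completion_AE:
  fixes f g :: "'a \<Rightarrow> real"
  assumes g: "g \<in> borel_measurable \<mu>" and ae: "AE x in \<mu>. f x = g x"
  shows "integral\<^sup>L (completion \<mu>) f = integral\<^sup>L \<mu> g"
proof -
  have g': "g \<in> borel_measurable (completion \<mu>)" using g by (rule measurable_completion)
  have ae': "AE x in completion \<mu>. f x = g x" using ae by (rule AE_completion)
  have f': "f \<in> borel_measurable (completion \<mu>)"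
  proof (rule measurableI)
    fix A :: "real set" assume A: "A \<in> sets borel"
    show "f -` A \<inter> space (completion \<mu>) \<in> sets (completion \<mu>)"
    proof (rule completion.in_sets_AE[where A = "g -` A \<inter> space (completion \<mu>)"])
      show "AE x in completion \<mu>. (x \<in> g -` A \<inter> space (completion \<mu>)) = (x \<in> f -` A \<inter> space (completion \<mu>))"
        using ae' by eventually_elim simp
      show "g -` A \<inter> space (completion \<mu>) \<in> sets (completion \<mu>)" using g' A by (rule measurable_sets)
    qed simp
  qed simp
  have "integral\<^sup>L (completion \<mu>) f = integral\<^sup>L (completion \<mu>) g"
    by (rule integral_cong_AE[OF f' g' ae'])
  then show ?thesis using integral_completion[OF g] by simp
qed

section \<open>From pieces to the whole surface\<close>

context surface_map begin

text \<open>Charts and constants are fixed before \<open>P\<close>, so that the partition can be cut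
  from the neighbourhoods afterwards. Writing \<open>U\<close> as a countable union of compact sets
  is what will make the images of the pieces Borel.\<close>

lemma map_piece_nbhd:
  assumes x: "x \<in> points M"
  shows "\<exists>U. openin (surf_top M) U \<and> x \<in> U \<and>
    (\<exists>S :: nat \<Rightarrow> 'a set. (\<forall>n. compactin (surf_top M) (S n)) \<and> U = (\<Union>n. S n)) \<and>
    (\<exists>c c' C \<kappa> \<Lambda>. \<forall>P. P \<subseteq> U \<longrightarrow> P \<in> sets (borel_top (surf_top M)) \<longrightarrow> \<phi> ` P \<in> sets (borel_top (surf_top N)) \<longrightarrow>
      map_piece M N \<phi> c c' U P C \<kappa> \<Lambda>)"
proof -
  obtain c where c: "c \<in> atlas M" "x \<in> fst c" using M.atlas_cover x by blast
  obtain c' where c': "c' \<in> atlas N" "\<phi> x \<in> fst c'" using N.atlas_cover map_points x by blast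
  let ?y = "snd c x" and ?z = "snd c' (\<phi> x)"
  obtain r0 where r0: "0 < r0" "compact (cball ?y r0 \<inter> im c)"
    using M.compact_chart_ball[OF c(1), of ?y] c(2) by blast
  obtain r1 where r1: "0 < r1" "compact (cball ?z r1 \<inter> im c')"
    using N.compact_chart_ball[OF c'(1), of ?z] c'(2) by blast
  obtain \<kappa> \<Lambda>1 where \<kappa>: "0 < \<kappa>" "\<And>y v. y \<in> cball ?y r0 \<inter> im c \<Longrightarrow> \<kappa> * norm v \<le> sqrt (gip (gmat M c (cinv c y)) v v)"
    using M.metric_bounds[OF c(1) r0(2)] by (metis inf.cobounded2)
  obtain \<kappa>1 \<Lambda> where \<Lambda>: "0 < \<Lambda>" "\<And>y v. y \<in> cball ?z r1 \<inter> im c' \<Longrightarrow> sqrt (gip (gmat N c' (cinv c' y)) v v) \<le> \<Lambda> * norm v"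
    using N.metric_bounds[OF c'(1) r1(2)] by (metis inf.cobounded2)
  obtain r C where r: "0 < r" "0 \<le> C" and lipr: "\<forall>x1\<in>fst c. snd c x1 \<in> ball ?y r \<longrightarrow>
    \<phi> x1 \<in> fst c' \<and> snd c' (\<phi> x1) \<in> ball ?z r1 \<and>
    (\<forall>x2\<in>fst c. snd c x2 \<in> ball ?y r \<longrightarrow>
      norm (snd c' (\<phi> x1) - snd c' (\<phi> x2)) \<le> C * norm (snd c x1 - snd c x2))"
    using local_lipschitz_in_charts[OF c c' r1(1)] by blast
  define R where "R = min r r0"
  have R: "0 < R" "R \<le> r" "R \<le> r0" using r(1) r0(1) by (simp_all add: R_def)
  define U where "U = fst c \<inter> snd c -` ball ?y R"
  have U: "openin (surf_top M) U" "x \<in> U" "U \<subseteq> fst c"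
    unfolding U_def using M.openin_chart_vimage[OF c(1) open_ball] c(2) R(1) by auto
  have Ur: "z \<in> fst c" "snd c z \<in> ball ?y r" "snd c z \<in> cball ?y r0 \<inter> im c" if "z \<in> U" for z
    using that R by (auto simp: U_def)
  have U\<phi>: "\<phi> z \<in> fst c'" "snd c' (\<phi> z) \<in> cball ?z r1 \<inter> im c'" if "z \<in> U" for z
    using lipr Ur(1,2)[OF that] by (auto simp: less_imp_le)
  \<comment> \<open>Closed chart balls whose radii increase to \<open>R\<close>; they lie in the
    compact set \<open>cball ?y r0 \<inter> im c\<close>.\<close>
  define S where "S n = cinv c ` (cball ?y (R - R / real (Suc n)) \<inter> im c)" for n :: nat
  have S1: "compactin (surf_top M) (S n)" for n
  proof -
    have "0 \<le> R / real (Suc n)" using R(1) by simp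
    then have "R - R / real (Suc n) \<le> r0" using R(3) by linarith
    then have "cball ?y (R - R / real (Suc n)) \<inter> im c = cball ?y (R - R / real (Suc n)) \<inter> (cball ?y r0 \<inter> im c)" by auto
    then have "compact (cball ?y (R - R / real (Suc n)) \<inter> im c)"
      using compact_Int[OF compact_cball r0(2)] by metis
    then show ?thesis
      unfolding S_def by (intro image_compactin[OF _ M.cinv_cont[OF c(1)]]) (simp add: compactin_subtopology)
  qed
  have S2: "U = (\<Union>n. S n)"
  proof (intro subset_antisym subsetI)
    fix z assume z: "z \<in> U"
    have "dist ?y (snd c z) < R" using z by (simp add: U_def)
    then have "0 < (R - dist ?y (snd c z)) / R" using R(1) by simp
    then obtain n where "1 / real (Suc n) < (R - dist ?y (snd c z)) / R" by (rule nat_approx_posE)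
    then have "R / real (Suc n) < R - dist ?y (snd c z)" using R(1) by (simp add: field_simps)
    then have "snd c z \<in> cball ?y (R - R / real (Suc n)) \<inter> im c" using Ur(1)[OF z] by simp
    moreover have "z = cinv c (snd c z)" using M.cinv_snd[OF c(1) Ur(1)[OF z]] by simp
    ultimately show "z \<in> (\<Union>n. S n)" unfolding S_def by blast
  next
    fix z assume "z \<in> (\<Union>n. S n)"
    then obtain n y where y: "y \<in> cball ?y (R - R / real (Suc n))" "y \<in> im c" "z = cinv c y" by (auto simp: S_def)
    have "R - R / real (Suc n) < R" using R(1) by simp
    then have "y \<in> ball ?y R" using y(1) by simp
    then show "z \<in> U" unfolding U_def using M.cinv_in[OF y(2)] M.snd_cinv[OF y(2)] y(3) by simp
  qed
  have piece: "map_piece M N \<phi> c c' U P C \<kappa> \<Lambda>"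
    if P: "P \<subseteq> U" "P \<in> sets (borel_top (surf_top M))" "\<phi> ` P \<in> sets (borel_top (surf_top N))" for P
  proof
    show "\<phi> ` U \<subseteq> fst c'" using U\<phi>(1) by blast
    show "\<forall>x1\<in>U. \<forall>x2\<in>U. norm (snd c' (\<phi> x1) - snd c' (\<phi> x2)) \<le> C * norm (snd c x1 - snd c x2)"
      using lipr Ur(1,2) by blast
    show "\<forall>x\<in>U. \<forall>v. \<kappa> * norm v \<le> sqrt (gip (gmat M c x) v v)"
    proof (intro ballI allI)
      fix z v assume z: "z \<in> U"
      show "\<kappa> * norm v \<le> sqrt (gip (gmat M c z) v v)"
        using \<kappa>(2)[OF Ur(3)[OF z]] M.cinv_snd[OF c(1) Ur(1)[OF z]] by simp
    qed
    show "\<forall>x\<in>U. \<forall>v. sqrt (gip (gmat N c' (\<phi> x)) v v) \<le> \<Lambda> * norm v"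
    proof (intro ballI allI)
      fix z v assume z: "z \<in> U"
      show "sqrt (gip (gmat N c' (\<phi> z)) v v) \<le> \<Lambda> * norm v"
        using \<Lambda>(2)[OF U\<phi>(2)[OF z]] N.cinv_snd[OF c'(1) U\<phi>(1)[OF z]] by simp
    qed
  qed (use c c' U P r \<kappa>(1) \<Lambda>(1) in auto)
  show ?thesis
  proof (intro exI[of _ U] conjI U(1,2))
    show "\<exists>S :: nat \<Rightarrow> 'a set. (\<forall>n. compactin (surf_top M) (S n)) \<and> U = (\<Union>n. S n)"
      using S1 S2 by blast
    show "\<exists>c c' C \<kappa> \<Lambda>. \<forall>P. P \<subseteq> U \<longrightarrow> P \<in> sets (borel_top (surf_top M)) \<longrightarrow> \<phi> ` P \<in> sets (borel_top (surf_top N)) \<longrightarrow>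
      map_piece M N \<phi> c c' U P C \<kappa> \<Lambda>"
      using piece by blast
  qed
qed

lemma map_piece_partition:
  "\<exists>n (P :: nat \<Rightarrow> 'a set). (\<forall>i<n. \<exists>c c' U C \<kappa> \<Lambda>. map_piece M N \<phi> c c' U (P i) C \<kappa> \<Lambda>) \<and>
    points M = (\<Union>i<n. P i) \<and> disjoint_family_on P {..<n}"
proof -
  have "\<forall>x\<in>points M. \<exists>U. openin (surf_top M) U \<and> x \<in> U \<and>
    (\<exists>S :: nat \<Rightarrow> 'a set. (\<forall>n. compactin (surf_top M) (S n)) \<and> U = (\<Union>n. S n)) \<and>
    (\<exists>c c' C \<kappa> \<Lambda>. \<forall>P. P \<subseteq> U \<longrightarrow> P \<in> sets (borel_top (surf_top M)) \<longrightarrow> \<phi> ` P \<in> sets (borel_top (surf_top N)) \<longrightarrow>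
      map_piece M N \<phi> c c' U P C \<kappa> \<Lambda>)"
    by (intro ballI) (rule map_piece_nbhd)
  from bchoice[OF this] obtain U where U: "\<forall>x\<in>points M. openin (surf_top M) (U x) \<and> x \<in> U x \<and>
    (\<exists>S :: nat \<Rightarrow> 'a set. (\<forall>n. compactin (surf_top M) (S n)) \<and> U x = (\<Union>n. S n)) \<and>
    (\<exists>c c' C \<kappa> \<Lambda>. \<forall>P. P \<subseteq> U x \<longrightarrow> P \<in> sets (borel_top (surf_top M)) \<longrightarrow> \<phi> ` P \<in> sets (borel_top (surf_top N)) \<longrightarrow>
      map_piece M N \<phi> c c' (U x) P C \<kappa> \<Lambda>)"
    by (elim exE)
  have "\<forall>x\<in>points M. openin (surf_top M) (U x) \<and> x \<in> U x"
  proof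
    fix x assume "x \<in> points M"
    from bspec[OF U this] show "openin (surf_top M) (U x) \<and> x \<in> U x" by (elim conjE) (intro conjI)
  qed
  from M.finite_chart_partition[OF this] obtain n and a :: "nat \<Rightarrow> 'a" and P :: "nat \<Rightarrow> 'a set" where part:
    "\<forall>i<n. a i \<in> points M \<and> (\<exists>C. closedin (surf_top M) C \<and> P i = U (a i) \<inter> C) \<and> P i \<in> sets (borel_top (surf_top M))"
    "points M = (\<Union>i<n. P i)" "disjoint_family_on P {..<n}"
    by (elim exE conjE)
  have "\<exists>c c' U C \<kappa> \<Lambda>. map_piece M N \<phi> c c' U (P i) C \<kappa> \<Lambda>" if i: "i < n" for i
  proof -
    obtain D where D: "closedin (surf_top M) D" "P i = U (a i) \<inter> D" and ai: "a i \<in> points M"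
      and Pb: "P i \<in> sets (borel_top (surf_top M))" using mp[OF spec[OF part(1)] i] by (elim exE conjE)
    from bspec[OF U ai] obtain S :: "nat \<Rightarrow> 'a set" and c c' C \<kappa> \<Lambda> where
      S0: "\<forall>n. compactin (surf_top M) (S n)" and S2: "U (a i) = (\<Union>n. S n)" and
      piece: "\<forall>P. P \<subseteq> U (a i) \<longrightarrow> P \<in> sets (borel_top (surf_top M)) \<longrightarrow> \<phi> ` P \<in> sets (borel_top (surf_top N)) \<longrightarrow>
        map_piece M N \<phi> c c' (U (a i)) P C \<kappa> \<Lambda>"
      by (elim exE conjE)
    have S1: "compactin (surf_top M) (S n)" for n using S0 by (rule spec)
    \<comment> \<open>A compact set cut by a closed one is compact, and so is its continuous image,
      which is closed because \<open>N\<close> is Hausdorff.\<close>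
    have "\<phi> ` (S n \<inter> D) \<in> sets (borel_top (surf_top N))" for n
    proof -
      have "compactin (surf_top M) (S n \<inter> D)" using compact_Int_closedin[OF S1 D(1)] .
      then have "compactin (surf_top N) (\<phi> ` (S n \<inter> D))" by (rule image_compactin[OF _ map_continuous])
      then have "closedin (surf_top N) (\<phi> ` (S n \<inter> D))"
        using N.surface by (simp add: oriented_riemannian_surface_def compactin_imp_closedin)
      then show ?thesis by (rule closedin_borel_top)
    qed
    then have "(\<Union>n. \<phi> ` (S n \<inter> D)) \<in> sets (borel_top (surf_top N))" by blast
    moreover have "(\<Union>n. \<phi> ` (S n \<inter> D)) = \<phi> ` P i" using D(2) S2 by blast
    ultimately have "\<phi> ` P i \<in> sets (borel_top (surf_top N))" by simp
    moreover have "P i \<subseteq> U (a i)" using D(2) by blast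
    ultimately have "map_piece M N \<phi> c c' (U (a i)) (P i) C \<kappa> \<Lambda>" using piece Pb by simp
    then show ?thesis by (intro exI)
  qed
  then show ?thesis using part(2,3) by (intro exI[of _ n] exI[of _ P]) simp
qed

lemma glue_representatives:
  fixes f :: "'a \<Rightarrow> real" and P :: "nat \<Rightarrow> 'a set"
  assumes P: "\<And>i. i < n \<Longrightarrow> P i \<in> sets (borel_top (surf_top M))" "points M = (\<Union>i<n. P i)" "disjoint_family_on P {..<n}"
    and g: "\<And>i. i < n \<Longrightarrow> \<exists>g\<in>borel_measurable (borel_top (surf_top M)). AE x in area M. x \<in> P i \<longrightarrow> f x = g x"
  shows "\<exists>g\<in>borel_measurable (borel_top (surf_top M)). AE x in area M. f x = g x"
proof -
  have "\<forall>i\<in>{..<n}. \<exists>g. g \<in> borel_measurable (borel_top (surf_top M)) \<and> (AE x in area M. x \<in> P i \<longrightarrow> f x = g x)"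
    using g by blast
  from bchoice[OF this] obtain G where G: "\<forall>i\<in>{..<n}. G i \<in> borel_measurable (borel_top (surf_top M)) \<and> (AE x in area M. x \<in> P i \<longrightarrow> f x = G i x)"
    by (elim exE)
  define g where "g x = (\<Sum>i<n. indicator (P i) x * G i x)" for x
  have "g \<in> borel_measurable (borel_top (surf_top M))"
    unfolding g_def using G P(1) by (intro borel_measurable_sum borel_measurable_times borel_measurable_indicator) auto
  moreover have "AE x in area M. \<forall>i\<in>{..<n}. x \<in> P i \<longrightarrow> f x = G i x"
    using G by (intro AE_finite_allI) auto
  then have "AE x in area M. f x = g x"
    using AE_space
  proof eventually_elim
    case (elim x)
    then obtain i where i: "i < n" "x \<in> P i" using P(2) by auto
    have "indicator (P j) x * G j x = (if j = i then G i x else 0)" if "j < n" for j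
      using P(3) i that by (auto simp: indicator_def disjoint_family_on_def)
    then have "g x = (\<Sum>j<n. if j = i then G i x else 0)" unfolding g_def by (intro sum.cong) auto
    then show ?case using elim(1) i by simp
  qed
  ultimately show ?thesis by blast
qed

text \<open>Everything the energy argument needs from geometry: Borel representatives of
  \<open>hs\<close> and of the Jacobian, a bound from the finitely many local constants, and the
  global area formula.\<close>

lemma invariants:
  assumes "\<phi> \<in> Lip_inj_plus M N"
  obtains S J B where "S \<in> borel_measurable (borel_top (surf_top M))" "J \<in> borel_measurable (borel_top (surf_top M))"
    "AE x in area M. hs (metric_at M x) (metric_at N (\<phi> x)) (dmap M N \<phi> x) = S x"
    "AE x in area M. jacobian M N \<phi> x = J x" "AE x in area M. S x \<le> B"
    "(\<integral>\<^sup>+x. ennreal (J x) \<partial>(area M)) = emeasure (area N) (\<phi> ` points M)"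
proof -
  have jpos: "AE x in area M. 0 \<le> jacobian M N \<phi> x"
    and inj: "AE q in area N. \<forall>x\<in>points M. \<forall>y\<in>points M. \<phi> x = q \<and> \<phi> y = q \<longrightarrow> x = y"
    using assms by (simp_all add: Lip_inj_plus_def)
  obtain Z where Z: "Z \<in> null_sets (area N)"
    "{q \<in> space (area N). \<not> (\<forall>x\<in>points M. \<forall>y\<in>points M. \<phi> x = q \<and> \<phi> y = q \<longrightarrow> x = y)} \<subseteq> Z"
    using inj by (auto simp: eventually_ae_filter)
  have injZ: "x = y" if "x \<in> points M" "y \<in> points M" "\<phi> x = \<phi> y" "\<phi> x \<notin> Z" for x y
  proof -
    have "\<phi> x \<in> space (area N)" using map_points[OF that(1)] by simp
    then have "\<forall>u\<in>points M. \<forall>v\<in>points M. \<phi> u = \<phi> x \<and> \<phi> v = \<phi> x \<longrightarrow> u = v" using Z(2) that(4) by blast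
    then show ?thesis using that(1-3) by simp
  qed
  obtain n and P :: "nat \<Rightarrow> 'a set" where part: "\<forall>i<n. \<exists>c c' U C \<kappa> \<Lambda>. map_piece M N \<phi> c c' U (P i) C \<kappa> \<Lambda>"
    "points M = (\<Union>i<n. P i)" "disjoint_family_on P {..<n}"
    using map_piece_partition by (elim exE conjE)
  have Pb: "P i \<in> sets (borel_top (surf_top M))" "\<phi> ` P i \<in> sets (borel_top (surf_top N))" if i: "i < n" for i
  proof -
    obtain c c' U C \<kappa> \<Lambda> where mp: "map_piece M N \<phi> c c' U (P i) C \<kappa> \<Lambda>" using part(1) i by blast
    show "P i \<in> sets (borel_top (surf_top M))" "\<phi> ` P i \<in> sets (borel_top (surf_top N))"
      using map_piece.P(2,3)[OF mp] by simp_all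
  qed
  have "\<exists>g\<in>borel_measurable (borel_top (surf_top M)). AE x in area M. hs (metric_at M x) (metric_at N (\<phi> x)) (dmap M N \<phi> x) = g x"
  proof (rule glue_representatives[OF Pb(1) part(2,3)])
    fix i assume "i < n"
    then obtain c c' U C \<kappa> \<Lambda> where "map_piece M N \<phi> c c' U (P i) C \<kappa> \<Lambda>" using part(1) by blast
    then show "\<exists>g\<in>borel_measurable (borel_top (surf_top M)). AE x in area M. x \<in> P i \<longrightarrow> hs (metric_at M x) (metric_at N (\<phi> x)) (dmap M N \<phi> x) = g x"
      by (rule map_piece.hs_representative)
  qed
  then obtain S where S: "S \<in> borel_measurable (borel_top (surf_top M))"
    "AE x in area M. hs (metric_at M x) (metric_at N (\<phi> x)) (dmap M N \<phi> x) = S x" by blast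
  have "\<exists>g\<in>borel_measurable (borel_top (surf_top M)). AE x in area M. jacobian M N \<phi> x = g x"
  proof (rule glue_representatives[OF Pb(1) part(2,3)])
    fix i assume "i < n"
    then obtain c c' U C \<kappa> \<Lambda> where "map_piece M N \<phi> c c' U (P i) C \<kappa> \<Lambda>" using part(1) by blast
    then show "\<exists>g\<in>borel_measurable (borel_top (surf_top M)). AE x in area M. x \<in> P i \<longrightarrow> jacobian M N \<phi> x = g x"
      by (rule map_piece.jacobian_representative)
  qed
  then obtain J where J: "J \<in> borel_measurable (borel_top (surf_top M))" "AE x in area M. jacobian M N \<phi> x = J x" by blast
  have "\<forall>i\<in>{..<n}. \<exists>b. AE x in area M. x \<in> P i \<longrightarrow> hs (metric_at M x) (metric_at N (\<phi> x)) (dmap M N \<phi> x) \<le> b"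
  proof
    fix i assume "i \<in> {..<n}"
    then obtain c c' U C \<kappa> \<Lambda> where "map_piece M N \<phi> c c' U (P i) C \<kappa> \<Lambda>" using part(1) by blast
    from map_piece.hs_AE_bound[OF this]
    show "\<exists>b. AE x in area M. x \<in> P i \<longrightarrow> hs (metric_at M x) (metric_at N (\<phi> x)) (dmap M N \<phi> x) \<le> b" by blast
  qed
  from bchoice[OF this] obtain b where b: "\<forall>i\<in>{..<n}. AE x in area M. x \<in> P i \<longrightarrow> hs (metric_at M x) (metric_at N (\<phi> x)) (dmap M N \<phi> x) \<le> b i"
    by (elim exE)
  define B where "B = (\<Sum>i<n. \<bar>b i\<bar>)"
  have "AE x in area M. \<forall>i\<in>{..<n}. x \<in> P i \<longrightarrow> hs (metric_at M x) (metric_at N (\<phi> x)) (dmap M N \<phi> x) \<le> b i"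
    using b by (intro AE_finite_allI) auto
  then have SB: "AE x in area M. S x \<le> B"
    using S(2) AE_space
  proof eventually_elim
    case (elim x)
    then obtain i where i: "i < n" "x \<in> P i" using part(2) by auto
    have "\<bar>b i\<bar> \<le> B" unfolding B_def using i(1) by (intro member_le_sum) auto
    then show ?case using elim(1,2) i by force
  qed
  \<comment> \<open>Images of different pieces may meet, but only inside \<open>Z\<close>. Removing
    this null set makes them disjoint without changing their areas.\<close>
  have piece: "(\<integral>\<^sup>+x. ennreal (J x) * indicator (P i) x \<partial>(area M)) = emeasure (area N) (\<phi> ` P i - Z)" if i: "i < n" for i
  proof -
    obtain c c' U C \<kappa> \<Lambda> where mp: "map_piece M N \<phi> c c' U (P i) C \<kappa> \<Lambda>" using part(1) i by blast
    have "(\<integral>\<^sup>+x. ennreal (J x) * indicator (P i) x \<partial>(area M)) = emeasure (area N) (\<phi> ` P i)"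
    proof (rule map_piece.area_formula[OF mp Z(1) _ jpos J(1)])
      show "x = y" if "x \<in> P i" "y \<in> P i" "\<phi> x = \<phi> y" "\<phi> x \<notin> Z" for x y
        using injZ that part(2) i by blast
      show "AE x in area M. x \<in> P i \<longrightarrow> jacobian M N \<phi> x = J x" using J(2) by eventually_elim simp
    qed
    then show ?thesis using Z(1) Pb(2)[OF i] by (simp add: emeasure_Diff_null_set)
  qed
  have Jm: "(\<lambda>x. ennreal (J x)) \<in> borel_measurable (area M)"
  proof (rule measurable_compose[OF _ measurable_ennreal])
    show "J \<in> borel_measurable (area M)" using J(1) by (simp add: measurable_cong_sets[OF M.sets_area refl])
  qed
  have "(\<integral>\<^sup>+x. ennreal (J x) \<partial>(area M)) = (\<integral>\<^sup>+x. (\<Sum>i<n. ennreal (J x) * indicator (P i) x) \<partial>(area M))"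
  proof (rule nn_integral_cong)
    fix x assume "x \<in> space (area M)"
    then have "indicator (\<Union>i<n. P i) x = (1::ennreal)" using part(2) by simp
    then have "(\<Sum>i<n. indicator (P i) x) = (1::ennreal)"
      using indicator_UN_disjoint[OF finite_lessThan part(3)] by metis
    then show "ennreal (J x) = (\<Sum>i<n. ennreal (J x) * indicator (P i) x)"
      by (simp flip: sum_distrib_left)
  qed
  also have "\<dots> = (\<Sum>i<n. \<integral>\<^sup>+x. ennreal (J x) * indicator (P i) x \<partial>(area M))"
    by (intro nn_integral_sum borel_measurable_times_ennreal Jm borel_measurable_indicator) (simp add: Pb(1))
  also have "\<dots> = (\<Sum>i<n. emeasure (area N) (\<phi> ` P i - Z))" using piece by (intro sum.cong) auto
  also have "\<dots> = emeasure (area N) (\<Union>i<n. \<phi> ` P i - Z)"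
  proof (rule sum_emeasure)
    show "(\<lambda>i. \<phi> ` P i - Z) ` {..<n} \<subseteq> sets (area N)"
      using Pb(2) Z(1) by (auto simp: null_sets_def)
    show "disjoint_family_on (\<lambda>i. \<phi> ` P i - Z) {..<n}"
    proof (unfold disjoint_family_on_def, intro ballI impI)
      fix i j assume ij: "i \<in> {..<n}" "j \<in> {..<n}" "i \<noteq> j"
      have "P i \<inter> P j = {}" using part(3) ij by (auto simp: disjoint_family_on_def)
      moreover have "P i \<subseteq> points M" "P j \<subseteq> points M" using ij part(2) by auto
      ultimately show "(\<phi> ` P i - Z) \<inter> (\<phi> ` P j - Z) = {}" using injZ by blast
    qed
  qed simp
  also have "(\<Union>i<n. \<phi> ` P i - Z) = \<phi> ` points M - Z" using part(2) by auto
  also have "emeasure (area N) (\<phi> ` points M - Z) = emeasure (area N) (\<phi> ` points M)"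
  proof (rule emeasure_Diff_null_set[OF Z(1)])
    have "\<phi> ` points M = (\<Union>i<n. \<phi> ` P i)" using part(2) by auto
    then show "\<phi> ` points M \<in> sets (area N)" using Pb(2) by auto
  qed
  finally show thesis by (rule that[OF S(1) J(1) S(2) J(2) SB])
qed

end

section \<open>The energy inequality\<close>

text \<open>The gap between \<open>g\<close> and the line is nonnegative, and the linear term
  integrates to zero because \<open>f\<close> has mean \<open>s\<close>. Equality thus means a
  nonnegative function with zero integral.\<close>

lemma average_support_line:
  fixes f g :: "'a \<Rightarrow> real"
  assumes fin: "finite_measure \<mu>" and V: "V = measure \<mu> (space \<mu>)" "0 < V"
    and f: "integrable \<mu> f" "integral\<^sup>L \<mu> f = s * V" and g: "integrable \<mu> g"
    and le: "AE x in \<mu>. a + m * (f x - s) \<le> g x"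
  shows "a \<le> 1 / V * integral\<^sup>L \<mu> g"
    and "1 / V * integral\<^sup>L \<mu> g = a \<longleftrightarrow> (AE x in \<mu>. g x = a + m * (f x - s))"
proof -
  interpret finite_measure \<mu> by (rule fin)
  let ?h = "\<lambda>x. g x - (a + m * (f x - s))"
  have h: "integrable \<mu> ?h" using f(1) g by simp
  have "integral\<^sup>L \<mu> ?h = integral\<^sup>L \<mu> g - (a * V + m * (integral\<^sup>L \<mu> f - s * V))"
    using f(1) g by (simp add: V(1) mult.commute)
  then have int: "integral\<^sup>L \<mu> ?h = V * (1 / V * integral\<^sup>L \<mu> g - a)"
    unfolding f(2) right_diff_distrib using V(2) by simp
  have pos: "AE x in \<mu>. 0 \<le> ?h x" using le by eventually_elim simp
  then have "0 \<le> integral\<^sup>L \<mu> ?h" by (rule integral_nonneg_AE)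
  then show "a \<le> 1 / V * integral\<^sup>L \<mu> g" unfolding int using V(2) by (simp add: zero_le_mult_iff)
  have "1 / V * integral\<^sup>L \<mu> g = a \<longleftrightarrow> integral\<^sup>L \<mu> ?h = 0" unfolding int using V(2) by simp
  also have "\<dots> \<longleftrightarrow> (AE x in \<mu>. ?h x = 0)" by (rule integral_nonneg_eq_0_iff_AE[OF h pos])
  also have "\<dots> \<longleftrightarrow> (AE x in \<mu>. g x = a + m * (f x - s))" by (simp only: right_minus_eq)
  finally show "1 / V * integral\<^sup>L \<mu> g = a \<longleftrightarrow> (AE x in \<mu>. g x = a + m * (f x - s))" .
qed

text \<open>Settles the borderline \<open>s = 1/4\<close>, \<open>p = 2\<close>, where the
  supporting line touches along a whole interval ending at \<open>s\<close>.\<close>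

lemma AE_eq_of_integral_eq:
  fixes f :: "'a \<Rightarrow> real"
  assumes fin: "finite_measure \<mu>" and f: "integrable \<mu> f" "integral\<^sup>L \<mu> f = s * measure \<mu> (space \<mu>)"
    and le: "AE x in \<mu>. f x \<le> s"
  shows "AE x in \<mu>. f x = s"
proof -
  interpret finite_measure \<mu> by (rule fin)
  have i: "integrable \<mu> (\<lambda>x. s - f x)" using f(1) by simp
  have "integral\<^sup>L \<mu> (\<lambda>x. s - f x) = 0" using f by (simp add: mult.commute)
  moreover have "AE x in \<mu>. 0 \<le> s - f x" using le by eventually_elim simp
  ultimately have "AE x in \<mu>. s - f x = 0" using integral_nonneg_eq_0_iff_AE[OF i] by blast
  then show ?thesis by eventually_elim simp
qed

text \<open>The Jacobian is here the product of two singular values with sum 1, so the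
  arithmetic-geometric mean inequality applies.\<close>

lemma K_riem_det_le:
  assumes "posdef G" "posdef H" "A \<in> K G H"
  shows "0 \<le> riem_det G H A" "riem_det G H A \<le> 1/4"
proof -
  show t: "0 \<le> riem_det G H A" using assms(3) by (simp add: K_def)
  have "sqrt (hs G H A + 2 * riem_det G H A) = 1"
    using assms(3) sv_sum_eq[OF assms(1,2), of A] t by (simp add: K_def)
  then have "hs G H A + 2 * riem_det G H A = 1" by (simp add: real_sqrt_eq_1_iff)
  then show "riem_det G H A \<le> 1/4" using hs_ge[OF assms(1,2), of A] t by simp
qed

context surface_map begin

lemma energy_bound:
  assumes \<phi>: "\<phi> \<in> Lip_inj_plus M N" and vol_le: "vol N (points N) \<le> vol M (points M)" and p: "2 \<le> p"
    and s_def: "s = vol N (\<phi> ` points M) / vol M (points M)"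
  shows "F s powr (p / 2) \<le> energy p M N \<phi>"
    and "1/4 \<le> s \<Longrightarrow> energy p M N \<phi> = F s powr (p / 2) \<longleftrightarrow> homothety M N \<phi>"
    and "s \<le> 1/4 \<Longrightarrow> p = 2 \<Longrightarrow> energy p M N \<phi> = F s powr (p / 2) \<longleftrightarrow>
        (AE x in area M. dmap M N \<phi> x \<in> K (metric_at M x) (metric_at N (\<phi> x)))"
    and "s \<le> 1/4 \<Longrightarrow> 2 < p \<Longrightarrow> energy p M N \<phi> = F s powr (p / 2) \<longleftrightarrow>
        (AE x in area M. dmap M N \<phi> x \<in> Ks s (metric_at M x) (metric_at N (\<phi> x)))"
proof -
  define \<mu> where "\<mu> = area M"
  define V where "V = measure \<mu> (space \<mu>)"
  define q where "q = p / 2"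
  define G where "G x = metric_at M x" for x
  define H where "H x = metric_at N (\<phi> x)" for x
  define A where "A x = dmap M N \<phi> x" for x
  define t where "t x = riem_det (G x) (H x) (A x)" for x
  define d where "d x = dist_SO (G x) (H x) (A x)" for x
  have fin: "finite_measure \<mu>" unfolding \<mu>_def by (rule M.finite_measure_area)
  interpret \<mu>: finite_measure \<mu> by (rule fin)
  have V: "V = vol M (points M)" "0 < V" using M.vol_pos by (simp_all add: V_def \<mu>_def vol_def)
  have q: "1 \<le> q" using p by (simp add: q_def)
  obtain S J B where SJ0: "S \<in> borel_measurable (borel_top (surf_top M))" "J \<in> borel_measurable (borel_top (surf_top M))"
    and hsS: "AE x in area M. hs (metric_at M x) (metric_at N (\<phi> x)) (dmap M N \<phi> x) = S x"
    and jJ: "AE x in area M. jacobian M N \<phi> x = J x" and SB: "AE x in area M. S x \<le> B"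
    and nnJ: "(\<integral>\<^sup>+x. ennreal (J x) \<partial>(area M)) = emeasure (area N) (\<phi> ` points M)"
    by (rule invariants[OF \<phi>])
  have meas[measurable]: "S \<in> borel_measurable \<mu>" "J \<in> borel_measurable \<mu>"
    using SJ0 by (simp_all add: \<mu>_def measurable_cong_sets[OF M.sets_area refl])
  have jpos: "AE x in area M. 0 \<le> jacobian M N \<phi> x" using \<phi> by (simp add: Lip_inj_plus_def)
  \<comment> \<open>One set of full measure on which the pointwise linear algebra applies and the
    unspecified differential enters only through the measurable \<open>S\<close> and
    \<open>J\<close>.\<close>
  have pt: "AE x in \<mu>. posdef (G x) \<and> posdef (H x) \<and> 0 \<le> t x \<and> t x = J x \<and> hs (G x) (H x) (A x) = S x \<and> S x \<le> B"
    using hsS jJ SB jpos AE_space unfolding \<mu>_def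
  proof eventually_elim
    case (elim x)
    then have "x \<in> points M" by simp
    then have "posdef (G x)" "posdef (H x)"
      using M.metric_at_posdef N.metric_at_posdef map_points by (simp_all add: G_def H_def)
    then show ?case using elim by (simp add: t_def G_def H_def A_def jacobian_def)
  qed
  have Jb: "AE x in \<mu>. 0 \<le> J x \<and> J x \<le> B"
    using pt
  proof eventually_elim
    case (elim x)
    have "2 * \<bar>t x\<bar> \<le> S x" using hs_ge[of "G x" "H x" "A x"] elim by (simp add: t_def)
    then show ?case using elim by simp
  qed
  have intJ: "integrable \<mu> J"
  proof (rule \<mu>.integrable_const_bound[where B = B])
    show "AE x in \<mu>. norm (J x) \<le> B" using Jb by eventually_elim simp
  qed simp
  have "integral\<^sup>L \<mu> J = enn2real (\<integral>\<^sup>+x. ennreal (J x) \<partial>\<mu>)"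
  proof (rule integral_eq_nn_integral)
    show "AE x in \<mu>. 0 \<le> J x" using Jb by eventually_elim simp
  qed simp
  then have "integral\<^sup>L \<mu> J = vol N (\<phi> ` points M)"
    by (simp add: \<mu>_def nnJ vol_def measure_def)
  then have sV: "integral\<^sup>L \<mu> J = s * V" using V by (simp add: s_def)
  have s: "0 \<le> s" "s \<le> 1"
  proof -
    show "0 \<le> s" by (simp add: s_def vol_def)
    have "vol N (\<phi> ` points M) \<le> vol N (points N)"
      unfolding vol_def
    proof (rule finite_measure.finite_measure_mono[OF N.finite_measure_area])
      show "\<phi> ` points M \<subseteq> points N" using map_points by blast
      show "points N \<in> sets (area N)" using sets.top[of "area N"] by simp
    qed
    then show "s \<le> 1" using vol_le V by (simp add: s_def)
  qed
  define D where "D x = sqrt (S x + 2 - 2 * sqrt (S x + 2 * J x)) powr p" for x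
  have Dm[measurable]: "D \<in> borel_measurable \<mu>" unfolding D_def by measurable
  have Dd: "AE x in \<mu>. d x powr p = D x \<and> 0 \<le> d x \<and> d x \<le> sqrt (B + 2)"
    using pt
  proof eventually_elim
    case (elim x)
    have dx: "d x = sqrt (S x + 2 - 2 * sqrt (S x + 2 * J x))"
      unfolding d_def using dist_SO_eq[of "G x" "H x" "A x"] elim by (simp add: t_def)
    have "0 \<le> d x" unfolding d_def using dist_SO_power2(4)[of "G x" "H x" "t x" "A x"] elim by (simp add: t_def)
    moreover have "0 \<le> S x + 2 * J x"
      using hs_ge[of "G x" "H x" "A x"] elim by (simp add: t_def)
    then have "0 \<le> sqrt (S x + 2 * J x)" by simp
    then have "S x + 2 - 2 * sqrt (S x + 2 * J x) \<le> B + 2" using elim by linarith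
    then have "d x \<le> sqrt (B + 2)" unfolding dx by (rule real_sqrt_le_mono)
    ultimately show ?case by (simp add: D_def flip: dx)
  qed
  have intD: "integrable \<mu> D"
  proof (rule \<mu>.integrable_const_bound[where B = "sqrt (B + 2) powr p"])
    show "AE x in \<mu>. norm (D x) \<le> sqrt (B + 2) powr p"
      using Dd
    proof eventually_elim
      case (elim x)
      then have "d x powr p \<le> sqrt (B + 2) powr p" using p by (intro powr_mono2) auto
      moreover have "0 \<le> D x" using elim powr_ge_zero[of "d x" p] by simp
      ultimately show ?case using elim by simp
    qed
  qed simp
  have energy: "energy p M N \<phi> = 1 / V * integral\<^sup>L \<mu> D"
  proof -
    have "AE x in \<mu>. d x powr p = D x" using Dd by eventually_elim simp
    from integral_completion_AE[OF Dm this] show ?thesis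
      by (simp add: energy_def V(1) \<mu>_def d_def G_def H_def A_def)
  qed
  obtain m where m1: "\<And>t. 0 \<le> t \<Longrightarrow> F s powr q + m * (t - s) \<le> F t powr q"
    and m2: "\<And>t. 0 \<le> t \<Longrightarrow> F t powr q = F s powr q + m * (t - s) \<Longrightarrow> t = s \<or> q = 1 \<and> s \<le> 1/4 \<and> t \<le> 1/4"
    and m3: "\<And>t. 0 \<le> t \<Longrightarrow> t \<le> 1/4 \<Longrightarrow> s \<le> 1/4 \<Longrightarrow> q = 1 \<Longrightarrow> F t powr q = F s powr q + m * (t - s)"
    using F_powr_support[OF s q] by blast
  \<comment> \<open>Two inequalities are chained: the squared distance is at least
    \<open>F (t x)\<close>, and the power of \<open>F\<close> lies above its line. Strict
    monotonicity of the power makes contact equivalent to equality in both.\<close>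
  have key: "AE x in \<mu>. F s powr q + m * (J x - s) \<le> D x \<and>
    (D x = F s powr q + m * (J x - s) \<longleftrightarrow> (d x)\<^sup>2 = F (t x) \<and> F (t x) powr q = F s powr q + m * (t x - s))"
    using pt Dd
  proof eventually_elim
    case (elim x)
    have Fd: "F (t x) \<le> (d x)\<^sup>2" unfolding t_def d_def
      by (rule dist_SO_ge_F(1)) (use elim in \<open>simp_all add: t_def\<close>)
    have F0: "0 \<le> F (t x)" using F_nonneg elim by blast
    have "(d x)\<^sup>2 = d x powr 2" using elim by simp
    then have "(d x)\<^sup>2 powr q = d x powr (2 * q)" by (simp only: powr_powr)
    then have D: "D x = (d x)\<^sup>2 powr q" using elim by (simp add: q_def)
    have le: "F (t x) powr q \<le> (d x)\<^sup>2 powr q" using Fd F0 q by (intro powr_mono2) auto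
    have strict: "F (t x) powr q < (d x)\<^sup>2 powr q" if "(d x)\<^sup>2 \<noteq> F (t x)"
      using Fd F0 q that by (intro powr_less_mono2) auto
    have m: "F s powr q + m * (t x - s) \<le> F (t x) powr q" using m1 elim by blast
    have tJ: "J x = t x" using elim by simp
    show ?case unfolding D tJ using le m strict by fastforce
  qed
  have le: "AE x in \<mu>. F s powr q + m * (J x - s) \<le> D x" using key by eventually_elim blast
  note avg = average_support_line[OF fin V_def V(2) intJ sV intD le]
  show "F s powr (p / 2) \<le> energy p M N \<phi>" using avg(1) by (simp add: energy q_def)
  have eq: "energy p M N \<phi> = F s powr (p / 2) \<longleftrightarrow>
    (AE x in \<mu>. (d x)\<^sup>2 = F (t x) \<and> F (t x) powr q = F s powr q + m * (t x - s))"
  proof -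
    have "(AE x in \<mu>. D x = F s powr q + m * (J x - s)) \<longleftrightarrow>
      (AE x in \<mu>. (d x)\<^sup>2 = F (t x) \<and> F (t x) powr q = F s powr q + m * (t x - s))"
      by (rule eventually_subst) (use key in \<open>eventually_elim, blast\<close>)
    then show ?thesis using avg(2) by (simp add: energy q_def)
  qed
  have hom_def: "homothety M N \<phi> \<longleftrightarrow> (\<exists>l>0. AE x in \<mu>. transpose (A x) ** H x ** A x = l\<^sup>2 *\<^sub>R G x)"
    unfolding homothety_def \<mu>_def A_def H_def G_def ..
  show "energy p M N \<phi> = F s powr (p / 2) \<longleftrightarrow> homothety M N \<phi>" if s4: "1/4 \<le> s"
  proof
    assume "energy p M N \<phi> = F s powr (p / 2)"
    then have ae: "AE x in \<mu>. (d x)\<^sup>2 = F (t x) \<and> F (t x) powr q = F s powr q + m * (t x - s)" by (simp only: eq)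
    \<comment> \<open>In every case contact gives \<open>t x \<le> s\<close>: either
      \<open>t x = s\<close>, or \<open>s = 1/4\<close> and \<open>t x\<close> lies on the affine
      part. The mean value \<open>s\<close> then excludes smaller values.\<close>
    then have "AE x in \<mu>. J x \<le> s"
      using pt
    proof eventually_elim
      case (elim x)
      then have "t x = s \<or> q = 1 \<and> s \<le> 1/4 \<and> t x \<le> 1/4" using m2 by blast
      then show ?case using elim s4 by auto
    qed
    then have "AE x in \<mu>. J x = s" by (rule AE_eq_of_integral_eq[OF fin intJ sV[unfolded V_def]])
    then have "AE x in \<mu>. transpose (A x) ** H x ** A x = (sqrt s)\<^sup>2 *\<^sub>R G x"
      using ae pt
    proof eventually_elim
      case (elim x)
      have "transpose (A x) ** H x ** A x = t x *\<^sub>R G x"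
        using dist_SO_ge_F(3)[of "G x" "H x" "A x"] elim s4 by (simp add: t_def d_def)
      then show ?case using elim s(1) by simp
    qed
    then show "homothety M N \<phi>" unfolding hom_def using s4 by (intro exI[of _ "sqrt s"]) simp
  next
    assume "homothety M N \<phi>"
    then obtain l where l: "AE x in \<mu>. transpose (A x) ** H x ** A x = l\<^sup>2 *\<^sub>R G x" unfolding hom_def by blast
    \<comment> \<open>A homothety with factor \<open>l\<close> has constant Jacobian, and the mean
      value of \<open>J\<close> identifies this constant with \<open>s\<close>.\<close>
    have tl: "AE x in \<mu>. t x = l\<^sup>2"
      using l pt
    proof eventually_elim
      case (elim x)
      then show ?case using conformal_iff[of "G x" "H x" "A x" "l\<^sup>2"] by (simp add: t_def)
    qed
    have "AE x in \<mu>. J x = l\<^sup>2" using tl pt by eventually_elim simp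
    then have "integral\<^sup>L \<mu> J = integral\<^sup>L \<mu> (\<lambda>x. l\<^sup>2)" by (intro integral_cong_AE) auto
    then have "s * V = l\<^sup>2 * V" unfolding sV by (simp add: V_def mult.commute)
    then have sl: "s = l\<^sup>2" using V(2) by simp
    have "AE x in \<mu>. (d x)\<^sup>2 = F (t x) \<and> F (t x) powr q = F s powr q + m * (t x - s)"
      using l tl pt
    proof eventually_elim
      case (elim x)
      then have "(d x)\<^sup>2 = F (t x)" using dist_SO_ge_F(3)[of "G x" "H x" "A x"] s4 sl by (simp add: t_def d_def)
      then show ?case using elim sl by simp
    qed
    then show "energy p M N \<phi> = F s powr (p / 2)" by (simp only: eq)
  qed
  have dK: "AE x in \<mu>. t x \<le> 1/4 \<longrightarrow> ((d x)\<^sup>2 = F (t x) \<longleftrightarrow> A x \<in> K (G x) (H x))"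
    using pt
  proof eventually_elim
    case (elim x)
    then show ?case using dist_SO_ge_F(2)[of "G x" "H x" "A x"] by (simp add: t_def d_def)
  qed
  show "energy p M N \<phi> = F s powr (p / 2) \<longleftrightarrow>
      (AE x in area M. dmap M N \<phi> x \<in> K (metric_at M x) (metric_at N (\<phi> x)))" if s4: "s \<le> 1/4" and p2: "p = 2"
  proof -
    have q1: "q = 1" using p2 by (simp add: q_def)
    \<comment> \<open>Both conditions confine \<open>t x\<close> to the interval up to 1/4. There
      the line coincides with \<open>F\<close>, so the only remaining requirement is the equality
      case of the distance.\<close>
    have "AE x in \<mu>. ((d x)\<^sup>2 = F (t x) \<and> F (t x) powr q = F s powr q + m * (t x - s)) \<longleftrightarrow> A x \<in> K (G x) (H x)"
      using dK pt
    proof eventually_elim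
      case (elim x)
      have "t x \<le> 1/4" if "A x \<in> K (G x) (H x)"
        using K_riem_det_le(2)[OF _ _ that] elim by (simp add: t_def)
      moreover have "t x \<le> 1/4" if "F (t x) powr q = F s powr q + m * (t x - s)"
        using m2[OF _ that] elim s4 by auto
      moreover have "F (t x) powr q = F s powr q + m * (t x - s)" if "t x \<le> 1/4"
        using m3[OF _ that s4 q1] elim by blast
      ultimately show ?case using elim by blast
    qed
    then have "(AE x in \<mu>. (d x)\<^sup>2 = F (t x) \<and> F (t x) powr q = F s powr q + m * (t x - s)) \<longleftrightarrow>
      (AE x in \<mu>. A x \<in> K (G x) (H x))" by (rule eventually_subst)
    then show ?thesis unfolding eq by (simp only: \<mu>_def A_def G_def H_def)
  qed
  show "energy p M N \<phi> = F s powr (p / 2) \<longleftrightarrow>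
      (AE x in area M. dmap M N \<phi> x \<in> Ks s (metric_at M x) (metric_at N (\<phi> x)))" if s4: "s \<le> 1/4" and p2: "2 < p"
  proof -
    have q1: "q \<noteq> 1" using p2 by (simp add: q_def)
    have "AE x in \<mu>. ((d x)\<^sup>2 = F (t x) \<and> F (t x) powr q = F s powr q + m * (t x - s)) \<longleftrightarrow> A x \<in> Ks s (G x) (H x)"
      using dK pt
    proof eventually_elim
      case (elim x)
      \<comment> \<open>Since \<open>q\<close> is not 1, the contact set is the single value
        \<open>s\<close>, which lies in the range where distance equality means membership in
        \<open>K\<close>.\<close>
      have "F (t x) powr q = F s powr q + m * (t x - s) \<longleftrightarrow> t x = s"
        using m2[of "t x"] elim q1 by auto
      moreover have "A x \<in> Ks s (G x) (H x) \<longleftrightarrow> A x \<in> K (G x) (H x) \<and> t x = s"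
        by (simp add: Ks_def t_def)
      ultimately show ?case using elim s4 by auto
    qed
    then have "(AE x in \<mu>. (d x)\<^sup>2 = F (t x) \<and> F (t x) powr q = F s powr q + m * (t x - s)) \<longleftrightarrow>
      (AE x in \<mu>. A x \<in> Ks s (G x) (H x))" by (rule eventually_subst)
    then show ?thesis unfolding eq by (simp only: \<mu>_def A_def G_def H_def)
  qed
qed

end

theorem theorem1p1:
  fixes M :: "'a surface" and N :: "'b surface" and p :: real and \<phi> :: "'a \<Rightarrow> 'b"
  assumes "oriented_riemannian_surface M" and "oriented_riemannian_surface N"
    and "compact_space (surf_top M)" and "compact_space (surf_top N)"
    and "connected_space (surf_top M)" and "connected_space (surf_top N)"
    and "points M \<noteq> {}" and "points N \<noteq> {}"
    and "vol N (points N) \<le> vol M (points M)"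
    and "2 \<le> p"
    and "\<phi> \<in> Lip_inj_plus M N"
  shows "let s = vol N (\<phi> ` points M) / vol M (points M) in
     F s powr (p / 2) \<le> energy p M N \<phi> \<and>
     (1/4 \<le> s \<longrightarrow> (energy p M N \<phi> = F s powr (p / 2) \<longleftrightarrow> homothety M N \<phi>)) \<and>
     (s \<le> 1/4 \<and> p = 2 \<longrightarrow> (energy p M N \<phi> = F s powr (p / 2) \<longleftrightarrow>
        (AE x in area M. dmap M N \<phi> x \<in> K (metric_at M x) (metric_at N (\<phi> x))))) \<and>
     (s \<le> 1/4 \<and> p > 2 \<longrightarrow> (energy p M N \<phi> = F s powr (p / 2) \<longleftrightarrow>
        (AE x in area M. dmap M N \<phi> x \<in> Ks s (metric_at M x) (metric_at N (\<phi> x)))))"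
proof -
  interpret surface_map M N \<phi>
    by unfold_locales (use assms in \<open>auto simp: Lip_inj_plus_def\<close>)
  note bound = energy_bound[OF assms(11,9,10) refl]
  show ?thesis
    unfolding Let_def by (intro conjI impI bound) auto
qed

end
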